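(* For each of the following symmetric pairs $(\mathfrak g,\mathfrak g_0)$, the isotropy representation does not have GNIB: (i) $(\mathfrak{gl}_n,\mathfrak{gl}_m\times\mathfrak{gl}_{n-m})$ with $4\le m\le n-m$; (ii) $(\mathfrak{so}_n,\mathfrak{so}_m\times\mathfrak{so}_{n-m})$ with $4\le m\le n-m$; (iii) $(\mathfrak{sp}_{2n},\mathfrak{sp}_{2m}\times\mathfrak{sp}_{2n-2m})$ with $4\le m\le n-m$. The cases of these three families with $m=3$ and $n-m=4$ also yield isotropy representations without GNIB.
   Context: The ground field $\Bbbk$ is algebraically closed of characteristic zero. For a Lie algebra $\mathfrak q$ and a finite-dimensional $\mathfrak q$-module $V$, the index is $\mathrm{ind}(\mathfrak q,V)=\dim V-\max_{\xi\in V^*}\dim(\mathfrak q\cdot\xi)$. For a rational representation $(G:V)$ of a reductive group $G$ with Lie algebra $\mathfrak g$, a vector $v\in V$ is nilpotent if $0\in\overline{G\cdot v}$; $\mathfrak g_v$ is the stabiliser of $v$ in $\mathfrak g$, and $V/\mathfrak g\cdot v$ is a $\mathfrak g_v$-module. $(G:V)$ has good nilpotent index behaviour (GNIB) if $\mathrm{ind}(\mathfrak g,V^* )=\mathrm{ind}(\mathfrak g_v,(V/\mathfrak g\cdot v)^* )$ for every nilpotent $v\in V$. If $\sigma$ is an involutory automorphism of $\mathfrak g$ with eigenspace decomposition $\mathfrak g=\mathfrak g_0\oplus\mathfrak g_1$ (eigenvalues $+1$, $-1$) and $G_0\subset G$ is the connected subgroup with Lie algebra $\mathfrak g_0$, then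 $(G,G_0)$, or $(\mathfrak g,\mathfrak g_0)$, is a symmetric pair and its isotropy representation is $(G_0:\mathfrak g_1)$. In the listed pairs, $\mathfrak g_0$ is the subalgebra of $\mathfrak g$ preserving a direct sum decomposition of the standard module into two subspaces of the indicated dimensions (an orthogonal decomposition into non-degenerate subspaces in the $\mathfrak{so}$ and $\mathfrak{sp}$ cases); $\mathfrak{sp}_{2k}$ acts on a $2k$-dimensional space. *)

theory Defs
  imports
    "HOL-Algebra.AbelCoset"
    "HOL-Analysis.Abstract_Topology"
    "Jordan_Normal_Form.VS_Connect"
begin

section \<open>Modules over a Lie algebra and the index\<close>

text \<open>
  Vector spaces over the ground field \<open>'a\<close> are records of type \<^typ>\<open>('a, 'v) module\<close>,
  regarded over \<^term>\<open>class_ring\<close>.  A module over a Lie algebra is such a space \<open>V\<close>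
  together with the set \<open>\<qq>\<close> of elements of the Lie algebra and the action \<open>act x v\<close> of
  \<open>x \<in> \<qq>\<close> on \<open>v \<in> V\<close>.  The fields \<open>mult\<close> and \<open>one\<close> of the record play no role for vector spaces.
\<close>

abbreviation vdim :: "('a::field, 'v) module \<Rightarrow> nat" where
  "vdim V \<equiv> vectorspace.dim (class_ring :: 'a ring) V"

abbreviation sub_space :: "('a::field, 'v) module \<Rightarrow> 'v set \<Rightarrow> ('a, 'v) module" where
  "sub_space V W \<equiv> V\<lparr>carrier := W\<rparr>"

definition dual_module :: "('a::field, 'v) module \<Rightarrow> ('a, 'v \<Rightarrow> 'a) module" where
  "dual_module V = \<lparr>
     carrier = {f \<in> extensional (carrier V).
       (\<forall>u \<in> carrier V. \<forall>v \<in> carrier V. f (u \<oplus>\<^bsub>V\<^esub> v) = f u + f v) \<and>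
       (\<forall>c. \<forall>v \<in> carrier V. f (c \<odot>\<^bsub>V\<^esub> v) = c * f v)},
     mult = undefined, one = undefined,
     zero = (\<lambda>v \<in> carrier V. 0),
     add = (\<lambda>f g. \<lambda>v \<in> carrier V. f v + g v),
     smult = (\<lambda>c f. \<lambda>v \<in> carrier V. c * f v)\<rparr>"

definition dual_action ::
    "('a::field, 'v) module \<Rightarrow> ('q \<Rightarrow> 'v \<Rightarrow> 'v) \<Rightarrow> 'q \<Rightarrow> ('v \<Rightarrow> 'a) \<Rightarrow> 'v \<Rightarrow> 'a" where
  "dual_action V act x \<xi> = (\<lambda>v \<in> carrier V. - \<xi> (act x v))"

definition quotient_module :: "('a::field, 'v) module \<Rightarrow> 'v set \<Rightarrow> ('a, 'v set) module" where
  "quotient_module V W = \<lparr>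
     carrier = a_rcosets\<^bsub>V\<^esub> W,
     mult = undefined, one = undefined,
     zero = W,
     add = set_add V,
     smult = (\<lambda>c C. \<Union>v \<in> C. W +>\<^bsub>V\<^esub> (c \<odot>\<^bsub>V\<^esub> v))\<rparr>"

text \<open>The induced action sends the coset of \<open>v\<close> to the coset of \<open>act x v\<close>; this is well defined
  for those \<open>x\<close> that map \<open>W\<close> into itself.\<close>

definition quotient_action ::
    "('a::field, 'v) module \<Rightarrow> 'v set \<Rightarrow> ('q \<Rightarrow> 'v \<Rightarrow> 'v) \<Rightarrow> 'q \<Rightarrow> 'v set \<Rightarrow> 'v set" where
  "quotient_action V W act x C = (\<Union>v \<in> C. W +>\<^bsub>V\<^esub> act x v)"

definition lie_orbit :: "'q set \<Rightarrow> ('q \<Rightarrow> 'v \<Rightarrow> 'v) \<Rightarrow> 'v \<Rightarrow> 'v set" where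
  "lie_orbit \<qq> act v = (\<lambda>x. act x v) ` \<qq>"

definition lie_stabiliser ::
    "'q set \<Rightarrow> ('q \<Rightarrow> 'v \<Rightarrow> 'v) \<Rightarrow> ('a::field, 'v) module \<Rightarrow> 'v \<Rightarrow> 'q set" where
  "lie_stabiliser \<qq> act V v = {x \<in> \<qq>. act x v = \<zero>\<^bsub>V\<^esub>}"

definition lie_index ::
    "'q set \<Rightarrow> ('q \<Rightarrow> 'v \<Rightarrow> 'v) \<Rightarrow> ('a::field, 'v) module \<Rightarrow> int" where
  "lie_index \<qq> act V = int (vdim V) -
     int (Max ((\<lambda>\<xi>. vdim (sub_space (dual_module V) (lie_orbit \<qq> (dual_action V act) \<xi>)))
               ` carrier (dual_module V)))"


section \<open>The Zariski topology\<close>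

inductive_set poly_funs :: "('a::field, 'v) module \<Rightarrow> ('v \<Rightarrow> 'a) set"
  for V :: "('a, 'v) module" where
  const: "(\<lambda>_. c) \<in> poly_funs V"
| linear: "f \<in> carrier (dual_module V) \<Longrightarrow> f \<in> poly_funs V"
| add: "f \<in> poly_funs V \<Longrightarrow> g \<in> poly_funs V \<Longrightarrow> (\<lambda>v. f v + g v) \<in> poly_funs V"
| mult: "f \<in> poly_funs V \<Longrightarrow> g \<in> poly_funs V \<Longrightarrow> (\<lambda>v. f v * g v) \<in> poly_funs V"

definition zariski :: "('a::field, 'v) module \<Rightarrow> 'v topology" where
  "zariski V = topology_generated_by {{v \<in> carrier V. f v \<noteq> 0} | f. f \<in> poly_funs V}"


section \<open>Linear algebraic groups and their Lie algebras\<close>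

definition GL :: "nat \<Rightarrow> ('a::field mat) monoid" where
  "GL N = units_of (ring_mat TYPE('a) N ())"

abbreviation matrix_space :: "nat \<Rightarrow> ('a::field, 'a mat) module" where
  "matrix_space N \<equiv> module_mat TYPE('a) N N"

definition connected_closed_subgroup :: "nat \<Rightarrow> ('a::field mat) set \<Rightarrow> bool" where
  "connected_closed_subgroup N H \<longleftrightarrow>
     subgroup H (GL N) \<and>
     closedin (subtopology (zariski (matrix_space N)) (carrier (GL N))) H \<and>
     connectedin (zariski (matrix_space N)) H"

text \<open>The tangent space of \<open>H\<close> at the identity: the differential at the identity, in the
  direction \<open>X\<close>, of every polynomial function vanishing on \<open>H\<close> is zero.  The restriction of such
  a function to the line \<open>1 + t X\<close> is a polynomial \<open>p\<close> in \<open>t\<close>, and \<open>coeff p 1\<close> is its derivative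
  at \<open>t = 0\<close>.\<close>

definition lie_algebra :: "nat \<Rightarrow> ('a::field_char_0 mat) set \<Rightarrow> 'a mat set" where
  "lie_algebra N H = {X \<in> carrier_mat N N.
     \<forall>f \<in> poly_funs (matrix_space N). (\<forall>h \<in> H. f h = 0) \<longrightarrow>
       (\<forall>p. (\<forall>t. poly p t = f (1\<^sub>m N + t \<cdot>\<^sub>m X)) \<longrightarrow> coeff p 1 = 0)}"

definition lie_bracket :: "'a::field mat \<Rightarrow> 'a mat \<Rightarrow> 'a mat" where
  "lie_bracket X Y = X * Y - Y * X"

definition conjugation :: "nat \<Rightarrow> 'a::field mat \<Rightarrow> 'a mat \<Rightarrow> 'a mat" where
  "conjugation N g X = g * X * inv\<^bsub>GL N\<^esub> g"


section \<open>Good nilpotent index behaviour\<close>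

definition nilpotent_vector ::
    "'g set \<Rightarrow> ('g \<Rightarrow> 'v \<Rightarrow> 'v) \<Rightarrow> ('a::field, 'v) module \<Rightarrow> 'v \<Rightarrow> bool" where
  "nilpotent_vector G \<rho> V v \<longleftrightarrow>
     v \<in> carrier V \<and> \<zero>\<^bsub>V\<^esub> \<in> zariski V closure_of ((\<lambda>g. \<rho> g v) ` G)"

text \<open>\<open>G\<close> is a closed subgroup of the general linear group of rank \<open>N\<close>, acting on \<open>V\<close> through
  \<open>\<rho>\<close>; the action \<open>act\<close> of the Lie algebra of \<open>G\<close> is to be the differential of \<open>\<rho>\<close>.\<close>

definition GNIB ::
    "nat \<Rightarrow> ('a::field_char_0 mat) set \<Rightarrow> ('a mat \<Rightarrow> 'v \<Rightarrow> 'v) \<Rightarrow> ('a mat \<Rightarrow> 'v \<Rightarrow> 'v)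
      \<Rightarrow> ('a, 'v) module \<Rightarrow> bool" where
  "GNIB N G \<rho> act V \<longleftrightarrow>
     (\<forall>v. nilpotent_vector G \<rho> V v \<longrightarrow>
        (let \<gg> = lie_algebra N G;
             \<gg>\<^sub>v = lie_stabiliser \<gg> act V v;
             T = lie_orbit \<gg> act v;
             Q = quotient_module V T
         in lie_index \<gg> (dual_action V act) (dual_module V) =
            lie_index \<gg>\<^sub>v (dual_action Q (quotient_action V T act)) (dual_module Q)))"


section \<open>Symmetric pairs\<close>

definition involutory_automorphism ::
    "nat \<Rightarrow> 'a::field mat set \<Rightarrow> ('a mat \<Rightarrow> 'a mat) \<Rightarrow> bool" where
  "involutory_automorphism N \<gg> \<sigma> \<longleftrightarrow>
     \<sigma> \<in> module_hom (class_ring :: 'a ring) (sub_space (matrix_space N) \<gg>)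
           (sub_space (matrix_space N) \<gg>) \<and>
     (\<forall>X \<in> \<gg>. \<forall>Y \<in> \<gg>. \<sigma> (lie_bracket X Y) = lie_bracket (\<sigma> X) (\<sigma> Y)) \<and>
     (\<forall>X \<in> \<gg>. \<sigma> (\<sigma> X) = X) \<and> (\<exists>X \<in> \<gg>. \<sigma> X \<noteq> X)"

text \<open>The isotropy representation is the restriction of the adjoint representation of \<open>G\<close> to
  \<open>G\<^sub>0\<close> and to the \<open>-1\<close>-eigenspace; its differential is the restriction of the bracket.\<close>

definition isotropy_GNIB ::
    "nat \<Rightarrow> 'a::field_char_0 mat set \<Rightarrow> ('a mat \<Rightarrow> 'a mat) \<Rightarrow> 'a mat set \<Rightarrow> bool" where
  "isotropy_GNIB N \<gg> \<sigma> G\<^sub>0 \<longleftrightarrow>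
     GNIB N G\<^sub>0 (conjugation N) lie_bracket (sub_space (matrix_space N) {X \<in> \<gg>. \<sigma> X = - X})"

definition direct_decomposition ::
    "nat \<Rightarrow> 'a::field vec set \<Rightarrow> nat \<Rightarrow> 'a vec set \<Rightarrow> nat \<Rightarrow> bool" where
  "direct_decomposition N U a W b \<longleftrightarrow>
     submodule (class_ring :: 'a ring) U (module_vec TYPE('a) N) \<and>
     submodule (class_ring :: 'a ring) W (module_vec TYPE('a) N) \<and>
     vdim (sub_space (module_vec TYPE('a) N) U) = a \<and>
     vdim (sub_space (module_vec TYPE('a) N) W) = b \<and>
     (\<forall>v \<in> carrier_vec N. \<exists>!(u, w). u \<in> U \<and> w \<in> W \<and> v = u + w)"

definition preserving :: "'a::field mat set \<Rightarrow> 'a vec set \<Rightarrow> 'a vec set \<Rightarrow> 'a mat set" where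
  "preserving \<gg> U W = {X \<in> \<gg>. (\<forall>u \<in> U. X *\<^sub>v u \<in> U) \<and> (\<forall>w \<in> W. X *\<^sub>v w \<in> W)}"

text \<open>Bilinear forms on the standard module are given by their Gram matrix \<open>J\<close>.\<close>

definition bform :: "'a::field mat \<Rightarrow> 'a vec \<Rightarrow> 'a vec \<Rightarrow> 'a" where
  "bform J x y = x \<bullet> (J *\<^sub>v y)"

definition nondegenerate_on :: "nat \<Rightarrow> 'a::field mat \<Rightarrow> 'a vec set \<Rightarrow> bool" where
  "nondegenerate_on N J U \<longleftrightarrow> (\<forall>x \<in> U. (\<forall>y \<in> U. bform J x y = 0) \<longrightarrow> x = 0\<^sub>v N)"

definition form_algebra :: "nat \<Rightarrow> 'a::field mat \<Rightarrow> 'a mat set" where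
  "form_algebra N J = {X \<in> carrier_mat N N.
     \<forall>x \<in> carrier_vec N. \<forall>y \<in> carrier_vec N. bform J (X *\<^sub>v x) y + bform J x (X *\<^sub>v y) = 0}"

definition orthogonal_decomposition ::
    "nat \<Rightarrow> 'a::field mat \<Rightarrow> 'a vec set \<Rightarrow> nat \<Rightarrow> 'a vec set \<Rightarrow> nat \<Rightarrow> bool" where
  "orthogonal_decomposition N J U a W b \<longleftrightarrow>
     direct_decomposition N U a W b \<and>
     (\<forall>u \<in> U. \<forall>w \<in> W. bform J u w = 0) \<and>
     nondegenerate_on N J U \<and> nondegenerate_on N J W"

definition gl_pair :: "nat \<Rightarrow> nat \<Rightarrow> 'a::field mat set \<Rightarrow> 'a mat set \<Rightarrow> bool" where
  "gl_pair n m \<gg> \<gg>\<^sub>0 \<longleftrightarrow>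
     (\<exists>U W. direct_decomposition n U m W (n - m) \<and>
            \<gg> = carrier_mat n n \<and> \<gg>\<^sub>0 = preserving \<gg> U W)"

definition so_pair :: "nat \<Rightarrow> nat \<Rightarrow> 'a::field mat set \<Rightarrow> 'a mat set \<Rightarrow> bool" where
  "so_pair n m \<gg> \<gg>\<^sub>0 \<longleftrightarrow>
     (\<exists>J U W. J \<in> carrier_mat n n \<and>
        (\<forall>x \<in> carrier_vec n. \<forall>y \<in> carrier_vec n. bform J x y = bform J y x) \<and>
        nondegenerate_on n J (carrier_vec n) \<and>
        orthogonal_decomposition n J U m W (n - m) \<and>
        \<gg> = form_algebra n J \<and> \<gg>\<^sub>0 = preserving \<gg> U W)"

definition sp_pair :: "nat \<Rightarrow> nat \<Rightarrow> 'a::field mat set \<Rightarrow> 'a mat set \<Rightarrow> bool" where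
  "sp_pair n m \<gg> \<gg>\<^sub>0 \<longleftrightarrow>
     (\<exists>J U W. J \<in> carrier_mat (2 * n) (2 * n) \<and>
        (\<forall>x \<in> carrier_vec (2 * n). bform J x x = 0) \<and>
        nondegenerate_on (2 * n) J (carrier_vec (2 * n)) \<and>
        orthogonal_decomposition (2 * n) J U (2 * m) W (2 * n - 2 * m) \<and>
        \<gg> = form_algebra (2 * n) J \<and> \<gg>\<^sub>0 = preserving \<gg> U W)"

end

(* All three families consist of the skew-hermitian matrices over a simple algebra with involution,
   with the symmetric pair given by a splitting U + W of the standard module.  By the trace form
   the two indices are the dimensions of generic centralisers, so the index of the isotropy
   representation is m = dim U: the centraliser of a generic odd element is spanned by m
   semisimple elements.  Take the nilpotent odd element e of type (3,3,1,...,1) that maps a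
   two-dimensional subspace of W onto one of U and this onto another one of W.  The slice
   representation at e is governed by the Lie bracket between the even and the odd centraliser of
   e; the annihilator of a generic bracket orbit contains the odd centraliser elements built from
   commuting expressions in the blocks of the generic element, and these span a space of
   dimension at least m + 1.  One explicit element witnesses this, and since the dimension is
   governed by determinants that are polynomial along a line, the bound passes to all elements
   whose orbit has maximal dimension. *)
theory Submission imports Defs begin

section \<open>Matrices of finite support as a ring\<close>

text \<open>The number m + 1 arises as 5 + (m - 4). The generic element induces two endomorphisms X
  and Y of the two-dimensional source space S of e, where Y = x y factors through the rest R of U,
  of rank m - 2. Every pair (Z, T) of selfadjoint endomorphisms of S with [Z, X] + [T, Y] = 0 gives
  an annihilating element; the pairs (1, 0), (X, 0), (Y, X), (0, 1), (0, Y) always qualify, the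
  third because its two brackets cancel. This is why e has two blocks of length three: with a single
  block X and Y would be scalars, and 1, X, Y dependent. If Y is invertible, R is the sum of im y
  and ker x, and powers of the compression to ker x of the map from R to the rest of W and back give
  m - 4 more elements. For m = 3 the rank of R is one, Y is singular, and four pairs are enough.
  Source and target of e inside W are isotropic planes in duality, which forces dim W >= 4. For the
  two indices only the bounds <= m and >= m + 1 are proved, so no generic orbit dimension has to be
  computed exactly.\<close>

typedef (overloaded) 'a fmatrix =
  "{f :: nat \<Rightarrow> nat \<Rightarrow> 'a::zero. \<exists>B. \<forall>i j. i \<ge> B \<or> j \<ge> B \<longrightarrow> f i j = 0}"
  morphisms entry Abs_fmatrix
  by (rule exI[of _ "\<lambda>_ _. 0"]) simp

setup_lifting type_definition_fmatrix

lemma fmatrix_eqI: "(\<And>i j. entry A i j = entry B i j) \<Longrightarrow> A = B"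
  by (metis entry_inject ext)

text \<open>Matrices of every size live in one ring without unit, and a corner is the algebra of N x
  N matrices inside it. Long identities between noncommuting words thus become plain ring
  simplification, free of dimension side conditions.\<close>

definition corner :: "nat \<Rightarrow> 'a::zero fmatrix set" where
  "corner N = {A. \<forall>i j. i \<ge> N \<or> j \<ge> N \<longrightarrow> entry A i j = 0}"

lemma corner_ex: "\<exists>N. A \<in> corner N"
  using entry[of A] by (auto simp: corner_def)

lemma corner_mono: "M \<le> N \<Longrightarrow> corner M \<subseteq> corner N"
  by (auto simp: corner_def)

lemma corner_entry_0: "A \<in> corner N \<Longrightarrow> i \<ge> N \<or> j \<ge> N \<Longrightarrow> entry A i j = 0"
  by (auto simp: corner_def)

lemma corner_entryD: "A \<in> corner N \<Longrightarrow> entry A i j \<noteq> 0 \<Longrightarrow> i < N \<and> j < N"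
  unfolding corner_def by (metis (mono_tags, lifting) mem_Collect_eq not_le)

instantiation fmatrix :: (comm_ring_1) ring
begin

lift_definition zero_fmatrix :: "'a fmatrix" is "\<lambda>_ _. 0" by simp

lift_definition plus_fmatrix :: "'a fmatrix \<Rightarrow> 'a fmatrix \<Rightarrow> 'a fmatrix"
  is "\<lambda>f g i j. f i j + g i j"
proof -
  fix f g :: "nat \<Rightarrow> nat \<Rightarrow> 'a"
  assume "\<exists>B. \<forall>i j. i \<ge> B \<or> j \<ge> B \<longrightarrow> f i j = 0" "\<exists>B. \<forall>i j. i \<ge> B \<or> j \<ge> B \<longrightarrow> g i j = 0"
  then obtain B C where "\<forall>i j. i \<ge> B \<or> j \<ge> B \<longrightarrow> f i j = 0" "\<forall>i j. i \<ge> C \<or> j \<ge> C \<longrightarrow> g i j = 0"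
    by blast
  then show "\<exists>B. \<forall>i j. i \<ge> B \<or> j \<ge> B \<longrightarrow> f i j + g i j = 0"
    by (intro exI[of _ "max B C"]) auto
qed

lift_definition uminus_fmatrix :: "'a fmatrix \<Rightarrow> 'a fmatrix" is "\<lambda>f i j. - f i j" by simp

lift_definition minus_fmatrix :: "'a fmatrix \<Rightarrow> 'a fmatrix \<Rightarrow> 'a fmatrix"
  is "\<lambda>f g i j. f i j - g i j"
proof -
  fix f g :: "nat \<Rightarrow> nat \<Rightarrow> 'a"
  assume "\<exists>B. \<forall>i j. i \<ge> B \<or> j \<ge> B \<longrightarrow> f i j = 0" "\<exists>B. \<forall>i j. i \<ge> B \<or> j \<ge> B \<longrightarrow> g i j = 0"
  then obtain B C where "\<forall>i j. i \<ge> B \<or> j \<ge> B \<longrightarrow> f i j = 0" "\<forall>i j. i \<ge> C \<or> j \<ge> C \<longrightarrow> g i j = 0"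
    by blast
  then show "\<exists>B. \<forall>i j. i \<ge> B \<or> j \<ge> B \<longrightarrow> f i j - g i j = 0"
    by (intro exI[of _ "max B C"]) auto
qed

text \<open>Summing over the support of row i keeps the sum finite without naming a bound;
  \<open>entry_mult_corner\<close> restores the usual range.\<close>

lift_definition times_fmatrix :: "'a fmatrix \<Rightarrow> 'a fmatrix \<Rightarrow> 'a fmatrix"
  is "\<lambda>f g i k. \<Sum>j | f i j \<noteq> 0. f i j * g j k"
proof -
  fix f g :: "nat \<Rightarrow> nat \<Rightarrow> 'a"
  assume "\<exists>B. \<forall>i j. i \<ge> B \<or> j \<ge> B \<longrightarrow> f i j = 0" "\<exists>B. \<forall>i j. i \<ge> B \<or> j \<ge> B \<longrightarrow> g i j = 0"
  then obtain B C where "\<forall>i j. i \<ge> B \<or> j \<ge> B \<longrightarrow> f i j = 0" "\<forall>i j. i \<ge> C \<or> j \<ge> C \<longrightarrow> g i j = 0"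
    by blast
  then show "\<exists>B. \<forall>i k. i \<ge> B \<or> k \<ge> B \<longrightarrow> (\<Sum>j | f i j \<noteq> 0. f i j * g j k) = 0"
    by (intro exI[of _ "max B C"]) auto
qed

lemma entry_mult_corner:
  assumes "A \<in> corner N"
  shows "entry (A * B) i k = (\<Sum>j<N. entry A i j * entry B j k)"
proof -
  have "entry (A * B) i k = (\<Sum>j | entry A i j \<noteq> 0. entry A i j * entry B j k)"
    by transfer simp
  also have "\<dots> = (\<Sum>j<N. entry A i j * entry B j k)"
    by (rule sum.mono_neutral_left) (use assms in \<open>auto dest: corner_entryD\<close>)
  finally show ?thesis .
qed

lemma entry_simps [simp]:
  "entry 0 i j = 0" "entry (A + B) i j = entry A i j + entry B i j"
  "entry (- A) i j = - entry A i j" "entry (A - B) i j = entry A i j - entry B i j"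
  by (transfer, simp)+

instance
proof
  fix A B C :: "'a fmatrix"
  obtain n1 n2 n3 where n: "A \<in> corner n1" "B \<in> corner n2" "C \<in> corner n3"
    using corner_ex by metis
  define N where "N = max n1 (max n2 n3)"
  have A: "A \<in> corner N" and B: "B \<in> corner N" and C: "C \<in> corner N"
    using n corner_mono[of _ N] unfolding N_def by (meson max.cobounded1 max.cobounded2 order_trans subsetD)+
  have AB: "A * B \<in> corner N"
    unfolding corner_def by (auto simp: entry_mult_corner[OF A] corner_entry_0[OF A] corner_entry_0[OF B])
  have ApB: "A + B \<in> corner N"
    unfolding corner_def by (auto simp: corner_entry_0[OF A] corner_entry_0[OF B])
  show "A * B * C = A * (B * C)"
  proof (rule fmatrix_eqI)
    fix i l
    have "entry (A * B * C) i l = (\<Sum>k<N. \<Sum>j<N. entry A i j * entry B j k * entry C k l)"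
      by (simp add: entry_mult_corner[OF A] entry_mult_corner[OF AB] sum_distrib_right)
    also have "\<dots> = (\<Sum>j<N. \<Sum>k<N. entry A i j * entry B j k * entry C k l)"
      by (rule sum.swap)
    also have "\<dots> = entry (A * (B * C)) i l"
      by (simp add: entry_mult_corner[OF A] entry_mult_corner[OF B] sum_distrib_left mult.assoc)
    finally show "entry (A * B * C) i l = entry (A * (B * C)) i l" .
  qed
  show "(A + B) * C = A * C + B * C"
    by (rule fmatrix_eqI) (simp add: entry_mult_corner[OF A] entry_mult_corner[OF B]
        entry_mult_corner[OF ApB] sum.distrib distrib_right)
  show "A * (B + C) = A * B + A * C"
    by (rule fmatrix_eqI) (simp add: entry_mult_corner[OF A] sum.distrib distrib_left)
  show "A + B + C = A + (B + C)" "A + B = B + A" "0 + A = A" "- A + A = 0" "A - B = A + - B"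
    by (rule fmatrix_eqI, simp)+
qed

end

lift_definition scale :: "'a::comm_ring_1 \<Rightarrow> 'a fmatrix \<Rightarrow> 'a fmatrix" is "\<lambda>c f i j. c * f i j"
  by (metis mult_zero_right)

lemma entry_scale [simp]: "entry (scale c A) i j = c * entry A i j"
  by transfer simp

lemma entry_sum: "entry (sum F I) i j = (\<Sum>x\<in>I. entry (F x) i j)"
  by (induction I rule: infinite_finite_induct) auto

lemma corner_closed [simp, intro]:
  "0 \<in> corner N"
  "A \<in> corner N \<Longrightarrow> B \<in> corner N \<Longrightarrow> A + B \<in> corner N"
  "A \<in> corner N \<Longrightarrow> B \<in> corner N \<Longrightarrow> A - B \<in> corner N"
  "A \<in> corner N \<Longrightarrow> - A \<in> corner N"
  "A \<in> corner N \<Longrightarrow> scale c A \<in> corner N"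
  by (auto simp: corner_def)

lemma corner_mult [simp, intro]: "A \<in> corner N \<Longrightarrow> B \<in> corner N \<Longrightarrow> A * B \<in> corner N"
  unfolding corner_def[of N] using entry_mult_corner[of A N B] by (auto simp: corner_def)

lemma corner_sum [simp, intro]: "(\<And>x. x \<in> I \<Longrightarrow> F x \<in> corner N) \<Longrightarrow> sum F I \<in> corner N"
  by (induction I rule: infinite_finite_induct) auto

lemma scale_simps [simp]:
  "scale c (A + B) = scale c A + scale c B" "scale c (A - B) = scale c A - scale c B"
  "scale c (- A) = - scale c A" "scale c 0 = 0" "scale 0 A = 0" "scale 1 A = A"
  "scale c (scale d A) = scale (c * d) A" "scale (-1) A = - A"
  by (rule fmatrix_eqI, simp add: algebra_simps)+

lemma scale_left: "scale (c + d) A = scale c A + scale d A" "scale (c - d) A = scale c A - scale d A"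
  "scale (- c) A = - scale c A"
  by (rule fmatrix_eqI, simp add: algebra_simps)+

lemma scale_mult [simp]: "scale c A * B = scale c (A * B)" "A * scale c B = scale c (A * B)"
proof -
  obtain N where N: "A \<in> corner N" using corner_ex by blast
  then have "scale c A \<in> corner N" by auto
  with N show "scale c A * B = scale c (A * B)" "A * scale c B = scale c (A * B)"
    by (auto intro!: fmatrix_eqI simp: entry_mult_corner[of _ N] sum_distrib_left algebra_simps)
qed

section \<open>The trace form on matrices of finite support\<close>

definition ftrace :: "'a::comm_ring_1 fmatrix \<Rightarrow> 'a" where
  "ftrace A = (\<Sum>i | entry A i i \<noteq> 0. entry A i i)"

lemma ftrace_corner: "A \<in> corner N \<Longrightarrow> ftrace A = (\<Sum>i<N. entry A i i)"
  unfolding ftrace_def by (rule sum.mono_neutral_left) (auto dest: corner_entryD)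

lemma common_corner: "\<exists>N. A \<in> corner N \<and> B \<in> corner N"
proof -
  obtain n1 n2 where n: "A \<in> corner n1" "B \<in> corner n2" using corner_ex by metis
  then have "A \<in> corner (max n1 n2)" "B \<in> corner (max n1 n2)"
    using corner_mono by (meson max.cobounded1 max.cobounded2 subsetD)+
  then show ?thesis by blast
qed

lemma ftrace_simps [simp]:
  "ftrace 0 = 0" "ftrace (A + B) = ftrace A + ftrace B" "ftrace (A - B) = ftrace A - ftrace B"
  "ftrace (- A) = - ftrace A" "ftrace (scale c A) = c * ftrace A"
proof -
  obtain N where N: "A \<in> corner N" "B \<in> corner N" using common_corner by metis
  show "ftrace 0 = 0" by (simp add: ftrace_def)
  show "ftrace (A + B) = ftrace A + ftrace B" "ftrace (A - B) = ftrace A - ftrace B"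
    "ftrace (- A) = - ftrace A" "ftrace (scale c A) = c * ftrace A"
    using N by (simp_all add: ftrace_corner[of _ N] corner_closed sum.distrib sum_subtractf sum_negf sum_distrib_left)
qed

lemma ftrace_sum: "ftrace (sum F I) = (\<Sum>x\<in>I. ftrace (F x))"
  by (induction I rule: infinite_finite_induct) auto

lemma ftrace_commute: "ftrace (A * B) = ftrace (B * A)"
proof -
  obtain N where N: "A \<in> corner N" "B \<in> corner N" using common_corner by metis
  have "ftrace (A * B) = (\<Sum>i<N. \<Sum>j<N. entry A i j * entry B j i)"
    using N by (simp add: ftrace_corner[of _ N] entry_mult_corner[of _ N])
  also have "\<dots> = (\<Sum>j<N. \<Sum>i<N. entry A i j * entry B j i)" by (rule sum.swap)
  also have "\<dots> = ftrace (B * A)"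
    using N by (simp add: ftrace_corner[of _ N] entry_mult_corner[of _ N] mult.commute)
  finally show ?thesis .
qed

lift_definition funit :: "nat \<Rightarrow> nat \<Rightarrow> 'a::comm_ring_1 fmatrix"
  is "\<lambda>a b i j. if i = a \<and> j = b then 1 else 0"
  subgoal for a b by (rule exI[of _ "Suc (max a b)"]) auto
  done

lemma entry_funit [simp]: "entry (funit a b) i j = (if i = a \<and> j = b then 1 else 0)"
  by transfer simp

lemma funit_corner: "a < N \<Longrightarrow> b < N \<Longrightarrow> funit a b \<in> corner N"
  by (auto simp: corner_def)

lemma ftrace_mult_funit:
  assumes "A \<in> corner N" "a < N" "b < N"
  shows "ftrace (A * funit a b) = entry A b a"
proof -
  have "ftrace (A * funit a b) = (\<Sum>i<N. \<Sum>j<N. entry A i j * (if j = a \<and> i = b then 1 else 0))"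
    using assms by (simp add: ftrace_corner[of _ N] entry_mult_corner[of _ N] corner_mult funit_corner)
  also have "\<dots> = (\<Sum>i<N. if i = b then entry A i a else 0)"
    by (rule sum.cong[OF refl]) (use assms in \<open>auto simp: if_distrib sum.delta cong: if_cong\<close>)
  finally show ?thesis using assms by simp
qed

lemma ftrace_nondegenerate:
  assumes "A \<in> corner N" "\<And>B. B \<in> corner N \<Longrightarrow> ftrace (A * B) = 0"
  shows "A = 0"
proof (rule fmatrix_eqI)
  fix i j show "entry A i j = entry 0 i j"
    using assms(2)[OF funit_corner[of j N i]] ftrace_mult_funit[OF assms(1), of j i] assms(1)
    by (cases "i < N \<and> j < N") (auto simp: corner_def)
qed

section \<open>Passage between matrices and matrices of finite support\<close>

lift_definition fmatrix_of_mat :: "'a::comm_ring_1 mat \<Rightarrow> 'a fmatrix"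
  is "\<lambda>A i j. if i < dim_row A \<and> j < dim_col A then A $$ (i, j) else 0"
  subgoal for A by (rule exI[of _ "max (dim_row A) (dim_col A)"]) auto
  done

lemma entry_fmatrix_of_mat [simp]:
  "entry (fmatrix_of_mat A) i j = (if i < dim_row A \<and> j < dim_col A then A $$ (i, j) else 0)"
  by transfer simp

definition mat_of_fmatrix :: "nat \<Rightarrow> 'a::comm_ring_1 fmatrix \<Rightarrow> 'a mat" where
  "mat_of_fmatrix N A = mat N N (\<lambda>(i, j). entry A i j)"

lemma mat_of_fmatrix_carrier [simp]: "mat_of_fmatrix N A \<in> carrier_mat N N"
  by (simp add: mat_of_fmatrix_def)

lemma fmatrix_of_mat_corner [simp]: "A \<in> carrier_mat N N \<Longrightarrow> fmatrix_of_mat A \<in> corner N"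
  by (auto simp: corner_def)

lemma mat_of_fmatrix_of_mat [simp]:
  "A \<in> carrier_mat N N \<Longrightarrow> mat_of_fmatrix N (fmatrix_of_mat A) = A"
  by (intro eq_matI) (auto simp: mat_of_fmatrix_def)

lemma fmatrix_of_mat_of_fmatrix [simp]:
  "A \<in> corner N \<Longrightarrow> fmatrix_of_mat (mat_of_fmatrix N A) = A"
  by (rule fmatrix_eqI) (auto simp: mat_of_fmatrix_def corner_entry_0)

lemma fmatrix_of_mat_inj:
  "A \<in> carrier_mat N N \<Longrightarrow> B \<in> carrier_mat N N \<Longrightarrow> fmatrix_of_mat A = fmatrix_of_mat B \<Longrightarrow> A = B"
  by (metis mat_of_fmatrix_of_mat)

lemma fmatrix_of_mat_hom:
  assumes A: "A \<in> carrier_mat N N" and B: "B \<in> carrier_mat N N"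
  shows "fmatrix_of_mat (A + B) = fmatrix_of_mat A + fmatrix_of_mat B"
    "fmatrix_of_mat (A - B) = fmatrix_of_mat A - fmatrix_of_mat B"
    "fmatrix_of_mat (- A) = - fmatrix_of_mat A"
    "fmatrix_of_mat (c \<cdot>\<^sub>m A) = scale c (fmatrix_of_mat A)"
    "fmatrix_of_mat (A * B) = fmatrix_of_mat A * fmatrix_of_mat B"
    "fmatrix_of_mat (0\<^sub>m N N) = 0"
proof -
  show "fmatrix_of_mat (A * B) = fmatrix_of_mat A * fmatrix_of_mat B"
    by (rule fmatrix_eqI, subst entry_mult_corner[OF fmatrix_of_mat_corner[OF A]])
      (use A B in \<open>auto simp: scalar_prod_def intro!: sum.cong\<close>)
qed (use A B in \<open>auto intro!: fmatrix_eqI\<close>)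

lemma mat_of_fmatrix_hom:
  "mat_of_fmatrix N (A + B) = mat_of_fmatrix N A + mat_of_fmatrix N B"
  "mat_of_fmatrix N (A - B) = mat_of_fmatrix N A - mat_of_fmatrix N B"
  "mat_of_fmatrix N (- A) = - mat_of_fmatrix N A"
  "mat_of_fmatrix N (scale c A) = c \<cdot>\<^sub>m mat_of_fmatrix N A"
  "mat_of_fmatrix N 0 = 0\<^sub>m N N"
  by (auto simp: mat_of_fmatrix_def)

lemma mat_of_fmatrix_mult:
  assumes "A \<in> corner N" "B \<in> corner N"
  shows "mat_of_fmatrix N (A * B) = mat_of_fmatrix N A * mat_of_fmatrix N B"
  by (rule fmatrix_of_mat_inj[of _ N])
    (use assms fmatrix_of_mat_hom(5)[of "mat_of_fmatrix N A" N "mat_of_fmatrix N B"]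
      in \<open>simp_all add: mult_carrier_mat[of _ N N _ N] corner_mult\<close>)

section \<open>Independence of families with polynomial entries\<close>

text \<open>Polynomial dependence as a property of functions of the line parameter: determinants,
  traces and products are covered by closure rules, and the finiteness of the zero set is what is
  finally used.\<close>

definition polyfn :: "('a::comm_ring_1 \<Rightarrow> 'a) \<Rightarrow> bool" where
  "polyfn f \<longleftrightarrow> (\<exists>p. \<forall>s. f s = poly p s)"

lemma polyfn_const [simp, intro]: "polyfn (\<lambda>_. c)"
  unfolding polyfn_def by (rule exI[of _ "[:c:]"]) simp

lemma polyfn_ident [simp, intro]: "polyfn (\<lambda>s. s)"
  unfolding polyfn_def by (rule exI[of _ "[:0, 1:]"]) simp

lemma polyfn_add [intro]: "polyfn f \<Longrightarrow> polyfn g \<Longrightarrow> polyfn (\<lambda>s. f s + g s)"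
  unfolding polyfn_def by (metis poly_add)

lemma polyfn_uminus [intro]: "polyfn f \<Longrightarrow> polyfn (\<lambda>s. - f s)"
  unfolding polyfn_def by (metis poly_minus)

lemma polyfn_diff [intro]: "polyfn f \<Longrightarrow> polyfn g \<Longrightarrow> polyfn (\<lambda>s. f s - g s)"
  unfolding polyfn_def by (metis poly_diff)

lemma polyfn_mult [intro]: "polyfn f \<Longrightarrow> polyfn g \<Longrightarrow> polyfn (\<lambda>s. f s * g s)"
  unfolding polyfn_def by (metis poly_mult)

lemma polyfn_sum [intro]: "(\<And>x. x \<in> I \<Longrightarrow> polyfn (f x)) \<Longrightarrow> polyfn (\<lambda>s. \<Sum>x\<in>I. f x s)"
  by (induction I rule: infinite_finite_induct) (auto intro!: polyfn_add)

lemma polyfn_prod [intro]: "(\<And>x. x \<in> I \<Longrightarrow> polyfn (f x)) \<Longrightarrow> polyfn (\<lambda>s. \<Prod>x\<in>I. f x s)"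
  by (induction I rule: infinite_finite_induct) (auto intro!: polyfn_mult)

lemma polyfn_power [intro]: "polyfn f \<Longrightarrow> polyfn (\<lambda>s. f s ^ n)"
  by (induction n) auto

lemma polyfn_finite_zeros:
  fixes f :: "'a::idom \<Rightarrow> 'a"
  assumes "polyfn f" "f s0 \<noteq> 0"
  shows "finite {s. f s = 0}"
proof -
  obtain p where p: "\<And>s. f s = poly p s" using assms unfolding polyfn_def by auto
  then have "p \<noteq> 0" using assms(2) by auto
  with p show ?thesis using poly_roots_finite[of p] by simp
qed

text \<open>One notion serves for functionals, for vectors read as functions of the coordinate, and
  for matrices read as functions of the entry position.\<close>

definition independent_on :: "'j set \<Rightarrow> nat \<Rightarrow> (nat \<Rightarrow> 'j \<Rightarrow> 'a::comm_ring_1) \<Rightarrow> bool" where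
  "independent_on J r w \<longleftrightarrow>
     (\<forall>c. (\<forall>j\<in>J. (\<Sum>i<r. c i * w i j) = 0) \<longrightarrow> (\<forall>i<r. c i = 0))"

lemma independent_onD:
  "independent_on J r w \<Longrightarrow> (\<And>j. j \<in> J \<Longrightarrow> (\<Sum>i<r. c i * w i j) = 0) \<Longrightarrow> i < r \<Longrightarrow> c i = 0"
  by (auto simp: independent_on_def)

lemma independent_onI:
  "(\<And>c i. (\<And>j. j \<in> J \<Longrightarrow> (\<Sum>i<r. c i * w i j) = 0) \<Longrightarrow> i < r \<Longrightarrow> c i = 0) \<Longrightarrow> independent_on J r w"
  by (auto simp: independent_on_def)

text \<open>Gaussian elimination without division, by induction on r: a pivot that is nonzero at
  \<open>s0\<close> has finitely many zeros, and the eliminated family again has polynomial entries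
  and is independent at \<open>s0\<close>. No minor has to be selected.\<close>

lemma independent_on_polyfn:
  fixes w :: "nat \<Rightarrow> 'j \<Rightarrow> 'a::idom \<Rightarrow> 'a"
  assumes "\<And>i j. i < r \<Longrightarrow> j \<in> J \<Longrightarrow> polyfn (w i j)"
    and "independent_on J r (\<lambda>i j. w i j s0)"
  shows "finite {s. \<not> independent_on J r (\<lambda>i j. w i j s)}"
  using assms
proof (induction r arbitrary: w)
  case 0
  then show ?case by (simp add: independent_on_def)
next
  case (Suc r)
  have "\<exists>j\<in>J. w r j s0 \<noteq> 0"
  proof (rule ccontr)
    assume "\<not> ?thesis"
    then have "(\<Sum>i<Suc r. (if i = r then 1 else 0) * w i j s0) = 0" if "j \<in> J" for j
      using that by (auto intro!: sum.neutral)
    from independent_onD[OF Suc.prems(2) this, of r] show False by simp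
  qed
  then obtain j0 where j0: "j0 \<in> J" "w r j0 s0 \<noteq> 0" by blast
  \<comment> \<open>The row operation with pivot \<open>w r j0\<close>, multiplied out so that the
    entries stay polynomial in s.\<close>
  define w' where "w' = (\<lambda>i j s. w r j0 s * w i j s - w i j0 s * w r j s)"
  have P: "polyfn (w' i j)" if "i < r" "j \<in> J" for i j
    unfolding w'_def using that j0(1) Suc.prems(1)
    by (intro polyfn_diff polyfn_mult) auto
  have comb: "(\<Sum>i<r. c i * w' i j s) =
      (\<Sum>i<Suc r. (if i = r then - (\<Sum>i<r. c i * w i j0 s) else c i * w r j0 s) * w i j s)" for c j s
    by (simp add: w'_def algebra_simps sum_subtractf sum_distrib_left sum_distrib_right)
  have I: "independent_on J r (\<lambda>i j. w' i j s0)"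
  proof (rule independent_onI)
    fix c i
    assume c: "\<And>j. j \<in> J \<Longrightarrow> (\<Sum>i<r. c i * w' i j s0) = 0" and i: "i < r"
    have "(if i = r then - (\<Sum>i<r. c i * w i j0 s0) else c i * w r j0 s0) = 0"
      by (rule independent_onD[OF Suc.prems(2)]) (use c comb i in auto)
    with i j0 show "c i = 0" by (auto split: if_splits)
  qed
  \<comment> \<open>Away from the zeros of the pivot, independence of the eliminated family lifts
    back to the original one.\<close>
  have sub: "{s. \<not> independent_on J (Suc r) (\<lambda>i j. w i j s)}
    \<subseteq> {s. w r j0 s = 0} \<union> {s. \<not> independent_on J r (\<lambda>i j. w' i j s)}"
  proof safe
    fix s assume n: "\<not> independent_on J (Suc r) (\<lambda>i j. w i j s)"
      and good: "independent_on J r (\<lambda>i j. w' i j s)" and nz: "w r j0 s \<noteq> 0"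
    have "independent_on J (Suc r) (\<lambda>i j. w i j s)"
    proof (rule independent_onI)
      fix c i
      assume c: "\<And>j. j \<in> J \<Longrightarrow> (\<Sum>i<Suc r. c i * w i j s) = 0" and i: "i < Suc r"
      have e: "(\<Sum>i<r. c i * w i j s) = - (c r * w r j s)" if "j \<in> J" for j
        using c[OF that] by (simp add: eq_neg_iff_add_eq_0)
      have z: "c i = 0" if "i < r" for i
      proof (rule independent_onD[OF good _ that])
        fix j assume j: "j \<in> J"
        have "(\<Sum>i<r. c i * w' i j s) =
            w r j0 s * (\<Sum>i<r. c i * w i j s) - w r j s * (\<Sum>i<r. c i * w i j0 s)"
          by (simp add: w'_def algebra_simps sum_subtractf sum_distrib_left)
        also have "\<dots> = 0" by (simp add: e j j0(1))
        finally show "(\<Sum>i<r. c i * w' i j s) = 0" .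
      qed
      moreover have "c r = 0" using c[OF j0(1)] z nz by simp
      ultimately show "c i = 0" using i by (cases "i = r") auto
    qed
    with n show False by blast
  qed
  have "finite {s. w r j0 s = 0}"
    by (rule polyfn_finite_zeros[of _ s0]) (use Suc.prems(1) j0 in auto)
  then show ?case
    using finite_subset[OF sub] Suc.IH[OF P I] by blast
qed

text \<open>On S the coordinate r is not the combination of the earlier coordinates dictated by the
  dual family found so far. An element z witnessing this, reduced and normalised, becomes the new
  dual vector, and the old ones are corrected by multiples of it.\<close>

lemma dual_family_aux:
  fixes S :: "(nat \<Rightarrow> 'a::field) set"
  assumes "S \<noteq> {}"
    and closed: "\<And>u w c. u \<in> S \<Longrightarrow> w \<in> S \<Longrightarrow> (\<lambda>i. u i + c * w i) \<in> S"
    and "independent_on S r (\<lambda>i u. u i)"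
  shows "\<exists>y. \<forall>j<r. y j \<in> S \<and> (\<forall>i<r. y j i = (if i = j then 1 else 0))"
  using assms(3)
proof (induction r)
  case 0
  then show ?case by simp
next
  case (Suc r)
  have zero: "(\<lambda>i. 0) \<in> S"
  proof -
    obtain u where u: "u \<in> S" using assms(1) by blast
    have "(\<lambda>i. u i + (-1) * u i) \<in> S" by (rule closed[OF u u])
    then show ?thesis by simp
  qed
  have comb: "(\<lambda>i. u i + (\<Sum>j<k. c j * y j i)) \<in> S"
    if "u \<in> S" "\<And>j. j < k \<Longrightarrow> y j \<in> S" for k c u and y :: "nat \<Rightarrow> nat \<Rightarrow> 'a"
    using that
  proof (induction k)
    case (Suc k)
    have "(\<lambda>i. (u i + (\<Sum>j<k. c j * y j i)) + c k * y k i) \<in> S"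
      by (rule closed) (use Suc in auto)
    then show ?case by (simp add: algebra_simps)
  qed simp
  have "independent_on S r (\<lambda>i u. u i)"
  proof (rule independent_onI)
    fix c i assume c: "\<And>u. u \<in> S \<Longrightarrow> (\<Sum>i<r. c i * u i) = 0" and i: "i < r"
    have "(\<lambda>i. if i = r then 0 else c i) i = 0"
      by (rule independent_onD[OF Suc.prems]) (use c i in auto)
    with i show "c i = 0" by simp
  qed
  from Suc.IH[OF this] obtain y where
    Y: "\<forall>j<r. y j \<in> S \<and> (\<forall>i<r. y j i = (if i = j then 1 else 0))" by (rule exE)
  have y: "\<And>j. j < r \<Longrightarrow> y j \<in> S" "\<And>i j. i < r \<Longrightarrow> j < r \<Longrightarrow> y j i = (if i = j then 1 else 0)"
    by (rule Y[rule_format, THEN conjunct1], assumption, rule Y[rule_format, THEN conjunct2, rule_format])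
  have "\<exists>z\<in>S. z r \<noteq> (\<Sum>j<r. z j * y j r)"
  proof (rule ccontr)
    assume n: "\<not> ?thesis"
    have "(if r = r then 1 else - y r r) = (0::'a)"
    proof (rule independent_onD[OF Suc.prems, of "\<lambda>i. if i = r then 1 else - y i r" r])
      fix u assume "u \<in> S"
      then have u: "u r = (\<Sum>j<r. u j * y j r)" using n by blast
      have "(\<Sum>i<Suc r. (if i = r then 1 else - y i r) * u i) = u r - (\<Sum>j<r. u j * y j r)"
        by (simp add: sum_negf mult.commute)
      also have "\<dots> = 0" by (subst u) simp
      finally show "(\<Sum>i<Suc r. (if i = r then 1 else - y i r) * u i) = 0" .
    qed simp
    then show False by simp
  qed
  then obtain z where z: "z \<in> S" "z r \<noteq> (\<Sum>j<r. z j * y j r)" by blast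
  \<comment> \<open>z minus its components along the family found so far: the earlier coordinates
    vanish, while coordinate r does not, by the choice of z.\<close>
  define x where "x = (\<lambda>i. z i + (\<Sum>j<r. (- z j) * y j i))"
  have x: "x \<in> S" unfolding x_def by (rule comb[OF z(1)]) (use y in auto)
  have xr: "x r \<noteq> 0" using z(2) by (simp add: x_def sum_negf)
  have xi: "x i = 0" if "i < r" for i
  proof -
    have "(\<Sum>j<r. (- z j) * y j i) = (\<Sum>j<r. if j = i then - z i else 0)"
      by (rule sum.cong) (use y that in auto)
    then show ?thesis using that by (simp add: x_def)
  qed
  define y' where "y' = (\<lambda>j. if j = r then (\<lambda>i. 0 + inverse (x r) * x i)
      else (\<lambda>i. y j i + (- y j r * inverse (x r)) * x i))"
  have "y' j \<in> S \<and> (\<forall>i<Suc r. y' j i = (if i = j then 1 else 0))" if j: "j < Suc r" for j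
  proof (cases "j = r")
    case True
    then have "y' j \<in> S" unfolding y'_def using closed[OF zero x] by simp
    then show ?thesis using True xi xr by (auto simp: y'_def less_Suc_eq)
  next
    case False
    then have jr: "j < r" using j by simp
    have "y' j \<in> S" unfolding y'_def
      using False closed[OF y(1)[OF jr] x, of "- y j r * inverse (x r)"] by (simp only: if_False)
    then show ?thesis using False jr xi xr y(2) by (auto simp: y'_def less_Suc_eq)
  qed
  then show ?case by blast
qed

text \<open>Linearity of Z is asked only through the values of the functionals, so that the lemma
  applies to carriers that are merely closed under their operations.\<close>

lemma dual_family:
  fixes \<phi> :: "nat \<Rightarrow> 'v \<Rightarrow> 'a::field"
  assumes "Z \<noteq> {}"
    and closed: "\<And>u w c. u \<in> Z \<Longrightarrow> w \<in> Z \<Longrightarrow> \<exists>x\<in>Z. \<forall>i<r. \<phi> i x = \<phi> i u + c * \<phi> i w"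
    and ind: "independent_on Z r \<phi>"
  shows "\<exists>y. \<forall>j<r. y j \<in> Z \<and> (\<forall>i<r. \<phi> i (y j) = (if i = j then 1 else 0))"
proof -
  define g where "g = (\<lambda>z i. if i < r then \<phi> i z else 0)"
  have "\<exists>y. \<forall>j<r. y j \<in> g ` Z \<and> (\<forall>i<r. y j i = (if i = j then 1 else 0))"
  proof (rule dual_family_aux)
    show "g ` Z \<noteq> {}" using assms(1) by simp
    fix u w c assume "u \<in> g ` Z" "w \<in> g ` Z"
    then obtain a b where ab: "a \<in> Z" "b \<in> Z" "u = g a" "w = g b" by auto
    then obtain x where "x \<in> Z" "\<forall>i<r. \<phi> i x = \<phi> i a + c * \<phi> i b" using closed by blast
    then show "(\<lambda>i. u i + c * w i) \<in> g ` Z"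
      using ab by (intro image_eqI[of _ _ x]) (auto simp: g_def)
  next
    show "independent_on (g ` Z) r (\<lambda>i u. u i)"
    proof (rule independent_onI)
      fix c i assume c: "\<And>j. j \<in> g ` Z \<Longrightarrow> (\<Sum>i<r. c i * j i) = 0" and "i < r"
      then show "c i = 0"
        by (intro independent_onD[OF ind, of c i]) (force simp: g_def)+
    qed
  qed
  then obtain y where y: "\<And>j. j < r \<Longrightarrow> y j \<in> g ` Z \<and> (\<forall>i<r. y j i = (if i = j then 1 else 0))"
    by blast
  then have "\<forall>j\<in>{..<r}. \<exists>z. z \<in> Z \<and> y j = g z" by blast
  from bchoice[OF this] obtain z where z: "\<And>j. j < r \<Longrightarrow> z j \<in> Z \<and> y j = g (z j)" by blast
  have Z: "z j \<in> Z" if "j < r" for j using z[OF that] by simp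
  have val: "\<phi> i (z j) = (if i = j then 1 else 0)" if "i < r" "j < r" for i j
  proof -
    have "\<phi> i (z j) = y j i" using z[OF that(2)] that(1) by (simp add: g_def)
    then show ?thesis using y[OF that(2)] that(1) by simp
  qed
  show ?thesis by (intro exI[of _ z] allI impI conjI Z val)
qed

section \<open>The centraliser of the bad nilpotent element\<close>

text \<open>\<open>p1\<close>, \<open>p0\<close>, \<open>p3\<close> project onto the three layers of
  the two Jordan blocks of length three: e sends the layer of \<open>p1\<close> to that of
  \<open>p0\<close> and this to that of \<open>p3\<close>, and f goes back. \<open>r\<close> and
  \<open>s\<close> are the remainders; \<open>p0\<close> and \<open>r\<close> belong to U, and
  \<open>p1\<close>, \<open>p3\<close>, \<open>s\<close> to W.\<close>

locale nilpotent_blocks =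
  fixes e f p0 p1 p3 r s :: "'r::ring"
  assumes pp: "p0 * p0 = p0" "p0 * p1 = 0" "p0 * p3 = 0" "p0 * r = 0" "p0 * s = 0"
    "p1 * p0 = 0" "p1 * p1 = p1" "p1 * p3 = 0" "p1 * r = 0" "p1 * s = 0"
    "p3 * p0 = 0" "p3 * p1 = 0" "p3 * p3 = p3" "p3 * r = 0" "p3 * s = 0"
    "r * p0 = 0" "r * p1 = 0" "r * p3 = 0" "r * r = r" "r * s = 0"
    "s * p0 = 0" "s * p1 = 0" "s * p3 = 0" "s * r = 0" "s * s = s"
    and pe: "p0 * e = e * p1" "p3 * e = e * p0" "p1 * e = 0" "r * e = 0" "s * e = 0"
      "e * p3 = 0" "e * r = 0" "e * s = 0"
    and pf: "p0 * f = f * p3" "p1 * f = f * p0" "p3 * f = 0" "r * f = 0" "s * f = 0"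
      "f * p1 = 0" "f * r = 0" "f * s = 0"
    and fe: "f * e = p0 + p1" and ef: "e * f = p0 + p3"
begin

lemma tail: "a * b = c \<Longrightarrow> a * (b * z) = c * z" for a b c z :: 'r
  by (simp add: mult.assoc [symmetric])

lemma eep0: "e * (e * p0) = 0"
  by (metis pe(2) pe(6) mult.assoc mult_zero_left)

lemma ffp0: "f * (f * p0) = 0"
  by (metis pf(2) pf(6) mult.assoc mult_zero_left)

lemma eep0': "e * (e * (p0 * z)) = 0"
  by (metis eep0 mult.assoc mult_zero_left)

lemma ffp0': "f * (f * (p0 * z)) = 0"
  by (metis ffp0 mult.assoc mult_zero_left)

text \<open>A rewriting system for words in these letters. Words associate to the right, so each
  relation also occurs with an arbitrary tail.\<close>

lemmas words = pp pe pf fe ef pp [THEN tail] pe [THEN tail] pf [THEN tail] fe [THEN tail] ef [THEN tail]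
  eep0 ffp0 eep0' ffp0' mult.assoc distrib_left distrib_right left_diff_distrib right_diff_distrib

lemma sandwich:
  assumes "p1 * Z = Z" "Z * p1 = Z"
  shows "p0 * Z = 0" "p3 * Z = 0" "r * Z = 0" "s * Z = 0" "Z * p0 = 0" "Z * p3 = 0" "Z * r = 0" "Z * s = 0"
    "Z * e = 0" "f * Z = 0"
  using assms pp pe pf by (metis mult.assoc mult_zero_left mult_zero_right)+

lemma sandwich_r:
  assumes "r * D = D" "D * r = D"
  shows "p0 * D = 0" "p3 * D = 0" "p1 * D = 0" "s * D = 0" "D * p0 = 0" "D * p3 = 0" "D * p1 = 0" "D * s = 0"
    "D * e = 0" "f * D = 0" "e * D = 0" "D * f = 0"
  using assms pp pe pf by (metis mult.assoc mult_zero_left mult_zero_right)+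

lemma eeesandwich:
  assumes "p1 * Z = Z"
  shows "e * (e * (e * Z)) = 0"
proof -
  have "e * (e * (e * Z)) = e * (e * (p0 * (e * Z)))"
    using assms pe(1) by (metis mult.assoc)
  then show ?thesis by (simp add: eep0')
qed

lemma eee_mult: "p1 * Z = Z \<Longrightarrow> e * (e * (e * (Z * z))) = 0"
  by (rule eeesandwich) (simp add: mult.assoc [symmetric])

lemma sandwich_f:
  assumes "Z * p1 = Z"
  shows "Z * (f * p0) = Z * f" "Z * (f * (p0 * z)) = Z * (f * z)"
  using assms pf(2) by (metis mult.assoc)+

section \<open>Odd elements modulo the image of ad e\<close>

definition "odd_element \<xi> \<longleftrightarrow>
   (p0 + r) * \<xi> * (p0 + r) = 0 \<and> (p1 + p3 + s) * \<xi> * (p1 + p3 + s) = 0 \<and>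
   (p0 + p1 + p3 + r + s) * \<xi> = \<xi> \<and> \<xi> * (p0 + p1 + p3 + r + s) = \<xi>"

text \<open>Of the twelve odd blocks these six represent the class modulo the image of ad e; the
  other six can be written as brackets with e.\<close>

definition "essential \<xi> = p1 * \<xi> * p0 + p0 * \<xi> * p3 + p1 * \<xi> * r + r * \<xi> * p3 + s * \<xi> * r + r * \<xi> * s"

lemma odd_blocks:
  assumes "odd_element \<xi>"
  shows "a \<in> {p0, r} \<Longrightarrow> b \<in> {p0, r} \<Longrightarrow> a * (\<xi> * b) = 0"
    "a \<in> {p1, p3, s} \<Longrightarrow> b \<in> {p1, p3, s} \<Longrightarrow> a * (\<xi> * b) = 0"
proof -
  assume a: "a \<in> {p0, r}" "b \<in> {p0, r}"
  then have "a * (p0 + r) = a" "(p0 + r) * b = b" by (auto simp: words)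
  then show "a * (\<xi> * b) = 0"
    using assms unfolding odd_element_def by (metis mult.assoc mult_zero_left mult_zero_right)
next
  assume a: "a \<in> {p1, p3, s}" "b \<in> {p1, p3, s}"
  then have "a * (p1 + p3 + s) = a" "(p1 + p3 + s) * b = b" by (auto simp: words)
  then show "a * (\<xi> * b) = 0"
    using assms unfolding odd_element_def by (metis mult.assoc mult_zero_left mult_zero_right)
qed

text \<open>Since f inverts e between adjacent layers, each of the six inessential blocks is a
  bracket of e with the same block shifted by f; u has one summand for each of them.\<close>

lemma essential_mod_image:
  assumes "odd_element \<xi>"
  shows "\<exists>u. \<xi> = essential \<xi> + (e * u - u * e)"
proof -
  define u where "u = f * p0 * \<xi> * p1 + f * p3 * \<xi> * r + f * p0 * \<xi> * s
    - p3 * \<xi> * p0 * f - r * \<xi> * p1 * f - s * \<xi> * p0 * f"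
  have "\<xi> = (p0 + p1 + p3 + r + s) * (\<xi> * (p0 + p1 + p3 + r + s))"
    using assms unfolding odd_element_def by simp
  also have "\<dots> = essential \<xi> + (e * u - u * e)"
    unfolding essential_def u_def
    by (simp add: words odd_blocks[OF assms])
  finally show ?thesis by blast
qed

text \<open>If k centralises e then ad k commutes with ad e and preserves its image, so the
  condition depends only on the class of \<xi>.\<close>

lemma commutator_mod_image:
  assumes "odd_element \<xi>" "e * k = k * e"
    and "\<exists>w. k * essential \<xi> - essential \<xi> * k = e * w - w * e"
  shows "\<exists>w. k * \<xi> - \<xi> * k = e * w - w * e"
proof -
  obtain u where u: "\<xi> = essential \<xi> + (e * u - u * e)" using essential_mod_image[OF assms(1)] by blast
  obtain w where w: "k * essential \<xi> - essential \<xi> * k = e * w - w * e" using assms(3) by blast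
  have *: "k * (e * u - u * e) - (e * u - u * e) * k = e * (k * u - u * k) - (k * u - u * k) * e"
    using assms(2) by (simp add: algebra_simps) (metis mult.assoc)
  have "k * \<xi> - \<xi> * k = (k * essential \<xi> - essential \<xi> * k)
      + (k * (e * u - u * e) - (e * u - u * e) * k)"
    by (subst (1 2) u) (simp add: algebra_simps)
  also have "\<dots> = e * (w + (k * u - u * k)) - (w + (k * u - u * k)) * e"
    unfolding w * by (simp add: algebra_simps)
  finally show ?thesis by blast
qed

text \<open>All blocks are transported by e and f to the source layer: X collects the blocks from
  \<open>p0\<close> to \<open>p1\<close> and from \<open>p3\<close> to \<open>p0\<close>, y the
  block from \<open>p3\<close> to \<open>r\<close>. Thus X and Y = x y are endomorphisms of the
  source layer, and M is the endomorphism of \<open>r\<close> that passes through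
  \<open>s\<close>.\<close>

definition "Xblock \<xi> = p1 * \<xi> * e * p1 + f * p0 * \<xi> * e * e * p1"
definition "xblock \<xi> = p1 * \<xi> * r"
definition "yblock \<xi> = r * \<xi> * e * e * p1"
definition "Yblock \<xi> = xblock \<xi> * yblock \<xi>"
definition "Mblock \<xi> = r * \<xi> * s * \<xi> * r"

text \<open>Z acts between consecutive layers, in the two positions forced by commuting with e. T is
  followed by y to map the source layer into the remainder of U, and preceded by x to map that
  remainder into the last layer.\<close>

definition "kel \<xi> Z T = e * Z + e * e * Z * f + yblock \<xi> * T + e * e * T * xblock \<xi>"

lemma XY_sandwich:
  "p1 * Xblock \<xi> = Xblock \<xi>" "Xblock \<xi> * p1 = Xblock \<xi>"
  "p1 * Yblock \<xi> = Yblock \<xi>" "Yblock \<xi> * p1 = Yblock \<xi>"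
  by (simp_all add: Xblock_def Yblock_def xblock_def yblock_def words)

lemma M_sandwich: "r * Mblock \<xi> = Mblock \<xi>" "Mblock \<xi> * r = Mblock \<xi>"
  by (simp_all add: Mblock_def words)

lemma kel_centralises:
  assumes "p1 * Z = Z" "Z * p1 = Z" "p1 * T = T" "T * p1 = T"
  shows "e * kel \<xi> Z T = kel \<xi> Z T * e"
  unfolding kel_def xblock_def yblock_def
  by (simp add: words assms sandwich[OF assms(1,2)] sandwich[OF assms(3,4)]
      assms[THEN tail] sandwich[OF assms(1,2), THEN tail] sandwich[OF assms(3,4), THEN tail]
      eee_mult[OF assms(1)] eee_mult[OF assms(3)])

text \<open>Modulo the image of ad e the bracket with \<xi> reduces to the single block e ([Z, X] +
  [T, Y]) f, which is the whole obstruction; w gathers everything that can be removed.\<close>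

lemma kel_image:
  assumes Z: "p1 * Z = Z" "Z * p1 = Z" and T: "p1 * T = T" "T * p1 = T" and \<xi>: "odd_element \<xi>"
    and H: "Z * Xblock \<xi> - Xblock \<xi> * Z + T * Yblock \<xi> - Yblock \<xi> * T = 0"
  shows "\<exists>w. kel \<xi> Z T * essential \<xi> - essential \<xi> * kel \<xi> Z T = e * w - w * e"
proof -
  define w where "w = (p1 * \<xi> * e * Z + Yblock \<xi> * T) * f
    + f * (e * e * Z * f * p0 * \<xi> * p3 + e * e * T * xblock \<xi> * \<xi> * p3)
    + Z * xblock \<xi> + yblock \<xi> * Z * f * f - yblock \<xi> * T * \<xi> * p0 * f
    + s * \<xi> * yblock \<xi> * T * f + e * T * xblock \<xi> * \<xi> * s - f * p0 * \<xi> * e * e * T * xblock \<xi>"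
  have "kel \<xi> Z T * essential \<xi> - essential \<xi> * kel \<xi> Z T - (e * w - w * e) =
    e * (Z * Xblock \<xi> - Xblock \<xi> * Z + T * Yblock \<xi> - Yblock \<xi> * T) * f"
    unfolding kel_def essential_def w_def Xblock_def Yblock_def xblock_def yblock_def
    by (simp add: words Z T sandwich[OF Z] sandwich[OF T] odd_blocks[OF \<xi>] sandwich_f[OF Z(2)] sandwich_f[OF T(2)]
      Z[THEN tail] T[THEN tail] sandwich[OF Z, THEN tail] sandwich[OF T, THEN tail])
  then show ?thesis unfolding H by auto
qed

section \<open>Centraliser elements supported on the remainder of U\<close>

definition "kelD \<xi> D \<Delta>1 \<Delta>2 = D * \<xi> * s + s * \<xi> * D + \<Delta>1 + \<Delta>2"

lemma sandwich_\<Delta>1: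
  assumes "r * D = D" "D * p1 = D"
  shows "p0 * D = 0" "p3 * D = 0" "p1 * D = 0" "s * D = 0" "D * p0 = 0" "D * p3 = 0" "D * r = 0" "D * s = 0"
    "D * e = 0" "f * D = 0" "e * D = 0"
  using assms pp pe pf by (metis mult.assoc mult_zero_left mult_zero_right)+

lemma sandwich_\<Delta>2:
  assumes "p3 * D = D" "D * r = D"
  shows "p0 * D = 0" "p1 * D = 0" "r * D = 0" "s * D = 0" "D * p0 = 0" "D * p1 = 0" "D * p3 = 0" "D * s = 0"
    "D * e = 0" "D * f = 0" "e * D = 0"
  using assms pp pe pf by (metis mult.assoc mult_zero_left mult_zero_right)+

lemma kelD_centralises:
  assumes D: "r * D = D" "D * r = D" and 1: "r * \<Delta>1 = \<Delta>1" "\<Delta>1 * p1 = \<Delta>1"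
    and 2: "p3 * \<Delta>2 = \<Delta>2" "\<Delta>2 * r = \<Delta>2"
  shows "e * kelD \<xi> D \<Delta>1 \<Delta>2 = kelD \<xi> D \<Delta>1 \<Delta>2 * e"
  unfolding kelD_def
  by (simp add: words sandwich_r[OF D] sandwich_r[OF D, THEN tail] sandwich_\<Delta>1[OF 1] sandwich_\<Delta>2[OF 2])

text \<open>The obstruction is [D, M] in the corner of \<open>r\<close>, and \<Delta>1, \<Delta>2
  contribute the multiples of x and of the block from \<open>p3\<close> to \<open>r\<close> by which
  it can be corrected. The four vanishing conditions eliminate the terms that would reach the layers
  of e.\<close>

lemma kelD_image:
  assumes D: "r * D = D" "D * r = D" and 1: "r * \<Delta>1 = \<Delta>1" "\<Delta>1 * p1 = \<Delta>1"
    and 2: "p3 * \<Delta>2 = \<Delta>2" "\<Delta>2 * r = \<Delta>2" and \<xi>: "odd_element \<xi>"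
    and xD: "xblock \<xi> * D = 0" and Dy: "D * \<xi> * p3 = 0"
    and x1: "xblock \<xi> * \<Delta>1 = 0" and y2: "\<Delta>2 * \<xi> * p3 = 0"
    and H: "D * Mblock \<xi> - Mblock \<xi> * D + \<Delta>1 * xblock \<xi> - r * \<xi> * \<Delta>2 = 0"
  shows "\<exists>w. kelD \<xi> D \<Delta>1 \<Delta>2 * essential \<xi> - essential \<xi> * kelD \<xi> D \<Delta>1 \<Delta>2 = e * w - w * e"
proof -
  define w where "w = f * \<Delta>2 * \<xi> * s + s * \<xi> * \<Delta>1 * f - \<Delta>1 * \<xi> * p0 * f - f * p0 * \<xi> * \<Delta>2"
  have x': "p1 * (\<xi> * D) = 0" "p1 * (\<xi> * \<Delta>1) = 0" "p1 * (\<xi> * (D * z)) = 0" for z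
    using xD x1 D(1) 1(1) unfolding xblock_def by (metis mult.assoc mult_zero_left)+
  have "kelD \<xi> D \<Delta>1 \<Delta>2 * essential \<xi> - essential \<xi> * kelD \<xi> D \<Delta>1 \<Delta>2 - (e * w - w * e) =
    D * Mblock \<xi> - Mblock \<xi> * D + \<Delta>1 * xblock \<xi> - r * \<xi> * \<Delta>2"
    unfolding kelD_def essential_def w_def xblock_def Mblock_def
    using Dy y2
    by (simp add: words D 1 2 sandwich_r[OF D] sandwich_\<Delta>1[OF 1] sandwich_\<Delta>2[OF 2] odd_blocks[OF \<xi>]
      D[THEN tail] 1[THEN tail] 2[THEN tail] x'
      sandwich_r[OF D, THEN tail] sandwich_\<Delta>1[OF 1, THEN tail] sandwich_\<Delta>2[OF 2, THEN tail])
  then show ?thesis unfolding H by auto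
qed

text \<open>With A the inverse of Y = x y, this is the projection of the remainder onto ker x along
  im y; \<open>Cblock\<close> is the compression of M to ker x.\<close>

definition "\<pi>block \<xi> A = r - yblock \<xi> * A * xblock \<xi>"
definition "Cblock \<xi> A = \<pi>block \<xi> A * Mblock \<xi> * \<pi>block \<xi> A"

text \<open>The ring has no unit, so the powers start at exponent one: index i stands for
  C^(i+1).\<close>

primrec Cpower :: "'r \<Rightarrow> 'r \<Rightarrow> nat \<Rightarrow> 'r" where
  "Cpower \<xi> A 0 = Cblock \<xi> A"
| "Cpower \<xi> A (Suc i) = Cblock \<xi> A * Cpower \<xi> A i"

text \<open>The two corrections are chosen to replace D M by D M \<pi> and M D by \<pi> M D in the
  obstruction.\<close>

definition "kC \<xi> A D = kelD \<xi> D (- (D * Mblock \<xi> * yblock \<xi> * A)) (- (e * e * A * xblock \<xi> * Mblock \<xi> * D))"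

context
  fixes \<xi> A
  assumes \<xi>: "odd_element \<xi>" and A: "p1 * A = A" "A * p1 = A"
    and inv: "Yblock \<xi> * A = p1" "A * Yblock \<xi> = p1"
begin

lemma x_\<pi>: "xblock \<xi> * \<pi>block \<xi> A = 0"
proof -
  have "xblock \<xi> * \<pi>block \<xi> A = xblock \<xi> * r - (Yblock \<xi> * A) * xblock \<xi>"
    by (simp add: \<pi>block_def Yblock_def right_diff_distrib mult.assoc)
  then show ?thesis by (simp add: inv xblock_def words)
qed

lemma \<pi>_y: "\<pi>block \<xi> A * yblock \<xi> = 0"
proof -
  have "\<pi>block \<xi> A * yblock \<xi> = r * yblock \<xi> - yblock \<xi> * (A * Yblock \<xi>)"
    by (simp add: \<pi>block_def Yblock_def left_diff_distrib mult.assoc)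
  then show ?thesis by (simp add: inv yblock_def words)
qed

lemma \<pi>_sandwich: "r * \<pi>block \<xi> A = \<pi>block \<xi> A" "\<pi>block \<xi> A * r = \<pi>block \<xi> A"
  by (simp_all add: \<pi>block_def xblock_def yblock_def words)

lemma \<pi>_idem: "\<pi>block \<xi> A * \<pi>block \<xi> A = \<pi>block \<xi> A"
proof -
  have "\<pi>block \<xi> A * \<pi>block \<xi> A = \<pi>block \<xi> A * r - (\<pi>block \<xi> A * yblock \<xi>) * A * xblock \<xi>"
    by (subst (2) \<pi>block_def) (simp add: right_diff_distrib mult.assoc)
  then show ?thesis by (simp add: \<pi>_y \<pi>_sandwich)
qed

lemma C_\<pi>: "\<pi>block \<xi> A * Cblock \<xi> A = Cblock \<xi> A" "Cblock \<xi> A * \<pi>block \<xi> A = Cblock \<xi> A"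
  unfolding Cblock_def by (metis \<pi>_idem mult.assoc)+

lemma Cpower_\<pi>:
  "\<pi>block \<xi> A * Cpower \<xi> A i = Cpower \<xi> A i" "Cpower \<xi> A i * \<pi>block \<xi> A = Cpower \<xi> A i"
  by (induction i) (simp_all add: C_\<pi> mult.assoc, metis C_\<pi>(1) mult.assoc)

lemma Cpower_commute: "Cpower \<xi> A i * Cblock \<xi> A = Cblock \<xi> A * Cpower \<xi> A i"
  by (induction i) (simp_all add: mult.assoc)

lemma Cpower_M_\<pi>: "Cpower \<xi> A i * Mblock \<xi> * \<pi>block \<xi> A = Cpower \<xi> A (Suc i)"
proof -
  have "Cpower \<xi> A i * Mblock \<xi> * \<pi>block \<xi> A = Cpower \<xi> A i * Cblock \<xi> A"
    by (metis Cblock_def Cpower_\<pi>(2) mult.assoc)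
  then show ?thesis by (simp add: Cpower_commute)
qed

lemma \<pi>_M_Cpower: "\<pi>block \<xi> A * Mblock \<xi> * Cpower \<xi> A i = Cpower \<xi> A (Suc i)"
  by (metis Cblock_def Cpower.simps(2) Cpower_\<pi>(1) mult.assoc)

lemma yeef: "yblock \<xi> * f * f = r * \<xi> * p3"
  by (simp add: yblock_def words)

text \<open>D = C^(i+1) is absorbed by \<pi> on both sides, hence x D = 0 and D y = 0. The corrected
  products D M \<pi> and \<pi> M D are both C^(i+2), so the obstruction cancels.\<close>

lemma kC_works:
  fixes i :: nat
  defines "k \<equiv> kC \<xi> A (Cpower \<xi> A i)"
  shows "e * k = k * e" "\<exists>w. k * essential \<xi> - essential \<xi> * k = e * w - w * e"
proof -
  define D where "D = Cpower \<xi> A i"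
  define \<Delta>1 where "\<Delta>1 = - (D * Mblock \<xi> * yblock \<xi> * A)"
  define \<Delta>2 where "\<Delta>2 = - (e * e * A * xblock \<xi> * Mblock \<xi> * D)"
  have k: "k = kelD \<xi> D \<Delta>1 \<Delta>2" by (simp add: k_def kC_def D_def \<Delta>1_def \<Delta>2_def)
  have D\<pi>: "D = \<pi>block \<xi> A * D" "D = D * \<pi>block \<xi> A" by (simp_all add: D_def Cpower_\<pi>)
  have D: "r * D = D" "D * r = D" by (metis D\<pi>(1) \<pi>_sandwich(1) mult.assoc, metis D\<pi>(2) \<pi>_sandwich(2) mult.assoc)
  have 1: "r * \<Delta>1 = \<Delta>1" "\<Delta>1 * p1 = \<Delta>1"
    by (simp_all add: \<Delta>1_def D [THEN tail] mult.assoc A)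
  have 2: "p3 * \<Delta>2 = \<Delta>2" "\<Delta>2 * r = \<Delta>2"
    by (simp_all add: \<Delta>2_def words A [THEN tail] D)
  have xD: "xblock \<xi> * D = 0" by (metis D\<pi>(1) x_\<pi> mult.assoc mult_zero_left)
  have Dyy: "D * yblock \<xi> = 0" by (metis D\<pi>(2) \<pi>_y mult.assoc mult_zero_right)
  have Dy: "D * \<xi> * p3 = 0"
  proof -
    have "D * \<xi> * p3 = D * (r * \<xi> * p3)" by (metis D(2) mult.assoc)
    also have "\<dots> = (D * yblock \<xi>) * f * f" by (simp add: yeef [unfolded mult.assoc] mult.assoc)
    finally show ?thesis by (simp add: Dyy)
  qed
  have x1: "xblock \<xi> * \<Delta>1 = 0"
    by (simp add: \<Delta>1_def mult.assoc [symmetric] xD)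
  have y2: "\<Delta>2 * \<xi> * p3 = 0"
    using Dy by (simp add: \<Delta>2_def mult.assoc)
  have H: "D * Mblock \<xi> - Mblock \<xi> * D + \<Delta>1 * xblock \<xi> - r * \<xi> * \<Delta>2 = 0"
  proof -
    have a: "D * Mblock \<xi> + \<Delta>1 * xblock \<xi> = D * Mblock \<xi> * \<pi>block \<xi> A"
      by (simp add: \<Delta>1_def \<pi>block_def right_diff_distrib mult.assoc M_sandwich)
    have "r * \<xi> * \<Delta>2 = - (yblock \<xi> * A * xblock \<xi> * Mblock \<xi> * D)"
      by (simp add: \<Delta>2_def yblock_def mult.assoc A [THEN tail])
    then have b: "Mblock \<xi> * D + r * \<xi> * \<Delta>2 = \<pi>block \<xi> A * Mblock \<xi> * D"
      by (simp add: \<pi>block_def left_diff_distrib mult.assoc M_sandwich [THEN tail])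
    have "D * Mblock \<xi> * \<pi>block \<xi> A = \<pi>block \<xi> A * Mblock \<xi> * D"
      unfolding D_def Cpower_M_\<pi> \<pi>_M_Cpower ..
    with a b show ?thesis by (simp add: algebra_simps)
  qed
  show "e * k = k * e" unfolding k by (rule kelD_centralises[OF D 1 2])
  show "\<exists>w. k * essential \<xi> - essential \<xi> * k = e * w - w * e"
    unfolding k by (rule kelD_image[OF D 1 2 \<xi> xD Dy x1 y2 H])
qed

end

end

section \<open>Skew-hermitian matrices\<close>

text \<open>The three families are the Lie algebras of skew-hermitian \<open>(m + k) \<times> (m + k)\<close> matrices over
  \<open>K\<close>, \<open>K \<times> K\<close> and \<open>Mat\<^sub>2(K)\<close>.  Here \<open>E\<close> is the system of matrix units, and \<open>adj X Y\<close> says that \<open>Y\<close> is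
  the adjoint of \<open>X\<close>.  For \<open>\<gg>\<ll>\<close> the relation \<open>adj\<close> is the total one, so that every matrix counts
  as skew-hermitian.  The map \<open>pr\<close> is the projection onto the skew-hermitian matrices.\<close>

locale hermitian =
  fixes N m k :: nat
    and E :: "nat \<Rightarrow> nat \<Rightarrow> 'a::field_char_0 fmatrix"
    and adj :: "'a fmatrix \<Rightarrow> 'a fmatrix \<Rightarrow> bool"
    and pr :: "'a fmatrix \<Rightarrow> 'a fmatrix"
  assumes E_corner: "i < m + k \<Longrightarrow> j < m + k \<Longrightarrow> E i j \<in> corner N"
    and E_mult: "i < m + k \<Longrightarrow> j < m + k \<Longrightarrow> i' < m + k \<Longrightarrow> j' < m + k \<Longrightarrow>
      E i j * E i' j' = (if j = i' then E i j' else 0)"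
    and E_nonzero: "i < m + k \<Longrightarrow> E i i \<noteq> 0"
    and E_unit: "A \<in> corner N \<Longrightarrow> (\<Sum>i<m + k. E i i) * A = A" "A \<in> corner N \<Longrightarrow> A * (\<Sum>i<m + k. E i i) = A"
    and adj_add: "adj X X' \<Longrightarrow> adj Y Y' \<Longrightarrow> adj (X + Y) (X' + Y')"
    and adj_scale: "adj X X' \<Longrightarrow> adj (scale c X) (scale c X')"
    and adj_mult: "adj X X' \<Longrightarrow> adj Y Y' \<Longrightarrow> adj (X * Y) (Y' * X')"
    and adj_E: "i < m + k \<Longrightarrow> j < m + k \<Longrightarrow> adj (E i j) (E j i)"
    and adj_inverse: "adj X X' \<Longrightarrow> adj p p' \<Longrightarrow> X * A = p \<Longrightarrow> p * A = A \<Longrightarrow> A * X = p \<Longrightarrow> A \<in> corner N \<Longrightarrow>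
      X' * B = p' \<Longrightarrow> p' * B = B \<Longrightarrow> B \<in> corner N \<Longrightarrow> adj A B"
    and adj_scalar: "i < m + k \<Longrightarrow> X \<in> corner N \<Longrightarrow> E i i * X * E i i = X \<Longrightarrow> adj X X \<Longrightarrow> \<exists>c. X = scale c (E i i)"
    and pr_adj: "A \<in> corner N \<Longrightarrow> pr A \<in> corner N \<and> adj (pr A) (- pr A)"
    and pr_id: "X \<in> corner N \<Longrightarrow> adj X (- X) \<Longrightarrow> pr X = X"
    and pr_trace: "A \<in> corner N \<Longrightarrow> X \<in> corner N \<Longrightarrow> adj X (- X) \<Longrightarrow> ftrace (pr A * X) = ftrace (A * X)"
    and pr_add: "A \<in> corner N \<Longrightarrow> B \<in> corner N \<Longrightarrow> pr (A + B) = pr A + pr B"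
    and pr_scale: "A \<in> corner N \<Longrightarrow> pr (scale c A) = scale c (pr A)"
begin

definition "skew = {X \<in> corner N. adj X (- X)}"
definition "eU = (\<Sum>i<m. E i i)"
definition "eW = (\<Sum>i=m..<m + k. E i i)"
definition "even_part X = eU * X * eU + eW * X * eW"
definition "odd_part X = eU * X * eW + eW * X * eU"
definition "skew0 = {X \<in> skew. eU * X = X * eU}"
definition "skew1 = {X \<in> skew. eU * X * eU = 0 \<and> eW * X * eW = 0}"

lemma adj_minus: "adj X X' \<Longrightarrow> adj (- X) (- X')"
  using adj_scale[of X X' "-1"] by simp

lemma adj_diff: "adj X X' \<Longrightarrow> adj Y Y' \<Longrightarrow> adj (X - Y) (X' - Y')"
  using adj_add[OF _ adj_minus] by fastforce

lemma adj_zero: "m + k > 0 \<Longrightarrow> adj 0 0"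
  using adj_scale[OF adj_E[of 0 0], of 0] by simp

lemma adj_sum:
  assumes "\<And>i. i \<in> I \<Longrightarrow> adj (F i) (G i)" "m + k > 0"
  shows "adj (sum F I) (sum G I)"
  using assms by (induction I rule: infinite_finite_induct) (auto intro!: adj_zero adj_add)

lemma eUW: "eU + eW = (\<Sum>i<m + k. E i i)"
proof -
  have *: "{..<m + k} = {..<m} \<union> {m..<m + k}" by auto
  show ?thesis unfolding eU_def eW_def
    by (subst *, rule sum.union_disjoint [symmetric]) auto
qed

lemma eUW_corner: "eU \<in> corner N" "eW \<in> corner N"
  unfolding eU_def eW_def by (auto intro!: corner_sum E_corner)

lemma unit: "A \<in> corner N \<Longrightarrow> eU * A + eW * A = A" "A \<in> corner N \<Longrightarrow> A * eU + A * eW = A"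
  using E_unit unfolding eUW [symmetric] by (simp_all add: distrib_left distrib_right)

lemma eU_E: "i < m + k \<Longrightarrow> j < m + k \<Longrightarrow> eU * E i j = (if i < m then E i j else 0)"
  "i < m + k \<Longrightarrow> j < m + k \<Longrightarrow> E i j * eU = (if j < m then E i j else 0)"
proof -
  assume ij: "i < m + k" "j < m + k"
  have "eU * E i j = (\<Sum>l<m. if l = i then E i j else 0)"
    unfolding eU_def sum_distrib_right by (rule sum.cong) (use ij in \<open>auto simp: E_mult\<close>)
  then show "eU * E i j = (if i < m then E i j else 0)" by simp
  have "E i j * eU = (\<Sum>l<m. if l = j then E i j else 0)"
    unfolding eU_def sum_distrib_left by (rule sum.cong) (use ij in \<open>auto simp: E_mult\<close>)
  then show "E i j * eU = (if j < m then E i j else 0)" by simp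
qed

lemma eW_E: "i < m + k \<Longrightarrow> j < m + k \<Longrightarrow> eW * E i j = (if i < m then 0 else E i j)"
  "i < m + k \<Longrightarrow> j < m + k \<Longrightarrow> E i j * eW = (if j < m then 0 else E i j)"
  using unit[OF E_corner, of i j] eU_E[of i j] by (auto split: if_splits)

lemma eUW_idem: "eU * eU = eU" "eU * eW = 0" "eW * eU = 0" "eW * eW = eW"
proof -
  show UU: "eU * eU = eU"
    by (subst (2 3) eU_def) (auto simp: sum_distrib_left eU_E intro!: sum.cong)
  show UW: "eU * eW = 0"
    by (subst eW_def) (auto simp: sum_distrib_left eU_E intro!: sum.neutral)
  show WU: "eW * eU = 0"
    by (subst eU_def) (auto simp: sum_distrib_left eW_E intro!: sum.neutral)
  show "eW * eW = eW" using unit(2)[OF eUW_corner(2)] WU by simp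
qed

lemma idem_tail: "eU * (eU * z) = eU * z" "eU * (eW * z) = 0" "eW * (eU * z) = 0" "eW * (eW * z) = eW * z"
  using eUW_idem by (simp_all add: mult.assoc [symmetric])

lemmas UW = eUW_idem idem_tail mult.assoc distrib_left distrib_right left_diff_distrib right_diff_distrib

lemma adj_eU: "m + k > 0 \<Longrightarrow> adj eU eU" and adj_eW: "m + k > 0 \<Longrightarrow> adj eW eW"
  unfolding eU_def eW_def by (auto intro!: adj_sum adj_E)

lemma even_odd: "X \<in> corner N \<Longrightarrow> even_part X + odd_part X = X"
proof -
  assume X: "X \<in> corner N"
  have "X = (eU + eW) * X * (eU + eW)" using X by (simp add: eUW E_unit)
  then show ?thesis by (simp add: even_part_def odd_part_def UW algebra_simps)
qed

lemma parts_corner: "X \<in> corner N \<Longrightarrow> even_part X \<in> corner N" "X \<in> corner N \<Longrightarrow> odd_part X \<in> corner N"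
  unfolding even_part_def odd_part_def by (auto intro!: corner_closed corner_mult eUW_corner)

lemma skew_corner: "X \<in> skew \<Longrightarrow> X \<in> corner N" "X \<in> skew0 \<Longrightarrow> X \<in> corner N" "X \<in> skew1 \<Longrightarrow> X \<in> corner N"
  by (auto simp: skew_def skew0_def skew1_def)

lemma skew01: "X \<in> skew0 \<Longrightarrow> X \<in> skew" "X \<in> skew1 \<Longrightarrow> X \<in> skew"
  by (auto simp: skew0_def skew1_def)

lemma skew_closed:
  assumes "X \<in> skew" "Y \<in> skew"
  shows "X + Y \<in> skew" "X - Y \<in> skew" "scale c X \<in> skew" "X * Y - Y * X \<in> skew"
proof -
  have X: "X \<in> corner N" "adj X (- X)" and Y: "Y \<in> corner N" "adj Y (- Y)"
    using assms by (auto simp: skew_def)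
  show "X + Y \<in> skew" "X - Y \<in> skew" "scale c X \<in> skew"
    using X Y adj_add[OF X(2) Y(2)] adj_diff[OF X(2) Y(2)] adj_scale[OF X(2), of c]
    by (auto simp: skew_def algebra_simps)
  have "adj (X * Y - Y * X) ((- Y) * (- X) - (- X) * (- Y))"
    by (intro adj_diff adj_mult X Y)
  then show "X * Y - Y * X \<in> skew" using X Y by (auto simp: skew_def)
qed

lemma skew0_closed:
  assumes "X \<in> skew0" "Y \<in> skew0"
  shows "X + Y \<in> skew0" "X - Y \<in> skew0" "scale c X \<in> skew0" "X * Y - Y * X \<in> skew0"
proof -
  have e: "eU * X = X * eU" "eU * Y = Y * eU" using assms by (auto simp: skew0_def)
  then have c: "eU * (X * Y) = X * Y * eU" "eU * (Y * X) = Y * X * eU"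
    by (metis mult.assoc)+
  show "X + Y \<in> skew0" "X - Y \<in> skew0" "scale c X \<in> skew0" "X * Y - Y * X \<in> skew0"
    using skew_closed[OF skew01(1)[OF assms(1)] skew01(1)[OF assms(2)]] e c
    by (auto simp: skew0_def distrib_left distrib_right left_diff_distrib right_diff_distrib)
qed

lemma skew1_closed:
  assumes "X \<in> skew1" "Y \<in> skew1"
  shows "X + Y \<in> skew1" "X - Y \<in> skew1" "scale c X \<in> skew1"
  using skew_closed[OF skew01(2)[OF assms(1)] skew01(2)[OF assms(2)]] assms
  by (auto simp: skew1_def distrib_left distrib_right left_diff_distrib right_diff_distrib)

lemma skew0_eW: "X \<in> skew0 \<Longrightarrow> eW * X = X * eW"
proof -
  assume X: "X \<in> skew0"
  have "eU * X + eW * X = X * eU + X * eW" using unit[OF skew_corner(2)[OF X]] by simp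
  moreover have "eU * X = X * eU" using X by (simp add: skew0_def)
  ultimately show ?thesis by simp
qed

lemma bracket_skew01: "X \<in> skew0 \<Longrightarrow> Y \<in> skew1 \<Longrightarrow> X * Y - Y * X \<in> skew1"
proof -
  assume X: "X \<in> skew0" and Y: "Y \<in> skew1"
  have c: "eU * X = X * eU" "eW * X = X * eW" using X skew0_eW by (auto simp: skew0_def)
  have y: "eU * (Y * eU) = 0" "eW * (Y * eW) = 0" using Y by (auto simp: skew1_def mult.assoc)
  have 1: "eU * (X * (Y * eU)) = 0" "eW * (X * (Y * eW)) = 0"
    using c y by (metis mult.assoc mult_zero_right)+
  have 2: "eU * (Y * (X * eU)) = 0" "eW * (Y * (X * eW)) = 0"
    using c y by (metis mult.assoc mult_zero_left)+
  show ?thesis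
    using skew_closed(4)[OF skew01(1)[OF X] skew01(2)[OF Y]]
    by (simp add: skew1_def mult.assoc left_diff_distrib right_diff_distrib 1 2)
qed

lemma parts_skew:
  assumes "X \<in> skew" "m + k > 0"
  shows "even_part X \<in> skew0" "odd_part X \<in> skew1"
proof -
  have X: "X \<in> corner N" "adj X (- X)" using assms by (auto simp: skew_def)
  note a = adj_eU[OF assms(2)] adj_eW[OF assms(2)]
  have "adj (even_part X) (eU * (- X * eU) + eW * (- X * eW))"
    "adj (odd_part X) (eW * (- X * eU) + eU * (- X * eW))"
    unfolding even_part_def odd_part_def by (intro adj_add adj_mult a X)+
  then show "even_part X \<in> skew0" "odd_part X \<in> skew1"
    using parts_corner[OF X(1)]
    by (auto simp: skew0_def skew1_def skew_def even_part_def odd_part_def UW algebra_simps)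
qed

text \<open>X commutes with both projections p, so tr (X p Y) = tr (X p Y p), and the diagonal
  blocks p Y p of an odd element vanish.\<close>

lemma trace_even_odd: "X \<in> skew0 \<Longrightarrow> Y \<in> skew1 \<Longrightarrow> ftrace (X * Y) = 0"
proof -
  assume X: "X \<in> skew0" and Y: "Y \<in> skew1"
  have c: "eU * X = X * eU" "eW * X = X * eW" using X skew0_eW by (auto simp: skew0_def)
  have y: "eU * Y * eU = 0" "eW * Y * eW = 0" using Y by (auto simp: skew1_def)
  have *: "ftrace (X * p * Y) = 0" if "p * X = X * p" "p * p = p" "p * Y * p = 0" for p
  proof -
    have "X * p * Y = X * (p * p) * Y" by (simp add: that(2))
    also have "\<dots> = p * (X * (p * Y))" by (simp only: mult.assoc [symmetric] that(1))
    also have "ftrace \<dots> = ftrace (X * (p * Y) * p)" by (rule ftrace_commute)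
    also have "X * (p * Y) * p = X * (p * Y * p)" by (simp only: mult.assoc)
    finally show ?thesis by (simp add: that(3))
  qed
  have "X * Y = (X * eU + X * eW) * Y" by (simp only: unit(2)[OF skew_corner(2)[OF X]])
  then have "ftrace (X * Y) = ftrace (X * eU * Y) + ftrace (X * eW * Y)"
    by (simp only: distrib_right ftrace_simps)
  then show ?thesis using *[OF c(1) eUW_idem(1) y(1)] *[OF c(2) eUW_idem(4) y(2)] by simp
qed

text \<open>For the trace form \<open>pr\<close> is adjoint to the inclusion of the skew-hermitian
  matrices, so testing against these amounts to testing against all matrices.\<close>

lemma skew_nondegenerate:
  assumes "X \<in> skew" "\<And>Y. Y \<in> skew \<Longrightarrow> ftrace (X * Y) = 0"
  shows "X = 0"
proof (rule ftrace_nondegenerate)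
  show "X \<in> corner N" using assms by (simp add: skew_corner)
  fix A :: "'a fmatrix" assume A: "A \<in> corner N"
  have "pr A \<in> skew" using pr_adj[OF A] by (simp add: skew_def)
  then have "ftrace (X * pr A) = 0" by (rule assms(2))
  then show "ftrace (X * A) = 0"
    using pr_trace[OF A, of X] assms(1) by (simp add: skew_def ftrace_commute)
qed

lemma skew0_nondegenerate:
  assumes "m + k > 0" "X \<in> skew0" "\<And>Y. Y \<in> skew0 \<Longrightarrow> ftrace (X * Y) = 0"
  shows "X = 0"
proof (rule skew_nondegenerate[OF skew01(1)[OF assms(2)]])
  fix Y assume Y: "Y \<in> skew"
  have "ftrace (X * Y) = ftrace (X * even_part Y) + ftrace (X * odd_part Y)"
    by (simp only: even_odd[OF skew_corner(1)[OF Y]] ftrace_simps(2) [symmetric] distrib_left [symmetric])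
  then show "ftrace (X * Y) = 0"
    using assms(2,3) trace_even_odd parts_skew[OF Y assms(1)] by simp
qed

lemma skew1_nondegenerate:
  assumes "m + k > 0" "X \<in> skew1" "\<And>Y. Y \<in> skew1 \<Longrightarrow> ftrace (X * Y) = 0"
  shows "X = 0"
proof (rule skew_nondegenerate[OF skew01(2)[OF assms(2)]])
  fix Y assume Y: "Y \<in> skew"
  have "ftrace (X * Y) = ftrace (X * even_part Y) + ftrace (X * odd_part Y)"
    by (simp only: even_odd[OF skew_corner(1)[OF Y]] ftrace_simps(2) [symmetric] distrib_left [symmetric])
  then show "ftrace (X * Y) = 0"
    using assms(2,3) trace_even_odd[of "even_part Y" X] parts_skew[OF Y assms(1)]
    by (simp add: ftrace_commute)
qed

lemma skew1_ex: "m + k > 0 \<Longrightarrow> 0 \<in> skew0" "m + k > 0 \<Longrightarrow> 0 \<in> skew1"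
  using adj_zero by (auto simp: skew0_def skew1_def skew_def)

text \<open>Used to extend functionals from the odd part to all matrices; \<open>pr1_trace\<close>
  is the adjointness that brings the representing matrix back into the odd part.\<close>

definition "pr1 A = odd_part (pr A)"

lemma pr1_skew: "m + k > 0 \<Longrightarrow> A \<in> corner N \<Longrightarrow> pr1 A \<in> skew1"
  unfolding pr1_def using parts_skew(2) pr_adj by (simp add: skew_def)

lemma pr1_id: "X \<in> skew1 \<Longrightarrow> pr1 X = X"
  using pr_id[of X] even_odd[of X]
  by (auto simp: pr1_def skew1_def skew_def even_part_def)

lemma pr1_trace:
  assumes "m + k > 0" "A \<in> corner N" "X \<in> skew1"
  shows "ftrace (pr1 A * X) = ftrace (A * X)"
proof -
  have p: "pr A \<in> skew" using pr_adj[OF assms(2)] by (simp add: skew_def)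
  have "ftrace (pr A * X) = ftrace (even_part (pr A) * X) + ftrace (pr1 A * X)"
    unfolding pr1_def
    by (simp only: even_odd[OF skew_corner(1)[OF p]] ftrace_simps(2) [symmetric] distrib_right [symmetric])
  moreover have "ftrace (even_part (pr A) * X) = 0"
    using trace_even_odd parts_skew[OF p assms(1)] assms(3) by blast
  ultimately show ?thesis
    using pr_trace[OF assms(2), of X] assms(3) by (simp add: skew1_def skew_def)
qed

lemma pr1_add: "A \<in> corner N \<Longrightarrow> B \<in> corner N \<Longrightarrow> pr1 (A + B) = pr1 A + pr1 B"
  by (simp add: pr1_def pr_add odd_part_def UW algebra_simps)

lemma pr1_scale: "A \<in> corner N \<Longrightarrow> pr1 (scale c A) = scale c (pr1 A)"
  by (simp add: pr1_def pr_scale odd_part_def)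

end

section \<open>Double brackets and a regular element of the odd part\<close>

context hermitian
begin

text \<open>The odd part is spanned by the brackets [a, [c, Y]] with a acting on U and c on W: on
  each rank one block B, suitable plane rotations a and c satisfy [a, [c, [a, [c, B]]]] = B. This
  serves to determine an involution on the odd part from its fixed algebra.\<close>

lemma skew1_double_bracket:
  assumes mk: "m \<ge> 2" "k \<ge> 2" and X: "X \<in> skew1"
    and zero: "P 0" and add: "\<And>X Y. X \<in> skew1 \<Longrightarrow> Y \<in> skew1 \<Longrightarrow> P X \<Longrightarrow> P Y \<Longrightarrow> P (X + Y)"
    and bracket: "\<And>a c Y. a \<in> skew0 \<Longrightarrow> eU * a * eU = a \<Longrightarrow> c \<in> skew0 \<Longrightarrow> eW * c * eW = c \<Longrightarrow> Y \<in> skew1 \<Longrightarrow>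
      P (a * (c * Y - Y * c) - (c * Y - Y * c) * a)"
  shows "P X"
proof -
  have mk0: "m + k > 0" using mk by simp
  define B where "B = (\<lambda>i j. E i i * X * E (m + j) (m + j) + E (m + j) (m + j) * X * E i i)"
  have Xc: "X \<in> corner N" "adj X (- X)" using X by (auto simp: skew1_def skew_def)
  have Bskew: "B i j \<in> skew1" if "i < m" "j < k" for i j
  proof -
    have E: "E i i \<in> corner N" "E (m + j) (m + j) \<in> corner N" "adj (E i i) (E i i)"
      "adj (E (m + j) (m + j)) (E (m + j) (m + j))"
      using that by (auto intro!: E_corner adj_E)
    have "adj (B i j) (E (m + j) (m + j) * (- X * E i i) + E i i * (- X * E (m + j) (m + j)))"
      unfolding B_def by (intro adj_add adj_mult E Xc)
    then have "adj (B i j) (- B i j)" by (simp add: B_def mult.assoc algebra_simps)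
    moreover have "B i j \<in> corner N" unfolding B_def by (intro corner_closed corner_mult E Xc)
    moreover have "eU * B i j * eU = 0" "eW * B i j * eW = 0"
      using that by (simp_all add: B_def distrib_left distrib_right eU_E eW_E mult.assoc [symmetric])
        (simp_all add: eU_E eW_E mult.assoc)
    ultimately show ?thesis by (simp add: skew1_def skew_def)
  qed
  have PB: "P (B i j)" if ij: "i < m" "j < k" for i j
  proof -
    \<comment> \<open>A second index in U, and below one in W, span the planes in which a and c
      rotate; here m and k have to be at least 2.\<close>
    define i' where "i' = (if i = 0 then 1 else (0::nat))"
    have i': "i' < m" "i' \<noteq> i" using mk by (auto simp: i'_def)
    define j' where "j' = (if j = 0 then 1 else (0::nat))"
    have j': "j' < k" "j' \<noteq> j" using mk by (auto simp: j'_def)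
    define a where "a = E i i' - E i' i"
    define c where "c = E (m + j) (m + j') - E (m + j') (m + j)"
    define Z where "Z = B i j"
    have lt: "i < m + k" "i' < m + k" "m + j < m + k" "m + j' < m + k" using ij i' j' by auto
    have a: "a \<in> skew0" "eU * a * eU = a"
    proof -
      have "adj a (E i' i - E i i')" unfolding a_def by (intro adj_diff adj_E lt)
      then show "a \<in> skew0" "eU * a * eU = a"
        using ij i' lt by (auto simp: skew0_def skew_def a_def left_diff_distrib right_diff_distrib eU_E
            intro!: corner_closed E_corner)
    qed
    have c: "c \<in> skew0" "eW * c * eW = c"
    proof -
      have "adj c (E (m + j') (m + j) - E (m + j) (m + j'))" unfolding c_def by (intro adj_diff adj_E lt)
      then show "c \<in> skew0" "eW * c * eW = c"
        using lt by (auto simp: skew0_def skew_def c_def left_diff_distrib right_diff_distrib eU_E eW_E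
            intro!: corner_closed E_corner)
    qed
    define Y where "Y = a * (c * Z - Z * c) - (c * Z - Z * c) * a"
    have Zs: "Z \<in> skew1" unfolding Z_def by (rule Bskew[OF ij])
    have cZ: "c * Z - Z * c \<in> skew1" by (rule bracket_skew01[OF c(1) Zs])
    have Y: "Y \<in> skew1" unfolding Y_def by (rule bracket_skew01[OF a(1) cZ])
    have aa: "a * a = - (E i i + E i' i')" and cc: "c * c = - (E (m + j) (m + j) + E (m + j') (m + j'))"
      and ac: "a * c = 0" "c * a = 0"
      unfolding a_def c_def using ij i' j' lt by (simp_all add: algebra_simps E_mult)
    have Ztail: "E x y * (E x' y' * z) = (if y = x' then E x y' * z else 0)"
      if "x < m + k" "y < m + k" "x' < m + k" "y' < m + k" for x y x' y' z
      using E_mult[OF that] by (simp add: mult.assoc [symmetric])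
    have aaZ: "a * a * Z + Z * (a * a) = - Z" and ccZ: "c * c * Z + Z * (c * c) = - Z"
      and aZa: "a * Z * a = 0" and cZc: "c * Z * c = 0"
      unfolding aa cc using ij i' j' lt
      by (simp_all add: a_def c_def Z_def B_def algebra_simps E_mult Ztail)
    \<comment> \<open>ad a and ad c commute because a c = c a = 0, and the square of each is -1 on
      Z.\<close>
    have "a * (c * Y - Y * c) - (c * Y - Y * c) * a = Z"
    proof -
      have ac': "a * (c * z) = 0" "c * (a * z) = 0" for z using ac by (simp_all add: mult.assoc [symmetric])
      have bb: "b * (b * z - z * b) - (b * z - z * b) * b = - z"
        if "b * b * z + z * (b * b) = - z" "b * z * b = 0" for b z :: "'a fmatrix"
      proof -
        have "b * (b * z - z * b) - (b * z - z * b) * b = (b * b * z + z * (b * b)) - b * z * b - b * z * b"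
          by (simp add: algebra_simps)
        then show ?thesis using that by simp
      qed
      have comm: "a * (c * z - z * c) - (c * z - z * c) * a = c * (a * z - z * a) - (a * z - z * a) * c" for z
        by (simp add: left_diff_distrib right_diff_distrib mult.assoc ac ac')
      define Q where "Q = c * Z - Z * c"
      have cQ: "c * Q - Q * c = - Z" unfolding Q_def by (rule bb[OF ccZ cZc])
      have "Y = a * Q - Q * a" by (simp add: Y_def Q_def)
      then have "c * Y - Y * c = a * (c * Q - Q * c) - (c * Q - Q * c) * a" using comm[of Q] by simp
      also have "\<dots> = - (a * Z - Z * a)" unfolding cQ by simp
      finally have q: "c * Y - Y * c = - (a * Z - Z * a)" .
      have neg: "a * (- z) - (- z) * a = - (a * z - z * a)" for z by simp
      show ?thesis unfolding q neg bb[OF aaZ aZa] by simp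
    qed
    moreover have "P (a * (c * Y - Y * c) - (c * Y - Y * c) * a)"
      by (rule bracket[OF a c Y])
    ultimately show ?thesis by (simp add: Z_def)
  qed
  have sums: "P (\<Sum>x\<in>I. F x)" "(\<Sum>x\<in>I. F x) \<in> skew1" if "\<And>x. x \<in> I \<Longrightarrow> P (F x) \<and> F x \<in> skew1" for I and F :: "nat \<Rightarrow> 'a fmatrix"
  proof -
    have "P (\<Sum>x\<in>I. F x) \<and> (\<Sum>x\<in>I. F x) \<in> skew1" using that
      by (induction I rule: infinite_finite_induct) (auto intro!: zero add skew1_ex(2)[OF mk0] skew1_closed)
    then show "P (\<Sum>x\<in>I. F x)" "(\<Sum>x\<in>I. F x) \<in> skew1" by auto
  qed
  have W: "eW = (\<Sum>j<k. E (m + j) (m + j))"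
    unfolding eW_def by (rule sum.reindex_bij_witness[of _ "\<lambda>j. m + j" "\<lambda>j. j - m"]) auto
  have "X = eU * X * eW + eW * X * eU"
    using even_odd[OF Xc(1)] X by (simp add: even_part_def odd_part_def skew1_def)
  also have "\<dots> = (\<Sum>i<m. \<Sum>j<k. B i j)"
    unfolding W eU_def B_def
    by (simp add: sum_distrib_left sum_distrib_right sum.distrib) (rule sum.swap)
  finally have "X = (\<Sum>i<m. \<Sum>j<k. B i j)" .
  moreover have "P (\<Sum>i<m. \<Sum>j<k. B i j)"
    by (intro sums conjI PB Bskew) auto
  ultimately show ?thesis by simp
qed

text \<open>The square of \<xi> is diagonal, and one index of U and one of W share an eigenvalue
  only if they are i and m + i. A commuting odd K therefore has only the blocks (i, m + i) and (m +
  i, i); commuting with \<xi> itself makes such a block selfadjoint after a shift to the diagonal,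
  hence scalar.\<close>

lemma regular_odd_element:
  assumes mk: "m \<le> k" "m > 0"
  defines "\<kappa> \<equiv> \<lambda>i. E (m + i) i - E i (m + i)"
  shows "\<exists>\<xi>\<in>skew1. \<forall>K\<in>skew1. K * \<xi> = \<xi> * K \<longrightarrow> (\<exists>c. K = (\<Sum>i<m. scale (c i) (\<kappa> i)))"
    "i < m \<Longrightarrow> \<kappa> i \<in> skew1"
proof -
  have k1: "\<kappa> i \<in> skew1" if "i < m" for i
  proof -
    have lt: "i < m + k" "m + i < m + k" "i < k" using that mk by auto
    have "adj (\<kappa> i) (E i (m + i) - E (m + i) i)" unfolding \<kappa>_def by (intro adj_diff adj_E lt(1,2))
    then show ?thesis
      using lt that by (auto simp: skew1_def skew_def \<kappa>_def left_diff_distrib right_diff_distrib eU_E eW_E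
          intro!: corner_closed E_corner)
  qed
  show "i < m \<Longrightarrow> \<kappa> i \<in> skew1" by (rule k1)
  \<comment> \<open>Nonzero with distinct squares, by characteristic zero.\<close>
  define \<mu> :: "nat \<Rightarrow> 'a" where "\<mu> i = of_nat (Suc i)" for i
  define \<xi> where "\<xi> = (\<Sum>i<m. scale (\<mu> i) (\<kappa> i))"
  have mk0: "m + k > 0" using mk by simp
  have \<xi>1: "\<xi> \<in> skew1"
  proof -
    have "(\<Sum>i\<in>I. scale (\<mu> i) (\<kappa> i)) \<in> skew1" if "I \<subseteq> {..<m}" for I
      using finite_subset[OF that finite_lessThan] that
      by (induction I rule: finite_induct) (auto intro!: skew1_ex(2)[OF mk0] skew1_closed(1) skew1_closed(3)[of "\<kappa> i" "\<kappa> i" for i] k1)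
    then show ?thesis by (simp add: \<xi>_def)
  qed
  have \<xi>E: "\<xi> * E i i = scale (\<mu> i) (E (m + i) i)" "\<xi> * E (m + i) (m + i) = - scale (\<mu> i) (E i (m + i))"
    "E i i * \<xi> = - scale (\<mu> i) (E i (m + i))" "E (m + i) (m + i) * \<xi> = scale (\<mu> i) (E (m + i) i)"
    if i: "i < m" for i
  proof -
    have lt: "i < m + k" "m + i < m + k" "i < k" using i mk by auto
    have "\<xi> * E i i = (\<Sum>l<m. if l = i then scale (\<mu> i) (E (m + i) i) else 0)"
      unfolding \<xi>_def sum_distrib_right by (rule sum.cong) (use i mk in \<open>auto simp: \<kappa>_def left_diff_distrib E_mult\<close>)
    then show "\<xi> * E i i = scale (\<mu> i) (E (m + i) i)" using i by simp
    have "\<xi> * E (m + i) (m + i) = (\<Sum>l<m. if l = i then - scale (\<mu> i) (E i (m + i)) else 0)"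
      unfolding \<xi>_def sum_distrib_right by (rule sum.cong) (use i mk in \<open>auto simp: \<kappa>_def left_diff_distrib E_mult\<close>)
    then show "\<xi> * E (m + i) (m + i) = - scale (\<mu> i) (E i (m + i))" using i by simp
    have "E i i * \<xi> = (\<Sum>l<m. if l = i then - scale (\<mu> i) (E i (m + i)) else 0)"
      unfolding \<xi>_def sum_distrib_left by (rule sum.cong) (use i mk in \<open>auto simp: \<kappa>_def right_diff_distrib E_mult\<close>)
    then show "E i i * \<xi> = - scale (\<mu> i) (E i (m + i))" using i by simp
    have "E (m + i) (m + i) * \<xi> = (\<Sum>l<m. if l = i then scale (\<mu> i) (E (m + i) i) else 0)"
      unfolding \<xi>_def sum_distrib_left by (rule sum.cong) (use i mk in \<open>auto simp: \<kappa>_def right_diff_distrib E_mult\<close>)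
    then show "E (m + i) (m + i) * \<xi> = scale (\<mu> i) (E (m + i) i)" using i by simp
  qed
  have \<xi>E0: "\<xi> * E j j = 0" "E j j * \<xi> = 0" if j: "2 * m \<le> j" "j < m + k" for j
    unfolding \<xi>_def sum_distrib_right sum_distrib_left
    by (rule sum.neutral, use j in \<open>auto simp: \<kappa>_def left_diff_distrib right_diff_distrib E_mult\<close>)+
  \<comment> \<open>The eigenvalues of the square of \<xi>; they are zero on the units of W that
    have no partner in U.\<close>
  define \<nu> where "\<nu> j = (if j < m then - (\<mu> j ^ 2) else if j < 2 * m then - (\<mu> (j - m) ^ 2) else 0)" for j
  have sq: "\<xi> * (\<xi> * E j j) = scale (\<nu> j) (E j j)" "E j j * \<xi> * \<xi> = scale (\<nu> j) (E j j)" if j: "j < m + k" for j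
  proof -
    have \<xi>E': "\<xi> * E (m + i) i = - scale (\<mu> i) (E i i)" "\<xi> * E i (m + i) = scale (\<mu> i) (E (m + i) (m + i))"
      "E i (m + i) * \<xi> = scale (\<mu> i) (E i i)" "E (m + i) i * \<xi> = - scale (\<mu> i) (E (m + i) (m + i))" if i: "i < m" for i
    proof -
      have lt: "i < m + k" "m + i < m + k" "i < k" using i mk by auto
      have "\<xi> * E (m + i) i = (\<xi> * E (m + i) (m + i)) * E (m + i) i"
        by (simp add: mult.assoc E_mult lt)
      then show "\<xi> * E (m + i) i = - scale (\<mu> i) (E i i)"
        unfolding \<xi>E(2)[OF i] by (simp add: E_mult lt)
      have "\<xi> * E i (m + i) = (\<xi> * E i i) * E i (m + i)"
        by (simp add: mult.assoc E_mult lt)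
      then show "\<xi> * E i (m + i) = scale (\<mu> i) (E (m + i) (m + i))"
        unfolding \<xi>E(1)[OF i] by (simp add: E_mult lt)
      have "E i (m + i) * \<xi> = E i (m + i) * (E (m + i) (m + i) * \<xi>)"
        by (simp add: mult.assoc [symmetric] E_mult lt)
      then show "E i (m + i) * \<xi> = scale (\<mu> i) (E i i)"
        unfolding \<xi>E(4)[OF i] by (simp add: E_mult lt)
      have "E (m + i) i * \<xi> = E (m + i) i * (E i i * \<xi>)"
        by (simp add: mult.assoc [symmetric] E_mult lt)
      then show "E (m + i) i * \<xi> = - scale (\<mu> i) (E (m + i) (m + i))"
        unfolding \<xi>E(3)[OF i] by (simp add: E_mult lt)
    qed
    consider "j < m" | "m \<le> j" "j < 2 * m" | "2 * m \<le> j" by linarith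
    then have "\<xi> * (\<xi> * E j j) = scale (\<nu> j) (E j j) \<and> E j j * \<xi> * \<xi> = scale (\<nu> j) (E j j)"
    proof cases
      case 1
      then show ?thesis by (simp add: \<xi>E \<xi>E' \<nu>_def power2_eq_square scale_left)
    next
      case 2
      then obtain i where "j = m + i" "i < m" by (metis add_less_cancel_left le_Suc_ex mult_2)
      then show ?thesis by (simp add: \<xi>E \<xi>E' \<nu>_def power2_eq_square scale_left)
    next
      case 3
      then show ?thesis using j by (simp add: \<xi>E0 \<nu>_def)
    qed
    then show "\<xi> * (\<xi> * E j j) = scale (\<nu> j) (E j j)" "E j j * \<xi> * \<xi> = scale (\<nu> j) (E j j)" by auto
  qed
  have \<nu>inj: "\<nu> i \<noteq> \<nu> j" if "i < m" "m \<le> j" "j \<noteq> m + i" for i j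
  proof (cases "j < 2 * m")
    case True
    have "\<mu> i ^ 2 \<noteq> \<mu> (j - m) ^ 2"
    proof
      assume "\<mu> i ^ 2 = \<mu> (j - m) ^ 2"
      then have "(of_nat ((Suc i) ^ 2) :: 'a) = of_nat ((Suc (j - m)) ^ 2)" by (simp add: \<mu>_def)
      then have "Suc i ^ 2 = Suc (j - m) ^ 2" by (simp only: of_nat_eq_iff)
      then have "i = j - m" using power_eq_iff_eq_base[of 2 "Suc i" "Suc (j - m)"] by simp
      then show False using that by simp
    qed
    then show ?thesis using True that by (simp add: \<nu>_def)
  next
    case False
    have "\<mu> i \<noteq> 0" unfolding \<mu>_def by (simp only: of_nat_eq_0_iff)
    then show ?thesis using False that by (simp add: \<nu>_def)
  qed
  have "\<exists>c. K = (\<Sum>i<m. scale (c i) (\<kappa> i))" if K: "K \<in> skew1" "K * \<xi> = \<xi> * K" for K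
  proof -
    have Kc: "K \<in> corner N" "adj K (- K)" using K by (auto simp: skew1_def skew_def)
    \<comment> \<open>K commutes with the square of \<xi>, which acts on the two diagonal units by
      \<open>\<nu> a\<close> and \<open>\<nu> b\<close>.\<close>
    have blk: "scale (\<nu> b - \<nu> a) (E a a * K * E b b) = 0" if "a < m + k" "b < m + k" for a b
    proof -
      have "E a a * K * (\<xi> * (\<xi> * E b b)) = E a a * \<xi> * \<xi> * K * E b b"
        using K(2) by (metis mult.assoc)
      then have "E a a * K * scale (\<nu> b) (E b b) = scale (\<nu> a) (E a a) * K * E b b"
        by (simp only: sq that)
      then show ?thesis by (simp add: scale_left mult.assoc)
    qed
    have blk0: "E a a * K * E b b = 0" if "a < m + k" "b < m + k" "\<nu> a \<noteq> \<nu> b" for a b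
    proof -
      have "scale (inverse (\<nu> b - \<nu> a)) (scale (\<nu> b - \<nu> a) (E a a * K * E b b)) = 0"
        by (simp only: blk[OF that(1,2)] scale_simps)
      then show ?thesis using that(3) by simp
    qed
    have "\<exists>c. E (m + i) (m + i) * K * E i i = scale c (E (m + i) i) \<and>
        E i i * K * E (m + i) (m + i) = - scale c (E i (m + i))" if i: "i < m" for i
    proof -
      have lt: "i < m + k" "m + i < m + k" "i < k" using i mk by auto
      \<comment> \<open>The block moved to the diagonal corner of i. Comparing K \<xi> with \<xi> K
        there relates it to the opposite block, and skewness of K then shows that d is its own
        adjoint.\<close>
      define d where "d = E i (m + i) * K * E i i"
      have mu0: "\<mu> i \<noteq> 0" unfolding \<mu>_def by (simp only: of_nat_eq_0_iff)
      have "E i i * (K * \<xi>) * E i i = E i i * (\<xi> * K) * E i i" using K(2) by simp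
      moreover have "E i i * (K * \<xi>) * E i i = E i i * K * (\<xi> * E i i)"
        "E i i * (\<xi> * K) * E i i = E i i * \<xi> * K * E i i" by (simp_all add: mult.assoc)
      ultimately have "scale (\<mu> i) (E i i * K * E (m + i) i) = - scale (\<mu> i) d"
        by (simp add: \<xi>E i d_def)
      then have "scale (inverse (\<mu> i)) (scale (\<mu> i) (E i i * K * E (m + i) i)) = scale (inverse (\<mu> i)) (- scale (\<mu> i) d)"
        by simp
      then have d': "E i i * K * E (m + i) i = - d" using mu0 by simp
      have "adj d (E i i * (- K * E (m + i) i))"
        unfolding d_def by (intro adj_mult adj_E lt(1,2) Kc)
      then have "adj d d" using d' by (simp add: mult.assoc)
      moreover have "d \<in> corner N" unfolding d_def by (intro corner_mult E_corner lt(1,2) Kc)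
      moreover have "E i i * d * E i i = d"
        unfolding d_def by (simp add: mult.assoc E_mult lt) (simp add: mult.assoc [symmetric] E_mult lt)
      ultimately obtain c where c: "d = scale c (E i i)" using adj_scalar[OF lt(1)] by blast
      have "E (m + i) (m + i) * K * E i i = E (m + i) i * d"
        unfolding d_def by (simp add: mult.assoc [symmetric] E_mult lt)
      also have "\<dots> = scale c (E (m + i) i)" by (simp add: c E_mult lt)
      finally have 1: "E (m + i) (m + i) * K * E i i = scale c (E (m + i) i)" .
      have "E i i * K * E (m + i) (m + i) = (E i i * K * E (m + i) i) * E i (m + i)"
        by (simp add: mult.assoc E_mult lt)
      also have "\<dots> = - scale c (E i (m + i))" by (simp add: d' c E_mult lt)
      finally show ?thesis using 1 by blast
    qed
    then obtain c where c: "\<And>i. i < m \<Longrightarrow> E (m + i) (m + i) * K * E i i = scale (c i) (E (m + i) i) \<and>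
        E i i * K * E (m + i) (m + i) = - scale (c i) (E i (m + i))" by metis
    have "K = eU * K * eW + eW * K * eU"
      using even_odd[OF Kc(1)] K by (simp add: even_part_def odd_part_def skew1_def)
    also have "eU * K * eW = (\<Sum>i<m. \<Sum>j=m..<m + k. E i i * K * E j j)"
      unfolding eU_def eW_def by (simp add: sum_distrib_left sum_distrib_right) (rule sum.swap)
    also have "\<dots> = (\<Sum>i<m. - scale (c i) (E i (m + i)))"
    proof (rule sum.cong[OF refl])
      fix i assume i: "i \<in> {..<m}"
      have "(\<Sum>j=m..<m + k. E i i * K * E j j) = (\<Sum>j=m..<m + k. if j = m + i then - scale (c i) (E i (m + i)) else 0)"
        by (rule sum.cong) (use i c \<nu>inj blk0 in auto)
      then show "(\<Sum>j=m..<m + k. E i i * K * E j j) = - scale (c i) (E i (m + i))" using i mk by simp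
    qed
    also have "eW * K * eU = (\<Sum>i<m. \<Sum>j=m..<m + k. E j j * K * E i i)"
      unfolding eU_def eW_def by (simp add: sum_distrib_left sum_distrib_right)
    also have "\<dots> = (\<Sum>i<m. scale (c i) (E (m + i) i))"
    proof (rule sum.cong[OF refl])
      fix i assume i: "i \<in> {..<m}"
      have "(\<Sum>j=m..<m + k. E j j * K * E i i) = (\<Sum>j=m..<m + k. if j = m + i then scale (c i) (E (m + i) i) else 0)"
        by (rule sum.cong) (use i c \<nu>inj[THEN not_sym] blk0 in auto)
      then show "(\<Sum>j=m..<m + k. E j j * K * E i i) = scale (c i) (E (m + i) i)" using i mk by simp
    qed
    finally have "K = (\<Sum>i<m. scale (c i) (\<kappa> i))"
      by (simp add: \<kappa>_def sum_subtractf sum_negf algebra_simps)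
    then show ?thesis by blast
  qed
  with \<xi>1 show "\<exists>\<xi>\<in>skew1. \<forall>K\<in>skew1. K * \<xi> = \<xi> * K \<longrightarrow> (\<exists>c. K = (\<Sum>i<m. scale (c i) (\<kappa> i)))" by blast
qed

end

section \<open>The bad nilpotent element\<close>

text \<open>In a basis adapted to two hyperbolic planes of \<open>W\<close>, with basis vectors \<open>m, m + 2\<close> and
  \<open>m + 1, m + 3\<close>, the adjoint of the matrix unit \<open>(i, j)\<close> is the unit \<open>(\<tau> j, \<tau> i)\<close>.\<close>

locale hermitian_hyperbolic = hermitian N m k E adj pr
  for N m k :: nat and E :: "nat \<Rightarrow> nat \<Rightarrow> 'a::field_char_0 fmatrix" and adj pr +
  fixes \<iota> :: 'a
  assumes iota: "\<iota> * \<iota> = -1" and m3: "m \<ge> 3" and k4: "k \<ge> 4"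
begin

definition "\<tau> i = (if i = m \<or> i = m + 1 then i + 2 else if i = m + 2 \<or> i = m + 3 then i - 2 else i)"
text \<open>The new basis vectors are f_i = \<alpha>_i e_i + \<beta>_i e_(\<tau> i). On the pair m,
  m + 2 they are e_m - \<iota> e_(m+2) and (e_m + \<iota> e_(m+2)) / 2, two isotropic vectors with
  product 1; likewise for m + 1, m + 3. All other basis vectors are kept.\<close>

definition "\<alpha> i = (if i = m + 2 \<or> i = m + 3 then \<iota> / 2 else 1)"
definition "\<beta> i = (if i = m \<or> i = m + 1 then - \<iota> else if i = m + 2 \<or> i = m + 3 then 1 / 2 else 0)"
text \<open>The column f_i times the transpose of f_(\<tau> j), expanded in the old units: f_(\<tau>
  j) represents the coordinate dual to f_j.\<close>

definition "F i j = scale (\<alpha> i * \<alpha> (\<tau> j)) (E i (\<tau> j)) + scale (\<alpha> i * \<beta> (\<tau> j)) (E i j)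
  + scale (\<beta> i * \<alpha> (\<tau> j)) (E (\<tau> i) (\<tau> j)) + scale (\<beta> i * \<beta> (\<tau> j)) (E (\<tau> i) j)"

lemma \<tau>: "i < m + k \<Longrightarrow> \<tau> i < m + k" "\<tau> (\<tau> i) = i" "\<tau> i < m \<longleftrightarrow> i < m"
  using k4 by (auto simp: \<tau>_def)

lemma \<tau>_inj: "\<tau> i = \<tau> j \<longleftrightarrow> i = j"
  by (metis \<tau>(2))

text \<open>Isotropy of the new vectors of each hyperbolic plane, and the value 1 of their
  pairing.\<close>

lemma \<alpha>\<beta>: "\<tau> i \<noteq> i \<Longrightarrow> \<alpha> i * \<alpha> i + \<beta> i * \<beta> i = 0" "\<tau> i \<noteq> i \<Longrightarrow> \<alpha> i * \<beta> (\<tau> i) + \<beta> i * \<alpha> (\<tau> i) = 1"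
  "\<tau> i = i \<Longrightarrow> \<alpha> i = 1" "\<tau> i = i \<Longrightarrow> \<beta> i = 0"
proof -
  have v: "\<tau> m = m + 2" "\<tau> (m + 1) = m + 3" "\<tau> (m + 2) = m" "\<tau> (m + 3) = m + 1"
    "\<alpha> m = 1" "\<alpha> (m + 1) = 1" "\<alpha> (m + 2) = \<iota> / 2" "\<alpha> (m + 3) = \<iota> / 2"
    "\<beta> m = - \<iota>" "\<beta> (m + 1) = - \<iota>" "\<beta> (m + 2) = 1 / 2" "\<beta> (m + 3) = 1 / 2"
    by (simp_all add: \<tau>_def \<alpha>_def \<beta>_def)
  show "\<tau> i = i \<Longrightarrow> \<alpha> i = 1" "\<tau> i = i \<Longrightarrow> \<beta> i = 0"
    by (auto simp: \<tau>_def \<alpha>_def \<beta>_def split: if_splits)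
  assume "\<tau> i \<noteq> i"
  then have c: "i = m \<or> i = m + 1 \<or> i = m + 2 \<or> i = m + 3"
    by (auto simp: \<tau>_def split: if_splits)
  show "\<alpha> i * \<alpha> i + \<beta> i * \<beta> i = 0"
    using c by (elim disjE; simp only: v; simp add: iota)
  show "\<alpha> i * \<beta> (\<tau> i) + \<beta> i * \<alpha> (\<tau> i) = 1"
    using c by (elim disjE; simp only: v; simp add: iota)
qed

lemmas fm_ac = add.assoc[where 'a = "'a fmatrix"] add.commute[where 'a = "'a fmatrix"]
  add.left_commute[where 'a = "'a fmatrix"] mult.commute[where 'a = 'a]

lemma F_mult:
  assumes "i < m + k" "j < m + k" "i' < m + k" "j' < m + k"
  shows "F i j * F i' j' = (if j = i' then F i j' else 0)"
proof -
  have [simp]: "\<tau> i < m + k" "\<tau> j < m + k" "\<tau> i' < m + k" "\<tau> j' < m + k" using assms \<tau> by auto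
  \<comment> \<open>Left and right factors are separated, so that the product only involves the
    pairing of the two inner vectors.\<close>
  define R where "R = (\<lambda>x. scale (\<alpha> i) (E i x) + scale (\<beta> i) (E (\<tau> i) x))"
  define C where "C = (\<lambda>x. scale (\<alpha> (\<tau> j')) (E x (\<tau> j')) + scale (\<beta> (\<tau> j')) (E x j'))"
  have F1: "F i j = scale (\<alpha> (\<tau> j)) (R (\<tau> j)) + scale (\<beta> (\<tau> j)) (R j)"
    and F2: "F i' j' = scale (\<alpha> i') (C i') + scale (\<beta> i') (C (\<tau> i'))"
    and F3: "F i j' = scale (\<alpha> i) (C i) + scale (\<beta> i) (C (\<tau> i))"
    by (simp_all add: F_def R_def C_def fm_ac)
  have RC: "R x * C y = (if x = y then F i j' else 0)" if "x < m + k" "y < m + k" for x y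
    using assms that by (simp add: R_def C_def F_def distrib_left distrib_right E_mult fm_ac)
  consider "j = i'" | "j \<noteq> i'" "j = \<tau> i'" | "j \<noteq> i'" "j \<noteq> \<tau> i'" by blast
  then show ?thesis
  proof cases
    case 1
    show ?thesis
    proof (cases "\<tau> j = j")
      case True
      then show ?thesis using 1 \<alpha>\<beta>(3,4)[OF True] assms
        unfolding F1 F2 by (simp add: RC)
    next
      case False
      have "F i j * F i' j' = scale (\<alpha> j * \<beta> (\<tau> j) + \<beta> j * \<alpha> (\<tau> j)) (F i j')"
        using 1 False False[symmetric] assms
        unfolding F1 F2 by (simp add: RC distrib_left distrib_right scale_left fm_ac)
      then show ?thesis using 1 \<alpha>\<beta>(2)[OF False] by simp
    qed
  next
    case 2
    have t: "\<tau> j = i'" "\<tau> i' \<noteq> i'" using 2 \<tau>(2) by auto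
    have "F i j * F i' j' = scale (\<alpha> i' * \<alpha> i' + \<beta> i' * \<beta> i') (F i j')"
      using 2 t t(2)[symmetric] assms
      unfolding F1 F2 by (simp add: RC distrib_left distrib_right scale_left)
    then show ?thesis using 2 \<alpha>\<beta>(1)[OF t(2)] by simp
  next
    case 3
    then have "\<tau> j \<noteq> i'" "\<tau> j \<noteq> \<tau> i'" using \<tau>(2) \<tau>_inj by metis+
    then show ?thesis using 3 assms unfolding F1 F2 by (simp add: RC distrib_left distrib_right)
  qed
qed

lemma F_corner: "i < m + k \<Longrightarrow> j < m + k \<Longrightarrow> F i j \<in> corner N"
  unfolding F_def using \<tau> by (auto intro!: corner_closed E_corner)

lemma adj_F: "i < m + k \<Longrightarrow> j < m + k \<Longrightarrow> adj (F i j) (F (\<tau> j) (\<tau> i))"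
proof -
  assume ij: "i < m + k" "j < m + k"
  then have t: "\<tau> i < m + k" "\<tau> j < m + k" using \<tau> by auto
  have "adj (F i j) (scale (\<alpha> i * \<alpha> (\<tau> j)) (E (\<tau> j) i) + scale (\<alpha> i * \<beta> (\<tau> j)) (E j i)
    + scale (\<beta> i * \<alpha> (\<tau> j)) (E (\<tau> j) (\<tau> i)) + scale (\<beta> i * \<beta> (\<tau> j)) (E j (\<tau> i)))"
    unfolding F_def by (intro adj_add adj_scale adj_E ij t)
  then show ?thesis by (simp add: F_def \<tau>(2) fm_ac)
qed

lemma F_nonzero: "i < m + k \<Longrightarrow> F i i \<noteq> 0"
proof
  assume i: "i < m + k" and 0: "F i i = 0"
  have t: "\<tau> i < m + k" using \<tau> i by auto
  show False
  proof (cases "\<tau> i = i")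
    case True
    then show False using 0 \<alpha>\<beta>(3,4)[OF True] E_nonzero[OF i] by (simp add: F_def)
  next
    case False
    have "E i i * F i i = scale (\<alpha> i * \<alpha> (\<tau> i)) (E i (\<tau> i)) + scale (\<alpha> i * \<beta> (\<tau> i)) (E i i)"
      using i t False by (simp add: F_def distrib_left E_mult)
    then have "E i i * F i i * E i i = scale (\<alpha> i * \<beta> (\<tau> i)) (E i i)"
      using i t False by (simp add: distrib_right E_mult)
    then have "scale (\<alpha> i * \<beta> (\<tau> i)) (E i i) = 0" using 0 by simp
    then have "scale (inverse (\<alpha> i * \<beta> (\<tau> i))) (scale (\<alpha> i * \<beta> (\<tau> i)) (E i i)) = 0" by simp
    moreover have "\<alpha> i * \<beta> (\<tau> i) \<noteq> 0"
      using \<alpha>\<beta>(2)[OF False] \<alpha>\<beta>(1)[OF False] iota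
      by (auto simp: \<tau>_def \<alpha>_def \<beta>_def split: if_splits)
    ultimately show False using E_nonzero[OF i] by (simp del: inverse_mult_distrib mult_eq_0_iff)
  qed
qed

lemma F_unit_neq: "i < m + k \<Longrightarrow> j < m + k \<Longrightarrow> F i j \<noteq> 0"
  by (metis F_mult F_nonzero mult_zero_left)

lemma eU_F: "i < m + k \<Longrightarrow> j < m + k \<Longrightarrow> eU * F i j = (if i < m then F i j else 0)"
  "i < m + k \<Longrightarrow> j < m + k \<Longrightarrow> F i j * eU = (if j < m then F i j else 0)"
  by (auto simp: F_def distrib_left distrib_right eU_E \<tau>)

lemma eW_F: "i < m + k \<Longrightarrow> j < m + k \<Longrightarrow> eW * F i j = (if i < m then 0 else F i j)"
  "i < m + k \<Longrightarrow> j < m + k \<Longrightarrow> F i j * eW = (if j < m then 0 else F i j)"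
  by (auto simp: F_def distrib_left distrib_right eW_E \<tau>)

section \<open>The nilpotent element and its Jordan layers\<close>

definition "q0 = F 0 0 + F 1 1"
definition "q1 = F m m + F (m + 1) (m + 1)"
definition "q3 = F (m + 2) (m + 2) + F (m + 3) (m + 3)"
definition "qr = eU - q0"
definition "qs = eW - q1 - q3"
text \<open>The signs make it skew-hermitian: the adjoint exchanges \<open>F (m + 2) 0\<close> with
  \<open>F 0 m\<close> and \<open>F (m + 3) 1\<close> with \<open>F 1 (m + 1)\<close>.\<close>

definition "nil = F (m + 2) 0 + F (m + 3) 1 - F 0 m - F 1 (m + 1)"
definition "nil' = F 0 (m + 2) + F 1 (m + 3) - F m 0 - F (m + 1) 1"

lemma F_mult_tail:
  "i < m + k \<Longrightarrow> j < m + k \<Longrightarrow> i' < m + k \<Longrightarrow> j' < m + k \<Longrightarrow>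
    F i j * (F i' j' * z) = (if j = i' then F i j' * z else 0)"
  using F_mult[of i j i' j'] by (simp add: mult.assoc [symmetric])

lemma index_less: "0 < m + k" "1 < m + k" "Suc 0 < m + k" "m < m + k" "m + 1 < m + k" "Suc m < m + k"
  "m + 2 < m + k" "Suc (Suc m) < m + k" "m + 3 < m + k" "0 < m" "Suc 0 < m" "0 < k" "Suc 0 < k" "2 < k" "3 < k"
  "Suc 0 < m + k" "2 < m + k"
  using m3 k4 by auto

lemma index_neq: "0 \<noteq> m" "Suc 0 \<noteq> m" "m \<noteq> 0" "m \<noteq> Suc 0"
  using m3 by auto

lemmas units = q0_def q1_def q3_def nil_def nil'_def

sublocale nilpotent_blocks nil nil' q0 q1 q3 qr qs
proof -
  note [simp] = index_less index_neq
  note rules = units qr_def qs_def distrib_left distrib_right left_diff_distrib right_diff_distrib F_mult eU_F eW_F eUW_idem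
  show "nilpotent_blocks nil nil' q0 q1 q3 qr qs"
    by unfold_locales (simp_all add: rules)
qed

lemma q_corner: "q0 \<in> corner N" "q1 \<in> corner N" "q3 \<in> corner N" "nil \<in> corner N" "nil' \<in> corner N"
  unfolding units by (intro corner_closed F_corner index_less)+

lemma adj_q: "adj q0 q0" "adj q1 q3" "adj q3 q1" "adj nil (- nil)" "adj nil' (- nil')"
proof -
  have t: "\<tau> 0 = 0" "\<tau> 1 = 1" "\<tau> m = m + 2" "\<tau> (m + 1) = m + 3" "\<tau> (m + 2) = m" "\<tau> (m + 3) = m + 1"
    using m3 by (auto simp: \<tau>_def)
  note A = adj_F[of 0 0] adj_F[of 1 1] adj_F[of m m] adj_F[of "m + 1" "m + 1"] adj_F[of "m + 2" "m + 2"]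
    adj_F[of "m + 3" "m + 3"] adj_F[of "m + 2" 0] adj_F[of "m + 3" 1] adj_F[of 0 m] adj_F[of 1 "m + 1"]
    adj_F[of 0 "m + 2"] adj_F[of 1 "m + 3"] adj_F[of m 0] adj_F[of "m + 1" 1]
  note A = A[unfolded t]
  show "adj q0 q0" unfolding q0_def by (intro adj_add A index_less)
  show "adj q1 q3" unfolding q1_def q3_def by (intro adj_add A index_less)
  show "adj q3 q1" unfolding q1_def q3_def by (intro adj_add A index_less)
  have "adj nil (F 0 m + F 1 (m + 1) - F (m + 2) 0 - F (m + 3) 1)"
    unfolding nil_def by (intro adj_add adj_diff A index_less)
  then show "adj nil (- nil)" by (simp add: nil_def algebra_simps)
  have "adj nil' (F m 0 + F (m + 1) 1 - F 0 (m + 2) - F 1 (m + 3))"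
    unfolding nil'_def by (intro adj_add adj_diff A index_less)
  then show "adj nil' (- nil')" by (simp add: nil'_def algebra_simps)
qed

lemma adj_rs: "adj qr qr" "adj qs qs"
proof -
  show "adj qr qr" unfolding qr_def by (intro adj_diff adj_eU adj_q index_less)
  have "adj qs (eW - q3 - q1)" unfolding qs_def by (intro adj_diff adj_eW adj_q index_less)
  then show "adj qs qs" by (simp add: qs_def algebra_simps)
qed

lemma rs_corner: "qr \<in> corner N" "qs \<in> corner N"
  unfolding qr_def qs_def by (intro corner_closed q_corner eUW_corner)+

lemma eUW_q: "eU = q0 + qr" "eW = q1 + q3 + qs"
  by (simp_all add: qr_def qs_def)

lemma nil_skew1: "nil \<in> skew1"
  using q_corner(4) adj_q(4)
  by (simp add: skew1_def skew_def nil_def distrib_left distrib_right left_diff_distrib right_diff_distrib eU_F eW_F index_less)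

lemma skew1_odd: "X \<in> skew1 \<Longrightarrow> odd_element X"
proof -
  assume X: "X \<in> skew1"
  have s: "q0 + qr = eU" "q1 + q3 + qs = eW" "q0 + q1 + q3 + qr + qs = eU + eW"
    by (simp_all add: qr_def qs_def)
  show ?thesis
    unfolding odd_element_def s using X unit[OF skew_corner(3)[OF X]]
    by (simp add: skew1_def distrib_left distrib_right)
qed

text \<open>The odd centraliser of \<open>nil\<close>. By the trace form it is the dual of the
  quotient of the odd part by the brackets of even elements with \<open>nil\<close>, that is, of the
  slice representation.\<close>

definition "slice = {y \<in> skew1. nil * y = y * nil}"

text \<open>The adjoint carries the corner of \<open>q1\<close> to that of \<open>q3\<close>, and
  the square of \<open>nil\<close> identifies the two layers. The condition is selfadjointness for
  the form transported to the source layer.\<close>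

definition "sadj X \<longleftrightarrow> X \<in> corner N \<and> q1 * X = X \<and> X * q1 = X \<and> adj X (nil * nil * X * nil' * nil')"

lemma adjD: "adj X Y \<Longrightarrow> Y = Y' \<Longrightarrow> adj X Y'"
  by simp

lemma sadj_q1: "sadj q1"
  using q_corner adjD[OF adj_q(2), of "nil * nil * q1 * nil' * nil'"]
  by (simp add: sadj_def words)

lemma sadj_Xblock: "\<xi> \<in> skew1 \<Longrightarrow> sadj (Xblock \<xi>)"
proof -
  assume x: "\<xi> \<in> skew1"
  then have \<xi>: "\<xi> \<in> corner N" "adj \<xi> (- \<xi>)" by (auto simp: skew1_def skew_def)
  have "adj (Xblock \<xi>) (q3 * (- nil * (- \<xi> * q3)) + q3 * (- nil * (- nil * (- \<xi> * (q0 * - nil')))))"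
    unfolding Xblock_def by (intro adj_add adj_mult adj_q \<xi>)
  then have "adj (Xblock \<xi>) (nil * nil * Xblock \<xi> * nil' * nil')"
    by (rule adjD) (simp add: Xblock_def words odd_blocks[OF skew1_odd[OF x]])
  moreover have "Xblock \<xi> \<in> corner N"
    unfolding Xblock_def by (intro corner_closed corner_mult q_corner \<xi>)
  ultimately show ?thesis by (simp add: sadj_def XY_sandwich)
qed

lemma sadj_Yblock: "\<xi> \<in> skew1 \<Longrightarrow> sadj (Yblock \<xi>)"
proof -
  assume x: "\<xi> \<in> skew1"
  then have \<xi>: "\<xi> \<in> corner N" "adj \<xi> (- \<xi>)" by (auto simp: skew1_def skew_def)
  have "adj (Yblock \<xi>) ((q3 * (- nil * (- nil * (- \<xi> * qr)))) * (qr * (- \<xi> * q3)))"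
    unfolding Yblock_def xblock_def yblock_def by (intro adj_mult adj_q adj_rs \<xi>)
  then have "adj (Yblock \<xi>) (nil * nil * Yblock \<xi> * nil' * nil')"
    by (rule adjD) (simp add: Yblock_def xblock_def yblock_def words)
  moreover have "Yblock \<xi> \<in> corner N"
    unfolding Yblock_def xblock_def yblock_def by (intro corner_closed corner_mult q_corner rs_corner \<xi>)
  ultimately show ?thesis by (simp add: sadj_def XY_sandwich)
qed

end

section \<open>Polynomial families of matrices\<close>

lemma det_fmatrix:
  fixes M :: "'a::comm_ring_1 \<Rightarrow> 'a mat"
  assumes "\<And>s. M s \<in> carrier_mat n n" "\<And>i j. i < n \<Longrightarrow> j < n \<Longrightarrow> polyfn (\<lambda>s. M s $$ (i, j))"
  shows "polyfn (\<lambda>s. det (M s))"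
proof -
  have "(\<lambda>s. det (M s)) = (\<lambda>s. \<Sum>p | p permutes {0..<n}. signof p * (\<Prod>i = 0..<n. M s $$ (i, p i)))"
    using assms(1) by (intro ext det_def') auto
  moreover have "p i < n" if "p permutes {0..<n}" "i < n" for p i
    using permutes_in_image[OF that(1), of i] that(2) by auto
  then have "polyfn (\<lambda>s. \<Sum>p | p permutes {0..<n}. signof p * (\<Prod>i = 0..<n. M s $$ (i, p i)))"
    by (intro polyfn_sum polyfn_mult polyfn_const polyfn_prod assms(2)) auto
  ultimately show ?thesis by simp
qed

definition polymat :: "nat \<Rightarrow> ('a::comm_ring_1 \<Rightarrow> 'a fmatrix) \<Rightarrow> bool" where
  "polymat N F \<longleftrightarrow> (\<forall>s. F s \<in> corner N) \<and> (\<forall>i j. polyfn (\<lambda>s. entry (F s) i j))"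

lemma polymat_const [intro]: "A \<in> corner N \<Longrightarrow> polymat N (\<lambda>_. A)"
  by (simp add: polymat_def)

lemma polymat_add [intro]: "polymat N F \<Longrightarrow> polymat N G \<Longrightarrow> polymat N (\<lambda>s. F s + G s)"
  by (auto simp: polymat_def intro: polyfn_add)

lemma polymat_diff [intro]: "polymat N F \<Longrightarrow> polymat N G \<Longrightarrow> polymat N (\<lambda>s. F s - G s)"
  by (auto simp: polymat_def intro: polyfn_diff)

lemma polymat_scale [intro]: "polyfn c \<Longrightarrow> polymat N F \<Longrightarrow> polymat N (\<lambda>s. scale (c s) (F s))"
  by (auto simp: polymat_def intro: polyfn_mult)

lemma polymat_mult [intro]: "polymat N F \<Longrightarrow> polymat N G \<Longrightarrow> polymat N (\<lambda>s. F s * G s)"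
  by (auto simp: polymat_def entry_mult_corner[of _ N] intro!: polyfn_sum polyfn_mult)

lemma polyfn_ftrace: "polymat N F \<Longrightarrow> polyfn (\<lambda>s. ftrace (F s))"
  by (auto simp: polymat_def ftrace_corner[of _ N] intro!: polyfn_sum)

text \<open>The adjugate is a polynomial substitute for the inverse and d is the determinant; the
  last clause certifies d s \<noteq> 0 from any right inverse at s.\<close>

lemma polymat_adjugate:
  assumes "polymat N F"
  shows "\<exists>d A. polyfn d \<and> polymat N A \<and>
    (\<forall>s. F s * A s = scale (d s) (fmatrix_of_mat (1\<^sub>m N)) \<and> A s * F s = scale (d s) (fmatrix_of_mat (1\<^sub>m N))) \<and>
    (\<forall>s. \<forall>Z\<in>corner N. F s * Z = fmatrix_of_mat (1\<^sub>m N) \<longrightarrow> d s \<noteq> 0)"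
proof (intro exI conjI allI ballI impI)
  define M where "M = (\<lambda>s. mat_of_fmatrix N (F s))"
  define d where "d = (\<lambda>s. det (M s))"
  define A where "A = (\<lambda>s. fmatrix_of_mat (adj_mat (M s)))"
  have F: "F s \<in> corner N" "polyfn (\<lambda>s. entry (F s) i j)" for s i j
    using assms by (auto simp: polymat_def)
  have M: "M s \<in> carrier_mat N N" for s by (simp add: M_def)
  have Mp: "polyfn (\<lambda>s. M s $$ (i, j))" if "i < N" "j < N" for i j
    using F(2)[of i j] that by (simp add: M_def mat_of_fmatrix_def)
  note adjm = adj_mat[OF M]
  have dims: "dim_row (M s) = N" "dim_col (M s) = N" for s using M[of s] by auto
  have MF: "fmatrix_of_mat (M s) = F s" for s using F by (simp add: M_def)
  show "polyfn (\<lambda>s. det (M s))" by (rule det_fmatrix[OF M Mp])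
  show "polymat N (\<lambda>s. fmatrix_of_mat (adj_mat (M s)))"
    unfolding polymat_def
  proof (intro conjI allI)
    fix s show "fmatrix_of_mat (adj_mat (M s)) \<in> corner N" by (intro fmatrix_of_mat_corner adjm(1))
    fix i j
    show "polyfn (\<lambda>s. entry (fmatrix_of_mat (adj_mat (M s))) i j)"
    proof (cases "i < N \<and> j < N")
      case True
      have "(\<lambda>s. entry (fmatrix_of_mat (adj_mat (M s))) i j) = (\<lambda>s. (-1) ^ (j + i) * det (mat_delete (M s) j i))"
        using True by (simp add: adj_mat_def cofactor_def dims)
      moreover have "polyfn (\<lambda>s. det (mat_delete (M s) j i))"
      proof (rule det_fmatrix)
        show "mat_delete (M s) j i \<in> carrier_mat (N - 1) (N - 1)" for s using M[of s] by (auto simp: mat_delete_def)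
        fix i' j' assume ij: "i' < N - 1" "j' < N - 1"
        have "(\<lambda>s. mat_delete (M s) j i $$ (i', j')) =
            (\<lambda>s. M s $$ (if i' < j then i' else Suc i', if j' < i then j' else Suc j'))"
          using ij by (simp add: mat_delete_def dims)
        moreover have "polyfn (\<lambda>s. M s $$ (if i' < j then i' else Suc i', if j' < i then j' else Suc j'))"
          using ij True by (intro Mp) auto
        ultimately show "polyfn (\<lambda>s. mat_delete (M s) j i $$ (i', j'))" by simp
      qed
      ultimately show ?thesis by (simp only:) (intro polyfn_mult polyfn_const)
    next
      case False
      then have "(\<lambda>s. entry (fmatrix_of_mat (adj_mat (M s))) i j) = (\<lambda>s. 0)"
        by (auto simp: adj_mat_def dims)
      then show ?thesis by simp
    qed
  qed
  fix s
  have "F s * fmatrix_of_mat (adj_mat (M s)) = fmatrix_of_mat (M s * adj_mat (M s))"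
    by (simp only: fmatrix_of_mat_hom(5)[OF M adjm(1)] MF)
  also have "\<dots> = scale (det (M s)) (fmatrix_of_mat (1\<^sub>m N))"
    using fmatrix_of_mat_hom(4)[of "1\<^sub>m N" N "1\<^sub>m N"] by (simp add: adjm(2))
  finally show "F s * fmatrix_of_mat (adj_mat (M s)) = scale (det (M s)) (fmatrix_of_mat (1\<^sub>m N))" .
  have "fmatrix_of_mat (adj_mat (M s)) * F s = fmatrix_of_mat (adj_mat (M s) * M s)"
    by (simp only: fmatrix_of_mat_hom(5)[OF adjm(1) M] MF)
  also have "\<dots> = scale (det (M s)) (fmatrix_of_mat (1\<^sub>m N))"
    using fmatrix_of_mat_hom(4)[of "1\<^sub>m N" N "1\<^sub>m N"] by (simp add: adjm(3))
  finally show "fmatrix_of_mat (adj_mat (M s)) * F s = scale (det (M s)) (fmatrix_of_mat (1\<^sub>m N))" .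
  fix Z :: "'a fmatrix" assume Z: "Z \<in> corner N" and FZ: "F s * Z = fmatrix_of_mat (1\<^sub>m N)"
  have "mat_of_fmatrix N (F s * Z) = 1\<^sub>m N" by (simp add: FZ)
  then have "M s * mat_of_fmatrix N Z = 1\<^sub>m N" using F Z by (simp add: mat_of_fmatrix_mult M_def)
  then have "det (M s) * det (mat_of_fmatrix N Z) = 1"
    by (metis M det_mult det_one mat_of_fmatrix_carrier)
  then show "det (M s) \<noteq> 0" by auto
qed

definition findependent :: "nat \<Rightarrow> (nat \<Rightarrow> 'a::comm_ring_1 fmatrix) \<Rightarrow> bool" where
  "findependent r F \<longleftrightarrow> (\<forall>c. (\<Sum>i<r. scale (c i) (F i)) = 0 \<longrightarrow> (\<forall>i<r. c i = 0))"

lemma findependentD: "findependent r F \<Longrightarrow> (\<Sum>i<r. scale (c i) (F i)) = 0 \<Longrightarrow> i < r \<Longrightarrow> c i = 0"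
  by (auto simp: findependent_def)

lemma findependentI: "(\<And>c i. (\<Sum>i<r. scale (c i) (F i)) = 0 \<Longrightarrow> i < r \<Longrightarrow> c i = 0) \<Longrightarrow> findependent r F"
  by (auto simp: findependent_def)

lemma findependent_entries:
  "findependent r F \<longleftrightarrow> independent_on UNIV r (\<lambda>i (a, b). entry (F i) a b)"
proof -
  have "(\<Sum>i<r. scale (c i) (F i)) = 0 \<longleftrightarrow> (\<forall>x. (\<Sum>i<r. c i * (case x of (a, b) \<Rightarrow> entry (F i) a b)) = 0)" for c
  proof
    assume *: "(\<Sum>i<r. scale (c i) (F i)) = 0"
    show "\<forall>x. (\<Sum>i<r. c i * (case x of (a, b) \<Rightarrow> entry (F i) a b)) = 0"
    proof
      fix x :: "nat \<times> nat"
      obtain a b where x: "x = (a, b)" by fastforce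
      have "entry (\<Sum>i<r. scale (c i) (F i)) a b = 0" by (simp add: *)
      then show "(\<Sum>i<r. c i * (case x of (a, b) \<Rightarrow> entry (F i) a b)) = 0" by (simp add: x entry_sum)
    qed
  next
    assume *: "\<forall>x. (\<Sum>i<r. c i * (case x of (a, b) \<Rightarrow> entry (F i) a b)) = 0"
    show "(\<Sum>i<r. scale (c i) (F i)) = 0"
    proof (rule fmatrix_eqI)
      fix a b
      show "entry (\<Sum>i<r. scale (c i) (F i)) a b = entry 0 a b"
        using *[rule_format, of "(a, b)"] by (simp add: entry_sum)
    qed
  qed
  then show ?thesis by (simp add: findependent_def independent_on_def)
qed

lemma findependent_polymat:
  fixes F :: "nat \<Rightarrow> 'a::idom \<Rightarrow> 'a fmatrix"
  assumes "\<And>i. i < r \<Longrightarrow> polymat N (F i)" "findependent r (\<lambda>i. F i s0)"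
  shows "finite {s. \<not> findependent r (\<lambda>i. F i s)}"
  unfolding findependent_entries case_prod_unfold
  by (rule independent_on_polyfn[where ?s0.0 = s0])
    (use assms in \<open>auto simp: findependent_entries case_prod_unfold polymat_def\<close>)

lemma findependent_scale:
  fixes F :: "nat \<Rightarrow> 'a::field fmatrix"
  assumes "\<And>i. i < r \<Longrightarrow> c i \<noteq> 0"
  shows "findependent r (\<lambda>i. scale (c i) (F i)) \<longleftrightarrow> findependent r F"
proof
  assume *: "findependent r (\<lambda>i. scale (c i) (F i))"
  show "findependent r F"
  proof (rule findependentI)
    fix b i assume b: "(\<Sum>i<r. scale (b i) (F i)) = 0" and i: "i < r"
    have "(\<Sum>i<r. scale (b i / c i) (scale (c i) (F i))) = (\<Sum>i<r. scale (b i) (F i))"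
      by (rule sum.cong) (use assms in auto)
    with b have z: "(\<Sum>i<r. scale (b i / c i) (scale (c i) (F i))) = 0" by (simp only:)
    have "b i / c i = 0" by (rule findependentD[OF *, of "\<lambda>i. b i / c i", OF z i])
    then show "b i = 0" using assms[OF i] by simp
  qed
next
  assume *: "findependent r F"
  show "findependent r (\<lambda>i. scale (c i) (F i))"
  proof (rule findependentI)
    fix b i assume b: "(\<Sum>i<r. scale (b i) (scale (c i) (F i))) = 0" and i: "i < r"
    then have "b i * c i = 0" using findependentD[OF *, of "\<lambda>i. b i * c i"] by simp
    then show "b i = 0" using assms[OF i] by simp
  qed
qed

lemma sum_lessThan_add: "(\<Sum>i<a + b. f i) = (\<Sum>i<a. f i) + (\<Sum>i<b. f (a + i))"
  for f :: "nat \<Rightarrow> 'b::comm_monoid_add"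
  by (induction b) (simp_all add: add.assoc)

lemma (in nilpotent_blocks) sandwich_f3:
  assumes "Z * p1 = Z"
  shows "Z * (f * p3) = 0" "Z * (f * (p3 * z)) = 0"
  using assms pf(2) pp(3) by (metis mult.assoc mult_zero_left mult_zero_right)+

section \<open>The constructed elements lie in the odd centraliser\<close>

context hermitian_hyperbolic
begin

text \<open>Here w ranges over all matrices. This is enough, because a bracket with
  \<open>nil\<close> has trace zero against everything that commutes with
  \<open>nil\<close>.\<close>

definition "image_nil X \<longleftrightarrow> (\<exists>w. X = nil * w - w * nil)"

text \<open>For selfadjoint Z and T the adjoint exchanges, up to sign, e Z with e e Z f and y T with
  e e T x, so their sum is skew-hermitian.\<close>

lemma kel_slice:
  assumes x: "\<xi> \<in> skew1" and Z: "sadj Z" and T: "sadj T"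
  shows "kel \<xi> Z T \<in> slice"
proof -
  have \<xi>: "\<xi> \<in> corner N" "adj \<xi> (- \<xi>)" using x by (auto simp: skew1_def skew_def)
  have Z': "Z \<in> corner N" "q1 * Z = Z" "Z * q1 = Z" "adj Z (nil * nil * Z * nil' * nil')"
    and T': "T \<in> corner N" "q1 * T = T" "T * q1 = T" "adj T (nil * nil * T * nil' * nil')"
    using Z T by (auto simp: sadj_def)
  have "adj (kel \<xi> Z T) ((nil * nil * Z * nil' * nil') * - nil
     + - nil' * ((nil * nil * Z * nil' * nil') * (- nil * - nil))
     + (nil * nil * T * nil' * nil') * (q3 * (- nil * (- nil * (- \<xi> * qr))))
     + (qr * (- \<xi> * q3)) * ((nil * nil * T * nil' * nil') * (- nil * - nil)))"
    unfolding kel_def xblock_def yblock_def by (intro adj_add adj_mult adj_q adj_rs \<xi> Z' T')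
  then have "adj (kel \<xi> Z T) (- kel \<xi> Z T)"
    by (rule adjD) (simp add: kel_def xblock_def yblock_def words Z'(2,3) T'(2,3)
      sandwich[OF Z'(2,3)] sandwich[OF T'(2,3)] sandwich_f[OF Z'(3)] sandwich_f[OF T'(3)] sandwich_f3[OF Z'(3)] sandwich_f3[OF T'(3)]
      Z'(2,3)[THEN tail] T'(2,3)[THEN tail] sandwich[OF Z'(2,3), THEN tail] sandwich[OF T'(2,3), THEN tail])
  moreover have "kel \<xi> Z T \<in> corner N"
    unfolding kel_def xblock_def yblock_def
    by (intro corner_closed corner_mult q_corner rs_corner \<xi> Z' T')
  moreover have "eU * kel \<xi> Z T * eU = 0" "eW * kel \<xi> Z T * eW = 0"
    unfolding eUW_q kel_def xblock_def yblock_def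
    by (simp_all add: words Z'(2,3) T'(2,3)
      sandwich[OF Z'(2,3)] sandwich[OF T'(2,3)] sandwich_f[OF Z'(3)] sandwich_f[OF T'(3)] sandwich_f3[OF Z'(3)] sandwich_f3[OF T'(3)]
      Z'(2,3)[THEN tail] T'(2,3)[THEN tail] sandwich[OF Z'(2,3), THEN tail] sandwich[OF T'(2,3), THEN tail])
  ultimately show ?thesis
    using kel_centralises[OF Z'(2,3) T'(2,3)] by (simp add: slice_def skew1_def skew_def)
qed

lemma kel_image_nil:
  assumes "\<xi> \<in> skew1" "sadj Z" "sadj T"
    "Z * Xblock \<xi> - Xblock \<xi> * Z + T * Yblock \<xi> - Yblock \<xi> * T = 0"
  shows "image_nil (kel \<xi> Z T * \<xi> - \<xi> * kel \<xi> Z T)"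
proof -
  have b: "q1 * Z = Z" "Z * q1 = Z" "q1 * T = T" "T * q1 = T" using assms by (auto simp: sadj_def)
  show ?thesis
    unfolding image_nil_def
    by (rule commutator_mod_image[OF skew1_odd[OF assms(1)] kel_centralises[OF b]
        kel_image[OF b skew1_odd[OF assms(1)] assms(4)]])
qed

context
  fixes \<xi> A
  assumes x: "\<xi> \<in> skew1" and A: "A \<in> corner N" "q1 * A = A" "A * q1 = A"
    and inv: "Yblock \<xi> * A = q1" "A * Yblock \<xi> = q1"
begin

text \<open>The adjoint of Y is its transport to the last layer, and the adjoint of the inverse is
  the inverse of the adjoint, hence the transport of A.\<close>

lemma sadj_A: "sadj A"
proof -
  have Y: "sadj (Yblock \<xi>)" by (rule sadj_Yblock[OF x])
  have "adj A (nil * nil * A * nil' * nil')"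
  proof (rule adj_inverse)
    show "adj (Yblock \<xi>) (nil * nil * Yblock \<xi> * nil' * nil')" using Y by (simp add: sadj_def)
    have "nil * nil * Yblock \<xi> * nil' * nil' * (nil * nil * A * nil' * nil')
      = nil * nil * (Yblock \<xi> * A) * nil' * nil'"
      by (simp add: words A A(2,3)[THEN tail] sandwich[OF A(2,3), THEN tail] XY_sandwich XY_sandwich[THEN tail])
    then show "nil * nil * Yblock \<xi> * nil' * nil' * (nil * nil * A * nil' * nil') = q3"
      by (simp add: inv words)
    show "q3 * (nil * nil * A * nil' * nil') = nil * nil * A * nil' * nil'"
      by (simp add: words A(2,3)[THEN tail] sandwich[OF A(2,3), THEN tail])
    show "nil * nil * A * nil' * nil' \<in> corner N" by (intro corner_mult q_corner A)
  qed (rule adj_q(2) inv A)+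
  then show ?thesis using A by (simp add: sadj_def)
qed

lemma xi: "\<xi> \<in> corner N" "adj \<xi> (- \<xi>)"
  using x by (auto simp: skew1_def skew_def)

lemma adj_\<pi>: "adj (\<pi>block \<xi> A) (\<pi>block \<xi> A)"
proof -
  have "adj (\<pi>block \<xi> A) (qr - (qr * (- \<xi> * q3)) *
      ((nil * nil * A * nil' * nil') * (q3 * (- nil * (- nil * (- \<xi> * qr))))))"
    unfolding \<pi>block_def xblock_def yblock_def
    using sadj_A by (intro adj_diff adj_mult adj_q adj_rs xi) (auto simp: sadj_def)
  then show ?thesis
    by (rule adjD) (simp add: \<pi>block_def xblock_def yblock_def words A sandwich[OF A(2,3)]
      A(2,3)[THEN tail] sandwich[OF A(2,3), THEN tail])
qed

lemma adj_M: "adj (Mblock \<xi>) (Mblock \<xi>)"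
proof -
  have "adj (Mblock \<xi>) (qr * (- \<xi> * (qs * (- \<xi> * qr))))"
    unfolding Mblock_def by (intro adj_mult adj_rs xi)
  then show ?thesis by (simp add: Mblock_def mult.assoc)
qed

lemma adj_C: "adj (Cblock \<xi> A) (Cblock \<xi> A)"
  unfolding Cblock_def using adj_mult[OF adj_mult[OF adj_\<pi> adj_M] adj_\<pi>] by (simp add: mult.assoc)

lemma block_corner: "\<pi>block \<xi> A \<in> corner N" "Mblock \<xi> \<in> corner N" "Cblock \<xi> A \<in> corner N"
  unfolding Cblock_def \<pi>block_def xblock_def yblock_def Mblock_def
  by (intro corner_closed corner_mult q_corner rs_corner xi A)+

lemma Cpower_adj: "adj (Cpower \<xi> A i) (Cpower \<xi> A i)" "Cpower \<xi> A i \<in> corner N"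
proof -
  show "adj (Cpower \<xi> A i) (Cpower \<xi> A i)"
  proof (induction i)
    case (Suc i)
    show ?case using adj_mult[OF adj_C Suc]
      by (simp add: Cpower_commute[OF skew1_odd[OF x] A(2,3) inv])
  qed (simp add: adj_C)
  show "Cpower \<xi> A i \<in> corner N" by (induction i) (auto simp: block_corner)
qed

lemma Cpower_r: "qr * Cpower \<xi> A i = Cpower \<xi> A i" "Cpower \<xi> A i * qr = Cpower \<xi> A i"
  using Cpower_\<pi>[OF skew1_odd[OF x] A(2,3) inv, of i] \<pi>_sandwich[OF skew1_odd[OF x] A(2,3) inv]
  by (metis mult.assoc)+

text \<open>C is the compression of the selfadjoint M by a selfadjoint projection, so its powers are
  selfadjoint. Under minus the adjoint D \<xi> s is then exchanged with s \<xi> D, and the two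
  corrections with each other.\<close>

lemma kC_slice: "kC \<xi> A (Cpower \<xi> A i) \<in> slice"
proof -
  define D where "D = Cpower \<xi> A i"
  have D: "qr * D = D" "D * qr = D" by (simp_all add: D_def Cpower_r)
  have Da: "adj D D" "D \<in> corner N" by (simp_all add: D_def Cpower_adj)
  have A': "adj A (nil * nil * A * nil' * nil')" using sadj_A by (simp add: sadj_def)
  have "adj (kC \<xi> A D) (qs * (- \<xi> * D) + D * (- \<xi> * qs)
     + - ((nil * nil * A * nil' * nil') * ((q3 * (- nil * (- nil * (- \<xi> * qr)))) * (Mblock \<xi> * D)))
     + - (D * (Mblock \<xi> * ((qr * (- \<xi> * q3)) * ((nil * nil * A * nil' * nil') * (- nil * - nil))))))"
    unfolding kC_def kelD_def xblock_def yblock_def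
    by (intro adj_add adj_minus adj_mult adj_q adj_rs xi Da A' adj_M)
  then have "adj (kC \<xi> A D) (- kC \<xi> A D)"
    by (rule adjD) (simp add: kC_def kelD_def xblock_def yblock_def words A sandwich[OF A(2,3)]
      A(2,3)[THEN tail] sandwich[OF A(2,3), THEN tail] M_sandwich M_sandwich[THEN tail])
  moreover have "kC \<xi> A D \<in> corner N"
    unfolding kC_def kelD_def xblock_def yblock_def
    by (intro corner_closed corner_mult q_corner rs_corner xi A Da block_corner)
  moreover have "eU * kC \<xi> A D * eU = 0" "eW * kC \<xi> A D * eW = 0"
    unfolding eUW_q kC_def kelD_def xblock_def yblock_def
    by (simp_all add: words A sandwich[OF A(2,3)] A(2,3)[THEN tail] sandwich[OF A(2,3), THEN tail]
      D D[THEN tail] sandwich_r[OF D] sandwich_r[OF D, THEN tail])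
  ultimately show ?thesis
    using kC_works(1)[OF skew1_odd[OF x] A(2,3) inv, of i]
    by (simp add: slice_def skew1_def skew_def D_def)
qed

lemma kC_image_nil: "image_nil (kC \<xi> A (Cpower \<xi> A i) * \<xi> - \<xi> * kC \<xi> A (Cpower \<xi> A i))"
  unfolding image_nil_def
  by (rule commutator_mod_image[OF skew1_odd[OF x] kC_works[OF skew1_odd[OF x] A(2,3) inv]])

end

end

text \<open>The sums are values at r distinct points of a polynomial of degree below r, which has to
  vanish.\<close>

lemma transposed_vandermonde_zero:
  fixes c :: "nat \<Rightarrow> 'a::idom"
  assumes "inj_on l {..<r}" "\<And>j. j < r \<Longrightarrow> (\<Sum>i<r. c i * l j ^ i) = 0" "i < r"
  shows "c i = 0"
proof -
  define p where "p = (\<Sum>i<r. monom (c i) i)"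
  have "p = 0"
  proof (rule ccontr)
    assume p0: "p \<noteq> 0"
    have "poly p (l j) = 0" if "j < r" for j
      using assms(2)[OF that] by (simp add: p_def poly_sum poly_monom)
    then have "l ` {..<r} \<subseteq> {x. poly p x = 0}" by blast
    from card_mono[OF poly_roots_finite[OF p0] this] have "r \<le> card {x. poly p x = 0}"
      by (simp add: card_image[OF assms(1)])
    also have "\<dots> \<le> degree p" by (rule card_poly_roots_bound[OF p0])
    finally have "r \<le> degree p" .
    moreover have "degree p \<le> r - 1"
      unfolding p_def by (rule degree_sum_le) (auto intro: order.trans[OF degree_monom_le])
    ultimately show False using assms(3) by simp
  qed
  then have "coeff p i = 0" by simp
  then show ?thesis using assms(3) by (simp add: p_def coeff_sum)
qed

section \<open>Elements with m + 1 independent annihilators\<close>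

context hermitian_hyperbolic
begin

lemma slice_corner: "y \<in> slice \<Longrightarrow> y \<in> corner N"
  by (simp add: slice_def skew_corner)

lemma slice_closed: "x \<in> slice \<Longrightarrow> y \<in> slice \<Longrightarrow> x + y \<in> slice" "x \<in> slice \<Longrightarrow> scale c x \<in> slice"
  using skew1_closed by (auto simp: slice_def distrib_left distrib_right)

lemma slice_zero: "0 \<in> slice"
  using skew1_ex(2) m3 by (simp add: slice_def)

text \<open>Invariance of the trace form gives tr (y [z, \<xi>]) = - tr (z [y, \<xi>]). The inner
  bracket is a bracket with \<open>nil\<close>, and z commutes with \<open>nil\<close>, so the trace
  is zero.\<close>

lemma image_nil_annihilated:
  assumes "image_nil (y * \<xi> - \<xi> * y)" "nil * z = z * nil"
  shows "ftrace (y * (z * \<xi> - \<xi> * z)) = 0"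
proof -
  obtain w where w: "y * \<xi> - \<xi> * y = nil * w - w * nil" using assms(1) by (auto simp: image_nil_def)
  have "ftrace (y * (z * \<xi> - \<xi> * z)) = ftrace (y * (z * \<xi>)) - ftrace (y * (\<xi> * z))"
    by (simp add: right_diff_distrib)
  also have "ftrace (y * (z * \<xi>)) = ftrace (z * \<xi> * y)" by (rule ftrace_commute)
  also have "ftrace (y * (\<xi> * z)) = ftrace (z * (y * \<xi>))" by (metis ftrace_commute mult.assoc)
  also have "ftrace (z * \<xi> * y) - ftrace (z * (y * \<xi>)) = - ftrace (z * (y * \<xi> - \<xi> * y))"
    by (simp add: right_diff_distrib mult.assoc)
  also have "ftrace (z * (y * \<xi> - \<xi> * y)) = ftrace (z * nil * w) - ftrace (z * (w * nil))"
    unfolding w by (simp add: right_diff_distrib mult.assoc)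
  also have "ftrace (z * (w * nil)) = ftrace (nil * (z * w))" by (metis ftrace_commute mult.assoc)
  also have "nil * (z * w) = z * nil * w" using assms(2) by (simp add: mult.assoc [symmetric])
  finally show ?thesis by simp
qed

text \<open>A certificate at a single \<xi>: by \<open>image_nil_annihilated\<close> these m + 1
  elements annihilate the brackets of \<xi> with the whole centraliser of
  \<open>nil\<close>.\<close>

definition "good \<xi> \<longleftrightarrow> (\<exists>y. findependent (m + 1) y \<and>
   (\<forall>i<m + 1. y i \<in> slice \<and> image_nil (y i * \<xi> - \<xi> * y i)))"

definition "basic \<xi> i = (if i = 0 then q1 else if i = 1 then Xblock \<xi> else Yblock \<xi>)" for i :: nat

lemma sum3: "(\<Sum>i<3. f i) = f 0 + f 1 + f 2" for f :: "nat \<Rightarrow> 'a fmatrix"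
  by (simp add: numeral_3_eq_3 numeral_2_eq_2)

lemma sum4: "(\<Sum>i<4. f i) = (\<Sum>i<3. f i) + f 3" for f :: "nat \<Rightarrow> 'a fmatrix"
  by (simp add: eval_nat_numeral)

lemma sum5: "(\<Sum>i<5. f i) = (\<Sum>i<3. f i) + f 3 + f 4" for f :: "nat \<Rightarrow> 'a fmatrix"
  by (simp add: eval_nat_numeral)

lemma basic_independent:
  assumes "findependent 3 (basic \<xi>)" "scale a q1 + scale b (Xblock \<xi>) + scale c (Yblock \<xi>) = 0"
  shows "a = 0" "b = 0" "c = 0"
proof -
  define d where "d i = (if i = 0 then a else if i = 1 then b else c)" for i :: nat
  have s: "(\<Sum>i<3. scale (d i) (basic \<xi> i)) = 0"
    using assms(2) by (simp add: sum3 d_def basic_def)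
  show "a = 0" "b = 0" "c = 0"
    using findependentD[OF assms(1) s, of 0] findependentD[OF assms(1) s, of 1] findependentD[OF assms(1) s, of 2]
    by (simp_all add: d_def)
qed

text \<open>The solutions (Z, T) of [Z, X] + [T, Y] = 0. The pair (0, Y) stands last, so that for m
  = 3 the first four members can be used.\<close>

definition "kel_family \<xi> i = (if i = 0 then kel \<xi> q1 0 else if i = 1 then kel \<xi> (Xblock \<xi>) 0
   else if i = 2 then kel \<xi> (Yblock \<xi>) (Xblock \<xi>) else if i = 3 then kel \<xi> 0 q1 else kel \<xi> 0 (Yblock \<xi>))"
  for i :: nat

lemma sadj_zero: "sadj 0"
  using adj_zero m3 by (simp add: sadj_def)

lemma kel_family_good:
  assumes x: "\<xi> \<in> skew1"
  shows "kel_family \<xi> i \<in> slice" "image_nil (kel_family \<xi> i * \<xi> - \<xi> * kel_family \<xi> i)"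
proof -
  note s = sadj_q1 sadj_zero sadj_Xblock[OF x] sadj_Yblock[OF x]
  show "kel_family \<xi> i \<in> slice" unfolding kel_family_def by (simp add: kel_slice x s)
  show "image_nil (kel_family \<xi> i * \<xi> - \<xi> * kel_family \<xi> i)"
    unfolding kel_family_def using kel_image_nil[OF x] s by (simp add: XY_sandwich)
qed

lemma kel_add: "kel \<xi> Z T + kel \<xi> Z' T' = kel \<xi> (Z + Z') (T + T')"
  by (simp add: kel_def distrib_left distrib_right)

lemma kel_scale: "scale c (kel \<xi> Z T) = kel \<xi> (scale c Z) (scale c T)"
  by (simp add: kel_def)

text \<open>Two blocks recover Z and y T, and a third one vanishes; this decouples linear relations
  between the two kinds of centraliser elements.\<close>

lemma kel_blocks:
  assumes Z: "q1 * Z = Z" "Z * q1 = Z" and T: "q1 * T = T" "T * q1 = T"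
  shows "q0 * kel \<xi> Z T * q1 = nil * Z" "qr * kel \<xi> Z T * qs = 0" "qr * kel \<xi> Z T * q1 = yblock \<xi> * T"
  unfolding kel_def xblock_def yblock_def
  by (simp_all add: words Z T sandwich[OF Z] sandwich[OF T] sandwich_f[OF Z(2)] sandwich_f[OF T(2)]
      Z[THEN tail] T[THEN tail] sandwich[OF Z, THEN tail] sandwich[OF T, THEN tail])

lemma nil_mult_zero: "q1 * Z = Z \<Longrightarrow> nil * Z = 0 \<Longrightarrow> Z = 0"
proof -
  assume Z: "q1 * Z = Z" "nil * Z = 0"
  have "Z = q1 * Z" using Z by simp
  also have "\<dots> = nil' * (nil * Z)"
    using Z sandwich(1)[of Z] by (metis Z(1) add.commute distrib_right fe mult.assoc pp(2) mult_zero_left add.right_neutral)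
  finally show "Z = 0" using Z by simp
qed

text \<open>For \<open>m = 3\<close> the element \<open>kel \<xi> 0 Y\<close> is not needed.\<close>

lemma good_3:
  assumes x: "\<xi> \<in> skew1" and ind: "findependent 3 (basic \<xi>)" and m: "m = 3"
  shows "good \<xi>"
  unfolding good_def
proof (intro exI conjI allI impI)
  show "kel_family \<xi> i \<in> slice" "image_nil (kel_family \<xi> i * \<xi> - \<xi> * kel_family \<xi> i)" for i
    by (rule kel_family_good[OF x])+
  have m4: "m + 1 = 4" using m by simp
  show "findependent (m + 1) (kel_family \<xi>)"
  proof (rule findependentI)
    fix c i
    assume c: "(\<Sum>i<m + 1. scale (c i) (kel_family \<xi> i)) = 0" and i: "i < m + 1"
    define Z where "Z = scale (c 0) q1 + scale (c 1) (Xblock \<xi>) + scale (c 2) (Yblock \<xi>)"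
    define T where "T = scale (c 2) (Xblock \<xi>) + scale (c 3) q1"
    have "(\<Sum>i<m + 1. scale (c i) (kel_family \<xi> i)) = (\<Sum>i<3. scale (c i) (kel_family \<xi> i)) + scale (c 3) (kel_family \<xi> 3)"
      unfolding m4 by (rule sum4)
    also have "\<dots> = kel \<xi> Z T"
      by (simp add: sum3 kel_family_def kel_scale kel_add Z_def T_def)
    finally have K: "kel \<xi> Z T = 0" using c by simp
    have Z: "q1 * Z = Z" "Z * q1 = Z" and T: "q1 * T = T" "T * q1 = T"
      by (simp_all add: Z_def T_def distrib_left distrib_right XY_sandwich pp)
    have "nil * Z = 0" using kel_blocks(1)[OF Z T, of \<xi>] K by simp
    then have "Z = 0" by (rule nil_mult_zero[OF Z(1)])
    then have c0: "c 0 = 0" "c 1 = 0" "c 2 = 0" using basic_independent[OF ind] unfolding Z_def by blast+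
    have "yblock \<xi> * T = 0" using kel_blocks(3)[OF Z T, of \<xi>] K by simp
    then have "scale (c 3) (yblock \<xi> * q1) = 0" by (simp add: T_def c0)
    \<comment> \<open>With a remainder of rank one y is not injective. Composing with x replaces y
      by Y, which is nonzero as a member of the independent family \<open>basic\<close>.\<close>
    then have "xblock \<xi> * scale (c 3) (yblock \<xi> * q1) = 0" by simp
    then have "scale (c 3) (Yblock \<xi>) = 0"
      by (simp add: mult.assoc [symmetric] Yblock_def [symmetric] XY_sandwich)
    then have "c 3 = 0" using basic_independent(3)[OF ind, of 0 0 "c 3"] by simp
    moreover have "i = 0 \<or> i = 1 \<or> i = 2 \<or> i = 3" using i unfolding m4 by linarith
    ultimately show "c i = 0" using c0 by blast
  qed
qed

text \<open>In a relation, the block from \<open>q1\<close> to \<open>q0\<close> isolates Z and the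
  block from \<open>qs\<close> to \<open>qr\<close> isolates D \<xi> s, with D the combination of
  powers of C. Multiplying on by \<xi> r \<pi> gives D M \<pi>, a combination of C^(i+2), which
  explains the shifted powers in \<open>indC\<close>. Finally T is recovered by inverting Y.\<close>

lemma good_4:
  assumes x: "\<xi> \<in> skew1" and ind: "findependent 3 (basic \<xi>)" and m: "m \<ge> 4"
    and A: "A \<in> corner N" "q1 * A = A" "A * q1 = A" "Yblock \<xi> * A = q1" "A * Yblock \<xi> = q1"
    and indC: "findependent (m - 4) (\<lambda>i. Cpower \<xi> A (Suc i))"
  shows "good \<xi>"
  unfolding good_def
proof (intro exI conjI allI impI)
  define y where "y i = (if i < 5 then kel_family \<xi> i else kC \<xi> A (Cpower \<xi> A (i - 5)))" for i
  note oA = skew1_odd[OF x] A(2-)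
  show "y i \<in> slice" "image_nil (y i * \<xi> - \<xi> * y i)" if "i < m + 1" for i
    unfolding y_def by (auto intro!: kel_family_good kC_slice kC_image_nil x A)
  show "findependent (m + 1) y"
  proof (rule findependentI)
    fix c i
    assume c: "(\<Sum>i<m + 1. scale (c i) (y i)) = 0" and i: "i < m + 1"
    define Z where "Z = scale (c 0) q1 + scale (c 1) (Xblock \<xi>) + scale (c 2) (Yblock \<xi>)"
    define T where "T = scale (c 2) (Xblock \<xi>) + scale (c 3) q1 + scale (c 4) (Yblock \<xi>)"
    define D where "D = (\<Sum>i<m - 4. scale (c (5 + i)) (Cpower \<xi> A i))"
    define S where "S = (\<Sum>i<m - 4. scale (c (5 + i)) (kC \<xi> A (Cpower \<xi> A i)))"
    have "m + 1 = 5 + (m - 4)" using m by simp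
    then have "(\<Sum>i<m + 1. scale (c i) (y i)) = (\<Sum>i<5. scale (c i) (y i)) + S"
      by (simp only: sum_lessThan_add S_def) (simp add: y_def)
    also have "(\<Sum>i<5. scale (c i) (y i)) = (\<Sum>i<3. scale (c i) (y i)) + scale (c 3) (y 3) + scale (c 4) (y 4)"
      by (rule sum5)
    also have "\<dots> = kel \<xi> Z T"
      by (simp add: sum3 kel_family_def kel_scale kel_add Z_def T_def y_def)
    finally have K: "kel \<xi> Z T + S = 0" using c by simp
    have Z: "q1 * Z = Z" "Z * q1 = Z" and T: "q1 * T = T" "T * q1 = T"
      by (simp_all add: Z_def T_def distrib_left distrib_right XY_sandwich pp)
    have kCb: "q0 * kC \<xi> A E * q1 = 0" "qr * kC \<xi> A E * qs = E * \<xi> * qs"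
      if E: "qr * E = E" "E * qr = E" for E
      unfolding kC_def kelD_def xblock_def yblock_def
      by (simp_all add: words E sandwich_r[OF E] A(2,3) sandwich[OF A(2,3)]
        E[THEN tail] A(2,3)[THEN tail] sandwich_r[OF E, THEN tail] sandwich[OF A(2,3), THEN tail])
    have Cr: "qr * Cpower \<xi> A i = Cpower \<xi> A i" "Cpower \<xi> A i * qr = Cpower \<xi> A i" for i
      by (rule Cpower_r[OF x A])+
    have "q0 * S * q1 = 0" "qr * S * qs = D * \<xi> * qs"
      by (simp_all add: S_def D_def sum_distrib_left sum_distrib_right kCb[OF Cr])
    note Sb = this
    have "nil * Z = 0"
      using kel_blocks(1)[OF Z T, of \<xi>] Sb(1) arg_cong[OF K, of "\<lambda>x. q0 * x * q1"]
      by (simp add: distrib_left distrib_right)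
    then have "Z = 0" by (rule nil_mult_zero[OF Z(1)])
    then have c0: "c 0 = 0" "c 1 = 0" "c 2 = 0" using basic_independent[OF ind] unfolding Z_def by blast+
    have D0: "D * \<xi> * qs = 0"
      using kel_blocks(2)[OF Z T, of \<xi>] Sb(2) arg_cong[OF K, of "\<lambda>x. qr * x * qs"]
      by (simp add: distrib_left distrib_right)
    have Dr: "D * qr = D" by (simp add: D_def sum_distrib_right Cr)
    have "D * Mblock \<xi> = (D * qr) * \<xi> * qs * \<xi> * qr" by (simp add: Mblock_def mult.assoc)
    then have "D * Mblock \<xi> * \<pi>block \<xi> A = 0" by (simp add: Dr D0)
    moreover have "D * Mblock \<xi> * \<pi>block \<xi> A = (\<Sum>i<m - 4. scale (c (5 + i)) (Cpower \<xi> A (Suc i)))"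
      unfolding D_def sum_distrib_right scale_mult Cpower_M_\<pi>[OF oA] ..
    ultimately have c5: "c (5 + i) = 0" if "i < m - 4" for i
      using findependentD[OF indC, of "\<lambda>i. c (5 + i)"] that by simp
    then have "S = 0" by (simp add: S_def)
    then have "yblock \<xi> * T = 0" using kel_blocks(3)[OF Z T, of \<xi>] K by simp
    then have "A * (xblock \<xi> * (yblock \<xi> * T)) = 0" by simp
    moreover have "A * (xblock \<xi> * (yblock \<xi> * T)) = (A * Yblock \<xi>) * T"
      by (simp add: Yblock_def mult.assoc)
    ultimately have "T = 0" by (simp add: A(5) T)
    then have "c 3 = 0" "c 4 = 0"
      using basic_independent(1,3)[OF ind, of "c 3" 0 "c 4"] by (simp_all add: T_def c0)
    moreover have "i = 0 \<or> i = 1 \<or> i = 2 \<or> i = 3 \<or> i = 4 \<or> i = 5 + (i - 5) \<and> i - 5 < m - 4"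
      using i m by linarith
    ultimately show "c i = 0" using c0 c5[of "i - 5"] by metis
  qed
qed

end

lemma mult_one_fmatrix:
  assumes X: "X \<in> corner N"
  shows "X * fmatrix_of_mat (1\<^sub>m N) = X" "fmatrix_of_mat (1\<^sub>m N) * X = X"
proof -
  have M: "mat_of_fmatrix N X \<in> carrier_mat N N" and 1: "(1\<^sub>m N :: 'a mat) \<in> carrier_mat N N" by simp_all
  show "X * fmatrix_of_mat (1\<^sub>m N) = X"
    using fmatrix_of_mat_hom(5)[OF M 1] by (simp only: right_mult_one_mat[OF M] fmatrix_of_mat_of_fmatrix[OF X])
  show "fmatrix_of_mat (1\<^sub>m N) * X = X"
    using fmatrix_of_mat_hom(5)[OF 1 M] by (simp only: left_mult_one_mat[OF M] fmatrix_of_mat_of_fmatrix[OF X])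
qed

lemma scale_scale_mult: "scale c A * scale d B = scale (c * d) (A * B)"
  by (simp add: mult.commute)

section \<open>An explicit good element\<close>

context hermitian_hyperbolic
begin

lemma eU_eW: "eU + eW = fmatrix_of_mat (1\<^sub>m N)"
proof -
  have "(eU + eW) * fmatrix_of_mat (1\<^sub>m N) = fmatrix_of_mat (1\<^sub>m N)"
    using E_unit(1)[of "fmatrix_of_mat (1\<^sub>m N)"] by (simp add: eUW)
  then show ?thesis using mult_one_fmatrix(1)[of "eU + eW" N] eUW_corner by simp
qed

lemma pair_skew1: "m \<le> a \<Longrightarrow> a < m + k \<Longrightarrow> b < m \<Longrightarrow> F a b - F b (\<tau> a) \<in> skew1"
proof -
  assume ab: "m \<le> a" "a < m + k" "b < m"
  have t: "\<tau> b = b" "\<tau> a < m + k" "\<not> \<tau> a < m" using ab \<tau> by (auto simp: \<tau>_def)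
  have "adj (F a b - F b (\<tau> a)) (F (\<tau> b) (\<tau> a) - F (\<tau> (\<tau> a)) (\<tau> b))"
    using ab t by (intro adj_diff adj_F) auto
  then have "adj (F a b - F b (\<tau> a)) (- (F a b - F b (\<tau> a)))" by (simp add: t \<tau>(2))
  then show ?thesis using ab t
    by (simp add: skew1_def skew_def left_diff_distrib right_diff_distrib eU_F eW_F corner_closed F_corner)
qed

lemma skew1_sum: "(\<And>x. x \<in> I \<Longrightarrow> f x \<in> skew1) \<Longrightarrow> sum f I \<in> skew1"
  using skew1_ex(2) m3 by (induction I rule: infinite_finite_induct) (auto intro: skew1_closed)

lemma \<tau>_values: "\<tau> m = m + 2" "\<tau> (m + 1) = m + 3" "4 \<le> j \<Longrightarrow> \<tau> (m + j) = m + j"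
  by (auto simp: \<tau>_def)

text \<open>The first pair occupies one entry each of x and y, the second pair produces an
  off-diagonal X.\<close>

definition "witness0 = (F m 2 - F 2 (m + 2)) + (F m 1 - F 1 (m + 2))"
definition "tailL = (\<Sum>j=4..<m. scale (of_nat j) (F (m + j) j))"
definition "tailR = (\<Sum>j=4..<m. scale (of_nat j) (F j (m + j)))"
text \<open>For m = 3, Y becomes diag (1, 0). Otherwise the coefficient 2 enters through both x and
  y and gives Y = diag (1, 4), invertible and not scalar, while the coefficients j of the tail make
  C diagonal with the distinct nonzero eigenvalues - j^2, j = 4, ..., m - 1.\<close>

definition "witness = (if m = 3 then witness0 else
  witness0 + scale 2 (F (m + 1) 3 - F 3 (m + 3)) + (tailL - tailR))"

lemma scale_F_zero: "i < m + k \<Longrightarrow> j < m + k \<Longrightarrow> scale c (F i j) = 0 \<Longrightarrow> c = 0"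
proof (rule ccontr)
  assume a: "i < m + k" "j < m + k" "scale c (F i j) = 0" "c \<noteq> 0"
  have "scale (inverse c) (scale c (F i j)) = 0" using a(3) by simp
  then show False using a(1,2,4) F_unit_neq[of i j] by simp
qed

context
  assumes mk: "m \<le> k"
begin

lemma witness_skew1: "witness \<in> skew1"
proof -
  have p: "F m 2 - F 2 (m + 2) \<in> skew1" "F m 1 - F 1 (m + 2) \<in> skew1"
    using pair_skew1[of m 2] pair_skew1[of m 1] m3 k4 by (simp_all add: \<tau>_values)
  have 0: "witness0 \<in> skew1" unfolding witness0_def by (intro skew1_closed p)
  show ?thesis
  proof (cases "m = 3")
    case False
    have q: "F (m + 1) 3 - F 3 (m + 3) \<in> skew1"
      using pair_skew1[of "m + 1" 3, unfolded \<tau>_values(2)] m3 k4 False by simp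
    have "tailL - tailR = (\<Sum>j=4..<m. scale (of_nat j) (F (m + j) j - F j (m + j)))"
      by (simp add: tailL_def tailR_def sum_subtractf)
    also have "\<dots> \<in> skew1"
    proof (rule skew1_sum)
      fix j assume "j \<in> {4..<m}"
      then have "F (m + j) j - F j (m + j) \<in> skew1"
        using pair_skew1[of "m + j" j] mk by (simp add: \<tau>_values)
      then show "scale (of_nat j) (F (m + j) j - F j (m + j)) \<in> skew1" by (metis skew1_closed(3))
    qed
    finally show ?thesis
      unfolding witness_def if_not_P[OF False]
      by (intro skew1_closed(1) skew1_closed(3)[OF q q] 0)
  next
    case True
    show ?thesis unfolding witness_def if_P[OF True] by (rule 0)
  qed
qed

lemmas expand = distrib_left distrib_right left_diff_distrib right_diff_distrib F_mult F_mult_tail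
  eU_F eW_F mult.assoc

text \<open>The unit and Y are diagonal and independent because t \<noteq> 1, whereas X is
  off-diagonal.\<close>

lemma basic_independentI:
  assumes X: "Xblock \<xi> = - F m (m + 1) - F (m + 1) m"
    and Y: "Yblock \<xi> = F m m + scale t (F (m + 1) (m + 1))" and t: "t \<noteq> 1"
  shows "findependent 3 (basic \<xi>)"
proof (rule findependentI)
  note [simp] = index_less
  fix c i assume c: "(\<Sum>i<3. scale (c i) (basic \<xi> i)) = 0" and i: "i < (3::nat)"
  define K where "K = scale (c 0) q1 + scale (c 1) (Xblock \<xi>) + scale (c 2) (Yblock \<xi>)"
  have K: "K = 0" using c by (simp add: sum3 basic_def K_def)
  have e: "F m m * K * F m m = scale (c 0 + c 2) (F m m)"
    "F m m * K * F (m + 1) (m + 1) = scale (- c 1) (F m (m + 1))"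
    "F (m + 1) (m + 1) * K * F (m + 1) (m + 1) = scale (c 0 + c 2 * t) (F (m + 1) (m + 1))"
    unfolding K_def X Y by (simp_all add: q1_def expand scale_left)
  have "c 0 + c 2 = 0" using e(1) K scale_F_zero[of m m "c 0 + c 2"] by simp
  moreover have c1: "c 1 = 0" using e(2) K scale_F_zero[of m "m + 1" "- c 1"] by simp
  moreover have "c 0 + c 2 * t = 0" using e(3) K scale_F_zero[of "m + 1" "m + 1" "c 0 + c 2 * t"] by simp
  ultimately have "c 2 * (t - 1) = 0" by (simp add: algebra_simps add_eq_0_iff)
  then have c2: "c 2 = 0" using t by simp
  have "i = 0 \<or> i = 1 \<or> i = 2" using i by linarith
  then show "c i = 0" using c1 c2 \<open>c 0 + c 2 = 0\<close> by auto
qed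

lemma witness_3:
  assumes m: "m = 3"
  shows "findependent 3 (basic witness)"
proof (rule basic_independentI[where t = 0])
  note [simp] = index_less index_neq
  have w: "witness = witness0" unfolding witness_def if_P[OF m] by (rule refl)
  have n: "2 < m" "2 \<noteq> m" "m \<noteq> 2" using m by auto
  show "Xblock witness = - F m (m + 1) - F (m + 1) m"
    unfolding Xblock_def unfolding w witness0_def using n by (simp add: units expand)
  show "Yblock witness = F m m + scale 0 (F (m + 1) (m + 1))"
    unfolding Yblock_def xblock_def yblock_def unfolding w witness0_def qr_def using n by (simp add: units expand)
qed simp

context
  assumes m4: "m \<ge> 4"
begin

lemma index4: "2 < m" "3 < m" "2 \<noteq> m" "3 \<noteq> m" "m \<noteq> 2" "m \<noteq> 3" "3 < m + k"
  using m4 by auto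

text \<open>The tails only involve the indices j and m + j with j at least 4, so they do not meet
  the layers of \<open>nil\<close> or the other summands of the witness.\<close>

lemma tail_zero:
  assumes "a < m + k" "b < 4 \<or> (m \<le> b \<and> b < m + 4)" "b < m + k"
  shows "F a b * tailL = 0" "F a b * tailR = 0" "tailL * F b a = 0" "tailR * F b a = 0"
  unfolding tailL_def tailR_def sum_distrib_left sum_distrib_right
  by (rule sum.neutral, use assms mk in \<open>auto simp: F_mult\<close>)+

lemma tail_zero':
  assumes "a < m + k" "b < 4 \<or> (m \<le> b \<and> b < m + 4)" "b < m + k"
  shows "F a b * (tailL * z) = 0" "F a b * (tailR * z) = 0" "tailL * (F b a * z) = 0" "tailR * (F b a * z) = 0"
  using tail_zero[OF assms] by (simp_all add: mult.assoc [symmetric])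

lemma tail_idem:
  "eU * tailL = 0" "eW * tailL = tailL" "eU * tailR = tailR" "eW * tailR = 0"
  "tailL * eU = tailL" "tailL * eW = 0" "tailR * eU = 0" "tailR * eW = tailR"
  unfolding tailL_def tailR_def sum_distrib_left sum_distrib_right
  using mk by (auto intro!: sum.neutral sum.cong simp: eU_F eW_F)

lemma witness_4: "witness = witness0 + scale 2 (F (m + 1) 3 - F 3 (m + 3)) + (tailL - tailR)"
  using m4 by (simp add: witness_def)

lemma blocks_4:
  "Xblock witness = - F m (m + 1) - F (m + 1) m"
  "xblock witness = F m 2 + scale 2 (F (m + 1) 3)"
  "yblock witness = F 2 m + scale 2 (F 3 (m + 1))"
proof -
  note [simp] = index_less index_neq index4
  show "Xblock witness = - F m (m + 1) - F (m + 1) m"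
    unfolding Xblock_def unfolding witness_4 witness0_def by (simp add: units expand tail_zero tail_zero')
  show "xblock witness = F m 2 + scale 2 (F (m + 1) 3)"
    unfolding xblock_def unfolding witness_4 witness0_def qr_def by (simp add: units expand tail_zero tail_zero' tail_idem)
  show "yblock witness = F 2 m + scale 2 (F 3 (m + 1))"
    unfolding yblock_def unfolding witness_4 witness0_def qr_def by (simp add: units expand tail_zero tail_zero' tail_idem)
qed

lemma Y_4: "Yblock witness = F m m + scale 4 (F (m + 1) (m + 1))"
  unfolding Yblock_def blocks_4 using index_less index_neq index4 by (simp add: expand)

lemma basic_4: "findependent 3 (basic witness)"
  by (rule basic_independentI[OF blocks_4(1) Y_4]) simp

lemma M_4: "Mblock witness = (\<Sum>j=4..<m. scale (- (of_nat j ^ 2)) (F j j))"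
proof -
  note [simp] = index_less index_neq index4
  have 1: "qs * witness * qr = tailL"
    unfolding witness_4 witness0_def qr_def qs_def
    by (simp add: units expand tail_zero tail_zero' tail_idem)
  have 2: "qr * witness * qs = - tailR"
    unfolding witness_4 witness0_def qr_def qs_def
    by (simp add: units expand tail_zero tail_zero' tail_idem)
  have "Mblock witness = (qr * witness * qs) * (qs * witness * qr)"
    by (simp add: Mblock_def mult.assoc words)
  also have "\<dots> = - (\<Sum>i=4..<m. \<Sum>j=4..<m. scale (of_nat i * of_nat j) (F i (m + i) * F (m + j) j))"
    unfolding 1 2 tailL_def tailR_def mult_minus_left sum_product scale_scale_mult ..
  also have "(\<Sum>i=4..<m. \<Sum>j=4..<m. scale (of_nat i * of_nat j) (F i (m + i) * F (m + j) j))
    = (\<Sum>i=4..<m. \<Sum>j=4..<m. if j = i then scale (of_nat i ^ 2) (F i i) else 0)"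
    by (intro sum.cong refl) (use mk in \<open>auto simp: F_mult power2_eq_square\<close>)
  finally show ?thesis by (simp add: scale_left sum_negf)
qed

definition "witness_inv = F m m + scale (1 / 4) (F (m + 1) (m + 1))"

lemma witness_inv: "q1 * witness_inv = witness_inv" "witness_inv * q1 = witness_inv"
  "Yblock witness * witness_inv = q1" "witness_inv * Yblock witness = q1" "witness_inv \<in> corner N"
  using index_less unfolding Y_4 witness_inv_def by (simp_all add: units expand corner_closed F_corner)

text \<open>The projection only removes the indices 2 and 3 from the remainder, and M vanishes on
  both.\<close>

lemma C_4: "Cblock witness witness_inv = Mblock witness"
proof -
  note [simp] = index_less index_neq index4
  have p: "\<pi>block witness witness_inv = qr - F 2 2 - F 3 3"
    unfolding \<pi>block_def blocks_4 witness_inv_def by (simp add: expand)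
  have z: "F a a * Mblock witness = 0" "Mblock witness * F a a = 0" if "a < 4" for a
    unfolding M_4 sum_distrib_left sum_distrib_right
    by (rule sum.neutral, use that m4 in \<open>auto simp: F_mult\<close>)+
  show ?thesis unfolding Cblock_def p
    by (simp add: left_diff_distrib right_diff_distrib M_sandwich z)
qed

lemma Cpower_4: "Cpower witness witness_inv i = (\<Sum>j=4..<m. scale ((- (of_nat j ^ 2)) ^ Suc i) (F j j))"
proof (induction i)
  case 0
  show ?case by (simp add: C_4 M_4)
next
  case (Suc i)
  have "Cpower witness witness_inv (Suc i) = (\<Sum>a=4..<m. \<Sum>j=4..<m.
      scale (- (of_nat a ^ 2) * (- (of_nat j ^ 2)) ^ Suc i) (F a a * F j j))"
    unfolding Cpower.simps Suc C_4 M_4 sum_product scale_scale_mult ..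
  also have "\<dots> = (\<Sum>a=4..<m. \<Sum>j=4..<m. if j = a then scale ((- (of_nat a ^ 2)) ^ Suc (Suc i)) (F a a) else 0)"
    by (intro sum.cong refl) (auto simp: F_mult)
  finally show ?case by simp
qed

text \<open>Multiplying a relation by the diagonal unit of index 4 + j evaluates it at the
  eigenvalue l j. After cancelling the nonzero square that comes from the shift of exponents, a
  Vandermonde system remains.\<close>

lemma Cpower_independent: "findependent (m - 4) (\<lambda>i. Cpower witness witness_inv (Suc i))"
proof (rule findependentI)
  fix c i assume c: "(\<Sum>i<m - 4. scale (c i) (Cpower witness witness_inv (Suc i))) = 0" and i: "i < m - 4"
  define l :: "nat \<Rightarrow> 'a" where "l j = - (of_nat (4 + j) ^ 2)" for j
  have inj: "inj_on l {..<m - 4}"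
  proof (rule inj_onI)
    fix a b assume "l a = l b"
    then have "(of_nat ((4 + a) ^ 2) :: 'a) = of_nat ((4 + b) ^ 2)" by (simp add: l_def)
    then have "(4 + a) ^ 2 = (4 + b) ^ 2" by (simp only: of_nat_eq_iff)
    then show "a = b" using power_eq_iff_eq_base[of 2 "4 + a" "4 + b"] by simp
  qed
  have "(\<Sum>i<m - 4. c i * l j ^ i) = 0" if j: "j < m - 4" for j
  proof -
    have lt: "4 + j < m + k" "4 + j < m" using j by auto
    have p: "Cpower witness witness_inv (Suc i) * F (4 + j) (4 + j) = scale (l j ^ Suc (Suc i)) (F (4 + j) (4 + j))" for i
    proof -
      have "Cpower witness witness_inv (Suc i) * F (4 + j) (4 + j) =
          (\<Sum>a=4..<m. if a = 4 + j then scale (l j ^ Suc (Suc i)) (F (4 + j) (4 + j)) else 0)"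
        unfolding Cpower_4 sum_distrib_right
        by (rule sum.cong) (use lt in \<open>auto simp: F_mult l_def\<close>)
      then show ?thesis using lt by simp
    qed
    have "(\<Sum>i<m - 4. scale (c i) (Cpower witness witness_inv (Suc i))) * F (4 + j) (4 + j)
      = (\<Sum>i<m - 4. scale (c i * l j ^ Suc (Suc i)) (F (4 + j) (4 + j)))"
      unfolding sum_distrib_right scale_mult p scale_simps ..
    also have "\<dots> = scale (\<Sum>i<m - 4. c i * l j ^ Suc (Suc i)) (F (4 + j) (4 + j))"
      by (rule fmatrix_eqI) (simp add: entry_sum sum_distrib_right)
    finally have "(\<Sum>i<m - 4. c i * l j ^ Suc (Suc i)) = 0" using c scale_F_zero[OF lt(1,1)] by simp
    moreover have "(\<Sum>i<m - 4. c i * l j ^ Suc (Suc i)) = (\<Sum>i<m - 4. c i * l j ^ i) * l j ^ 2"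
      by (simp add: sum_distrib_left sum_distrib_right power2_eq_square algebra_simps)
    moreover have "(of_nat (4 + j) :: 'a) \<noteq> 0" unfolding of_nat_eq_0_iff by simp
    then have "l j \<noteq> 0" unfolding l_def neg_equal_0_iff_equal power_eq_0_iff by blast
    ultimately show ?thesis by simp
  qed
  then show "c i = 0" using transposed_vandermonde_zero[OF inj _ i] by blast
qed

end

end

end

section \<open>Genericity along lines through the witness\<close>

context hermitian_hyperbolic
begin

context
  assumes mk: "m \<le> k"
begin

text \<open>The line reaches the witness at s = 1. Goodness follows from finitely many conditions
  that hold there and are polynomial in s, once the inverse of Y is replaced by an adjugate.\<close>

lemma good_generic:
  assumes \<xi>1: "\<xi>1 \<in> skew1"
  shows "finite {s. \<not> good (\<xi>1 + scale s (witness - \<xi>1))}"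
proof -
  define \<xi> where "\<xi> s = \<xi>1 + scale s (witness - \<xi>1)" for s
  have w: "witness \<in> skew1" by (rule witness_skew1[OF mk])
  have D: "witness - \<xi>1 \<in> skew1" by (rule skew1_closed(2)[OF w \<xi>1])
  have x: "\<xi> s \<in> skew1" for s
    unfolding \<xi>_def by (rule skew1_closed(1)[OF \<xi>1 skew1_closed(3)[OF D D]])
  have x1: "\<xi> 1 = witness" by (simp add: \<xi>_def)
  note q = q_corner rs_corner
  have px: "polymat N \<xi>"
    unfolding \<xi>_def
    by (intro polymat_add polymat_scale polymat_const polyfn_ident corner_closed skew_corner(3) \<xi>1 w)
  have pX: "polymat N (\<lambda>s. Xblock (\<xi> s))" and pY: "polymat N (\<lambda>s. Yblock (\<xi> s))"
    and pM: "polymat N (\<lambda>s. Mblock (\<xi> s))" and pxb: "polymat N (\<lambda>s. xblock (\<xi> s))"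
    and pyb: "polymat N (\<lambda>s. yblock (\<xi> s))"
    unfolding Xblock_def Yblock_def Mblock_def xblock_def yblock_def
    by (intro polymat_add polymat_mult polymat_const px q)+
  have pbasic: "polymat N (\<lambda>s. basic (\<xi> s) i)" for i
    using polymat_const[OF q_corner(2)] pX pY by (cases "i = 0"; cases "i = 1") (simp_all add: basic_def)
  show ?thesis
  proof (cases "m = 3")
    case True
    have "finite {s. \<not> findependent 3 (\<lambda>i. basic (\<xi> s) i)}"
      by (rule findependent_polymat[where ?s0.0 = 1, OF pbasic]) (simp add: x1 witness_3[OF mk True])
    moreover have "{s. \<not> good (\<xi> s)} \<subseteq> {s. \<not> findependent 3 (\<lambda>i. basic (\<xi> s) i)}"
      using good_3[OF x _ True] by blast
    ultimately show ?thesis unfolding \<xi>_def by (rule rev_finite_subset)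
  next
    case False
    then have m4: "m \<ge> 4" using m3 by linarith
    define I :: "'a fmatrix" where "I = fmatrix_of_mat (1\<^sub>m N)"
    have Ic: "I \<in> corner N" by (simp add: I_def)
    have I1: "X * I = X" "I * X = X" if "X \<in> corner N" for X
      using mult_one_fmatrix[OF that] by (simp_all add: I_def)
    \<comment> \<open>Y lives in the corner of \<open>q1\<close>; adding the complementary
      idempotent turns its invertibility in that corner into invertibility of an N x N
      matrix.\<close>
    define Yt where "Yt s = Yblock (\<xi> s) + (I - q1)" for s
    have pYt: "polymat N Yt" unfolding Yt_def by (intro polymat_add pY polymat_const corner_closed Ic q)
    obtain d A where d: "polyfn d" and pA: "polymat N A"
      and YA: "\<And>s. Yt s * A s = scale (d s) I" "\<And>s. A s * Yt s = scale (d s) I"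
      and dn: "\<And>s Z. Z \<in> corner N \<Longrightarrow> Yt s * Z = I \<Longrightarrow> d s \<noteq> 0"
      using polymat_adjugate[OF pYt] unfolding I_def by blast
    have q1Y: "q1 * Yt s = Yblock (\<xi> s)" "Yt s * q1 = Yblock (\<xi> s)" for s
      by (simp_all add: Yt_def distrib_left distrib_right left_diff_distrib right_diff_distrib
        XY_sandwich I1[OF q_corner(2)] pp)
    define A' where "A' s = scale (1 / d s) (q1 * A s * q1)" for s
    have Ac: "A s \<in> corner N" for s using pA by (simp add: polymat_def)
    have A'c: "A' s \<in> corner N" "q1 * A' s = A' s" "A' s * q1 = A' s" for s
      unfolding A'_def by (simp_all add: Ac q corner_closed corner_mult words)
    have A'Y: "Yblock (\<xi> s) * A' s = q1" "A' s * Yblock (\<xi> s) = q1" if "d s \<noteq> 0" for s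
    proof -
      have "Yblock (\<xi> s) * (q1 * A s * q1) = (Yblock (\<xi> s) * q1) * A s * q1" by (simp only: mult.assoc)
      also have "\<dots> = (q1 * Yt s) * A s * q1" by (simp only: XY_sandwich q1Y)
      also have "\<dots> = q1 * (Yt s * A s) * q1" by (simp only: mult.assoc)
      also have "\<dots> = scale (d s) q1" by (simp add: YA I1[OF q_corner(2)] pp)
      finally show "Yblock (\<xi> s) * A' s = q1" using that by (simp add: A'_def)
      have "(q1 * A s * q1) * Yblock (\<xi> s) = q1 * A s * (q1 * Yblock (\<xi> s))" by (simp only: mult.assoc)
      also have "\<dots> = q1 * A s * (Yt s * q1)" by (simp only: XY_sandwich q1Y)
      also have "\<dots> = q1 * (A s * Yt s) * q1" by (simp only: mult.assoc)
      also have "\<dots> = scale (d s) q1" by (simp add: YA I1[OF q_corner(2)] pp)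
      finally show "A' s * Yblock (\<xi> s) = q1" using that by (simp add: A'_def)
    qed
    \<comment> \<open>This is d s times the projection \<pi>. Clearing the denominator keeps the
      powers of C polynomial, and for d s \<noteq> 0 it changes them by nonzero factors, which does
      not affect independence.\<close>
    define P where "P s = scale (d s) qr - yblock (\<xi> s) * (q1 * A s * q1) * xblock (\<xi> s)" for s
    define C where "C s = P s * Mblock (\<xi> s) * P s" for s
    define Cp where "Cp i s = (((*) (C s)) ^^ i) (C s)" for i s
    have pP: "polymat N P"
      unfolding P_def by (intro polymat_diff polymat_scale polymat_mult d pyb pxb pA polymat_const q)
    have pC: "polymat N C" unfolding C_def by (intro polymat_mult pP pM)
    have pCp: "polymat N (Cp i)" for i
    proof (induction i)
      case 0
      then show ?case using pC by (simp add: Cp_def)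
    next
      case (Suc i)
      then show ?case using polymat_mult[OF pC Suc] by (simp add: Cp_def)
    qed
    have PP: "P s = scale (d s) (\<pi>block (\<xi> s) (A' s))" if "d s \<noteq> 0" for s
      using that by (simp add: P_def \<pi>block_def A'_def)
    have CC: "C s = scale (d s ^ 2) (Cblock (\<xi> s) (A' s))" if "d s \<noteq> 0" for s
      by (simp add: C_def PP[OF that] Cblock_def power2_eq_square)
    have CCp: "Cp i s = scale ((d s ^ 2) ^ Suc i) (Cpower (\<xi> s) (A' s) i)" if "d s \<noteq> 0" for i s
    proof (induction i)
      case 0
      show ?case by (simp add: Cp_def CC[OF that])
    next
      case (Suc i)
      have "Cp (Suc i) s = C s * Cp i s" by (simp add: Cp_def)
      then show ?case unfolding Suc CC[OF that] scale_scale_mult by simp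
    qed
    have CpI: "findependent r (\<lambda>i. Cp (Suc i) s) \<longleftrightarrow> findependent r (\<lambda>i. Cpower (\<xi> s) (A' s) (Suc i))"
      if "d s \<noteq> 0" for r s
      unfolding CCp[OF that] by (rule findependent_scale) (use that in simp)
    have d1: "d 1 \<noteq> 0"
    proof (rule dn)
      note W = witness_inv[OF mk m4]
      show Z: "witness_inv + (I - q1) \<in> corner N" by (intro corner_closed W Ic q)
      have Yc: "Yblock witness * I = Yblock witness" using pY x1 I1(1) by (metis polymat_def)
      have "Yt 1 * (witness_inv + (I - q1)) = Yblock witness * witness_inv + (Yblock witness * I - Yblock witness * q1)
          + (I * witness_inv - q1 * witness_inv) + (I * I - I * q1 - (q1 * I - q1 * q1))"
        by (simp add: Yt_def x1 algebra_simps)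
      also have "\<dots> = I"
        by (simp add: W Yc XY_sandwich I1[OF W(5)] I1[OF Ic] I1[OF q_corner(2)] pp)
      finally show "Yt 1 * (witness_inv + (I - q1)) = I" .
    qed
    have A'1: "A' 1 = witness_inv"
    proof -
      note W = witness_inv[OF mk m4]
      have "A' 1 = A' 1 * (Yblock witness * witness_inv)" by (simp add: W(3) A'c)
      also have "\<dots> = (A' 1 * Yblock (\<xi> 1)) * witness_inv" by (simp only: mult.assoc x1)
      also have "\<dots> = witness_inv" by (simp only: A'Y[OF d1] W(1))
      finally show ?thesis .
    qed
    have "finite {s. d s = 0}" by (rule polyfn_finite_zeros[OF d d1])
    moreover have "finite {s. \<not> findependent 3 (\<lambda>i. basic (\<xi> s) i)}"
      by (rule findependent_polymat[where ?s0.0 = 1, OF pbasic]) (simp add: x1 basic_4[OF mk m4])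
    moreover have "finite {s. \<not> findependent (m - 4) (\<lambda>i. Cp (Suc i) s)}"
      by (rule findependent_polymat[where ?s0.0 = 1, OF pCp])
        (simp only: CpI[OF d1] A'1 x1 Cpower_independent[OF mk m4])
    moreover have "{s. \<not> good (\<xi> s)} \<subseteq> {s. d s = 0} \<union> ({s. \<not> findependent 3 (\<lambda>i. basic (\<xi> s) i)} \<union>
      {s. \<not> findependent (m - 4) (\<lambda>i. Cp (Suc i) s)})"
    proof
      fix s assume s: "s \<in> {s. \<not> good (\<xi> s)}"
      show "s \<in> {s. d s = 0} \<union> ({s. \<not> findependent 3 (\<lambda>i. basic (\<xi> s) i)} \<union>
        {s. \<not> findependent (m - 4) (\<lambda>i. Cp (Suc i) s)})"
      proof (rule ccontr)
        assume "\<not> ?thesis"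
        then have ds: "d s \<noteq> 0" and b: "findependent 3 (basic (\<xi> s))" and "findependent (m - 4) (\<lambda>i. Cp (Suc i) s)"
          by auto
        then have "good (\<xi> s)"
          using good_4[OF x b m4 A'c A'Y[OF ds]] CpI[OF ds] by blast
        then show False using s by simp
      qed
    qed
    ultimately show ?thesis unfolding \<xi>_def by (meson finite_UnI finite_subset)
  qed
qed

text \<open>R independent bracket functionals at \<xi>1 stay independent for almost all s, and
  almost all points of the line are good. At a common parameter a dual family of the functionals,
  together with the m + 1 annihilators, is independent. This treats every \<xi>1, and hence also one
  whose orbit has maximal dimension.\<close>

theorem slice_bound:
  assumes \<xi>1: "\<xi>1 \<in> skew1" and x: "\<And>i. i < R \<Longrightarrow> x i \<in> skew0 \<and> nil * x i = x i * nil"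
    and ind: "independent_on slice R (\<lambda>i y. ftrace (y * (x i * \<xi>1 - \<xi>1 * x i)))"
  shows "\<exists>y. (\<forall>i<R + (m + 1). y i \<in> slice) \<and> findependent (R + (m + 1)) y"
proof -
  define \<xi> where "\<xi> s = \<xi>1 + scale s (witness - \<xi>1)" for s
  define \<phi> where "\<phi> = (\<lambda>s i y. ftrace (y * (x i * \<xi> s - \<xi> s * x i)))"
  have w: "witness \<in> skew1" by (rule witness_skew1[OF mk])
  have dual: "\<exists>y. \<forall>j<R. y j \<in> slice \<and> (\<forall>i<R. \<phi> s i (y j) = (if i = j then 1 else 0))"
    if "independent_on slice R (\<phi> s)" for s
  proof (rule dual_family[OF _ _ that])
    show "slice \<noteq> {}" using slice_zero by blast
    fix u v c assume "u \<in> slice" "v \<in> slice"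
    then show "\<exists>y\<in>slice. \<forall>i<R. \<phi> s i y = \<phi> s i u + c * \<phi> s i v"
      by (intro bexI[of _ "u + scale c v"] slice_closed) (simp_all add: \<phi>_def distrib_right)
  qed
  have i0: "independent_on slice R (\<phi> 0)" using ind by (simp add: \<phi>_def \<xi>_def)
  obtain y where "\<forall>j<R. y j \<in> slice \<and> (\<forall>i<R. \<phi> 0 i (y j) = (if i = j then 1 else 0))"
    using dual[OF i0] by (rule exE)
  then have y: "\<And>j. j < R \<Longrightarrow> y j \<in> slice" "\<And>i j. i < R \<Longrightarrow> j < R \<Longrightarrow> \<phi> 0 i (y j) = (if i = j then 1 else 0)"
    by auto
  have "finite {s. \<not> independent_on {..<R} R (\<lambda>i j. \<phi> s i (y j))}"
  proof (rule independent_on_polyfn[where ?s0.0 = 0])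
    fix i j assume ij: "i < R" "j \<in> {..<R}"
    have c: "y j \<in> corner N" "x i \<in> corner N" using y(1) x ij by (auto intro: slice_corner skew_corner)
    have px: "polymat N \<xi>" unfolding \<xi>_def
      by (intro polymat_add polymat_scale polymat_const polyfn_ident corner_closed skew_corner(3) \<xi>1 w)
    show "polyfn (\<lambda>s. \<phi> s i (y j))"
      unfolding \<phi>_def
      by (rule polyfn_ftrace[of N], intro polymat_mult polymat_diff polymat_const px c)
  next
    show "independent_on {..<R} R (\<lambda>i j. \<phi> 0 i (y j))"
    proof (rule independent_onI)
      fix c i assume c: "\<And>j. j \<in> {..<R} \<Longrightarrow> (\<Sum>i<R. c i * \<phi> 0 i (y j)) = 0" and i: "i < R"
      have "(\<Sum>l<R. c l * \<phi> 0 l (y i)) = (\<Sum>l<R. if l = i then c i else 0)"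
        by (rule sum.cong) (use y(2) i in auto)
      then show "c i = 0" using c[of i] i by simp
    qed
  qed
  moreover have "finite {s. \<not> good (\<xi> s)}" unfolding \<xi>_def by (rule good_generic[OF \<xi>1])
  ultimately have "finite ({s. \<not> independent_on {..<R} R (\<lambda>i j. \<phi> s i (y j))} \<union> {s. \<not> good (\<xi> s)})" by simp
  \<comment> \<open>The field is infinite, so some parameter avoids both finite exceptional
    sets.\<close>
  then obtain s where s: "s \<notin> {s. \<not> independent_on {..<R} R (\<lambda>i j. \<phi> s i (y j))} \<union> {s. \<not> good (\<xi> s)}"
    using ex_new_if_finite[OF infinite_UNIV_char_0] by blast
  have inds: "independent_on slice R (\<phi> s)"
  proof (rule independent_onI)
    fix c i assume c: "\<And>j. j \<in> slice \<Longrightarrow> (\<Sum>i<R. c i * \<phi> s i j) = 0" and i: "i < R"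
    have I: "independent_on {..<R} R (\<lambda>i j. \<phi> s i (y j))" using s by simp
    show "c i = 0" by (rule independent_onD[OF I _ i]) (use c y(1) in simp)
  qed
  obtain z where "\<forall>j<R. z j \<in> slice \<and> (\<forall>i<R. \<phi> s i (z j) = (if i = j then 1 else 0))"
    using dual[OF inds] by (rule exE)
  then have z: "\<And>j. j < R \<Longrightarrow> z j \<in> slice" "\<And>i j. i < R \<Longrightarrow> j < R \<Longrightarrow> \<phi> s i (z j) = (if i = j then 1 else 0)"
    by auto
  obtain g where g: "findependent (m + 1) g" "\<And>i. i < m + 1 \<Longrightarrow> g i \<in> slice"
    "\<And>i. i < m + 1 \<Longrightarrow> image_nil (g i * \<xi> s - \<xi> s * g i)"
    using s unfolding good_def by blast
  have \<phi>g: "\<phi> s i (g j) = 0" if "i < R" "j < m + 1" for i j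
    unfolding \<phi>_def by (rule image_nil_annihilated[OF g(3)[OF that(2)]]) (use x that in blast)
  \<comment> \<open>The R functionals detect the z i and vanish on all annihilators g j; applying
    them to a relation first eliminates the z i.\<close>
  define b where "b i = (if i < R then z i else g (i - R))" for i
  have "b i \<in> slice" if "i < R + (m + 1)" for i using z(1) g(2) that by (simp add: b_def)
  moreover have "findependent (R + (m + 1)) b"
  proof (rule findependentI)
    fix c i assume c: "(\<Sum>i<R + (m + 1). scale (c i) (b i)) = 0" and i: "i < R + (m + 1)"
    have split: "(\<Sum>i<R. scale (c i) (z i)) + (\<Sum>i<m + 1. scale (c (R + i)) (g i)) = 0"
      using c unfolding sum_lessThan_add by (simp add: b_def)
    have \<phi>add: "\<phi> s l (u + v) = \<phi> s l u + \<phi> s l v" and \<phi>sum: "\<phi> s l (\<Sum>i\<in>S. scale (a i) (f i)) = (\<Sum>i\<in>S. a i * \<phi> s l (f i))"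
      for l u v and S :: "nat set" and a f
      by (simp_all add: \<phi>_def distrib_right sum_distrib_right ftrace_sum)
    have c0: "c l = 0" if l: "l < R" for l
    proof -
      have "\<phi> s l (\<Sum>i<R. scale (c i) (z i)) + \<phi> s l (\<Sum>i<m + 1. scale (c (R + i)) (g i)) = \<phi> s l 0"
        unfolding \<phi>add [symmetric] split ..
      moreover have "\<phi> s l (\<Sum>i<m + 1. scale (c (R + i)) (g i)) = 0"
        unfolding \<phi>sum by (rule sum.neutral) (use \<phi>g[OF l] in auto)
      moreover have "\<phi> s l (\<Sum>i<R. scale (c i) (z i)) = (\<Sum>i<R. if i = l then c l else 0)"
        unfolding \<phi>sum by (rule sum.cong) (use z(2)[OF l] in auto)
      moreover have "\<phi> s l 0 = 0" by (simp add: \<phi>_def)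
      ultimately show ?thesis using l by simp
    qed
    then have "(\<Sum>i<m + 1. scale (c (R + i)) (g i)) = 0" using split by simp
    then have "c (R + j) = 0" if "j < m + 1" for j
      using findependentD[OF g(1), of "\<lambda>i. c (R + i)"] that by blast
    then show "c i = 0" using c0 i by (cases "i < R") (auto dest!: meta_spec[of _ "i - R"])
  qed
  ultimately show ?thesis by blast
qed

end

end

section \<open>Index of a module of linear functionals\<close>

text \<open>Closure alone makes the dual a vector space, whose axioms hold pointwise. The quotient
  by cosets thus enters without a verification of the vector space axioms for it.\<close>

definition lin_closed :: "('a::field, 'v) module \<Rightarrow> bool" where
  "lin_closed X \<longleftrightarrow> (\<forall>u\<in>carrier X. \<forall>v\<in>carrier X. u \<oplus>\<^bsub>X\<^esub> v \<in> carrier X) \<and> (\<forall>c. \<forall>v\<in>carrier X. c \<odot>\<^bsub>X\<^esub> v \<in> carrier X)"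

definition dual_subspace :: "('a::field, 'v) module \<Rightarrow> ('v \<Rightarrow> 'a) set \<Rightarrow> bool" where
  "dual_subspace X W \<longleftrightarrow> W \<subseteq> carrier (dual_module X) \<and> (\<lambda>v\<in>carrier X. 0) \<in> W \<and>
     (\<forall>f\<in>W. \<forall>g\<in>W. (\<lambda>v\<in>carrier X. f v + g v) \<in> W) \<and> (\<forall>c. \<forall>f\<in>W. (\<lambda>v\<in>carrier X. c * f v) \<in> W)"

lemma dual_carrierD:
  assumes "f \<in> carrier (dual_module X)"
  shows "f \<in> extensional (carrier X)"
    "u \<in> carrier X \<Longrightarrow> v \<in> carrier X \<Longrightarrow> f (u \<oplus>\<^bsub>X\<^esub> v) = f u + f v"
    "v \<in> carrier X \<Longrightarrow> f (c \<odot>\<^bsub>X\<^esub> v) = c * f v"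
  using assms by (auto simp: dual_module_def)

lemma dual_carrierI:
  assumes "f \<in> extensional (carrier X)"
    "\<And>u v. u \<in> carrier X \<Longrightarrow> v \<in> carrier X \<Longrightarrow> f (u \<oplus>\<^bsub>X\<^esub> v) = f u + f v"
    "\<And>c v. v \<in> carrier X \<Longrightarrow> f (c \<odot>\<^bsub>X\<^esub> v) = c * f v"
  shows "f \<in> carrier (dual_module X)"
  using assms by (auto simp: dual_module_def)

lemma dual_module_simps [simp]:
  "zero (dual_module X) = (\<lambda>v\<in>carrier X. 0)"
  "add (dual_module X) f g = (\<lambda>v\<in>carrier X. f v + g v)"
  "smult (dual_module X) c f = (\<lambda>v\<in>carrier X. c * f v)"
  by (simp_all add: dual_module_def)

lemma dual_eqI:
  "f \<in> carrier (dual_module X) \<Longrightarrow> g \<in> carrier (dual_module X) \<Longrightarrow> (\<And>v. v \<in> carrier X \<Longrightarrow> f v = g v) \<Longrightarrow> f = g"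
  by (metis dual_carrierD(1) extensionalityI)

lemma dual_subspace_carrier: "lin_closed X \<Longrightarrow> dual_subspace X (carrier (dual_module X))"
  unfolding dual_subspace_def lin_closed_def
  by (auto intro!: dual_carrierI simp: dual_carrierD algebra_simps)

lemma lin_closed_dual: "lin_closed X \<Longrightarrow> lin_closed (dual_module X)"
  using dual_subspace_carrier[of X] by (simp add: lin_closed_def dual_subspace_def)

lemma dual_subspace_vectorspace:
  assumes W: "dual_subspace X W"
  shows "vectorspace (class_ring :: 'a ring) (sub_space (dual_module X :: ('a::field, 'v \<Rightarrow> 'a) module) W)"
proof -
  have ext: "f \<in> extensional (carrier X)" if "f \<in> W" for f
    using that W by (auto simp: dual_subspace_def dual_module_def)
  have ext': "f x = undefined" if "f \<in> W" "x \<notin> carrier X" for f x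
    using extensional_arb[OF ext[OF that(1)] that(2)] .
  have cl: "(\<lambda>v\<in>carrier X. f v + g v) \<in> W" "(\<lambda>v\<in>carrier X. c * f v) \<in> W" "(\<lambda>v\<in>carrier X. 0) \<in> W"
    if "f \<in> W" "g \<in> W" for f g c
    using that W by (auto simp: dual_subspace_def)
  have z: "(\<lambda>v\<in>carrier X. 0) \<in> W" using W by (simp add: dual_subspace_def)
  show ?thesis
  proof (rule vs_criteria[OF class_field])
    show "\<forall>v\<in>carrier (sub_space (dual_module X) W). \<exists>neg_v\<in>carrier (sub_space (dual_module X) W).
        v \<oplus>\<^bsub>sub_space (dual_module X) W\<^esub> neg_v = \<zero>\<^bsub>sub_space (dual_module X) W\<^esub>"
    proof
      fix f assume "f \<in> carrier (sub_space (dual_module X) W)"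
      then have "(\<lambda>v\<in>carrier X. (-1) * f v) \<in> W" using cl(2)[of f f "-1"] by simp
      then show "\<exists>neg_v\<in>carrier (sub_space (dual_module X) W).
        f \<oplus>\<^bsub>sub_space (dual_module X) W\<^esub> neg_v = \<zero>\<^bsub>sub_space (dual_module X) W\<^esub>"
        by (intro bexI[of _ "\<lambda>v\<in>carrier X. (-1) * f v"]) (auto simp: restrict_def)
    qed
  qed (use cl z in \<open>auto simp: restrict_def ext' algebra_simps fun_eq_iff\<close>)
qed

lemma dual_lincomb:
  fixes X :: "('a::field, 'v) module"
  assumes W: "dual_subspace X W" and S: "finite S" "S \<subseteq> W"
  shows "module.lincomb (sub_space (dual_module X) W) a S = (\<lambda>v\<in>carrier X. \<Sum>f\<in>S. a f * f v)"
proof -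
  interpret D: vectorspace "class_ring :: 'a ring" "sub_space (dual_module X) W"
    by (rule dual_subspace_vectorspace[OF W])
  have cl: "(\<lambda>v\<in>carrier X. c * f v) \<in> W" if "f \<in> W" for f c
    using that W by (auto simp: dual_subspace_def)
  show ?thesis unfolding D.lincomb_def using S
  proof (induction S rule: finite_induct)
    case empty
    then show ?case using D.finsum_empty by (simp add: restrict_def)
  next
    case (insert f S)
    have "finsum (sub_space (dual_module X) W) (\<lambda>v. a v \<odot>\<^bsub>sub_space (dual_module X) W\<^esub> v) (insert f S)
      = (a f \<odot>\<^bsub>sub_space (dual_module X) W\<^esub> f) \<oplus>\<^bsub>sub_space (dual_module X) W\<^esub>
        finsum (sub_space (dual_module X) W) (\<lambda>v. a v \<odot>\<^bsub>sub_space (dual_module X) W\<^esub> v) S"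
      by (rule D.finsum_insert) (use insert cl in \<open>auto simp: Pi_def\<close>)
    also have "\<dots> = (\<lambda>v\<in>carrier X. \<Sum>f\<in>insert f S. a f * f v)"
      using insert by (auto simp: restrict_def)
    finally show ?case .
  qed
qed

text \<open>Bases as sequences of functions tested on C, a form common to subspaces of duals,
  subspaces of double duals and coordinate functions of vectors.\<close>

definition fbasis :: "('v \<Rightarrow> 'a::field) set \<Rightarrow> 'v set \<Rightarrow> nat \<Rightarrow> (nat \<Rightarrow> 'v \<Rightarrow> 'a) \<Rightarrow> bool" where
  "fbasis W C r F \<longleftrightarrow> (\<forall>i<r. F i \<in> W) \<and> independent_on C r F \<and>
     (\<forall>w\<in>W. \<exists>c. \<forall>v\<in>C. w v = (\<Sum>i<r. c i * F i v))"

lemma independent_on_inj: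
  fixes F :: "nat \<Rightarrow> 'v \<Rightarrow> 'a::field"
  assumes "independent_on C r F"
  shows "inj_on F {..<r}"
proof (rule inj_onI, rule ccontr)
  fix i j assume ij: "i \<in> {..<r}" "j \<in> {..<r}" "F i = F j" "i \<noteq> j"
  define c :: "nat \<Rightarrow> 'a" where "c l = (if l = i then 1 else if l = j then -1 else 0)" for l
  have "c i = 0"
  proof (rule independent_onD[OF assms, of c i])
    fix v assume "v \<in> C"
    have "(\<Sum>l<r. c l * F l v) = (\<Sum>l\<in>{i, j}. c l * F l v)"
      by (rule sum.mono_neutral_right) (use ij(1,2) in \<open>auto simp: c_def\<close>)
    also have "\<dots> = 0" using ij(3,4) by (simp add: c_def)
    finally show "(\<Sum>l<r. c l * F l v) = 0" .
  next
    show "i < r" using ij(1) by simp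
  qed
  then show False by (simp add: c_def)
qed

lemma family_lin_indpt:
  fixes X :: "('a::field, 'v) module"
  assumes W: "dual_subspace X W" and F: "\<And>i. i < r \<Longrightarrow> F i \<in> W" and ind: "independent_on (carrier X) r F"
  shows "\<not> module.lin_dep (class_ring :: 'a ring) (sub_space (dual_module X) W) (F ` {..<r})"
proof -
  interpret D: vectorspace "class_ring :: 'a ring" "sub_space (dual_module X) W"
    by (rule dual_subspace_vectorspace[OF W])
  have S: "F ` {..<r} \<subseteq> W" using F by auto
  show ?thesis
  proof (rule D.finite_lin_indpt2)
    fix a assume "D.lincomb a (F ` {..<r}) = \<zero>\<^bsub>sub_space (dual_module X) W\<^esub>"
    then have *: "(\<lambda>v\<in>carrier X. \<Sum>f\<in>F ` {..<r}. a f * f v) = (\<lambda>v\<in>carrier X. 0)"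
      by (simp add: dual_lincomb[OF W _ S])
    have "(\<Sum>i<r. a (F i) * F i v) = 0" if "v \<in> carrier X" for v
      using fun_cong[OF *, of v] that by (simp add: sum.reindex[OF independent_on_inj[OF ind]])
    then have "a (F i) = 0" if "i < r" for i using independent_onD[OF ind, of "\<lambda>i. a (F i)"] that by blast
    then show "\<forall>v\<in>F ` {..<r}. a v = \<zero>\<^bsub>class_ring\<^esub>" by auto
  qed (use S in auto)
qed

lemma fbasis_basis:
  fixes X :: "('a::field, 'v) module"
  assumes W: "dual_subspace X W" and F: "fbasis W (carrier X) r F"
  shows "vectorspace.basis (class_ring :: 'a ring) (sub_space (dual_module X) W) (F ` {..<r})"
proof -
  interpret D: vectorspace "class_ring :: 'a ring" "sub_space (dual_module X) W"
    by (rule dual_subspace_vectorspace[OF W])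
  have S: "F ` {..<r} \<subseteq> W" and ind: "independent_on (carrier X) r F" using F by (auto simp: fbasis_def)
  have "W \<subseteq> D.span (F ` {..<r})"
  proof
    fix w assume w: "w \<in> W"
    then obtain c where c: "\<And>v. v \<in> carrier X \<Longrightarrow> w v = (\<Sum>i<r. c i * F i v)"
      using F by (auto simp: fbasis_def)
    define a where "a f = c (the_inv_into {..<r} F f)" for f
    have "D.lincomb a (F ` {..<r}) = (\<lambda>v\<in>carrier X. \<Sum>f\<in>F ` {..<r}. a f * f v)"
      by (rule dual_lincomb[OF W _ S]) simp
    also have "\<dots> = w"
    proof
      fix v
      have we: "w \<in> extensional (carrier X)" using w W by (auto simp: dual_subspace_def dual_module_def)
      have aF: "a (F i) = c i" if "i < r" for i
        using that the_inv_into_f_f[OF independent_on_inj[OF ind]] by (simp add: a_def)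
      show "(\<lambda>v\<in>carrier X. \<Sum>f\<in>F ` {..<r}. a f * f v) v = w v"
      proof (cases "v \<in> carrier X")
        case True
        have "(\<Sum>f\<in>F ` {..<r}. a f * f v) = (\<Sum>i<r. a (F i) * F i v)"
          by (simp add: sum.reindex[OF independent_on_inj[OF ind]])
        also have "\<dots> = (\<Sum>i<r. c i * F i v)" by (rule sum.cong) (simp_all add: aF)
        finally show ?thesis using True c[OF True] by simp
      qed (simp add: extensional_arb[OF we])
    qed
    finally show "w \<in> D.span (F ` {..<r})" using D.finite_span[of "F ` {..<r}"] S by auto
  qed
  moreover have "D.span (F ` {..<r}) \<subseteq> W" using D.span_is_subset2[of "F ` {..<r}"] S by simp
  moreover have "\<not> D.lin_dep (F ` {..<r})"
    by (rule family_lin_indpt[OF W _ ind]) (use S in auto)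
  ultimately show ?thesis using S by (auto simp: D.basis_def)
qed

lemma fbasis_vdim:
  fixes X :: "('a::field, 'v) module"
  assumes W: "dual_subspace X W" and F: "fbasis W (carrier X) r F"
  shows "vdim (sub_space (dual_module X) W) = r"
proof -
  interpret D: vectorspace "class_ring :: 'a ring" "sub_space (dual_module X) W"
    by (rule dual_subspace_vectorspace[OF W])
  have "D.dim = card (F ` {..<r})" by (rule D.dim_basis[OF _ fbasis_basis[OF W F]]) simp
  also have "\<dots> = r" using F by (subst card_image) (auto simp: fbasis_def intro: independent_on_inj)
  finally show ?thesis .
qed

lemma independent_le_fbasis:
  fixes X :: "('a::field, 'v) module"
  assumes W: "dual_subspace X W" and F: "fbasis W (carrier X) r F"
    and G: "\<And>i. i < n \<Longrightarrow> G i \<in> W" and ind: "independent_on (carrier X) n G"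
  shows "n \<le> r"
proof -
  interpret D: vectorspace "class_ring :: 'a ring" "sub_space (dual_module X) W"
    by (rule dual_subspace_vectorspace[OF W])
  have fd: "D.fin_dim"
    using fbasis_basis[OF W F] unfolding D.fin_dim_def D.basis_def by blast
  have "card (G ` {..<n}) \<le> D.dim"
    by (rule D.li_le_dim(2)[OF fd _ family_lin_indpt[OF W G ind]]) (use G in auto)
  then show ?thesis using fbasis_vdim[OF W F] card_image[OF independent_on_inj[OF ind]] by simp
qed

text \<open>An independent sequence of maximal length spans: an element outside its span could be
  appended. The bound d guarantees that a maximal length exists.\<close>

lemma fbasis_exists:
  assumes "\<And>n G. (\<And>i. i < n \<Longrightarrow> G i \<in> W) \<Longrightarrow> independent_on C n G \<Longrightarrow> n \<le> (d::nat)"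
  shows "\<exists>r F. fbasis W C r F \<and> r \<le> d"
proof -
  define P where "P n \<longleftrightarrow> (\<exists>G. (\<forall>i<n. G i \<in> W) \<and> independent_on C n G)" for n
  have "P 0" by (simp add: P_def independent_on_def)
  moreover have Pd: "n \<le> d" if "P n" for n
  proof -
    obtain G where "\<forall>i<n. G i \<in> W" "independent_on C n G" using \<open>P n\<close> unfolding P_def by (elim exE conjE)
    then show ?thesis by (intro assms[of n G]) auto
  qed
  ultimately obtain r where r: "P r" "\<And>n. P n \<Longrightarrow> n \<le> r"
    using Nat.ex_has_greatest_nat[of P 0 d] by blast
  obtain F where F': "\<forall>i<r. F i \<in> W" and F2: "independent_on C r F" using r(1) unfolding P_def by (elim exE conjE)
  have F: "\<And>i. i < r \<Longrightarrow> F i \<in> W" "independent_on C r F" using F' F2 by auto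
  have "\<exists>c. \<forall>v\<in>C. w v = (\<Sum>i<r. c i * F i v)" if w: "w \<in> W" for w
  proof (rule ccontr)
    assume n: "\<not> ?thesis"
    define G where "G i = (if i < r then F i else w)" for i
    have "independent_on C (Suc r) G"
    proof (rule independent_onI)
      fix c i assume c: "\<And>v. v \<in> C \<Longrightarrow> (\<Sum>i<Suc r. c i * G i v) = 0" and i: "i < Suc r"
      have s: "(\<Sum>i<r. c i * F i v) + c r * w v = 0" if "v \<in> C" for v
        using c[OF that] by (simp add: G_def)
      have cr: "c r = 0"
      proof (rule ccontr)
        assume cr: "c r \<noteq> 0"
        have comb: "w v = (\<Sum>i<r. (- c i / c r) * F i v)" if "v \<in> C" for v
        proof -
          have "(\<Sum>i<r. (- c i / c r) * F i v) = - (\<Sum>i<r. c i * F i v) / c r"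
            by (simp add: sum_divide_distrib sum_negf)
          also have "\<dots> = w v" using s[OF that] cr by (simp add: eq_neg_iff_add_eq_0 [symmetric] field_simps)
          finally show ?thesis by simp
        qed
        from n show False
          by (rule notE) (intro exI[of _ "\<lambda>i. - c i / c r"] ballI comb)
      qed
      then have "(\<Sum>i<r. c i * F i v) = 0" if "v \<in> C" for v using s[OF that] by simp
      then have "i < r \<Longrightarrow> c i = 0" using independent_onD[OF F(2)] by blast
      with cr i show "c i = 0" by (cases "i = r") auto
    qed
    moreover have "\<forall>i<Suc r. G i \<in> W" using F w by (simp add: G_def less_Suc_eq)
    ultimately have "P (Suc r)" unfolding P_def by (intro exI[of _ G] conjI)
    then show False using r(2)[of "Suc r"] by simp
  qed
  then have "fbasis W C r F" using F by (auto simp: fbasis_def)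
  moreover have "r \<le> d" by (rule Pd[OF r(1)])
  ultimately show ?thesis by blast
qed

lemma dual_sum:
  fixes n :: nat
  assumes "lin_closed X" "\<And>i. i < n \<Longrightarrow> f i \<in> carrier (dual_module X)"
  shows "(\<lambda>v\<in>carrier X. \<Sum>i<n. c i * f i v) \<in> carrier (dual_module X)"
  using assms unfolding lin_closed_def
  by (intro dual_carrierI) (auto simp: dual_carrierD distrib_left sum.distrib sum_distrib_left mult.left_commute intro!: sum.cong)

lemma functional_sum:
  fixes n :: nat
  assumes X: "lin_closed X" and \<xi>: "\<xi> \<in> carrier (dual_module (dual_module X))"
    and f: "\<And>i. i < n \<Longrightarrow> f i \<in> carrier (dual_module X)"
  shows "\<xi> (\<lambda>v\<in>carrier X. \<Sum>i<n. c i * f i v) = (\<Sum>i<n. c i * \<xi> (f i))"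
  using f
proof (induction n)
  case 0
  have z: "(\<lambda>v\<in>carrier X. 0) \<in> carrier (dual_module X)"
    using dual_subspace_carrier[OF X] by (simp add: dual_subspace_def)
  have "\<xi> (0 \<odot>\<^bsub>dual_module X\<^esub> (\<lambda>v\<in>carrier X. 0)) = 0 * \<xi> (\<lambda>v\<in>carrier X. 0)"
    by (rule dual_carrierD(3)[OF \<xi> z])
  then show ?case by (simp add: restrict_def)
next
  case (Suc n)
  have a: "(\<lambda>v\<in>carrier X. \<Sum>i<n. c i * f i v) \<in> carrier (dual_module X)"
    by (rule dual_sum[OF X]) (use Suc in auto)
  have b: "(\<lambda>v\<in>carrier X. c n * f n v) \<in> carrier (dual_module X)"
    using dual_subspace_carrier[OF X] Suc.prems[of n] by (auto simp: dual_subspace_def)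
  have eq: "(\<lambda>v\<in>carrier X. \<Sum>i<Suc n. c i * f i v) =
      (\<lambda>v\<in>carrier X. \<Sum>i<n. c i * f i v) \<oplus>\<^bsub>dual_module X\<^esub> (c n \<odot>\<^bsub>dual_module X\<^esub> f n)"
    by (auto simp: restrict_def)
  have "\<xi> (\<lambda>v\<in>carrier X. \<Sum>i<Suc n. c i * f i v) = \<xi> (\<lambda>v\<in>carrier X. \<Sum>i<n. c i * f i v) + c n * \<xi> (f n)"
    unfolding eq
    using dual_carrierD(2)[OF \<xi> a b] dual_carrierD(3)[OF \<xi> Suc.prems[of n], of "c n"] by simp
  moreover have "\<xi> (\<lambda>v\<in>carrier X. \<Sum>i<n. c i * f i v) = (\<Sum>i<n. c i * \<xi> (f i))"
    by (rule Suc.IH) (use Suc.prems in auto)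
  ultimately show ?case by (simp only: sum.lessThan_Suc)
qed

lemma dual_dual_family:
  assumes X: "lin_closed X" and G: "\<And>i. i < n \<Longrightarrow> G i \<in> carrier (dual_module (dual_module X))"
    and ind: "independent_on (carrier (dual_module X)) n G"
  shows "\<exists>f. \<forall>j<n. f j \<in> carrier (dual_module X) \<and> (\<forall>i<n. G i (f j) = (if i = j then 1 else 0))"
proof (rule dual_family[OF _ _ ind])
  have D: "dual_subspace X (carrier (dual_module X))" by (rule dual_subspace_carrier[OF X])
  then show "carrier (dual_module X) \<noteq> {}" by (auto simp: dual_subspace_def)
  fix u w c assume uw: "u \<in> carrier (dual_module X)" "w \<in> carrier (dual_module X)"
  have cw: "c \<odot>\<^bsub>dual_module X\<^esub> w \<in> carrier (dual_module X)"
    using D uw by (auto simp: dual_subspace_def)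
  then have "u \<oplus>\<^bsub>dual_module X\<^esub> (c \<odot>\<^bsub>dual_module X\<^esub> w) \<in> carrier (dual_module X)"
    using D uw(1) cw unfolding dual_subspace_def dual_module_simps by blast
  moreover have "G i (u \<oplus>\<^bsub>dual_module X\<^esub> (c \<odot>\<^bsub>dual_module X\<^esub> w)) = G i u + c * G i w" if "i < n" for i
    using dual_carrierD(2)[OF G[OF that] uw(1) cw] dual_carrierD(3)[OF G[OF that] uw(2), of c] by simp
  ultimately show "\<exists>x\<in>carrier (dual_module X). \<forall>i<n. G i x = G i u + c * G i w" by blast
qed

text \<open>Independent functionals on the dual have a dual family inside the dual, which is itself
  independent and hence has at most d members.\<close>

lemma dual_dual_independent_le:
  assumes X: "lin_closed X" and B: "fbasis (carrier (dual_module X)) (carrier X) d B"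
    and G: "\<And>i. i < n \<Longrightarrow> G i \<in> carrier (dual_module (dual_module X))"
    and ind: "independent_on (carrier (dual_module X)) n G"
  shows "n \<le> d"
proof -
  obtain f where f: "\<And>j. j < n \<Longrightarrow> f j \<in> carrier (dual_module X)"
    "\<And>i j. i < n \<Longrightarrow> j < n \<Longrightarrow> G i (f j) = (if i = j then 1 else 0)"
    using dual_dual_family[OF X G ind] by blast
  have ind': "independent_on (carrier X) n f"
  proof (rule independent_onI)
    fix c i assume c: "\<And>v. v \<in> carrier X \<Longrightarrow> (\<Sum>i<n. c i * f i v) = 0" and i: "i < n"
    have eq: "(\<lambda>v\<in>carrier X. \<Sum>i<n. c i * f i v) = (\<lambda>v\<in>carrier X. \<Sum>j<n. 0 * f j v)"
      using c by (auto simp: restrict_def)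
    have "(\<Sum>j<n. c j * G i (f j)) = G i (\<lambda>v\<in>carrier X. \<Sum>i<n. c i * f i v)"
      by (rule functional_sum[OF X G[OF i] f(1), symmetric])
    also have "\<dots> = (\<Sum>j<n. 0 * G i (f j))"
      unfolding eq by (rule functional_sum[OF X G[OF i] f(1)])
    finally have "(\<Sum>j<n. c j * G i (f j)) = (\<Sum>j<n. 0 * G i (f j))" .
    moreover have "(\<Sum>j<n. c j * G i (f j)) = (\<Sum>j<n. if j = i then c i else 0)"
      by (rule sum.cong) (use f(2) i in auto)
    ultimately show "c i = 0" using i by simp
  qed
  show ?thesis by (rule independent_le_fbasis[OF dual_subspace_carrier[OF X] B f(1) ind'])
qed

section \<open>Upper and lower bounds for the index\<close>

context
  fixes X :: "('a::field, 'v) module" and \<qq> :: "'q set" and act :: "'q \<Rightarrow> ('v \<Rightarrow> 'a) \<Rightarrow> 'v \<Rightarrow> 'a" and d B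
  assumes X: "lin_closed X" and B: "fbasis (carrier (dual_module X)) (carrier X) d B"
    and orbit: "\<And>\<xi>. \<xi> \<in> carrier (dual_module (dual_module X)) \<Longrightarrow>
      dual_subspace (dual_module X) (lie_orbit \<qq> (dual_action (dual_module X) act) \<xi>)"
begin

lemma orbit_basis:
  assumes "\<xi> \<in> carrier (dual_module (dual_module X))"
  shows "\<exists>r x. r \<le> d \<and> vdim (sub_space (dual_module (dual_module X)) (lie_orbit \<qq> (dual_action (dual_module X) act) \<xi>)) = r \<and>
    (\<forall>i<r. x i \<in> \<qq>) \<and> fbasis (lie_orbit \<qq> (dual_action (dual_module X) act) \<xi>) (carrier (dual_module X)) r
      (\<lambda>i. dual_action (dual_module X) act (x i) \<xi>)"
proof -
  define Orb where "Orb = lie_orbit \<qq> (dual_action (dual_module X) act) \<xi>"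
  have Orb: "dual_subspace (dual_module X) Orb" unfolding Orb_def by (rule orbit[OF assms])
  have "\<exists>r F. fbasis Orb (carrier (dual_module X)) r F \<and> r \<le> d"
  proof (rule fbasis_exists)
    fix n and G :: "nat \<Rightarrow> ('v \<Rightarrow> 'a) \<Rightarrow> 'a"
    assume G: "\<And>i. i < n \<Longrightarrow> G i \<in> Orb" "independent_on (carrier (dual_module X)) n G"
    show "n \<le> d"
    proof (rule dual_dual_independent_le[OF X B _ G(2)])
      show "G i \<in> carrier (dual_module (dual_module X))" if "i < n" for i
        using G(1)[OF that] Orb by (auto simp: dual_subspace_def)
    qed
  qed
  then obtain r F where F: "fbasis Orb (carrier (dual_module X)) r F" "r \<le> d" by blast
  have "\<forall>i\<in>{..<r}. \<exists>x. x \<in> \<qq> \<and> F i = dual_action (dual_module X) act x \<xi>"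
    using F(1) by (auto simp: fbasis_def Orb_def lie_orbit_def)
  from bchoice[OF this] obtain x where x: "\<And>i. i < r \<Longrightarrow> x i \<in> \<qq> \<and> F i = dual_action (dual_module X) act (x i) \<xi>" by blast
  have "fbasis Orb (carrier (dual_module X)) r (\<lambda>i. dual_action (dual_module X) act (x i) \<xi>)"
    using F(1) x by (simp add: fbasis_def independent_on_def)
  then show ?thesis using F(2) fbasis_vdim[OF Orb F(1)] x unfolding Orb_def by blast
qed

lemma vdim_dual: "vdim (dual_module X) = d"
proof -
  have "sub_space (dual_module X) (carrier (dual_module X)) = dual_module X" by simp
  then show ?thesis using fbasis_vdim[OF dual_subspace_carrier[OF X] B] by simp
qed

lemma zero_functional: "(\<lambda>v\<in>carrier (dual_module X). 0) \<in> carrier (dual_module (dual_module X))"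
  using dual_subspace_carrier[OF lin_closed_dual[OF X]] by (simp add: dual_subspace_def)

lemma orbit_dims_finite:
  "finite ((\<lambda>\<xi>. vdim (sub_space (dual_module (dual_module X)) (lie_orbit \<qq> (dual_action (dual_module X) act) \<xi>)))
    ` carrier (dual_module (dual_module X)))"
  by (rule finite_subset[of _ "{..d}"]) (use orbit_basis in fastforce)+

text \<open>If the orbit of \<xi> has dimension r, its annihilator has dimension d - r and is
  spanned by c elements, so d <= r + c. An orbit of larger dimension only lowers the index.\<close>

lemma lie_index_le:
  assumes \<xi>: "\<xi> \<in> carrier (dual_module (dual_module X))"
    and ann: "\<And>\<mu>. \<mu> \<in> carrier (dual_module X) \<Longrightarrow> (\<And>x. x \<in> \<qq> \<Longrightarrow> \<xi> (act x \<mu>) = 0) \<Longrightarrow>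
      \<exists>a. \<forall>v\<in>carrier X. \<mu> v = (\<Sum>i<c. a i * \<kappa> i v)"
    and \<kappa>: "\<And>i. i < c \<Longrightarrow> \<kappa> i \<in> carrier (dual_module X)"
  shows "lie_index \<qq> act (dual_module X) \<le> int c"
proof -
  obtain r x where r: "vdim (sub_space (dual_module (dual_module X)) (lie_orbit \<qq> (dual_action (dual_module X) act) \<xi>)) = r"
    and x: "\<And>i. i < r \<Longrightarrow> x i \<in> \<qq>"
    and Fb: "fbasis (lie_orbit \<qq> (dual_action (dual_module X) act) \<xi>) (carrier (dual_module X)) r
      (\<lambda>i. dual_action (dual_module X) act (x i) \<xi>)"
    using orbit_basis[OF \<xi>] by blast
  define o' where "o' = (\<lambda>i. dual_action (dual_module X) act (x i) \<xi>)"
  have oD: "o' i \<in> carrier (dual_module (dual_module X))" if "i < r" for i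
    using orbit[OF \<xi>] x[OF that] by (auto simp: dual_subspace_def o'_def lie_orbit_def)
  have ind: "independent_on (carrier (dual_module X)) r o'" using Fb by (simp add: fbasis_def o'_def)
  obtain f where f: "\<And>j. j < r \<Longrightarrow> f j \<in> carrier (dual_module X)"
    "\<And>i j. i < r \<Longrightarrow> j < r \<Longrightarrow> o' i (f j) = (if i = j then 1 else 0)"
    using dual_dual_family[OF X oD ind] by blast
  define b where "b i = (if i < r then f i else \<kappa> (i - r))" for i
  have "d \<le> r + c"
  proof -
    have span: "\<exists>a. \<forall>v\<in>carrier X. \<mu> v = (\<Sum>i<r + c. a i * b i v)" if \<mu>: "\<mu> \<in> carrier (dual_module X)" for \<mu>
    proof -
      define g where "g i = (if i < r then f i else \<mu>)" for i
      define cc where "cc i = (if i < r then - o' i \<mu> else 1)" for i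
      have g: "g i \<in> carrier (dual_module X)" if "i < Suc r" for i using f(1) \<mu> by (simp add: g_def)
      \<comment> \<open>\<mu> minus its components along the dual family f of the orbit basis; by
        construction the orbit annihilates it.\<close>
      define \<nu> where "\<nu> = (\<lambda>v\<in>carrier X. \<Sum>i<Suc r. cc i * g i v)"
      have \<nu>: "\<nu> \<in> carrier (dual_module X)" unfolding \<nu>_def by (rule dual_sum[OF X g])
      have o\<nu>: "o' i \<nu> = 0" if "i < r" for i
      proof -
        have "o' i \<nu> = (\<Sum>j<Suc r. cc j * o' i (g j))"
          unfolding \<nu>_def by (rule functional_sum[OF X oD[OF that] g])
        also have "\<dots> = (\<Sum>j<r. - o' j \<mu> * o' i (f j)) + o' i \<mu>" by (simp add: cc_def g_def)
        also have "(\<Sum>j<r. - o' j \<mu> * o' i (f j)) = (\<Sum>j<r. if j = i then - o' i \<mu> else 0)"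
          by (rule sum.cong) (use f(2)[OF that] in auto)
        finally show ?thesis using that by simp
      qed
      have "\<xi> (act y \<nu>) = 0" if y: "y \<in> \<qq>" for y
      proof -
        have "dual_action (dual_module X) act y \<xi> \<in> lie_orbit \<qq> (dual_action (dual_module X) act) \<xi>"
          using y by (simp add: lie_orbit_def)
        then obtain a where "dual_action (dual_module X) act y \<xi> \<nu> = (\<Sum>i<r. a i * o' i \<nu>)"
          using Fb \<nu> unfolding fbasis_def o'_def by blast
        then show ?thesis using \<nu> o\<nu> by (simp add: dual_action_def)
      qed
      then obtain a where a: "\<And>v. v \<in> carrier X \<Longrightarrow> \<nu> v = (\<Sum>i<c. a i * \<kappa> i v)" using ann[OF \<nu>] by blast
      define h where "h i = (if i < r then o' i \<mu> else a (i - r))" for i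
      have "\<mu> v = (\<Sum>i<r + c. h i * b i v)" if v: "v \<in> carrier X" for v
      proof -
        have "\<nu> v = \<mu> v - (\<Sum>i<r. o' i \<mu> * f i v)"
          using v by (simp add: \<nu>_def cc_def g_def sum_negf)
        moreover have "(\<Sum>i<r + c. h i * b i v) = (\<Sum>i<r. h i * b i v) + (\<Sum>i<c. h (r + i) * b (r + i) v)"
          by (induction c) (simp_all add: add.assoc)
        ultimately show ?thesis using a[OF v] by (simp add: h_def b_def)
      qed
      then show ?thesis by blast
    qed
    have bD: "b i \<in> carrier (dual_module X)" if "i < r + c" for i using f(1) \<kappa> that by (simp add: b_def)
    have Bind: "independent_on (carrier X) d B" and BW: "\<And>i. i < d \<Longrightarrow> B i \<in> carrier (dual_module X)"
      using B by (auto simp: fbasis_def)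
    show ?thesis
    proof -
      interpret D: vectorspace "class_ring :: 'a ring" "dual_module X"
        using dual_subspace_vectorspace[OF dual_subspace_carrier[OF X]] by simp
      have S: "b ` {..<r + c} \<subseteq> carrier (dual_module X)" using bD by auto
      have "carrier (dual_module X) \<subseteq> D.span (b ` {..<r + c})"
      proof
        fix \<mu> assume \<mu>: "\<mu> \<in> carrier (dual_module X)"
        then obtain a where a: "\<And>v. v \<in> carrier X \<Longrightarrow> \<mu> v = (\<Sum>i<r + c. a i * b i v)" using span by blast
        define a' where "a' f = (\<Sum>i | i < r + c \<and> b i = f. a i)" for f
        have "D.lincomb a' (b ` {..<r + c}) = (\<lambda>v\<in>carrier X. \<Sum>f\<in>b ` {..<r + c}. a' f * f v)"
          using dual_lincomb[OF dual_subspace_carrier[OF X] _ S] by simp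
        also have "\<dots> = (\<lambda>v\<in>carrier X. \<Sum>i<r + c. a i * b i v)"
        proof (rule restrict_ext)
          fix v
          have "(\<Sum>f\<in>b ` {..<r + c}. a' f * f v) = (\<Sum>f\<in>b ` {..<r + c}. \<Sum>i | i < r + c \<and> b i = f. a i * b i v)"
            by (rule sum.cong) (auto simp: a'_def sum_distrib_right)
          also have "\<dots> = (\<Sum>i<r + c. a i * b i v)"
            using sum.image_gen[of "{..<r + c}" "\<lambda>i. a i * b i v" b] by simp
          finally show "(\<Sum>f\<in>b ` {..<r + c}. a' f * f v) = (\<Sum>i<r + c. a i * b i v)" .
        qed
        also have "\<dots> = \<mu>"
          by (rule dual_eqI[OF dual_sum[OF X bD] \<mu>]) (use a in auto)
        finally show "\<mu> \<in> D.span (b ` {..<r + c})" using D.finite_span[of "b ` {..<r + c}"] S by auto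
      qed
      moreover have "D.span (b ` {..<r + c}) \<subseteq> carrier (dual_module X)" using D.span_is_subset2[OF S] .
      ultimately have "D.dim \<le> card (b ` {..<r + c})" using D.gen_ge_dim[OF _ S] by blast
      also have "\<dots> \<le> r + c" using card_image_le[of "{..<r + c}" b] by simp
      finally show ?thesis using vdim_dual by simp
    qed
  qed
  moreover have "r \<le> Max ((\<lambda>\<xi>. vdim (sub_space (dual_module (dual_module X)) (lie_orbit \<qq> (dual_action (dual_module X) act) \<xi>)))
    ` carrier (dual_module (dual_module X)))"
    by (rule Max_ge[OF orbit_dims_finite]) (use \<xi> r in auto)
  ultimately show ?thesis unfolding lie_index_def vdim_dual by linarith
qed

text \<open>The bound is asked at every point, so it holds at a point where the maximal orbit
  dimension is attained. Independence is phrased through \<xi> (x \<mu>), the sign of the dual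
  action being immaterial.\<close>

lemma lie_index_ge:
  assumes "\<And>\<xi> r x. \<xi> \<in> carrier (dual_module (dual_module X)) \<Longrightarrow> (\<And>i. i < r \<Longrightarrow> x i \<in> \<qq>) \<Longrightarrow>
    independent_on (carrier (dual_module X)) r (\<lambda>i \<mu>. \<xi> (act (x i) \<mu>)) \<Longrightarrow> r + c \<le> d"
  shows "int c \<le> lie_index \<qq> act (dual_module X)"
proof -
  have bound: "vdim (sub_space (dual_module (dual_module X)) (lie_orbit \<qq> (dual_action (dual_module X) act) \<xi>)) + c \<le> d"
    if \<xi>: "\<xi> \<in> carrier (dual_module (dual_module X))" for \<xi>
  proof -
    obtain r x where r: "vdim (sub_space (dual_module (dual_module X)) (lie_orbit \<qq> (dual_action (dual_module X) act) \<xi>)) = r"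
      and x: "\<And>i. i < r \<Longrightarrow> x i \<in> \<qq>"
      and Fb: "fbasis (lie_orbit \<qq> (dual_action (dual_module X) act) \<xi>) (carrier (dual_module X)) r
        (\<lambda>i. dual_action (dual_module X) act (x i) \<xi>)"
      using orbit_basis[OF \<xi>] by blast
    have "independent_on (carrier (dual_module X)) r (\<lambda>i \<mu>. \<xi> (act (x i) \<mu>))"
    proof (rule independent_onI)
      fix a i assume a: "\<And>\<mu>. \<mu> \<in> carrier (dual_module X) \<Longrightarrow> (\<Sum>i<r. a i * \<xi> (act (x i) \<mu>)) = 0" and i: "i < r"
      have ind: "independent_on (carrier (dual_module X)) r (\<lambda>i. dual_action (dual_module X) act (x i) \<xi>)"
        using Fb by (simp add: fbasis_def)
      show "a i = 0"
        by (rule independent_onD[OF ind _ i]) (use a in \<open>simp add: dual_action_def sum_negf\<close>)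
    qed
    then show ?thesis using assms[OF \<xi> x] r by simp
  qed
  have "Max ((\<lambda>\<xi>. vdim (sub_space (dual_module (dual_module X)) (lie_orbit \<qq> (dual_action (dual_module X) act) \<xi>)))
    ` carrier (dual_module (dual_module X))) \<in> ((\<lambda>\<xi>. vdim (sub_space (dual_module (dual_module X)) (lie_orbit \<qq> (dual_action (dual_module X) act) \<xi>)))
    ` carrier (dual_module (dual_module X)))"
    by (rule Max_in[OF orbit_dims_finite]) (use zero_functional in blast)
  then obtain \<xi> where "\<xi> \<in> carrier (dual_module (dual_module X))"
    "Max ((\<lambda>\<xi>. vdim (sub_space (dual_module (dual_module X)) (lie_orbit \<qq> (dual_action (dual_module X) act) \<xi>)))
    ` carrier (dual_module (dual_module X))) = vdim (sub_space (dual_module (dual_module X)) (lie_orbit \<qq> (dual_action (dual_module X) act) \<xi>))"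
    by blast
  then show ?thesis using bound unfolding lie_index_def vdim_dual by force
qed

end

section \<open>Nilpotent vectors\<close>

text \<open>The generating sets already form a base: the intersection of two of them is the
  nonvanishing set of a product.\<close>

lemma zariski_neighbourhood:
  assumes "openin (zariski V) U" "x \<in> U"
  shows "\<exists>f\<in>poly_funs V. x \<in> carrier V \<and> f x \<noteq> 0 \<and> {v \<in> carrier V. f v \<noteq> 0} \<subseteq> U"
proof -
  have "generate_topology_on {{v \<in> carrier V. f v \<noteq> 0} |f. f \<in> poly_funs V} U"
    using assms(1) by (simp add: zariski_def openin_topology_generated_by_iff)
  then show ?thesis using assms(2)
  proof (induction U arbitrary: x rule: generate_topology_on.induct)
    case Empty
    then show ?case by simp
  next
    case (Int a b)
    obtain f g where "f \<in> poly_funs V" "x \<in> carrier V" "f x \<noteq> 0" "{v \<in> carrier V. f v \<noteq> 0} \<subseteq> a"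
      "g \<in> poly_funs V" "g x \<noteq> 0" "{v \<in> carrier V. g v \<noteq> 0} \<subseteq> b"
      using Int.IH[of x] Int.prems by blast
    then show ?case
      by (intro bexI[of _ "\<lambda>v. f v * g v"] poly_funs.mult) auto
  next
    case (UN K)
    then obtain k where "k \<in> K" "x \<in> k" by blast
    then show ?case using UN.IH[of k x] by blast
  next
    case (Basis s)
    then show ?case by blast
  qed
qed

lemma zariski_topspace:
  fixes V :: "('a::field, 'v) module"
  shows "topspace (zariski V) = carrier V"
proof -
  have c: "carrier V \<in> {{v \<in> carrier V. f v \<noteq> 0} |f. f \<in> poly_funs V}"
    by (rule CollectI, intro exI[of _ "\<lambda>_. 1"] conjI poly_funs.const) simp
  have "\<Union> {{v \<in> carrier V. f v \<noteq> 0} |f. f \<in> poly_funs V} \<subseteq> carrier V" by auto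
  then show ?thesis unfolding zariski_def topology_generated_by_topspace
    using Union_upper[OF c] by (rule equalityI)
qed

lemma dual_carrier_smult:
  "f \<in> carrier (dual_module V) \<Longrightarrow> v \<in> carrier V \<Longrightarrow> f (c \<odot>\<^bsub>V\<^esub> v) = c * f v"
  by (simp add: dual_module_def)

text \<open>h is the derivative of f along the left-invariant vector field of X, read off as the
  linear coefficient of f on the line g + s g X.\<close>

definition curve_derivative :: "nat \<Rightarrow> 'a::field mat \<Rightarrow> ('a mat \<Rightarrow> 'a) \<Rightarrow> ('a mat \<Rightarrow> 'a) \<Rightarrow> bool" where
  "curve_derivative N X f h \<longleftrightarrow> (\<forall>g\<in>carrier_mat N N.
     \<exists>q. (\<forall>s. poly q s = f (g + s \<cdot>\<^sub>m (g * X))) \<and> coeff q 0 = f g \<and> coeff q 1 = h g)"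

lemma matrix_space_simps [simp]: "carrier (module_mat TYPE('a::field) N N) = carrier_mat N N"
  "add (module_mat TYPE('a) N N) = (+)" "smult (module_mat TYPE('a) N N) = (\<cdot>\<^sub>m)"
  "zero (module_mat TYPE('a) N N) = 0\<^sub>m N N"
  for N :: nat by (simp_all add: module_mat_def)

text \<open>Suppose t^K f equals p (t) along the one-parameter group generated by X. Since X acts
  there as t d/dt, t^K times the derivative of f by X equals t p' - K p.\<close>

definition euler :: "nat \<Rightarrow> 'a::field poly \<Rightarrow> 'a poly" where
  "euler K p = [:0, 1:] * pderiv p - [:of_nat K:] * p"

lemma linear_matrix:
  assumes "f \<in> carrier (dual_module (matrix_space N))"
  shows "A \<in> carrier_mat N N \<Longrightarrow> B \<in> carrier_mat N N \<Longrightarrow> f (A + B) = f A + f B"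
    "A \<in> carrier_mat N N \<Longrightarrow> f (c \<cdot>\<^sub>m A) = c * f A"
    "A \<in> carrier_mat N N \<Longrightarrow> B \<in> carrier_mat N N \<Longrightarrow> f (A - B) = f A - f B"
proof -
  show a: "A \<in> carrier_mat N N \<Longrightarrow> B \<in> carrier_mat N N \<Longrightarrow> f (A + B) = f A + f B" for A B
    using assms by (auto simp: dual_module_def)
  show s: "A \<in> carrier_mat N N \<Longrightarrow> f (c \<cdot>\<^sub>m A) = c * f A" for A c
    using assms by (auto simp: dual_module_def)
  assume AB: "A \<in> carrier_mat N N" "B \<in> carrier_mat N N"
  have "A - B = A + (-1) \<cdot>\<^sub>m B" using AB by auto
  then show "f (A - B) = f A - f B" using AB a[of A "(-1) \<cdot>\<^sub>m B"] s[of B "-1"] by simp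
qed

lemma linear_matrix_multiple:
  assumes f: "f \<in> carrier (dual_module (matrix_space N))" and X: "X \<in> carrier_mat N N"
  shows "(\<lambda>A\<in>carrier_mat N N. f (A * X)) \<in> carrier (dual_module (matrix_space N))"
    "(\<lambda>A\<in>carrier_mat N N. f (X * A)) \<in> carrier (dual_module (matrix_space N))"
proof -
  note l = linear_matrix[OF f]
  have "f ((A + B) * X) = f (A * X) + f (B * X)" "f (X * (A + B)) = f (X * A) + f (X * B)"
    if "A \<in> carrier_mat N N" "B \<in> carrier_mat N N" for A B
    using that X l(1)[of "A * X" "B * X"] l(1)[of "X * A" "X * B"]
    by (simp_all add: add_mult_distrib_mat[of A N N B X N] mult_add_distrib_mat[of X N N A N B])
  moreover have "f ((c \<cdot>\<^sub>m A) * X) = c * f (A * X)" "f (X * (c \<cdot>\<^sub>m A)) = c * f (X * A)"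
    if "A \<in> carrier_mat N N" for A c
    using that X l(2)[of "A * X" c] l(2)[of "X * A" c]
    by (simp_all add: mult_smult_assoc_mat[of A N N X N] mult_smult_distrib[of X N N A N])
  ultimately show "(\<lambda>A\<in>carrier_mat N N. f (A * X)) \<in> carrier (dual_module (matrix_space N))"
    "(\<lambda>A\<in>carrier_mat N N. f (X * A)) \<in> carrier (dual_module (matrix_space N))"
    by (simp_all add: dual_module_def)
qed

lemma poly_funs_left_translate:
  assumes "f \<in> poly_funs (matrix_space N)" "X \<in> carrier_mat N N"
  shows "\<exists>h\<in>poly_funs (matrix_space N). \<forall>A\<in>carrier_mat N N. h A = f (X * A)"
  using assms(1)
proof (induction rule: poly_funs.induct)
  case (const c)
  then show ?case by (intro bexI[of _ "\<lambda>_. c"] poly_funs.const) simp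
next
  case (linear f)
  show ?case
    by (intro bexI[OF _ poly_funs.linear[OF linear_matrix_multiple(2)[OF linear assms(2)]]]) simp
next
  case (add f g)
  then obtain h h' where "h \<in> poly_funs (matrix_space N)" "h' \<in> poly_funs (matrix_space N)"
    "\<forall>A\<in>carrier_mat N N. h A = f (X * A)" "\<forall>A\<in>carrier_mat N N. h' A = g (X * A)" by blast
  then show ?case by (intro bexI[OF _ poly_funs.add[of h _ h']]) auto
next
  case (mult f g)
  then obtain h h' where "h \<in> poly_funs (matrix_space N)" "h' \<in> poly_funs (matrix_space N)"
    "\<forall>A\<in>carrier_mat N N. h A = f (X * A)" "\<forall>A\<in>carrier_mat N N. h' A = g (X * A)" by blast
  then show ?case by (intro bexI[OF _ poly_funs.mult[of h _ h']]) auto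
qed

lemma coeff_mult_1: "coeff (p * q) 1 = coeff p 0 * coeff q 1 + coeff p 1 * coeff q 0"
  by (simp add: coeff_mult)

lemma coeff_mult_0': "coeff (p * q) 0 = coeff p 0 * coeff q 0"
  by (simp add: coeff_mult)

lemma euler_mult: "euler (K + L) (p * q) = euler K p * q + p * euler L q"
proof -
  have "[:of_nat (K + L):] = [:of_nat K:] + ([:of_nat L:] :: 'a poly)" by simp
  then show ?thesis unfolding euler_def pderiv_mult by (simp only: algebra_simps)
qed

lemma euler_power_X: "euler L ([:0, 1:] ^ L) = (0 :: 'a::field poly)"
proof (induction L)
  case 0
  show ?case by (simp add: euler_def)
next
  case (Suc L)
  have "euler 1 [:0, 1 :: 'a:] = 0" by (simp add: euler_def pderiv_pCons)
  then show ?case using euler_mult[of 1 L "[:0, 1 :: 'a:]" "[:0, 1:] ^ L"] Suc by simp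
qed

lemma euler_shift: "euler (K + L) ([:0, 1:] ^ L * p) = [:0, 1:] ^ L * euler K p"
  using euler_mult[of L K "[:0, 1:] ^ L" p] by (simp only: euler_power_X add.commute mult_zero_left add_0_left)

lemma euler_add: "euler K (p + q) = euler K p + euler K q"
  by (simp add: euler_def pderiv_add distrib_left)

section \<open>One-parameter subgroups inside closed subgroups\<close>

context
  fixes N :: nat and Q1 Q3 :: "'a::{field_char_0} mat"
  assumes Q: "Q1 \<in> carrier_mat N N" "Q3 \<in> carrier_mat N N"
    and QQ: "Q1 * Q1 = Q1" "Q3 * Q3 = Q3" "Q1 * Q3 = 0\<^sub>m N N" "Q3 * Q1 = 0\<^sub>m N N"
begin

text \<open>The cocharacter with weight 1 on the image of Q3, weight -1 on that of Q1 and weight 0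
  elsewhere; its derivative at t = 1 is Q3 - Q1. Its entries are Laurent polynomials, so no
  exponential is involved.\<close>

definition "one_parameter t = t \<cdot>\<^sub>m Q3 + ((1 / t) \<cdot>\<^sub>m Q1 + (1\<^sub>m N - Q1 - Q3))"

lemmas carriers = add_carrier_mat smult_carrier_mat minus_carrier_mat mult_carrier_mat[of _ N N _ N] one_carrier_mat Q

lemma one_parameter_carrier: "one_parameter t \<in> carrier_mat N N"
  unfolding one_parameter_def by (intro carriers)

lemma one_parameter_1: "one_parameter 1 = 1\<^sub>m N"
  unfolding one_parameter_def by (rule eq_matI) (use Q in auto)

lemma fmatrix_hom:
  assumes "A \<in> carrier_mat N N" "B \<in> carrier_mat N N"
  shows "fmatrix_of_mat (A * B) = fmatrix_of_mat A * (fmatrix_of_mat B :: 'a fmatrix)"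
    "fmatrix_of_mat (A + B) = fmatrix_of_mat A + (fmatrix_of_mat B :: 'a fmatrix)"
    "fmatrix_of_mat (A - B) = fmatrix_of_mat A - (fmatrix_of_mat B :: 'a fmatrix)"
    "fmatrix_of_mat (c \<cdot>\<^sub>m A) = (scale c (fmatrix_of_mat A) :: 'a fmatrix)"
  using fmatrix_of_mat_hom[OF assms] by auto

lemma Q_fmatrix:
  "fmatrix_of_mat Q1 * fmatrix_of_mat Q1 = fmatrix_of_mat Q1" "fmatrix_of_mat Q3 * fmatrix_of_mat Q3 = fmatrix_of_mat Q3"
  "fmatrix_of_mat Q1 * fmatrix_of_mat Q3 = 0" "fmatrix_of_mat Q3 * fmatrix_of_mat Q1 = 0"
  using fmatrix_hom(1)[OF Q(1) Q(1)] fmatrix_hom(1)[OF Q(2) Q(2)] fmatrix_hom(1)[OF Q(1) Q(2)] fmatrix_hom(1)[OF Q(2) Q(1)]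
  by (simp_all add: QQ fmatrix_of_mat_hom(6)[OF Q(1) Q(1)])

lemma one_fmatrix: "A \<in> carrier_mat N N \<Longrightarrow> fmatrix_of_mat (1\<^sub>m N) * fmatrix_of_mat A = (fmatrix_of_mat A :: 'a fmatrix)"
  "A \<in> carrier_mat N N \<Longrightarrow> fmatrix_of_mat A * fmatrix_of_mat (1\<^sub>m N) = (fmatrix_of_mat A :: 'a fmatrix)"
  using fmatrix_hom(1)[of "1\<^sub>m N" A] fmatrix_hom(1)[of A "1\<^sub>m N"] by auto

lemma one_parameter_fmatrix: "fmatrix_of_mat (one_parameter t) = scale t (fmatrix_of_mat Q3) +
    (scale (1 / t) (fmatrix_of_mat Q1) + (fmatrix_of_mat (1\<^sub>m N) - fmatrix_of_mat Q1 - fmatrix_of_mat Q3))"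
proof -
  have c: "1\<^sub>m N - Q1 \<in> carrier_mat N N" "1\<^sub>m N - Q1 - Q3 \<in> carrier_mat N N" "t \<cdot>\<^sub>m Q3 \<in> carrier_mat N N"
    "(1 / t) \<cdot>\<^sub>m Q1 \<in> carrier_mat N N" "(1 / t) \<cdot>\<^sub>m Q1 + (1\<^sub>m N - Q1 - Q3) \<in> carrier_mat N N"
    by (intro carriers)+
  show ?thesis unfolding one_parameter_def
    by (simp only: fmatrix_hom(2)[OF c(3,5)] fmatrix_hom(2)[OF c(4,2)] fmatrix_hom(3)[OF c(1) Q(2)]
      fmatrix_hom(3)[OF one_carrier_mat Q(1)] fmatrix_hom(4)[OF Q(1) Q(1)] fmatrix_hom(4)[OF Q(2) Q(2)])
qed

lemma one_parameter_mult:
  assumes t: "t \<noteq> 0"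
  shows "one_parameter t * (Q3 - Q1) = t \<cdot>\<^sub>m Q3 - (1 / t) \<cdot>\<^sub>m Q1"
proof (rule fmatrix_of_mat_inj[of _ N])
  have c: "Q3 - Q1 \<in> carrier_mat N N" "t \<cdot>\<^sub>m Q3 \<in> carrier_mat N N" "(1 / t) \<cdot>\<^sub>m Q1 \<in> carrier_mat N N"
    by (intro carriers)+
  show "one_parameter t * (Q3 - Q1) \<in> carrier_mat N N" by (intro carriers one_parameter_carrier)
  show "t \<cdot>\<^sub>m Q3 - (1 / t) \<cdot>\<^sub>m Q1 \<in> carrier_mat N N" by (intro carriers)
  show "fmatrix_of_mat (one_parameter t * (Q3 - Q1)) = fmatrix_of_mat (t \<cdot>\<^sub>m Q3 - (1 / t) \<cdot>\<^sub>m Q1)"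
    unfolding fmatrix_hom(1)[OF one_parameter_carrier c(1)] fmatrix_hom(3)[OF c(2,3)] fmatrix_hom(3)[OF Q(2,1)]
      fmatrix_hom(4)[OF Q(1) Q(1)] fmatrix_hom(4)[OF Q(2) Q(2)] one_parameter_fmatrix
    by (simp add: distrib_left distrib_right left_diff_distrib right_diff_distrib Q_fmatrix one_fmatrix Q)
qed

lemma one_parameter_inverse:
  assumes t: "t \<noteq> 0"
  shows "one_parameter t * one_parameter (1 / t) = 1\<^sub>m N"
proof (rule fmatrix_of_mat_inj[of _ N])
  show "one_parameter t * one_parameter (1 / t) \<in> carrier_mat N N" by (intro carriers one_parameter_carrier)
  show "fmatrix_of_mat (one_parameter t * one_parameter (1 / t)) = fmatrix_of_mat (1\<^sub>m N)"
    unfolding fmatrix_hom(1)[OF one_parameter_carrier one_parameter_carrier] one_parameter_fmatrix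
    using t by (simp add: distrib_left distrib_right left_diff_distrib right_diff_distrib Q_fmatrix one_fmatrix Q)
qed simp

text \<open>Induction over the generation of polynomial functions: the factor t^K clears the
  negative powers, and both the derivative and \<open>euler\<close> satisfy the Leibniz
  rule.\<close>

lemma poly_funs_curve:
  assumes "f \<in> poly_funs (matrix_space N)"
  shows "\<exists>h\<in>poly_funs (matrix_space N). \<exists>K p. curve_derivative N (Q3 - Q1) f h \<and>
    (\<forall>t. t \<noteq> 0 \<longrightarrow> t ^ K * f (one_parameter t) = poly p t \<and> t ^ K * h (one_parameter t) = poly (euler K p) t)"
  using assms
proof (induction rule: poly_funs.induct)
  case (const c)
  have "curve_derivative N (Q3 - Q1) (\<lambda>_. c) (\<lambda>_. 0)"
    unfolding curve_derivative_def by (intro ballI exI[of _ "[:c:]"]) simp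
  then show ?case
    by (intro bexI[OF _ poly_funs.const[of 0]] exI[of _ 0] exI[of _ "[:c:]"]) (simp add: euler_def)
next
  case (linear f)
  note l = linear_matrix[OF linear]
  have X: "Q3 - Q1 \<in> carrier_mat N N" by (intro carriers)
  define h where "h = (\<lambda>A\<in>carrier_mat N N. f (A * (Q3 - Q1)))"
  have "curve_derivative N (Q3 - Q1) f h"
    unfolding curve_derivative_def
  proof
    fix g :: "'a mat" assume g: "g \<in> carrier_mat N N"
    have gX: "g * (Q3 - Q1) \<in> carrier_mat N N" by (rule mult_carrier_mat[OF g X])
    show "\<exists>q. (\<forall>s. poly q s = f (g + s \<cdot>\<^sub>m (g * (Q3 - Q1)))) \<and> coeff q 0 = f g \<and> coeff q 1 = h g"
      using g gX l(1)[OF g, of "s \<cdot>\<^sub>m (g * (Q3 - Q1))" for s] l(2)[OF gX]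
      by (intro exI[of _ "[:f g, f (g * (Q3 - Q1)):]"]) (simp add: h_def)
  qed
  moreover have "t ^ 1 * f (one_parameter t) = poly [:f Q1, f (1\<^sub>m N - Q1 - Q3), f Q3:] t \<and>
      t ^ 1 * h (one_parameter t) = poly (euler 1 [:f Q1, f (1\<^sub>m N - Q1 - Q3), f Q3:]) t" if t: "t \<noteq> 0" for t
  proof
    have c: "1\<^sub>m N - Q1 - Q3 \<in> carrier_mat N N" "t \<cdot>\<^sub>m Q3 \<in> carrier_mat N N"
      "(1 / t) \<cdot>\<^sub>m Q1 \<in> carrier_mat N N" "(1 / t) \<cdot>\<^sub>m Q1 + (1\<^sub>m N - Q1 - Q3) \<in> carrier_mat N N"
      by (intro carriers)+
    have "f (one_parameter t) = t * f Q3 + ((1 / t) * f Q1 + f (1\<^sub>m N - Q1 - Q3))"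
      unfolding one_parameter_def
      by (simp only: l(1)[OF c(2,4)] l(1)[OF c(3,1)] l(2)[OF Q(1)] l(2)[OF Q(2)])
    then show "t ^ 1 * f (one_parameter t) = poly [:f Q1, f (1\<^sub>m N - Q1 - Q3), f Q3:] t"
      using t by (simp add: algebra_simps)
    have "h (one_parameter t) = f (t \<cdot>\<^sub>m Q3 - (1 / t) \<cdot>\<^sub>m Q1)"
      using one_parameter_carrier[of t] by (simp add: h_def one_parameter_mult[OF t])
    also have "\<dots> = t * f Q3 - (1 / t) * f Q1"
      by (simp only: l(3)[OF c(2,3)] l(2)[OF Q(1)] l(2)[OF Q(2)])
    finally have "h (one_parameter t) = t * f Q3 - (1 / t) * f Q1" .
    show "t ^ 1 * h (one_parameter t) = poly (euler 1 [:f Q1, f (1\<^sub>m N - Q1 - Q3), f Q3:]) t"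
      unfolding \<open>h (one_parameter t) = t * f Q3 - (1 / t) * f Q1\<close> using t by (simp add: euler_def pderiv_pCons right_diff_distrib)
  qed
  moreover have "h \<in> poly_funs (matrix_space N)"
    unfolding h_def by (rule poly_funs.linear[OF linear_matrix_multiple(1)[OF linear X]])
  ultimately show ?case by blast
next
  case (add f g)
  obtain h K p where 1: "h \<in> poly_funs (matrix_space N)" "curve_derivative N (Q3 - Q1) f h"
    "\<And>t. t \<noteq> 0 \<Longrightarrow> t ^ K * f (one_parameter t) = poly p t \<and> t ^ K * h (one_parameter t) = poly (euler K p) t"
    using add.IH(1) by blast
  obtain h' L q where 2: "h' \<in> poly_funs (matrix_space N)" "curve_derivative N (Q3 - Q1) g h'"
    "\<And>t. t \<noteq> 0 \<Longrightarrow> t ^ L * g (one_parameter t) = poly q t \<and> t ^ L * h' (one_parameter t) = poly (euler L q) t"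
    using add.IH(2) by blast
  have "curve_derivative N (Q3 - Q1) (\<lambda>v. f v + g v) (\<lambda>v. h v + h' v)"
    unfolding curve_derivative_def
  proof
    fix A :: "'a mat" assume A: "A \<in> carrier_mat N N"
    obtain a where "\<forall>s. poly a s = f (A + s \<cdot>\<^sub>m (A * (Q3 - Q1)))" "coeff a 0 = f A" "coeff a 1 = h A"
      using 1(2) A unfolding curve_derivative_def by blast
    moreover obtain b where "\<forall>s. poly b s = g (A + s \<cdot>\<^sub>m (A * (Q3 - Q1)))" "coeff b 0 = g A" "coeff b 1 = h' A"
      using 2(2) A unfolding curve_derivative_def by blast
    ultimately show "\<exists>q. (\<forall>s. poly q s = f (A + s \<cdot>\<^sub>m (A * (Q3 - Q1))) + g (A + s \<cdot>\<^sub>m (A * (Q3 - Q1)))) \<and>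
        coeff q 0 = f A + g A \<and> coeff q 1 = h A + h' A"
      by (intro exI[of _ "a + b"]) simp
  qed
  moreover have "t ^ (K + L) * (f (one_parameter t) + g (one_parameter t)) = poly ([:0, 1:] ^ L * p + [:0, 1:] ^ K * q) t \<and>
      t ^ (K + L) * (h (one_parameter t) + h' (one_parameter t)) = poly (euler (K + L) ([:0, 1:] ^ L * p + [:0, 1:] ^ K * q)) t"
    if t: "t \<noteq> 0" for t
  proof
    show "t ^ (K + L) * (f (one_parameter t) + g (one_parameter t)) = poly ([:0, 1:] ^ L * p + [:0, 1:] ^ K * q) t"
      using 1(3)[OF t] 2(3)[OF t]
      by (simp add: poly_power power_add distrib_left mult.assoc mult.left_commute[of "t ^ K" "t ^ L"])
    have "euler (K + L) ([:0, 1:] ^ L * p + [:0, 1:] ^ K * q) = [:0, 1:] ^ L * euler K p + [:0, 1:] ^ K * euler L q"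
      using euler_shift[of K L p] euler_shift[of L K q] by (simp add: euler_add add.commute)
    then show "t ^ (K + L) * (h (one_parameter t) + h' (one_parameter t)) = poly (euler (K + L) ([:0, 1:] ^ L * p + [:0, 1:] ^ K * q)) t"
      using 1(3)[OF t] 2(3)[OF t]
      by (simp add: poly_power power_add distrib_left mult.assoc mult.left_commute[of "t ^ K" "t ^ L"])
  qed
  ultimately show ?case using poly_funs.add[OF 1(1) 2(1)] by blast
next
  case (mult f g)
  obtain h K p where 1: "h \<in> poly_funs (matrix_space N)" "curve_derivative N (Q3 - Q1) f h"
    "\<And>t. t \<noteq> 0 \<Longrightarrow> t ^ K * f (one_parameter t) = poly p t \<and> t ^ K * h (one_parameter t) = poly (euler K p) t"
    using mult.IH(1) by blast
  obtain h' L q where 2: "h' \<in> poly_funs (matrix_space N)" "curve_derivative N (Q3 - Q1) g h'"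
    "\<And>t. t \<noteq> 0 \<Longrightarrow> t ^ L * g (one_parameter t) = poly q t \<and> t ^ L * h' (one_parameter t) = poly (euler L q) t"
    using mult.IH(2) by blast
  have "curve_derivative N (Q3 - Q1) (\<lambda>v. f v * g v) (\<lambda>v. h v * g v + f v * h' v)"
    unfolding curve_derivative_def
  proof
    fix A :: "'a mat" assume A: "A \<in> carrier_mat N N"
    obtain a where "\<forall>s. poly a s = f (A + s \<cdot>\<^sub>m (A * (Q3 - Q1)))" "coeff a 0 = f A" "coeff a 1 = h A"
      using 1(2) A unfolding curve_derivative_def by blast
    moreover obtain b where "\<forall>s. poly b s = g (A + s \<cdot>\<^sub>m (A * (Q3 - Q1)))" "coeff b 0 = g A" "coeff b 1 = h' A"
      using 2(2) A unfolding curve_derivative_def by blast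
    ultimately show "\<exists>q. (\<forall>s. poly q s = f (A + s \<cdot>\<^sub>m (A * (Q3 - Q1))) * g (A + s \<cdot>\<^sub>m (A * (Q3 - Q1)))) \<and>
        coeff q 0 = f A * g A \<and> coeff q 1 = h A * g A + f A * h' A"
      unfolding coeff_mult_1 coeff_mult_0'
      by (intro exI[of _ "a * b"]) (simp only: coeff_mult_1 coeff_mult_0' poly_mult, simp)
  qed
  moreover have "t ^ (K + L) * (f (one_parameter t) * g (one_parameter t)) = poly (p * q) t \<and>
      t ^ (K + L) * (h (one_parameter t) * g (one_parameter t) + f (one_parameter t) * h' (one_parameter t)) = poly (euler (K + L) (p * q)) t"
    if t: "t \<noteq> 0" for t
  proof -
    have a: "poly p t = t ^ K * f (one_parameter t)" "poly (euler K p) t = t ^ K * h (one_parameter t)"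
      "poly q t = t ^ L * g (one_parameter t)" "poly (euler L q) t = t ^ L * h' (one_parameter t)"
      using 1(3)[OF t] 2(3)[OF t] by auto
    show ?thesis unfolding euler_mult poly_mult poly_add a by (simp add: power_add algebra_simps)
  qed
  moreover have "(\<lambda>v. h v * g v + f v * h' v) \<in> poly_funs (matrix_space N)"
    by (intro poly_funs.add poly_funs.mult 1 2 mult.hyps)
  ultimately show ?case by blast
qed

text \<open>In characteristic zero t p' vanishes at 1 to exactly one order less than p, and the
  multiple K p vanishes to at least the order of p, so the lower order survives.\<close>

lemma order_euler:
  assumes p: "(p :: 'a poly) \<noteq> 0" and z: "poly p 1 = 0"
  shows "euler K p \<noteq> 0" "order 1 (euler K p) < order 1 p"
proof -
  define n where "n = order 1 p"
  have n0: "n \<noteq> 0" using p z order_root[of p 1] by (simp add: n_def)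
  have dp: "pderiv p \<noteq> 0"
  proof
    assume "pderiv p = 0"
    then obtain c where "p = [:c:]" using pderiv_eq_0_iff[of p] degree_eq_zeroE[of p] by metis
    then show False using p z by simp
  qed
  have o: "order 1 p = Suc (order 1 (pderiv p))" using order_pderiv[OF p z] .
  have X: "[:0, 1:] * pderiv p \<noteq> 0" using dp by simp
  have "order 1 [:0, 1 :: 'a:] = 0" by (simp add: order_0I)
  then have oX: "order 1 ([:0, 1:] * pderiv p) = order 1 (pderiv p)" using order_mult[OF X] by simp
  have nd: "\<not> [:- 1, 1:] ^ n dvd euler K p"
  proof
    assume "[:- 1, 1:] ^ n dvd euler K p"
    moreover have "[:- 1, 1:] ^ n dvd [:of_nat K:] * p" unfolding n_def by (intro dvd_mult order_1)
    ultimately have "[:- 1, 1:] ^ n dvd euler K p + [:of_nat K:] * p" by (rule dvd_add)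
    then have "[:- 1, 1:] ^ n dvd [:0, 1:] * pderiv p" by (simp only: euler_def diff_add_cancel)
    then have "n \<le> order 1 ([:0, 1:] * pderiv p)" using X by (simp add: order_divides)
    then show False using o oX by (simp add: n_def)
  qed
  then show e: "euler K p \<noteq> 0" by auto
  show "order 1 (euler K p) < order 1 p" using nd e by (simp add: order_divides n_def not_le)
qed

text \<open>Descent on the order of vanishing at t = 1. A function vanishing on H has, by left
  translation, a derivative along Q3 - Q1 that also vanishes on H; on the curve this is the Euler
  operator, which strictly lowers the order. As the curve passes through 1, an element of H, the
  order is always positive, so p must be zero.\<close>

lemma vanishing_on_curve:
  assumes H: "\<And>g. g \<in> H \<Longrightarrow> g \<in> carrier_mat N N" "1\<^sub>m N \<in> H"
    and mult: "\<And>g h. g \<in> H \<Longrightarrow> h \<in> H \<Longrightarrow> g * h \<in> H"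
    and lie: "Q3 - Q1 \<in> lie_algebra N H"
    and f: "f \<in> poly_funs (matrix_space N)" "\<And>g. g \<in> H \<Longrightarrow> f g = 0" and t: "t \<noteq> 0"
  shows "f (one_parameter t) = 0"
proof -
  have X: "Q3 - Q1 \<in> carrier_mat N N" by (intro carriers)
  have vanish: "h g = 0" if f: "f \<in> poly_funs (matrix_space N)" "\<And>g. g \<in> H \<Longrightarrow> f g = 0"
    and c: "curve_derivative N (Q3 - Q1) f h" and g: "g \<in> H" for f h g
  proof -
    obtain q where q: "\<And>s. poly q s = f (g + s \<cdot>\<^sub>m (g * (Q3 - Q1)))" "coeff q 1 = h g"
      using c H(1)[OF g] unfolding curve_derivative_def by blast
    obtain f' where f': "f' \<in> poly_funs (matrix_space N)" "\<And>A. A \<in> carrier_mat N N \<Longrightarrow> f' A = f (g * A)"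
      using poly_funs_left_translate[OF f(1) H(1)[OF g]] by blast
    have "\<forall>h\<in>H. f' h = 0" using f(2) f'(2) mult[OF g] H(1) by auto
    moreover have "poly q s = f' (1\<^sub>m N + s \<cdot>\<^sub>m (Q3 - Q1))" for s
    proof -
      have "g * (1\<^sub>m N + s \<cdot>\<^sub>m (Q3 - Q1)) = g + s \<cdot>\<^sub>m (g * (Q3 - Q1))"
        by (simp only: mult_add_distrib_mat[OF H(1)[OF g] one_carrier_mat smult_carrier_mat[OF X]]
            mult_smult_distrib[OF H(1)[OF g] X] right_mult_one_mat[OF H(1)[OF g]])
      moreover have "1\<^sub>m N + s \<cdot>\<^sub>m (Q3 - Q1) \<in> carrier_mat N N" by (intro carriers)
      ultimately show ?thesis using f'(2) q(1) by simp
    qed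
    ultimately have "coeff q 1 = 0" using lie f'(1) unfolding lie_algebra_def by blast
    then show ?thesis using q(2) by simp
  qed
  have False if "order 1 p = n" "(p :: 'a poly) \<noteq> 0" "f \<in> poly_funs (matrix_space N)" "\<And>g. g \<in> H \<Longrightarrow> f g = 0"
    "\<And>t. t \<noteq> 0 \<Longrightarrow> t ^ K * f (one_parameter t) = poly p t" for n f K p
    using that
  proof (induction n arbitrary: f K p rule: less_induct)
    case (less n)
    obtain h L q where hq: "h \<in> poly_funs (matrix_space N)" "curve_derivative N (Q3 - Q1) f h"
      "\<And>t. t \<noteq> 0 \<Longrightarrow> t ^ L * f (one_parameter t) = poly q t \<and> t ^ L * h (one_parameter t) = poly (euler L q) t"
      using poly_funs_curve[OF less.prems(3)] by blast
    have "poly ([:0, 1:] ^ L * p) t = poly ([:0, 1:] ^ K * q) t" if "t \<in> UNIV - {0}" for t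
      using less.prems(5)[of t, symmetric] hq(3)[of t, THEN conjunct1, symmetric] that
      by (simp add: poly_power)
    then have "UNIV - {0} \<subseteq> {t. poly ([:0, 1:] ^ L * p - [:0, 1:] ^ K * q) t = 0}" by auto
    moreover have "infinite (UNIV - {0 :: 'a})" by (simp add: infinite_UNIV_char_0)
    ultimately have "infinite {t. poly ([:0, 1:] ^ L * p - [:0, 1:] ^ K * q) t = 0}" using finite_subset by blast
    \<comment> \<open>The clearing exponents K and L may differ; powers of t do not vanish at 1, so
      p and q have the same order there.\<close>
    then have eq: "[:0, 1:] ^ L * p = [:0, 1:] ^ K * q"
      using poly_roots_finite[of "[:0, 1:] ^ L * p - [:0, 1:] ^ K * q"] by auto
    have nz: "[:0, 1:] ^ L * p \<noteq> 0" using less.prems(2) by simp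
    then have q0: "q \<noteq> 0" using eq by auto
    have o0: "order 1 ([:0, 1 :: 'a:] ^ j) = 0" for j by (rule order_0I) (simp add: poly_power)
    have oq: "order 1 q = n"
      using order_mult[OF nz, of 1] order_mult[OF nz[unfolded eq], of 1] eq less.prems(1) o0[of K] o0[of L] by simp
    have "poly q 1 = 0"
      using hq(3)[of 1] less.prems(4)[OF H(2)] by (simp add: one_parameter_1)
    then have "euler L q \<noteq> 0" "order 1 (euler L q) < n" using order_euler[OF q0] oq by auto
    moreover have "h g = 0" if "g \<in> H" for g by (rule vanish[OF less.prems(3,4) hq(2) that])
    ultimately show False using less.IH[of "order 1 (euler L q)" "euler L q" h L] hq by blast
  qed
  note no = this
  obtain h K p where "\<And>t. t \<noteq> 0 \<Longrightarrow> t ^ K * f (one_parameter t) = poly p t"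
    using poly_funs_curve[OF f(1)] by blast
  moreover from this have "p = 0" using no[OF refl _ f] by blast
  ultimately show ?thesis using t by (metis mult_eq_0_iff poly_0 power_not_zero)
qed

lemma GL_simps: "carrier (GL N) = Units (ring_mat TYPE('a) N ())" "mult (GL N :: 'a mat monoid) = (*)" "one (GL N :: 'a mat monoid) = 1\<^sub>m N"
  by (simp_all add: GL_def units_of_def ring_mat_def)

lemma GL_carrier: "(g :: 'a mat) \<in> carrier (GL N) \<Longrightarrow> g \<in> carrier_mat N N"
  by (auto simp: GL_simps Units_def ring_mat_def)

lemma one_parameter_GL:
  assumes t: "t \<noteq> 0"
  shows "one_parameter t \<in> carrier (GL N)" "inv\<^bsub>GL N\<^esub> (one_parameter t) = one_parameter (1 / t)"
proof -
  have inv: "one_parameter s * one_parameter (1 / s) = 1\<^sub>m N" "one_parameter (1 / s) * one_parameter s = 1\<^sub>m N"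
    "one_parameter s \<in> carrier (GL N)" if "s \<noteq> 0" for s
  proof -
    show 1: "one_parameter s * one_parameter (1 / s) = 1\<^sub>m N" by (rule one_parameter_inverse[OF that])
    show 2: "one_parameter (1 / s) * one_parameter s = 1\<^sub>m N" using one_parameter_inverse[of "1 / s"] that by simp
    show "one_parameter s \<in> carrier (GL N)"
      unfolding GL_simps Units_def using 1 2 one_parameter_carrier by (auto simp: ring_mat_def)
  qed
  show "one_parameter t \<in> carrier (GL N)" by (rule inv(3)[OF t])
  interpret R: Ring.ring "ring_mat TYPE('a) N ()" by (rule ring_mat)
  interpret G: group "GL N :: 'a mat monoid" unfolding GL_def by (rule R.units_group)
  show "inv\<^bsub>GL N\<^esub> (one_parameter t) = one_parameter (1 / t)"
    by (rule G.inv_equality) (use inv t in \<open>simp_all add: GL_simps(2,3)\<close>)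
qed

text \<open>H is closed in the general linear group, so a point outside it is separated by a
  polynomial function vanishing on H, contrary to \<open>vanishing_on_curve\<close>.\<close>

lemma one_parameter_in_subgroup:
  assumes H: "connected_closed_subgroup N H" and lie: "Q3 - Q1 \<in> lie_algebra N H" and t: "t \<noteq> 0"
  shows "one_parameter t \<in> H"
proof (rule ccontr)
  assume n: "one_parameter t \<notin> H"
  have sub: "subgroup H (GL N)" and cl: "closedin (subtopology (zariski (matrix_space N)) (carrier (GL N))) H"
    using H by (auto simp: connected_closed_subgroup_def)
  obtain C where C: "closedin (zariski (matrix_space N)) C" "H = C \<inter> carrier (GL N)"
    using cl unfolding closedin_subtopology by blast
  have "openin (zariski (matrix_space N)) (carrier_mat N N - C)"
    using C(1) by (auto simp: closedin_def zariski_topspace)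
  moreover have "one_parameter t \<in> carrier_mat N N - C"
    using n C(2) one_parameter_GL(1)[OF t] one_parameter_carrier by blast
  ultimately obtain f where f: "f \<in> poly_funs (matrix_space N)" "f (one_parameter t) \<noteq> 0"
    "{v \<in> carrier_mat N N. f v \<noteq> 0} \<subseteq> carrier_mat N N - C"
    using zariski_neighbourhood[of "matrix_space N" "carrier_mat N N - C" "one_parameter t"] by (auto simp del: mem_Collect_eq)
  have Hc: "g \<in> carrier_mat N N" if "g \<in> H" for g
    using that sub GL_carrier by (auto dest: subgroup.mem_carrier)
  have "f g = 0" if "g \<in> H" for g using f(3) that C(2) Hc by blast
  then have "f (one_parameter t) = 0"
    using vanishing_on_curve[OF Hc _ _ lie f(1) _ t] subgroup.one_closed[OF sub] subgroup.m_closed[OF sub]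
    by (simp add: GL_simps(2,3))
  then show False using f(2) by simp
qed

text \<open>The orbit contains t v for all t \<noteq> 0. A polynomial function that is nonzero at 0
  restricts to a nonzero polynomial in t, hence is nonzero at some t v, so every neighbourhood of 0
  meets the orbit.\<close>

lemma nilpotent_vectorI:
  assumes H: "connected_closed_subgroup N H" and lie: "Q3 - Q1 \<in> lie_algebra N H"
    and v: "v \<in> V" "\<And>c x. x \<in> V \<Longrightarrow> c \<cdot>\<^sub>m x \<in> V" "V \<subseteq> carrier_mat N N"
    and grade: "\<And>t. t \<noteq> 0 \<Longrightarrow> one_parameter t * v * one_parameter (1 / t) = t \<cdot>\<^sub>m v"
  shows "nilpotent_vector H (conjugation N) (sub_space (matrix_space N) V) v"
proof -
  let ?V = "sub_space (matrix_space N) V :: ('a, 'a mat) module"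
  have vc: "v \<in> carrier_mat N N" using v by blast
  have v0: "0 \<cdot>\<^sub>m v = 0\<^sub>m N N" by (rule eq_matI) (use vc in auto)
  have z: "0\<^sub>m N N \<in> V" using v(2)[OF v(1), of 0] v0 by simp
  have poly: "\<exists>p. \<forall>t. f (t \<cdot>\<^sub>m v) = poly p t" if "f \<in> poly_funs ?V" for f
    using that
  proof (induction rule: poly_funs.induct)
    case (const c)
    show ?case by (rule exI[of _ "[:c:]"]) simp
  next
    case (linear f)
    show ?case using dual_carrier_smult[OF linear] v(1)
      by (intro exI[of _ "[:0, f v:]"]) (auto simp: mult.commute)
  next
    case (add f g)
    then show ?case by (metis poly_add)
  next
    case (mult f g)
    then show ?case by (metis poly_mult)
  qed
  have "0\<^sub>m N N \<in> zariski ?V closure_of ((\<lambda>g. conjugation N g v) ` H)"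
    unfolding in_closure_of zariski_topspace
  proof (intro conjI allI impI)
    show "0\<^sub>m N N \<in> carrier ?V" using z by simp
    fix T assume T: "0\<^sub>m N N \<in> T \<and> openin (zariski ?V) T"
    then obtain f where f: "f \<in> poly_funs ?V" "f (0\<^sub>m N N) \<noteq> 0" "{v \<in> V. f v \<noteq> 0} \<subseteq> T"
      using zariski_neighbourhood[of ?V T "0\<^sub>m N N"] by auto
    obtain p where p: "\<And>t. f (t \<cdot>\<^sub>m v) = poly p t" using poly[OF f(1)] by blast
    have "poly p 0 \<noteq> 0" using p[of 0] f(2) v0 by simp
    then have "p \<noteq> 0" by auto
    then have "finite ({t. poly p t = 0} \<union> {0})" by (simp add: poly_roots_finite)
    then obtain t where t: "t \<notin> {t. poly p t = 0} \<union> {0}"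
      using ex_new_if_finite[OF infinite_UNIV_char_0] by blast
    then have "t \<cdot>\<^sub>m v \<in> T" using f(3) v(1,2) p by auto
    moreover have "t \<cdot>\<^sub>m v = conjugation N (one_parameter t) v"
      using t grade[of t] one_parameter_GL(2)[of t] by (simp add: conjugation_def)
    moreover have "one_parameter t \<in> H" using t one_parameter_in_subgroup[OF H lie] by simp
    ultimately show "\<exists>y. y \<in> (\<lambda>g. conjugation N g v) ` H \<and> y \<in> T" by blast
  qed
  then show ?thesis using v(1) by (simp add: nilpotent_vector_def)
qed

end

text \<open>Sums and multiples of Lie algebra elements are required only through their action, which
  is what makes orbits linear subspaces.\<close>

definition lin_action :: "'q set \<Rightarrow> ('q \<Rightarrow> 'v \<Rightarrow> 'v) \<Rightarrow> ('a::field, 'v) module \<Rightarrow> bool" where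
  "lin_action \<qq> b X \<longleftrightarrow> \<qq> \<noteq> {} \<and> (\<forall>x\<in>\<qq>. \<forall>u\<in>carrier X. b x u \<in> carrier X) \<and>
     (\<forall>x\<in>\<qq>. \<forall>u\<in>carrier X. \<forall>v\<in>carrier X. b x (u \<oplus>\<^bsub>X\<^esub> v) = b x u \<oplus>\<^bsub>X\<^esub> b x v) \<and>
     (\<forall>x\<in>\<qq>. \<forall>c. \<forall>v\<in>carrier X. b x (c \<odot>\<^bsub>X\<^esub> v) = c \<odot>\<^bsub>X\<^esub> b x v) \<and>
     (\<forall>x\<in>\<qq>. \<forall>y\<in>\<qq>. \<exists>z\<in>\<qq>. \<forall>v\<in>carrier X. b z v = b x v \<oplus>\<^bsub>X\<^esub> b y v) \<and>
     (\<forall>c. \<forall>x\<in>\<qq>. \<exists>z\<in>\<qq>. \<forall>v\<in>carrier X. b z v = c \<odot>\<^bsub>X\<^esub> b x v)"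

lemma dual_span_bound:
  fixes X :: "('a::field, 'v) module"
  assumes X: "lin_closed X" and b: "\<And>i. i < n \<Longrightarrow> b i \<in> carrier (dual_module X)"
    and span: "\<And>\<mu>. \<mu> \<in> carrier (dual_module X) \<Longrightarrow> \<exists>a. \<forall>v\<in>carrier X. \<mu> v = (\<Sum>i<n. a i * b i v)"
    and G: "\<And>i. i < r \<Longrightarrow> G i \<in> carrier (dual_module X)" and ind: "independent_on (carrier X) r G"
  shows "r \<le> (n::nat)"
proof -
  interpret D: vectorspace "class_ring :: 'a ring" "dual_module X"
    using dual_subspace_vectorspace[OF dual_subspace_carrier[OF X]] by simp
  have S: "b ` {..<n} \<subseteq> carrier (dual_module X)" using b by auto
  have "carrier (dual_module X) \<subseteq> D.span (b ` {..<n})"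
  proof
    fix \<mu> assume \<mu>: "\<mu> \<in> carrier (dual_module X)"
    then obtain a where a: "\<And>v. v \<in> carrier X \<Longrightarrow> \<mu> v = (\<Sum>i<n. a i * b i v)" using span by blast
    define a' where "a' f = (\<Sum>i | i < n \<and> b i = f. a i)" for f
    have "D.lincomb a' (b ` {..<n}) = (\<lambda>v\<in>carrier X. \<Sum>f\<in>b ` {..<n}. a' f * f v)"
      using dual_lincomb[OF dual_subspace_carrier[OF X] _ S] by simp
    also have "\<dots> = (\<lambda>v\<in>carrier X. \<Sum>i<n. a i * b i v)"
    proof (rule restrict_ext)
      fix v
      have "(\<Sum>f\<in>b ` {..<n}. a' f * f v) = (\<Sum>f\<in>b ` {..<n}. \<Sum>i | i < n \<and> b i = f. a i * b i v)"
        by (rule sum.cong) (auto simp: a'_def sum_distrib_right)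
      also have "\<dots> = (\<Sum>i<n. a i * b i v)"
        using sum.image_gen[of "{..<n}" "\<lambda>i. a i * b i v" b] by simp
      finally show "(\<Sum>f\<in>b ` {..<n}. a' f * f v) = (\<Sum>i<n. a i * b i v)" .
    qed
    also have "\<dots> = \<mu>"
      by (rule dual_eqI[OF dual_sum[OF X b] \<mu>]) (use a in auto)
    finally show "\<mu> \<in> D.span (b ` {..<n})" using D.finite_span[of "b ` {..<n}"] S by auto
  qed
  moreover have "D.span (b ` {..<n}) \<subseteq> carrier (dual_module X)" using D.span_is_subset2[OF S] .
  ultimately have gen: "D.span (b ` {..<n}) = carrier (dual_module X)" by (rule equalityI[rotated])
  then have fd: "D.fin_dim" unfolding D.fin_dim_def using S by blast
  have "card (G ` {..<r}) \<le> D.dim"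
    by (rule D.li_le_dim(2)[OF fd])
      (use G family_lin_indpt[OF dual_subspace_carrier[OF X] G ind] in auto)
  also have "\<dots> \<le> card (b ` {..<n})" using D.gen_ge_dim[OF _ S gen] by simp
  also have "\<dots> \<le> n" using card_image_le[of "{..<n}" b] by simp
  finally show ?thesis using card_image[OF independent_on_inj[OF ind]] by simp
qed

lemma lin_closed_comb:
  fixes n :: nat
  assumes X: "lin_closed X" "carrier X \<noteq> {}" and u: "\<And>i. i < n \<Longrightarrow> u i \<in> carrier X"
  shows "\<exists>v\<in>carrier X. \<forall>\<mu>\<in>carrier (dual_module X). \<mu> v = (\<Sum>i<n. c i * \<mu> (u i))"
  using u
proof (induction n)
  case 0
  obtain v where v: "v \<in> carrier X" using X(2) by blast
  have "\<mu> (0 \<odot>\<^bsub>X\<^esub> v) = 0" if "\<mu> \<in> carrier (dual_module X)" for \<mu>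
    using dual_carrierD(3)[OF that v, of 0] by simp
  moreover have "0 \<odot>\<^bsub>X\<^esub> v \<in> carrier X" using X(1) v by (auto simp: lin_closed_def)
  ultimately show ?case by (intro bexI[of _ "0 \<odot>\<^bsub>X\<^esub> v"]) auto
next
  case (Suc n)
  then obtain v where v: "v \<in> carrier X" "\<And>\<mu>. \<mu> \<in> carrier (dual_module X) \<Longrightarrow> \<mu> v = (\<Sum>i<n. c i * \<mu> (u i))"
    using less_SucI by blast
  have un: "u n \<in> carrier X" using Suc.prems by simp
  have cu: "c n \<odot>\<^bsub>X\<^esub> u n \<in> carrier X" using X(1) un by (auto simp: lin_closed_def)
  have "v \<oplus>\<^bsub>X\<^esub> (c n \<odot>\<^bsub>X\<^esub> u n) \<in> carrier X" using X(1) v(1) cu by (auto simp: lin_closed_def)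
  moreover have "\<mu> (v \<oplus>\<^bsub>X\<^esub> (c n \<odot>\<^bsub>X\<^esub> u n)) = (\<Sum>i<Suc n. c i * \<mu> (u i))" if "\<mu> \<in> carrier (dual_module X)" for \<mu>
    using dual_carrierD(2)[OF that v(1) cu] dual_carrierD(3)[OF that un] v(2)[OF that] by simp
  ultimately show ?case by (intro bexI[of _ "v \<oplus>\<^bsub>X\<^esub> (c n \<odot>\<^bsub>X\<^esub> u n)"]) auto
qed

text \<open>A basis B of the dual has a dual family u in X, and \<xi> is evaluation at the
  combination of the u i with coefficients \<xi> (B i).\<close>

lemma double_dual_evaluation:
  assumes X: "lin_closed X" "carrier X \<noteq> {}" and B: "fbasis (carrier (dual_module X)) (carrier X) d B"
    and \<xi>: "\<xi> \<in> carrier (dual_module (dual_module X))"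
  shows "\<exists>v\<in>carrier X. \<forall>\<mu>\<in>carrier (dual_module X). \<xi> \<mu> = \<mu> v"
proof -
  have BD: "B i \<in> carrier (dual_module X)" if "i < d" for i using B that by (simp add: fbasis_def)
  have "\<exists>u. \<forall>j<d. u j \<in> carrier X \<and> (\<forall>i<d. B i (u j) = (if i = j then 1 else 0))"
  proof (rule dual_family)
    show "independent_on (carrier X) d B" using B by (simp add: fbasis_def)
    fix u w c assume uw: "u \<in> carrier X" "w \<in> carrier X"
    have cw: "c \<odot>\<^bsub>X\<^esub> w \<in> carrier X" using X(1) uw by (auto simp: lin_closed_def)
    have "B i (u \<oplus>\<^bsub>X\<^esub> (c \<odot>\<^bsub>X\<^esub> w)) = B i u + c * B i w" if "i < d" for i
      using dual_carrierD(2)[OF BD[OF that] uw(1) cw] dual_carrierD(3)[OF BD[OF that] uw(2)] by simp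
    moreover have "u \<oplus>\<^bsub>X\<^esub> (c \<odot>\<^bsub>X\<^esub> w) \<in> carrier X" using X(1) uw(1) cw by (auto simp: lin_closed_def)
    ultimately show "\<exists>x\<in>carrier X. \<forall>i<d. B i x = B i u + c * B i w" by blast
  qed (rule X(2))
  then obtain u where u: "\<And>j. j < d \<Longrightarrow> u j \<in> carrier X"
    "\<And>i j. i < d \<Longrightarrow> j < d \<Longrightarrow> B i (u j) = (if i = j then 1 else 0)" by blast
  obtain v where v: "v \<in> carrier X" "\<And>\<mu>. \<mu> \<in> carrier (dual_module X) \<Longrightarrow> \<mu> v = (\<Sum>i<d. \<xi> (B i) * \<mu> (u i))"
    using lin_closed_comb[OF X, of d u "\<lambda>i. \<xi> (B i)"] u(1) by blast
  have "\<xi> \<mu> = \<mu> v" if \<mu>: "\<mu> \<in> carrier (dual_module X)" for \<mu>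
  proof -
    obtain a where a: "\<And>v. v \<in> carrier X \<Longrightarrow> \<mu> v = (\<Sum>i<d. a i * B i v)"
      using B \<mu> unfolding fbasis_def by blast
    have "\<mu> = (\<lambda>v\<in>carrier X. \<Sum>i<d. a i * B i v)"
      by (rule dual_eqI[OF \<mu> dual_sum[OF X(1) BD]]) (use a in auto)
    then have "\<xi> \<mu> = (\<Sum>i<d. a i * \<xi> (B i))" using functional_sum[OF X(1) \<xi>, of d B a] BD by simp
    also have "\<dots> = (\<Sum>i<d. \<xi> (B i) * \<mu> (u i))"
    proof (rule sum.cong)
      fix i assume "i \<in> {..<d}"
      then have i: "i < d" by simp
      have "\<mu> (u i) = (\<Sum>j<d. if j = i then a i else 0)"
        unfolding a[OF u(1)[OF i]] by (rule sum.cong) (use u(2) i in auto)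
      then show "a i * \<xi> (B i) = \<xi> (B i) * \<mu> (u i)" using i by simp
    qed simp
    finally show ?thesis using v(2)[OF \<mu>] by simp
  qed
  then show ?thesis using v(1) by blast
qed

section \<open>Index bounds tested at vectors of the module\<close>

context
  fixes X :: "('a::field, 'v) module" and \<qq> :: "'q set" and b :: "'q \<Rightarrow> 'v \<Rightarrow> 'v" and D :: nat
  assumes X: "lin_closed X" "carrier X \<noteq> {}" and b: "lin_action \<qq> b X"
    and bound: "\<And>n G. (\<And>i. i < n \<Longrightarrow> G i \<in> carrier (dual_module X)) \<Longrightarrow> independent_on (carrier X) n G \<Longrightarrow> n \<le> D"
begin

lemma dual_action_carrier:
  assumes x: "x \<in> \<qq>" and \<mu>: "\<mu> \<in> carrier (dual_module X)"
  shows "dual_action X b x \<mu> \<in> carrier (dual_module X)"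
  using X(1) b x \<mu> unfolding lin_closed_def lin_action_def dual_action_def
  by (intro dual_carrierI) (auto simp: dual_carrierD)

text \<open>The orbit is the image of the acting set under x \<mapsto> x \<xi>, and the sums and
  multiples supplied by \<open>lin_action\<close> carry over to the double dual.\<close>

lemma orbit_subspace:
  assumes \<xi>: "\<xi> \<in> carrier (dual_module (dual_module X))"
  shows "dual_subspace (dual_module X) (lie_orbit \<qq> (dual_action (dual_module X) (dual_action X b)) \<xi>)"
proof -
  let ?a = "dual_action X b" and ?D = "dual_module X"
  have lc: "lin_closed ?D" by (rule lin_closed_dual[OF X(1)])
  note cl = lc[unfolded lin_closed_def]
  have lin: "dual_action ?D ?a x \<xi> \<in> carrier (dual_module ?D)" if x: "x \<in> \<qq>" for x
  proof (rule dual_carrierI)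
    show "dual_action ?D ?a x \<xi> \<in> extensional (carrier ?D)" by (simp add: dual_action_def)
    fix u v c assume u: "u \<in> carrier ?D" and v: "v \<in> carrier ?D"
    have "?a x (u \<oplus>\<^bsub>?D\<^esub> v) = ?a x u \<oplus>\<^bsub>?D\<^esub> ?a x v"
      using b x by (auto simp: dual_action_def lin_action_def restrict_def)
    then show "dual_action ?D ?a x \<xi> (u \<oplus>\<^bsub>?D\<^esub> v) = dual_action ?D ?a x \<xi> u + dual_action ?D ?a x \<xi> v"
      using dual_carrierD(2)[OF \<xi> dual_action_carrier[OF x u] dual_action_carrier[OF x v]] cl u v
      by (simp add: dual_action_def del: dual_module_simps)
  next
    fix u c assume u: "u \<in> carrier ?D"
    have "?a x (c \<odot>\<^bsub>?D\<^esub> u) = c \<odot>\<^bsub>?D\<^esub> ?a x u"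
      using b x by (auto simp: dual_action_def lin_action_def restrict_def)
    then show "dual_action ?D ?a x \<xi> (c \<odot>\<^bsub>?D\<^esub> u) = c * dual_action ?D ?a x \<xi> u"
      using dual_carrierD(3)[OF \<xi> dual_action_carrier[OF x u], of c] cl u
      by (simp add: dual_action_def del: dual_module_simps)
  qed
  have sum: "\<exists>z\<in>\<qq>. (\<lambda>v\<in>carrier ?D. dual_action ?D ?a x \<xi> v + dual_action ?D ?a y \<xi> v) = dual_action ?D ?a z \<xi>"
    if xy: "x \<in> \<qq>" "y \<in> \<qq>" for x y
  proof -
    have "\<exists>z\<in>\<qq>. \<forall>v\<in>carrier X. b z v = b x v \<oplus>\<^bsub>X\<^esub> b y v" using b xy unfolding lin_action_def by blast
    then obtain z where z: "z \<in> \<qq>" "\<forall>v\<in>carrier X. b z v = b x v \<oplus>\<^bsub>X\<^esub> b y v" by (rule bexE)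
    have "?a z \<mu> = ?a x \<mu> \<oplus>\<^bsub>?D\<^esub> ?a y \<mu>" if "\<mu> \<in> carrier ?D" for \<mu>
      using b xy z dual_carrierD(2)[OF that] by (auto simp: dual_action_def lin_action_def restrict_def)
    then have "\<xi> (?a z \<mu>) = \<xi> (?a x \<mu>) + \<xi> (?a y \<mu>)" if "\<mu> \<in> carrier ?D" for \<mu>
      using dual_carrierD(2)[OF \<xi> dual_action_carrier[OF xy(1) that] dual_action_carrier[OF xy(2) that]] that by simp
    then show ?thesis using z(1) by (intro bexI[of _ z]) (auto simp: dual_action_def restrict_def)
  qed
  have scal: "\<exists>z\<in>\<qq>. (\<lambda>v\<in>carrier ?D. c * dual_action ?D ?a x \<xi> v) = dual_action ?D ?a z \<xi>" if x: "x \<in> \<qq>" for x c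
  proof -
    have "\<exists>z\<in>\<qq>. \<forall>v\<in>carrier X. b z v = c \<odot>\<^bsub>X\<^esub> b x v" using b x unfolding lin_action_def by blast
    then obtain z where z: "z \<in> \<qq>" "\<forall>v\<in>carrier X. b z v = c \<odot>\<^bsub>X\<^esub> b x v" by (rule bexE)
    have "?a z \<mu> = c \<odot>\<^bsub>?D\<^esub> ?a x \<mu>" if "\<mu> \<in> carrier ?D" for \<mu>
      using b x z dual_carrierD(3)[OF that] by (auto simp: dual_action_def lin_action_def restrict_def)
    then have "\<xi> (?a z \<mu>) = c * \<xi> (?a x \<mu>)" if "\<mu> \<in> carrier ?D" for \<mu>
      using dual_carrierD(3)[OF \<xi> dual_action_carrier[OF x that], of c] that by simp
    then show ?thesis using z(1) by (intro bexI[of _ z]) (auto simp: dual_action_def restrict_def)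
  qed
  obtain x0 where x0: "x0 \<in> \<qq>" using b by (auto simp: lin_action_def)
  have zero: "\<exists>z\<in>\<qq>. (\<lambda>v\<in>carrier ?D. 0) = dual_action ?D ?a z \<xi>"
    using scal[OF x0, of 0] by (simp only: mult_zero_left)
  show ?thesis
    unfolding dual_subspace_def
  proof (intro conjI ballI allI)
    show "lie_orbit \<qq> (dual_action ?D ?a) \<xi> \<subseteq> carrier (dual_module ?D)" using lin by (auto simp: lie_orbit_def)
    show "(\<lambda>v\<in>carrier ?D. 0) \<in> lie_orbit \<qq> (dual_action ?D ?a) \<xi>"
      using zero by (auto simp only: lie_orbit_def)
    fix f assume f: "f \<in> lie_orbit \<qq> (dual_action ?D ?a) \<xi>"
    then obtain x where x: "x \<in> \<qq>" "f = dual_action ?D ?a x \<xi>" by (auto simp only: lie_orbit_def)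
    show "(\<lambda>v\<in>carrier ?D. c * f v) \<in> lie_orbit \<qq> (dual_action ?D ?a) \<xi>" for c
      using scal[OF x(1), of c] by (auto simp only: x(2) lie_orbit_def)
    fix g assume "g \<in> lie_orbit \<qq> (dual_action ?D ?a) \<xi>"
    then obtain y where y: "y \<in> \<qq>" "g = dual_action ?D ?a y \<xi>" by (auto simp only: lie_orbit_def)
    show "(\<lambda>v\<in>carrier ?D. f v + g v) \<in> lie_orbit \<qq> (dual_action ?D ?a) \<xi>"
      using sum[OF x(1) y(1)] by (auto simp only: x(2) y(2) lie_orbit_def)
  qed
qed

lemma index_le:
  assumes v: "v \<in> carrier X"
    and ann: "\<And>\<mu>. \<mu> \<in> carrier (dual_module X) \<Longrightarrow> (\<And>x. x \<in> \<qq> \<Longrightarrow> \<mu> (b x v) = 0) \<Longrightarrow>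
      \<exists>a. \<forall>u\<in>carrier X. \<mu> u = (\<Sum>i<c. a i * \<kappa> i u)"
    and \<kappa>: "\<And>i. i < c \<Longrightarrow> \<kappa> i \<in> carrier (dual_module X)"
  shows "lie_index \<qq> (dual_action X b) (dual_module X) \<le> int c"
proof -
  obtain d B where B: "fbasis (carrier (dual_module X)) (carrier X) d B"
    using fbasis_exists[of "carrier (dual_module X)" "carrier X" D] bound by blast
  have lc: "lin_closed (dual_module X)" by (rule lin_closed_dual[OF X(1)])
  define \<xi> where "\<xi> = (\<lambda>\<mu>\<in>carrier (dual_module X). \<mu> v)"
  have \<xi>: "\<xi> \<in> carrier (dual_module (dual_module X))"
    by (rule dual_carrierI) (use lc v in \<open>auto simp: \<xi>_def lin_closed_def\<close>)
  show ?thesis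
  proof (rule lie_index_le[OF X(1) B orbit_subspace \<xi>])
    fix \<mu> assume \<mu>: "\<mu> \<in> carrier (dual_module X)" "\<And>x. x \<in> \<qq> \<Longrightarrow> \<xi> (dual_action X b x \<mu>) = 0"
    have "\<mu> (b x v) = 0" if "x \<in> \<qq>" for x
      using \<mu>(2)[OF that] dual_action_carrier[OF that \<mu>(1)] v by (simp add: \<xi>_def dual_action_def)
    then show "\<exists>a. \<forall>u\<in>carrier X. \<mu> u = (\<Sum>i<c. a i * \<kappa> i u)" by (rule ann[OF \<mu>(1)])
  qed (use \<kappa> in auto)
qed

text \<open>Elements of the double dual are evaluations at vectors, so orbits can be tested in X
  itself. Exhibiting r + c independent functionals is the form in which r + c is bounded by the
  dimension.\<close>

lemma index_ge:
  assumes "\<And>v r x. v \<in> carrier X \<Longrightarrow> (\<And>i. i < r \<Longrightarrow> x i \<in> \<qq>) \<Longrightarrow>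
      independent_on (carrier (dual_module X)) r (\<lambda>i \<mu>. \<mu> (b (x i) v)) \<Longrightarrow>
      \<exists>G. (\<forall>i<r + c. G i \<in> carrier (dual_module X)) \<and> independent_on (carrier X) (r + c) G"
  shows "int c \<le> lie_index \<qq> (dual_action X b) (dual_module X)"
proof -
  obtain d B where B: "fbasis (carrier (dual_module X)) (carrier X) d B"
    using fbasis_exists[of "carrier (dual_module X)" "carrier X" D] bound by blast
  show ?thesis
  proof (rule lie_index_ge[OF X(1) B orbit_subspace])
    fix \<xi> r and x :: "nat \<Rightarrow> 'q"
    assume \<xi>: "\<xi> \<in> carrier (dual_module (dual_module X))" and x: "\<And>i. i < r \<Longrightarrow> x i \<in> \<qq>"
      and ind: "independent_on (carrier (dual_module X)) r (\<lambda>i \<mu>. \<xi> (dual_action X b (x i) \<mu>))"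
    obtain v where v: "v \<in> carrier X" "\<And>\<mu>. \<mu> \<in> carrier (dual_module X) \<Longrightarrow> \<xi> \<mu> = \<mu> v"
      using double_dual_evaluation[OF X B \<xi>] by blast
    have eq: "\<xi> (dual_action X b (x i) \<mu>) = - \<mu> (b (x i) v)" if "i < r" "\<mu> \<in> carrier (dual_module X)" for i \<mu>
      using v(2)[OF dual_action_carrier[OF x[OF that(1)] that(2)]] v(1) by (simp add: dual_action_def)
    have "independent_on (carrier (dual_module X)) r (\<lambda>i \<mu>. \<mu> (b (x i) v))"
    proof (rule independent_onI)
      fix a i assume a: "\<And>\<mu>. \<mu> \<in> carrier (dual_module X) \<Longrightarrow> (\<Sum>i<r. a i * \<mu> (b (x i) v)) = 0" and i: "i < r"
      show "a i = 0"
        by (rule independent_onD[OF ind _ i]) (use a in \<open>simp add: eq sum_negf\<close>)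
    qed
    then obtain G where G: "\<forall>i<r + c. G i \<in> carrier (dual_module X)" "independent_on (carrier X) (r + c) G"
      using assms[OF v(1), of r x] x by blast
    show "r + c \<le> d"
      by (rule independent_le_fbasis[OF dual_subspace_carrier[OF X(1)] B _ G(2)]) (use G(1) in auto)
  qed
qed

end

section \<open>Adapted bases\<close>

definition comb :: "nat \<Rightarrow> nat \<Rightarrow> (nat \<Rightarrow> 'a::field) \<Rightarrow> (nat \<Rightarrow> 'a vec) \<Rightarrow> 'a vec" where
  "comb N r c b = vec N (\<lambda>a. \<Sum>i<r. c i * b i $ a)"

definition lin_subspace :: "nat \<Rightarrow> 'a::field vec set \<Rightarrow> bool" where
  "lin_subspace N U \<longleftrightarrow> U \<subseteq> carrier_vec N \<and> 0\<^sub>v N \<in> U \<and> (\<forall>x\<in>U. \<forall>y\<in>U. x + y \<in> U) \<and> (\<forall>c. \<forall>x\<in>U. c \<cdot>\<^sub>v x \<in> U)"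

abbreviation vindep :: "nat \<Rightarrow> nat \<Rightarrow> (nat \<Rightarrow> 'a::field vec) \<Rightarrow> bool" where
  "vindep N r b \<equiv> independent_on {..<N} r (\<lambda>i a. b i $ a)"

lemma comb_carrier [simp]: "comb N r c b \<in> carrier_vec N"
  by (simp add: comb_def)

lemma comb_0: "comb N 0 c b = 0\<^sub>v N"
  by (auto simp: comb_def)

lemma comb_Suc: "b r \<in> carrier_vec N \<Longrightarrow> comb N (Suc r) c b = comb N r c b + c r \<cdot>\<^sub>v b r"
  by (rule eq_vecI) (auto simp: comb_def)

lemma comb_subspace:
  assumes U: "lin_subspace N U" and b: "\<And>i. i < r \<Longrightarrow> b i \<in> U"
  shows "comb N r c b \<in> U"
  using b
proof (induction r)
  case (Suc r)
  have "b r \<in> U" "b r \<in> carrier_vec N" using Suc.prems[of r] U by (auto simp: lin_subspace_def)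
  then show ?case using Suc U by (simp add: comb_Suc lin_subspace_def)
qed (use U in \<open>simp add: comb_0 lin_subspace_def\<close>)

lemma comb_zeroD: "vindep N r b \<Longrightarrow> comb N r c b = 0\<^sub>v N \<Longrightarrow> i < r \<Longrightarrow> c i = 0"
proof -
  assume ind: "vindep N r b" and z: "comb N r c b = 0\<^sub>v N" and i: "i < r"
  show "c i = 0"
  proof (rule independent_onD[OF ind _ i])
    fix a assume "a \<in> {..<N}"
    then show "(\<Sum>i<r. c i * b i $ a) = 0" using arg_cong[OF z, of "\<lambda>v. v $ a"] by (simp add: comb_def)
  qed
qed

lemma vindepI:
  assumes "\<And>c i. comb N r c b = 0\<^sub>v N \<Longrightarrow> i < r \<Longrightarrow> c i = 0"
  shows "vindep N r b"
proof (rule independent_onI)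
  fix c i assume "\<And>a. a \<in> {..<N} \<Longrightarrow> (\<Sum>i<r. c i * b i $ a) = 0" "i < r"
  then show "c i = 0" by (intro assms[of c i]) (auto simp: comb_def)
qed

lemma vindep_inj: "vindep N r b \<Longrightarrow> inj_on b {..<r}"
  using independent_on_inj[of "{..<N}" r "\<lambda>i a. b i $ a"] by (auto simp: inj_on_def)

lemma vindep_lin_indpt:
  fixes b :: "nat \<Rightarrow> 'a::field vec"
  assumes b: "\<And>i. i < r \<Longrightarrow> b i \<in> carrier_vec N" and ind: "vindep N r b"
  shows "\<not> module.lin_dep (class_ring :: 'a ring) (module_vec TYPE('a) N) (b ` {..<r})"
proof -
  interpret vec_space "TYPE('a)" N .
  have S: "b ` {..<r} \<subseteq> carrier_vec N" using b by auto
  show ?thesis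
  proof (rule finite_lin_indpt2)
    fix a assume z: "lincomb a (b ` {..<r}) = 0\<^sub>v N"
    have "(\<Sum>i<r. a (b i) * b i $ j) = 0" if "j \<in> {..<N}" for j
      using lincomb_index[OF _ S, of j a] that z
      by (simp add: module_vec_simps sum.reindex[OF vindep_inj[OF ind]])
    then have "a (b i) = 0" if "i < r" for i using independent_onD[OF ind, of "\<lambda>i. a (b i)"] that by blast
    then show "\<forall>v\<in>b ` {..<r}. a v = 0" by auto
  qed (use S in \<open>auto simp: module_vec_simps\<close>)
qed

lemma vindep_le:
  fixes b :: "nat \<Rightarrow> 'a::field vec"
  assumes b: "\<And>i. i < r \<Longrightarrow> b i \<in> carrier_vec N" and ind: "vindep N r b"
  shows "r \<le> N"
proof -
  interpret vec_space "TYPE('a)" N .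
  have "card (b ` {..<r}) \<le> dim"
    by (rule li_le_dim(2)[OF fin_dim _ vindep_lin_indpt[OF b ind]]) (use b in \<open>auto simp: module_vec_simps\<close>)
  then show ?thesis by (simp add: card_image[OF vindep_inj[OF ind]] dim_is_n)
qed

lemma vdim_eq:
  fixes U :: "'a::field vec set"
  assumes U: "submodule (class_ring :: 'a ring) U (module_vec TYPE('a) N)"
    and b: "\<And>i. i < r \<Longrightarrow> b i \<in> U" and ind: "vindep N r b"
    and span: "\<And>u. u \<in> U \<Longrightarrow> \<exists>c. u = comb N r c b"
  shows "vdim (sub_space (module_vec TYPE('a) N) U) = r"
proof -
  interpret vec_space "TYPE('a)" N .
  have UC: "U \<subseteq> carrier_vec N" using submodule.subset[OF U] by (simp add: module_vec_simps)
  have "subspace class_ring U (module_vec TYPE('a) N)"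
    using U vectorspace_axioms by (simp add: subspace_def)
  then interpret D: vectorspace "class_ring :: 'a ring" "sub_space (module_vec TYPE('a) N) U"
    by (rule subspace_is_vs)
  have S: "b ` {..<r} \<subseteq> U" using b by auto
  then have SC: "b ` {..<r} \<subseteq> carrier_vec N" using UC by blast
  have bC: "b i \<in> carrier_vec N" if "i < r" for i using b[OF that] UC by blast
  have "U \<subseteq> span (b ` {..<r})"
  proof
    fix u assume u: "u \<in> U"
    then obtain c where c: "u = comb N r c b" using span by blast
    define a where "a x = c (the_inv_into {..<r} b x)" for x
    have aF: "a (b i) = c i" if "i < r" for i
      using that the_inv_into_f_f[OF vindep_inj[OF ind]] by (simp add: a_def)
    have "lincomb a (b ` {..<r}) = u"
    proof (rule eq_vecI)
      show "dim_vec (lincomb a (b ` {..<r})) = dim_vec u"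
        using lincomb_dim[OF _ SC, of a] u UC by auto
      fix j assume "j < dim_vec u"
      then have j: "j < N" using u UC by auto
      have "lincomb a (b ` {..<r}) $ j = (\<Sum>i<r. a (b i) * b i $ j)"
        by (simp add: lincomb_index[OF j SC] sum.reindex[OF vindep_inj[OF ind]])
      also have "\<dots> = (\<Sum>i<r. c i * b i $ j)" by (rule sum.cong) (simp_all add: aF)
      finally show "lincomb a (b ` {..<r}) $ j = u $ j" using j by (simp add: c comb_def)
    qed
    then show "u \<in> span (b ` {..<r})" using finite_span[of "b ` {..<r}"] SC by (auto simp: module_vec_simps)
  qed
  moreover have "D.span (b ` {..<r}) \<subseteq> U" using D.span_is_subset2[of "b ` {..<r}"] S by simp
  ultimately have "D.basis (b ` {..<r})"
    using span_li_not_depend[OF S U] vindep_lin_indpt[OF bC ind] S unfolding D.basis_def by auto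
  then have "D.dim = card (b ` {..<r})" by (rule D.dim_basis[rotated]) simp
  then show ?thesis by (simp add: card_image[OF vindep_inj[OF ind]])
qed

lemma submodule_lin_subspace:
  fixes U :: "'a::field vec set"
  assumes U: "submodule (class_ring :: 'a ring) U (module_vec TYPE('a) N)"
  shows "lin_subspace N U"
  using submodule.subset[OF U] submodule.zero_closed[OF U] submodule.m_closed[OF U] submodule.smult_closed[OF U]
  by (simp add: lin_subspace_def module_vec_simps)

text \<open>A maximal independent family is found among the coordinate functions of the vectors of
  U; \<open>vdim_eq\<close> then identifies its length with the prescribed dimension.\<close>

lemma basis_exists:
  fixes U :: "'a::field vec set"
  assumes U: "submodule (class_ring :: 'a ring) U (module_vec TYPE('a) N)"
    and dim: "vdim (sub_space (module_vec TYPE('a) N) U) = m"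
  shows "\<exists>b. (\<forall>i<m. b i \<in> U) \<and> vindep N m b"
proof -
  have UC: "U \<subseteq> carrier_vec N" using submodule_lin_subspace[OF U] by (simp add: lin_subspace_def)
  define f where "f = (\<lambda>(u :: 'a vec) a. u $ a)"
  have rep: "\<exists>b. \<forall>i<n. b i \<in> U \<and> G i = f (b i)" if "\<forall>i<n. G i \<in> f ` U" for n and G :: "nat \<Rightarrow> nat \<Rightarrow> 'a"
  proof -
    have "\<forall>i. \<exists>u. i < n \<longrightarrow> u \<in> U \<and> G i = f u" using that by blast
    from choice[OF this] show ?thesis by blast
  qed
  have cong: "vindep N n b \<longleftrightarrow> independent_on {..<N} n G" if "\<forall>i<n. b i \<in> U \<and> G i = f (b i)" for n b G
    using that by (simp add: independent_on_def f_def)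
  have "\<exists>r F. fbasis (f ` U) {..<N} r F \<and> r \<le> N"
  proof (rule fbasis_exists)
    fix n and G :: "nat \<Rightarrow> nat \<Rightarrow> 'a"
    assume G: "\<And>i. i < n \<Longrightarrow> G i \<in> f ` U" and ind: "independent_on {..<N} n G"
    obtain b where b: "\<forall>i<n. b i \<in> U \<and> G i = f (b i)" using rep[of n G] G by blast
    show "n \<le> N" by (rule vindep_le[of n b]) (use b UC cong[OF b] ind in auto)
  qed
  then obtain r F where F: "fbasis (f ` U) {..<N} r F" by blast
  obtain b where b: "\<forall>i<r. b i \<in> U \<and> F i = f (b i)" using rep[of r F] F by (auto simp: fbasis_def)
  have ind: "vindep N r b" using cong[OF b] F by (simp add: fbasis_def)
  have "vdim (sub_space (module_vec TYPE('a) N) U) = r"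
  proof (rule vdim_eq[OF U _ ind])
    fix u assume u: "u \<in> U"
    then obtain c where c: "\<forall>a\<in>{..<N}. f u a = (\<Sum>i<r. c i * F i a)" using F unfolding fbasis_def by blast
    have "u = comb N r c b"
      by (rule eq_vecI) (use c b u UC in \<open>auto simp: comb_def f_def\<close>)
    then show "\<exists>c. u = comb N r c b" by blast
  qed (use b in auto)
  then show ?thesis using b ind dim by auto
qed

section \<open>Frames with prescribed Gram matrix\<close>

context
  fixes N :: nat and J :: "'a::field mat" and d :: nat and \<tau> :: "nat \<Rightarrow> nat" and s :: "nat \<Rightarrow> 'a" and \<epsilon> :: 'a
  assumes J: "J \<in> carrier_mat N N" and d: "d > 0"
    and tau: "\<And>i. \<tau> (\<tau> i) = i" "\<And>i r. i < d * r \<Longrightarrow> \<tau> i < d * r" "\<And>i r. i < d \<Longrightarrow> \<tau> (d * r + i) = d * r + \<tau> i"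
    and s: "\<And>i. s i * s i = 1" "\<And>i r. i < d \<Longrightarrow> s (d * r + i) = s i"
    and sym: "\<And>x y. x \<in> carrier_vec N \<Longrightarrow> y \<in> carrier_vec N \<Longrightarrow> bform J y x = \<epsilon> * bform J x y"
    and ext: "\<And>Z z. lin_subspace N Z \<Longrightarrow> nondegenerate_on N J Z \<Longrightarrow> z \<in> Z \<Longrightarrow> z \<noteq> 0\<^sub>v N \<Longrightarrow>
      \<exists>f. \<forall>i<d. f i \<in> Z \<and> (\<forall>j<d. bform J (f i) (f j) = (if j = \<tau> i then s i else 0))"
begin

lemma bform_right:
  assumes "x \<in> carrier_vec N" "y \<in> carrier_vec N" "z \<in> carrier_vec N"
  shows "bform J x (y + z) = bform J x y + bform J x z" "bform J x (c \<cdot>\<^sub>v y) = c * bform J x y"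
    "bform J x (0\<^sub>v N) = 0"
proof -
  have M: "J *\<^sub>v y \<in> carrier_vec N" "J *\<^sub>v z \<in> carrier_vec N" using J assms by auto
  show "bform J x (y + z) = bform J x y + bform J x z"
    unfolding bform_def mult_add_distrib_mat_vec[OF J assms(2,3)] by (rule scalar_prod_add_distrib[OF assms(1) M])
  show c: "bform J x (c \<cdot>\<^sub>v y) = c * bform J x y" for c
    unfolding bform_def mult_mat_vec[OF J assms(2)] using assms(1) M by simp
  have "(0 :: 'a) \<cdot>\<^sub>v y = 0\<^sub>v N" using assms(2) by auto
  then show "bform J x (0\<^sub>v N) = 0" using c[of 0] by simp
qed

lemma bform_comb:
  assumes "x \<in> carrier_vec N" "\<And>i. i < r \<Longrightarrow> b i \<in> carrier_vec N"
  shows "bform J x (comb N r c b) = (\<Sum>i<r. c i * bform J x (b i))"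
  using assms(2)
proof (induction r)
  case 0
  then show ?case using bform_right(3)[OF assms(1,1,1)] by (simp add: comb_0)
next
  case (Suc r)
  have "b r \<in> carrier_vec N" using Suc.prems by simp
  then show ?case
    using Suc bform_right(1)[OF assms(1) comb_carrier, of "c r \<cdot>\<^sub>v b r" r c b] bform_right(2)[OF assms(1), of "b r" "b r" "c r"]
    by (simp add: comb_Suc)
qed

text \<open>A frame of r blocks of size d in standard position: orthonormal vectors if d = 1 and
  \<tau> is the identity, symplectic pairs if d = 2 and \<tau> exchanges the two members of each
  block.\<close>

definition "gram r b \<longleftrightarrow> (\<forall>i<d * r. \<forall>j<d * r. bform J (b i) (b j) = (if j = \<tau> i then s i else 0))"
definition "coord b u i = s (\<tau> i) * bform J (b (\<tau> i)) u"

lemma bform_comb_gram: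
  assumes g: "gram r b" and b: "\<And>i. i < d * r \<Longrightarrow> b i \<in> carrier_vec N" and i: "i < d * r"
  shows "bform J (b i) (comb N (d * r) c b) = c (\<tau> i) * s i"
proof -
  have "bform J (b i) (comb N (d * r) c b) = (\<Sum>j<d * r. c j * bform J (b i) (b j))"
    by (rule bform_comb[OF b[OF i] b])
  also have "\<dots> = (\<Sum>j<d * r. if j = \<tau> i then c (\<tau> i) * s i else 0)"
    by (rule sum.cong) (use g i in \<open>auto simp: gram_def\<close>)
  finally show ?thesis using tau(2)[OF i] by simp
qed

lemma gram_vindep:
  assumes g: "gram r b" and b: "\<And>i. i < d * r \<Longrightarrow> b i \<in> carrier_vec N"
  shows "vindep N (d * r) b"
proof (rule vindepI)
  fix c i assume c: "comb N (d * r) c b = 0\<^sub>v N" and i: "i < d * r"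
  have "c (\<tau> (\<tau> i)) * s (\<tau> i) = 0"
    using bform_comb_gram[OF g b tau(2)[OF i], of c] bform_right(3)[OF b b b, OF tau(2)[OF i] i i] by (simp add: c)
  then have "c i * s (\<tau> i) * s (\<tau> i) = 0" by (simp add: tau(1))
  then show "c i = 0" by (simp add: mult.assoc s(1))
qed

text \<open>Take the number of blocks maximal. The orthogonal complement Z of the frame in U is
  again nondegenerate, so by \<open>ext\<close> a nonzero vector in Z would supply a further
  block.\<close>

lemma gram_frame:
  assumes U: "lin_subspace N U" and nd: "nondegenerate_on N J U"
  shows "\<exists>r b. (\<forall>i<d * r. b i \<in> U) \<and> gram r b \<and> (\<forall>u\<in>U. u = comb N (d * r) (coord b u) b)"
proof -
  have UC: "u \<in> carrier_vec N" if "u \<in> U" for u using U that by (auto simp: lin_subspace_def)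
  define P where "P r \<longleftrightarrow> (\<exists>b. (\<forall>i<d * r. b i \<in> U) \<and> gram r b)" for r
  have "P 0" by (simp add: P_def gram_def)
  moreover have "r \<le> N" if "P r" for r
  proof -
    obtain b where b: "\<forall>i<d * r. b i \<in> U" "gram r b" using \<open>P r\<close> by (auto simp: P_def)
    have "d * r \<le> N" by (rule vindep_le[OF _ gram_vindep[OF b(2)]]) (use b(1) UC in auto)
    moreover have "r \<le> d * r" using d by simp
    ultimately show ?thesis by (rule order_trans[rotated])
  qed
  ultimately obtain r where r: "P r" "\<And>n. P n \<Longrightarrow> n \<le> r" using Nat.ex_has_greatest_nat[of P 0 N] by blast
  obtain b where b: "\<forall>i<d * r. b i \<in> U" and g: "gram r b" using r(1) by (auto simp: P_def)
  have bC: "b i \<in> carrier_vec N" if "i < d * r" for i using b UC that by blast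
  define Z where "Z = {u \<in> U. \<forall>i<d * r. bform J (b i) u = 0}"
  have ZU: "z \<in> U" if "z \<in> Z" for z using that by (simp add: Z_def)
  define rest where "rest u = u + (-1) \<cdot>\<^sub>v comb N (d * r) (coord b u) b" for u
  have restZ: "rest u \<in> Z" if u: "u \<in> U" for u
  proof -
    have cU: "comb N (d * r) (coord b u) b \<in> U" by (rule comb_subspace[OF U]) (use b in auto)
    then have "rest u \<in> U" using u U by (simp add: rest_def lin_subspace_def)
    moreover have "bform J (b i) (rest u) = 0" if i: "i < d * r" for i
    proof -
      have "bform J (b i) (rest u) = bform J (b i) u + (-1) * bform J (b i) (comb N (d * r) (coord b u) b)"
        unfolding rest_def using bform_right(1,2)[OF bC[OF i]] UC[OF u] by simp
      also have "\<dots> = bform J (b i) u - s i * s i * bform J (b i) u"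
        using bform_comb_gram[OF g _ i, of "coord b u"] bC by (simp add: coord_def tau(1))
      finally show ?thesis by (simp add: s(1))
    qed
    ultimately show ?thesis by (simp add: Z_def)
  qed
  have Zsub: "lin_subspace N Z"
    unfolding lin_subspace_def
  proof (intro conjI ballI allI)
    show "Z \<subseteq> carrier_vec N" using ZU UC by blast
    show "0\<^sub>v N \<in> Z" using U bform_right(3)[OF bC bC bC] by (auto simp: Z_def lin_subspace_def)
    show "x + y \<in> Z" if "x \<in> Z" "y \<in> Z" for x y
      using that U UC bform_right(1)[OF bC] by (auto simp: Z_def lin_subspace_def)
    show "c \<cdot>\<^sub>v x \<in> Z" if "x \<in> Z" for c x
      using that U UC bform_right(2)[OF bC, of _ x x] by (auto simp: Z_def lin_subspace_def)
  qed
  have Znd: "nondegenerate_on N J Z"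
    unfolding nondegenerate_on_def
  proof (intro ballI impI)
    fix x assume x: "x \<in> Z" and z: "\<forall>y\<in>Z. bform J x y = 0"
    have xC: "x \<in> carrier_vec N" using ZU[OF x] UC by blast
    have "bform J x y = 0" if y: "y \<in> U" for y
    proof -
      have "bform J x (b i) = 0" if "i < d * r" for i
        using sym[OF bC[OF that] xC] x that by (simp add: Z_def)
      then have "bform J x (comb N (d * r) (coord b y) b) = 0" using bform_comb[OF xC bC] by simp
      moreover have "bform J x (rest y) = 0" using z restZ[OF y] by blast
      ultimately show ?thesis
        unfolding rest_def using bform_right(1,2)[OF xC] UC[OF y] by simp
    qed
    then show "x = 0\<^sub>v N" using nd ZU[OF x] unfolding nondegenerate_on_def by blast
  qed
  have Z0: "z = 0\<^sub>v N" if z: "z \<in> Z" for z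
  proof (rule ccontr)
    assume "z \<noteq> 0\<^sub>v N"
    then obtain f where f: "\<And>i. i < d \<Longrightarrow> f i \<in> Z"
      "\<And>i j. i < d \<Longrightarrow> j < d \<Longrightarrow> bform J (f i) (f j) = (if j = \<tau> i then s i else 0)"
      using ext[OF Zsub Znd z] by blast
    define h where "h i = (if i < d * r then b i else f (i - d * r))" for i
    have split: "\<exists>l<d. i = d * r + l" if "i < d * Suc r" "\<not> i < d * r" for i
      using that by (intro exI[of _ "i - d * r"]) auto
    have fC: "f i \<in> carrier_vec N" if "i < d" for i using ZU[OF f(1)[OF that]] UC by blast
    have hl: "h (d * r + l) = f l" for l by (simp add: h_def)
    have hb: "h i = b i" if "i < d * r" for i using that by (simp add: h_def)
    have "gram (Suc r) h"
      unfolding gram_def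
    proof (intro allI impI)
      fix i j assume i: "i < d * Suc r" and j: "j < d * Suc r"
      show "bform J (h i) (h j) = (if j = \<tau> i then s i else 0)"
      proof (cases "i < d * r")
        case True
        show ?thesis
        proof (cases "j < d * r")
          case j': True
          then show ?thesis using g True by (simp add: hb gram_def)
        next
          case False
          then obtain l where l: "l < d" "j = d * r + l" using split[OF j] by blast
          have "bform J (b i) (f l) = 0" using f(1)[OF l(1)] True by (simp add: Z_def)
          then show ?thesis using tau(2)[OF True] False True by (auto simp: l(2) hl hb)
        qed
      next
        case False
        then obtain k where k: "k < d" "i = d * r + k" using split[OF i] by blast
        have ti: "\<tau> i = d * r + \<tau> k" unfolding k(2) by (rule tau(3)[OF k(1)])
        show ?thesis
        proof (cases "j < d * r")
          case True
          have "bform J (f k) (b j) = 0"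
            using sym[OF bC[OF True] fC[OF k(1)]] f(1)[OF k(1)] True by (simp add: Z_def)
          then show ?thesis using True ti by (auto simp: k(2) hl hb)
        next
          case False
          then obtain l where l: "l < d" "j = d * r + l" using split[OF j] by blast
          show ?thesis using f(2)[OF k(1) l(1)] s(2)[OF k(1), of r] ti by (simp add: k(2) l(2) hl)
        qed
      qed
    qed
    moreover have "h i \<in> U" if ih: "i < d * Suc r" for i
    proof (cases "i < d * r")
      case True
      then show ?thesis using b by (simp add: hb)
    next
      case False
      then obtain l where "l < d" "i = d * r + l" using split[OF ih] by blast
      then show ?thesis using ZU[OF f(1)] by (simp add: hl)
    qed
    ultimately have "P (Suc r)" by (auto simp: P_def)
    then show False using r(2)[of "Suc r"] by simp
  qed
  have "u = comb N (d * r) (coord b u) b" if u: "u \<in> U" for u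
  proof (rule eq_vecI)
    show "dim_vec u = dim_vec (comb N (d * r) (coord b u) b)" using UC[OF u] by (simp add: comb_def)
    fix a assume "a < dim_vec (comb N (d * r) (coord b u) b)"
    then have a: "a < N" by (simp add: comb_def)
    have "rest u $ a = 0" using Z0[OF restZ[OF u]] a by simp
    then show "u $ a = comb N (d * r) (coord b u) b $ a" using a UC[OF u] by (simp add: rest_def comb_def)
  qed
  then show ?thesis using b g by blast
qed

text \<open>Frames of U and W are put side by side. Orthogonality makes the joint Gram matrix block
  diagonal, and the given dimensions fix the numbers of blocks.\<close>

lemma form_frame:
  assumes N: "N = d * (m + k)" and dec: "orthogonal_decomposition N J U (d * m) W (d * k)"
  shows "\<exists>P\<in>carrier_mat N N. (\<forall>i<d * m. col P i \<in> U) \<and> (\<forall>i<N. d * m \<le> i \<longrightarrow> col P i \<in> W) \<and>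
    transpose_mat P * (J * P) = mat N N (\<lambda>(i, j). if j = \<tau> i then s i else 0)"
proof -
  have sub: "submodule (class_ring :: 'a ring) U (module_vec TYPE('a) N)" "submodule (class_ring :: 'a ring) W (module_vec TYPE('a) N)"
    and dims: "vdim (sub_space (module_vec TYPE('a) N) U) = d * m" "vdim (sub_space (module_vec TYPE('a) N) W) = d * k"
    and nd: "nondegenerate_on N J U" "nondegenerate_on N J W" and orth: "\<And>u w. u \<in> U \<Longrightarrow> w \<in> W \<Longrightarrow> bform J u w = 0"
    using dec by (auto simp: orthogonal_decomposition_def direct_decomposition_def)
  note ls = submodule_lin_subspace[OF sub(1)] submodule_lin_subspace[OF sub(2)]
  have C: "u \<in> carrier_vec N" if "u \<in> U \<or> u \<in> W" for u using ls that by (auto simp: lin_subspace_def)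
  obtain r b where b: "\<forall>i<d * r. b i \<in> U" "gram r b" "\<forall>u\<in>U. u = comb N (d * r) (coord b u) b"
    using gram_frame[OF ls(1) nd(1)] by (elim exE conjE)
  obtain r' b' where b': "\<forall>i<d * r'. b' i \<in> W" "gram r' b'" "\<forall>u\<in>W. u = comb N (d * r') (coord b' u) b'"
    using gram_frame[OF ls(2) nd(2)] by (elim exE conjE)
  have "d * m = d * r"
    using vdim_eq[OF sub(1) _ gram_vindep[OF b(2)]] b(1,3) C dims(1) by (metis)
  then have r: "r = m" using d by simp
  have "d * k = d * r'"
    using vdim_eq[OF sub(2) _ gram_vindep[OF b'(2)]] b'(1,3) C dims(2) by (metis)
  then have r': "r' = k" using d by simp
  define h where "h i = (if i < d * m then b i else b' (i - d * m))" for i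
  have hU: "h i \<in> U" if "i < d * m" for i using that b(1) r by (simp add: h_def)
  have hW: "h i \<in> W" if "i < N" "d * m \<le> i" for i using that b'(1) r' N by (simp add: h_def algebra_simps less_diff_conv2)
  have hC: "h i \<in> carrier_vec N" if "i < N" for i using hU[of i] hW[of i] that C by (cases "i < d * m") auto
  define P where "P = mat N N (\<lambda>(a, i). h i $ a)"
  have P: "P \<in> carrier_mat N N" by (simp add: P_def)
  have col: "col P i = h i" if "i < N" for i
    by (rule eq_vecI) (use that hC[OF that] in \<open>auto simp: P_def\<close>)
  have gram: "bform J (h i) (h j) = (if j = \<tau> i then s i else 0)" if i: "i < N" and j: "j < N" for i j
  proof (cases "i < d * m")
    case True
    show ?thesis
    proof (cases "j < d * m")
      case j': True
      then show ?thesis using b(2) True r by (simp add: h_def gram_def)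
    next
      case False
      then show ?thesis using orth[OF hU[OF True] hW[OF j]] tau(2)[OF True] by auto
    qed
  next
    case i': False
    define l where "l = i - d * m"
    have l: "i = d * m + l" "l < d * k" using i i' N by (auto simp: l_def algebra_simps less_diff_conv2)
    \<comment> \<open>\<tau> acts inside each block of size d, so it commutes with a shift by the d
      m indices of U; l is split into block number and offset.\<close>
    have ti: "\<tau> i = d * m + \<tau> l"
    proof -
      have ld: "l mod d < d" "l = d * (l div d) + l mod d" using d by auto
      have "\<tau> (d * (m + l div d) + l mod d) = d * (m + l div d) + \<tau> (l mod d)" "\<tau> (d * (l div d) + l mod d) = d * (l div d) + \<tau> (l mod d)"
        by (rule tau(3)[OF ld(1)])+
      then show ?thesis by (simp add: l(1) distrib_left add.assoc)
    qed
    have si: "s i = s l"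
    proof -
      have ld: "l mod d < d" using d by auto
      have "s (d * (m + l div d) + l mod d) = s (l mod d)" "s (d * (l div d) + l mod d) = s (l mod d)"
        by (rule s(2)[OF ld])+
      then show ?thesis by (simp add: l(1) distrib_left add.assoc)
    qed
    show ?thesis
    proof (cases "j < d * m")
      case True
      then show ?thesis
        using orth[OF hU[OF True] hW[OF i]] i' sym[OF hC[OF j] hC[OF i]] ti by auto
    next
      case False
      then have j': "j = d * m + (j - d * m)" "j - d * m < d * k" using j N by (auto simp: algebra_simps less_diff_conv2)
      have "bform J (b' l) (b' (j - d * m)) = (if j - d * m = \<tau> l then s l else 0)"
        using b'(2) l(2) j'(2) r' by (simp add: gram_def)
      then show ?thesis using ti si False j'(1) i' by (auto simp: h_def l_def)
    qed
  qed
  have "transpose_mat P * (J * P) = mat N N (\<lambda>(i, j). if j = \<tau> i then s i else 0)"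
  proof (rule eq_matI)
    fix i j assume "i < dim_row (mat N N (\<lambda>(i, j). if j = \<tau> i then s i else 0))" "j < dim_col (mat N N (\<lambda>(i, j). if j = \<tau> i then s i else 0))"
    then have ij: "i < N" "j < N" by auto
    have "(transpose_mat P * (J * P)) $$ (i, j) = col P i \<bullet> col (J * P) j" using ij P J by simp
    also have "col (J * P) j = J *\<^sub>v col P j" using ij P J by (intro col_mult2) auto
    finally show "(transpose_mat P * (J * P)) $$ (i, j) = mat N N (\<lambda>(i, j). if j = \<tau> i then s i else 0) $$ (i, j)"
      using gram[OF ij] ij by (simp add: col bform_def)
  qed (use P J in auto)
  then show ?thesis using P col hU hW N by (intro bexI[OF _ P]) (auto simp: algebra_simps)
qed

end

lemma mult_mat_vec_cols:
  fixes P :: "'a::field mat"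
  assumes P: "P \<in> carrier_mat N N" and y: "y \<in> carrier_vec N"
  shows "P *\<^sub>v y = comb N N (\<lambda>i. y $ i) (col P)"
  by (rule eq_vecI) (use P y in \<open>auto simp: comb_def scalar_prod_def lessThan_atLeast0 mult.commute intro!: sum.cong\<close>)

lemma mat_eq_vecI:
  fixes A :: "'a::field mat"
  assumes A: "A \<in> carrier_mat N N" and B: "B \<in> carrier_mat N N"
    and eq: "\<And>x. x \<in> carrier_vec N \<Longrightarrow> A *\<^sub>v x = B *\<^sub>v x"
  shows "A = B"
proof (rule eq_matI)
  fix i j assume "i < dim_row B" "j < dim_col B"
  then have ij: "i < N" "j < N" using B by auto
  have M: "(M *\<^sub>v unit_vec N j) $ i = M $$ (i, j)" if "M \<in> carrier_mat N N" for M :: "'a mat"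
    using that ij by (simp add: scalar_prod_right_unit)
  show "A $$ (i, j) = B $$ (i, j)" using M[OF A] M[OF B] eq[of "unit_vec N j"] by simp
qed (use A B in auto)

lemma decomposition_unique:
  assumes "direct_decomposition N U a W b" "u \<in> U" "w \<in> W" "u' \<in> U" "w' \<in> W" "u + w = u' + w'"
  shows "u = u'" "w = w'"
proof -
  have ls: "lin_subspace N U" "lin_subspace N W"
    using assms(1) submodule_lin_subspace by (auto simp: direct_decomposition_def)
  then have "u \<in> carrier_vec N" "w \<in> carrier_vec N" using assms(2,3) by (auto simp: lin_subspace_def)
  then have "u + w \<in> carrier_vec N" by simp
  then have "\<exists>!(x, y). x \<in> U \<and> y \<in> W \<and> u + w = x + y" using assms(1) by (auto simp: direct_decomposition_def)
  then have "(u, w) = (u', w')" using assms(2-6) by (elim ex1E) (auto dest: spec[of _ "(u, w)"] spec[of _ "(u', w')"])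
  then show "u = u'" "w = w'" by auto
qed

text \<open>A kernel vector of P would give u + w = 0 with u in U and w in W; uniqueness of the
  decomposition makes both zero, and independence of the two bases kills the coefficients.\<close>

lemma direct_frame:
  fixes U W :: "'a::field vec set"
  assumes N: "N = m + k" and dec: "direct_decomposition N U m W k"
  shows "\<exists>P\<in>carrier_mat N N. (\<forall>i<m. col P i \<in> U) \<and> (\<forall>i<N. m \<le> i \<longrightarrow> col P i \<in> W) \<and> (\<exists>P'\<in>carrier_mat N N. P' * P = 1\<^sub>m N)"
proof -
  have sub: "submodule (class_ring :: 'a ring) U (module_vec TYPE('a) N)" "submodule (class_ring :: 'a ring) W (module_vec TYPE('a) N)"
    and dims: "vdim (sub_space (module_vec TYPE('a) N) U) = m" "vdim (sub_space (module_vec TYPE('a) N) W) = k"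
    using dec by (auto simp: direct_decomposition_def)
  note ls = submodule_lin_subspace[OF sub(1)] submodule_lin_subspace[OF sub(2)]
  have C: "u \<in> carrier_vec N" if "u \<in> U \<or> u \<in> W" for u using ls that by (auto simp: lin_subspace_def)
  obtain b where b: "\<forall>i<m. b i \<in> U" "vindep N m b" using basis_exists[OF sub(1) dims(1)] by blast
  obtain b' where b': "\<forall>i<k. b' i \<in> W" "vindep N k b'" using basis_exists[OF sub(2) dims(2)] by blast
  define h where "h i = (if i < m then b i else b' (i - m))" for i
  have hU: "h i \<in> U" if "i < m" for i using that b(1) by (simp add: h_def)
  have hW: "h i \<in> W" if "i < N" "m \<le> i" for i using that b'(1) N by (simp add: h_def)
  have hC: "h i \<in> carrier_vec N" if "i < N" for i using hU[of i] hW[of i] that C by (cases "i < m") auto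
  define P where "P = mat N N (\<lambda>(a, i). h i $ a)"
  have P: "P \<in> carrier_mat N N" by (simp add: P_def)
  have col: "col P i = h i" if "i < N" for i
    by (rule eq_vecI) (use that hC[OF that] in \<open>auto simp: P_def\<close>)
  have "det P \<noteq> 0"
  proof
    assume "det P = 0"
    then obtain y where y: "y \<in> carrier_vec N" "y \<noteq> 0\<^sub>v N" "P *\<^sub>v y = 0\<^sub>v N"
      using det_0_iff_vec_prod_zero[OF P] by blast
    define u where "u = comb N m (\<lambda>i. y $ i) b"
    define w where "w = comb N k (\<lambda>i. y $ (m + i)) b'"
    have uw: "u \<in> U" "w \<in> W"
      unfolding u_def w_def by (rule comb_subspace[OF ls(1)], use b in simp, rule comb_subspace[OF ls(2)], use b' in simp)
    have Py: "P *\<^sub>v y = u + w"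
    proof (rule eq_vecI)
      fix a assume "a < dim_vec (u + w)"
      then have a: "a < N" by (simp add: w_def comb_def)
      have "(P *\<^sub>v y) $ a = (\<Sum>i<m + k. y $ i * h i $ a)"
        unfolding mult_mat_vec_cols[OF P y(1)] using a by (simp add: comb_def N [symmetric] col)
      also have "\<dots> = (\<Sum>i<m. y $ i * b i $ a) + (\<Sum>i<k. y $ (m + i) * b' i $ a)"
        unfolding sum_lessThan_add by (simp add: h_def)
      finally show "(P *\<^sub>v y) $ a = (u + w) $ a" using a by (simp add: u_def w_def comb_def)
    qed (use P in \<open>simp add: w_def comb_def\<close>)
    have z: "0\<^sub>v N \<in> U" "0\<^sub>v N \<in> W" using ls by (auto simp: lin_subspace_def)
    have "u + w = 0\<^sub>v N + 0\<^sub>v N" unfolding Py[symmetric] y(3) by simp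
    then have "u = 0\<^sub>v N" "w = 0\<^sub>v N" by (rule decomposition_unique[OF dec uw z])+
    then have z: "comb N m (\<lambda>i. y $ i) b = 0\<^sub>v N" "comb N k (\<lambda>i. y $ (m + i)) b' = 0\<^sub>v N"
      by (simp_all only: u_def w_def)
    have 1: "y $ i = 0" if "i < m" for i using comb_zeroD[OF b(2) z(1) that] .
    have 2: "y $ (m + i) = 0" if "i < k" for i using comb_zeroD[OF b'(2) z(2) that] .
    have "y $ i = 0" if "i < N" for i
      using 1[of i] 2[of "i - m"] that N by (cases "i < m") auto
    then have "y = 0\<^sub>v N" using y(1) by (intro eq_vecI) auto
    then show False using y(2) by simp
  qed
  then have "P \<in> Units (ring_mat TYPE('a) N ())" by (rule det_non_zero_imp_unit[OF P])
  then have "\<exists>P'\<in>carrier_mat N N. P' * P = 1\<^sub>m N" by (auto simp: Units_def ring_mat_def)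
  then show ?thesis using P col hU hW N by (intro bexI[OF _ P]) auto
qed

text \<open>\<open>e\<close> is the projection onto U along W, because the first q columns of P lie
  in U and the others in W; a matrix preserves both summands exactly if it commutes with this
  projection.\<close>

lemma preserving_iff:
  fixes U W :: "'a::field vec set"
  assumes dec: "direct_decomposition N U a W b" and P: "P \<in> carrier_mat N N" and P': "P' \<in> carrier_mat N N" "P * P' = 1\<^sub>m N"
    and q: "q \<le> N" "\<And>i. i < q \<Longrightarrow> col P i \<in> U" "\<And>i. i < N \<Longrightarrow> q \<le> i \<Longrightarrow> col P i \<in> W"
    and X: "X \<in> carrier_mat N N"
  defines "e \<equiv> P * (mat N N (\<lambda>(i, j). if i = j \<and> i < q then 1 else 0) * P')"
  shows "(\<forall>u\<in>U. X *\<^sub>v u \<in> U) \<and> (\<forall>w\<in>W. X *\<^sub>v w \<in> W) \<longleftrightarrow> e * X = X * e"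
proof -
  have ls: "lin_subspace N U" "lin_subspace N W"
    using dec submodule_lin_subspace by (auto simp: direct_decomposition_def)
  have C: "u \<in> carrier_vec N" if "u \<in> U \<or> u \<in> W" for u using ls that by (auto simp: lin_subspace_def)
  define D :: "'a mat" where "D = mat N N (\<lambda>(i, j). if i = j \<and> i < q then 1 else 0)"
  have D: "D \<in> carrier_mat N N" by (simp add: D_def)
  have e: "e \<in> carrier_mat N N" unfolding e_def using P P' by (intro mult_carrier_mat[of _ N N]) auto
  have split: "\<exists>w\<in>W. e *\<^sub>v x \<in> U \<and> x = e *\<^sub>v x + w" if x: "x \<in> carrier_vec N" for x
  proof -
    define y where "y = P' *\<^sub>v x"
    have y: "y \<in> carrier_vec N" using P' x by (simp add: y_def)
    have Dy: "(D *\<^sub>v y) $ i = (if i < q then y $ i else 0)" if i: "i < N" for i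
    proof -
      have "(D *\<^sub>v y) $ i = (\<Sum>j=0..<N. (if i = j \<and> i < q then 1 else 0) * y $ j)"
        using i y by (simp add: D_def scalar_prod_def)
      also have "\<dots> = (\<Sum>j=0..<N. if j = i then (if i < q then y $ i else 0) else 0)"
        by (rule sum.cong) auto
      finally show ?thesis using i by simp
    qed
    have DyC: "D *\<^sub>v y \<in> carrier_vec N" using D y by simp
    have "e *\<^sub>v x = P *\<^sub>v (D *\<^sub>v y)"
      unfolding e_def y_def D_def [symmetric] using P D P' x
      by (simp add: assoc_mult_mat_vec[of _ N N _ N] assoc_mult_mat_vec[OF D P'(1) x] mult_carrier_mat[of _ N N])
    also have "\<dots> = comb N q (\<lambda>i. y $ i) (col P)"
    proof (rule eq_vecI)
      fix a assume "a < dim_vec (comb N q (\<lambda>i. y $ i) (col P))"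
      then have a: "a < N" by (simp add: comb_def)
      have "(P *\<^sub>v (D *\<^sub>v y)) $ a = (\<Sum>i<N. (D *\<^sub>v y) $ i * col P i $ a)"
        unfolding mult_mat_vec_cols[OF P DyC] using a by (simp add: comb_def)
      also have "\<dots> = (\<Sum>i<q. (D *\<^sub>v y) $ i * col P i $ a)"
        by (rule sum.mono_neutral_right) (use q(1) in \<open>auto simp: Dy\<close>)
      also have "\<dots> = (\<Sum>i<q. y $ i * col P i $ a)" by (rule sum.cong) (use q(1) in \<open>auto simp: Dy\<close>)
      finally show "(P *\<^sub>v (D *\<^sub>v y)) $ a = comb N q (\<lambda>i. y $ i) (col P) $ a" using a by (simp add: comb_def)
    qed (use P in \<open>simp add: comb_def\<close>)
    finally have ex: "e *\<^sub>v x = comb N q (\<lambda>i. y $ i) (col P)" .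
    define w where "w = comb N (N - q) (\<lambda>i. y $ (q + i)) (\<lambda>i. col P (q + i))"
    have "w \<in> W" unfolding w_def by (rule comb_subspace[OF ls(2)]) (use q in auto)
    moreover have "e *\<^sub>v x \<in> U" unfolding ex by (rule comb_subspace[OF ls(1) q(2)])
    moreover have "x = e *\<^sub>v x + w"
    proof -
      have "x = P *\<^sub>v y" unfolding y_def using P P' x by (simp add: assoc_mult_mat_vec[OF P P'(1) x, symmetric])
      also have "\<dots> = e *\<^sub>v x + w"
      proof (rule eq_vecI)
        fix a assume "a < dim_vec (e *\<^sub>v x + w)"
        then have a: "a < N" by (simp add: w_def comb_def)
        have "(P *\<^sub>v y) $ a = (\<Sum>i<q + (N - q). y $ i * col P i $ a)"
          unfolding mult_mat_vec_cols[OF P y] using a q(1) by (simp add: comb_def)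
        then show "(P *\<^sub>v y) $ a = (e *\<^sub>v x + w) $ a"
          unfolding sum_lessThan_add ex using a by (simp add: w_def comb_def)
      qed (use P in \<open>simp add: w_def comb_def\<close>)
      finally show ?thesis .
    qed
    ultimately show ?thesis by blast
  qed
  have z: "0\<^sub>v N \<in> U" "0\<^sub>v N \<in> W" using ls by (auto simp: lin_subspace_def)
  have eU: "e *\<^sub>v u = u" if u: "u \<in> U" for u
  proof -
    obtain w where w: "w \<in> W" "e *\<^sub>v u \<in> U" "u = e *\<^sub>v u + w" using split[of u] C u by blast
    have "u + 0\<^sub>v N = e *\<^sub>v u + w" using w(3) C[of u] u by simp
    then show ?thesis using decomposition_unique(1)[OF dec u z(2) w(2,1)] by simp
  qed
  have eW: "e *\<^sub>v w = 0\<^sub>v N" if w: "w \<in> W" for w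
  proof -
    obtain w' where w': "w' \<in> W" "e *\<^sub>v w \<in> U" "w = e *\<^sub>v w + w'" using split[of w] C w by blast
    have "0\<^sub>v N + w = e *\<^sub>v w + w'" using w'(3) C[of w] w by simp
    then show ?thesis using decomposition_unique(1)[OF dec z(1) w w'(2,1)] by simp
  qed
  have eX: "(e * X) *\<^sub>v x = e *\<^sub>v (X *\<^sub>v x)" "(X * e) *\<^sub>v x = X *\<^sub>v (e *\<^sub>v x)" if "x \<in> carrier_vec N" for x
    using assoc_mult_mat_vec[OF e X that] assoc_mult_mat_vec[OF X e that] by auto
  have ec: "e *\<^sub>v x \<in> carrier_vec N" "X *\<^sub>v x \<in> carrier_vec N" if "x \<in> carrier_vec N" for x using e X that by auto
  show ?thesis
  proof
    assume comm: "e * X = X * e"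
    have "X *\<^sub>v u \<in> U" if u: "u \<in> U" for u
    proof -
      have "X *\<^sub>v u = e *\<^sub>v (X *\<^sub>v u)" using eX[of u] comm eU[OF u] C u by simp
      then show ?thesis using split[OF ec(2)[of u]] C u by metis
    qed
    moreover have "X *\<^sub>v w \<in> W" if w: "w \<in> W" for w
    proof -
      have "X *\<^sub>v 0\<^sub>v N = 0\<^sub>v N" using X by (intro eq_vecI) (auto simp: scalar_prod_def)
      then have 0: "e *\<^sub>v (X *\<^sub>v w) = 0\<^sub>v N" using eX[of w] comm eW[OF w] C w by simp
      obtain w' where w': "w' \<in> W" "X *\<^sub>v w = e *\<^sub>v (X *\<^sub>v w) + w'" using split[OF ec(2)[of w]] C w by blast
      then have "X *\<^sub>v w = w'" using C[of w'] by (simp add: 0)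
      then show ?thesis using w'(1) by simp
    qed
    ultimately show "(\<forall>u\<in>U. X *\<^sub>v u \<in> U) \<and> (\<forall>w\<in>W. X *\<^sub>v w \<in> W)" by blast
  next
    assume pr: "(\<forall>u\<in>U. X *\<^sub>v u \<in> U) \<and> (\<forall>w\<in>W. X *\<^sub>v w \<in> W)"
    have "(e * X) *\<^sub>v x = (X * e) *\<^sub>v x" if x: "x \<in> carrier_vec N" for x
    proof -
      obtain w where w: "w \<in> W" "e *\<^sub>v x \<in> U" "x = e *\<^sub>v x + w" using split[OF x] by blast
      have wc: "w \<in> carrier_vec N" "e *\<^sub>v x \<in> carrier_vec N" using C w(1) ec x by auto
      have "(e * X) *\<^sub>v x = e *\<^sub>v (X *\<^sub>v (e *\<^sub>v x) + X *\<^sub>v w)"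
        using eX(1)[OF x] w(3) mult_add_distrib_mat_vec[OF X wc(2,1)] by simp
      also have "\<dots> = e *\<^sub>v (X *\<^sub>v (e *\<^sub>v x)) + e *\<^sub>v (X *\<^sub>v w)"
        by (rule mult_add_distrib_mat_vec[OF e ec(2)[OF wc(2)] ec(2)[OF wc(1)]])
      also have "\<dots> = X *\<^sub>v (e *\<^sub>v x)"
        using eU eW pr w(1,2) ec(2)[OF wc(2)] by simp
      finally show ?thesis using eX(2)[OF x] by simp
    qed
    then show "e * X = X * e"
      by (intro mat_eq_vecI[of _ N]) (use e X in auto)
  qed
qed

section \<open>Transposes and block matrix units\<close>

lift_definition ftrans :: "'a::comm_ring_1 fmatrix \<Rightarrow> 'a fmatrix" is "\<lambda>A i j. A j i"
  by auto

lemma entry_ftrans [simp]: "entry (ftrans A) i j = entry A j i"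
  by transfer simp

lemma ftrans_corner [simp]: "ftrans A \<in> corner N \<longleftrightarrow> A \<in> corner N"
  by (auto simp: corner_def)

lemma ftrans_mult [simp]: "ftrans (A * B) = ftrans B * ftrans A"
proof -
  obtain N where N: "A \<in> corner N" "B \<in> corner N" using common_corner by blast
  show ?thesis
    by (rule fmatrix_eqI) (use N in \<open>simp add: entry_mult_corner[of _ N] mult.commute\<close>)
qed

lemma ftrans_simps [simp]: "ftrans (ftrans A) = A" "ftrans (A + B) = ftrans A + ftrans B"
  "ftrans (A - B) = ftrans A - ftrans B" "ftrans (- A) = - ftrans A" "ftrans (scale c A) = scale c (ftrans A)"
  "ftrans 0 = 0" "ftrans (funit a b) = funit b a"
  by (auto intro!: fmatrix_eqI)

lemma ftrace_ftrans [simp]: "ftrace (ftrans A) = ftrace A"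
proof -
  obtain N where N: "A \<in> corner N" using corner_ex by blast
  then show ?thesis using ftrace_corner[of "ftrans A" N] ftrace_corner[of A N] by simp
qed

lemma ftrans_sum: "ftrans (sum F I) = (\<Sum>i\<in>I. ftrans (F i))"
  by (rule fmatrix_eqI) (simp add: entry_sum)

lemma funit_left: "entry (funit a b * A) x y = (if x = a then entry A b y else 0)"
proof -
  obtain N where N: "A \<in> corner N" using corner_ex by blast
  have f: "funit a b \<in> corner (Suc (max a b))" by (rule funit_corner) auto
  have "entry (funit a b * A) x y = (\<Sum>j<Suc (max a b). if j = b then (if x = a then entry A b y else 0) else 0)"
    unfolding entry_mult_corner[OF f] by (rule sum.cong) auto
  then show ?thesis by simp
qed

lemma funit_right: "entry (A * funit a b) x y = (if y = b then entry A x a else 0)"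
  using funit_left[of b a "ftrans A" y x] by (metis entry_ftrans ftrans_mult ftrans_simps(1,7))

lemma funit_mult: "funit a b * funit c e = (if b = c then funit a e else 0)"
  by (rule fmatrix_eqI) (simp add: funit_left)

lemma funit_sandwich: "funit a b * Y * funit c e = scale (entry Y b c) (funit a e)"
  by (rule fmatrix_eqI) (simp add: funit_left funit_right)

text \<open>The matrix units of matrices over the d x d matrices: the identity of size d placed at
  block position (i, j).\<close>

definition blk :: "nat \<Rightarrow> nat \<Rightarrow> nat \<Rightarrow> 'a::comm_ring_1 fmatrix" where
  "blk d i j = (\<Sum>l<d. funit (d * i + l) (d * j + l))"

lemma blk_index:
  assumes "l < d" "l' < (d :: nat)"
  shows "d * i + l = d * j + l' \<longleftrightarrow> i = j \<and> l = l'"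
proof
  assume eq: "d * i + l = d * j + l'"
  have "(d * i + l) div d = i" "(d * j + l') div d = j" using assms by auto
  then have "i = j" using eq by simp
  then show "i = j \<and> l = l'" using eq by simp
qed simp

lemma blk_mult: "blk d i j * blk d i' j' = (if j = i' then blk d i j' else 0)"
proof -
  have "blk d i j * blk d i' j' = (\<Sum>l<d. \<Sum>l'<d. funit (d * i + l) (d * j + l) * funit (d * i' + l') (d * j' + l'))"
    unfolding blk_def by (simp add: sum_product)
  also have "\<dots> = (\<Sum>l<d. \<Sum>l'<d. if l' = l then (if j = i' then funit (d * i + l) (d * j' + l) else 0) else 0)"
    by (intro sum.cong) (auto simp: funit_mult blk_index)
  also have "\<dots> = (if j = i' then blk d i j' else 0)" by (simp add: blk_def)
  finally show ?thesis .
qed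

lemma blk_corner: "i < M \<Longrightarrow> j < M \<Longrightarrow> blk d i j \<in> corner (d * M)"
proof -
  assume ij: "i < M" "j < M"
  have "d * x + l < d * M" if "x < M" "l < d" for x l
  proof -
    have "d * x + l < d * x + d" using that by simp
    also have "\<dots> = d * (x + 1)" by simp
    also have "\<dots> \<le> d * M" using that by (intro mult_le_mono2) simp
    finally show ?thesis .
  qed
  then show ?thesis unfolding blk_def using ij by (intro corner_sum funit_corner) auto
qed

lemma blk_nonzero: "d > 0 \<Longrightarrow> blk d i i \<noteq> (0 :: 'a::comm_ring_1 fmatrix)"
proof
  assume d: "d > 0" and z: "blk d i i = (0 :: 'a fmatrix)"
  have "entry (blk d i i) (d * i) (d * i) = (\<Sum>l<d. if l = 0 then 1 else 0 :: 'a)"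
    unfolding blk_def entry_sum by (rule sum.cong) auto
  then show False using d by (simp add: z)
qed

lemma ftrans_blk: "ftrans (blk d i j) = blk d j i"
  by (simp add: blk_def ftrans_sum)

lemma sum_blk_prefix: "(\<Sum>i<q. blk d i i) = fmatrix_of_mat (mat (d * M) (d * M) (\<lambda>(i, j). if i = j \<and> i < d * q then 1 else 0))"
  if "q \<le> M"
proof -
  have "(\<Sum>i<q. blk d i i) = (\<Sum>p<d * q. funit p p :: 'a fmatrix)"
  proof (induction q)
    case (Suc q)
    have "(\<Sum>p<d * Suc q. funit p p :: 'a fmatrix) = (\<Sum>p<d * q + d. funit p p)" by (simp add: add.commute)
    also have "\<dots> = (\<Sum>p<d * q. funit p p) + (\<Sum>l<d. funit (d * q + l) (d * q + l))" by (rule sum_lessThan_add)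
    finally show ?case using Suc by (simp add: blk_def)
  qed simp
  also have "\<dots> = fmatrix_of_mat (mat (d * M) (d * M) (\<lambda>(i, j). if i = j \<and> i < d * q then 1 else 0))"
  proof (rule fmatrix_eqI)
    fix a b
    have le: "d * q \<le> d * M" using that by simp
    have "entry (\<Sum>p<d * q. funit p p :: 'a fmatrix) a b = (\<Sum>p<d * q. if p = a then (if a = b then 1 else 0) else 0)"
      unfolding entry_sum by (rule sum.cong) auto
    also have "\<dots> = (if a < d * q \<and> a = b then 1 else 0)" by simp
    finally show "entry (\<Sum>p<d * q. funit p p :: 'a fmatrix) a b =
        entry (fmatrix_of_mat (mat (d * M) (d * M) (\<lambda>(i, j). if i = j \<and> i < d * q then 1 else 0))) a b"
      using less_le_trans[OF _ le, of b] by auto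
  qed
  finally show ?thesis .
qed

section \<open>Hermitian structures obtained from frames\<close>

context
  fixes N m k d :: nat and P P' :: "'a::field_char_0 fmatrix"
  assumes N: "N = d * (m + k)" and d: "d > 0"
    and P: "P \<in> corner N" "P' \<in> corner N" "P * P' = fmatrix_of_mat (1\<^sub>m N)" "P' * P = fmatrix_of_mat (1\<^sub>m N)"
begin

definition "frameE i j = P * blk d i j * P'"

lemma one_mult: "A \<in> corner N \<Longrightarrow> fmatrix_of_mat (1\<^sub>m N) * A = A" "A \<in> corner N \<Longrightarrow> A * fmatrix_of_mat (1\<^sub>m N) = A"
  "A \<in> corner N \<Longrightarrow> P * (P' * A) = A" "A \<in> corner N \<Longrightarrow> P' * (P * A) = A"
  using mult_one_fmatrix[of A N] P(3,4) by (simp_all add: mult.assoc [symmetric])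

lemma blkN: "i < m + k \<Longrightarrow> j < m + k \<Longrightarrow> (blk d i j :: 'a fmatrix) \<in> corner N"
  unfolding N by (rule blk_corner)

lemma frame_sum: "q \<le> m + k \<Longrightarrow> (\<Sum>i<q. frameE i i) =
    P * (fmatrix_of_mat (mat N N (\<lambda>(i, j). if i = j \<and> i < d * q then 1 else 0)) * P')"
  unfolding frameE_def N sum_blk_prefix[symmetric] by (simp add: sum_distrib_left sum_distrib_right mult.assoc)

lemma frame_units:
  "i < m + k \<Longrightarrow> j < m + k \<Longrightarrow> frameE i j \<in> corner N"
  "i < m + k \<Longrightarrow> j < m + k \<Longrightarrow> i' < m + k \<Longrightarrow> j' < m + k \<Longrightarrow>
      frameE i j * frameE i' j' = (if j = i' then frameE i j' else 0)"
  "i < m + k \<Longrightarrow> frameE i i \<noteq> 0"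
  "A \<in> corner N \<Longrightarrow> (\<Sum>i<m + k. frameE i i) * A = A" "A \<in> corner N \<Longrightarrow> A * (\<Sum>i<m + k. frameE i i) = A"
proof -
  show c: "frameE i j \<in> corner N" if "i < m + k" "j < m + k" for i j
    unfolding frameE_def by (intro corner_mult P blkN that)
  show "frameE i j * frameE i' j' = (if j = i' then frameE i j' else 0)"
    if "i < m + k" "j < m + k" "i' < m + k" "j' < m + k" for i j i' j'
  proof -
    have b: "blk d i' j' * P' \<in> corner N" by (intro corner_mult P blkN that)
    have "frameE i j * frameE i' j' = P * (blk d i j * (P' * (P * (blk d i' j' * P'))))"
      by (simp add: frameE_def mult.assoc)
    also have "\<dots> = P * ((blk d i j * blk d i' j') * P')" by (simp add: one_mult(4)[OF b] mult.assoc)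
    finally show ?thesis by (simp add: blk_mult frameE_def mult.assoc)
  qed
  show "frameE i i \<noteq> 0" if i: "i < m + k" for i
  proof
    assume "frameE i i = 0"
    then have "P' * (P * (blk d i i * (P' * P))) = 0" by (simp add: frameE_def mult.assoc [symmetric])
    then have "blk d i i = (0 :: 'a fmatrix)" using blkN[OF i i] by (simp add: P(4) one_mult)
    then show False using blk_nonzero[OF d] by blast
  qed
  have "mat N N (\<lambda>(i, j). if i = j \<and> i < d * (m + k) then 1 else 0) = (1\<^sub>m N :: 'a mat)"
    unfolding N by (rule eq_matI) auto
  then have "(\<Sum>i<m + k. frameE i i) = fmatrix_of_mat (1\<^sub>m N)"
    using frame_sum[of "m + k"] P by (simp add: one_mult)
  then show "A \<in> corner N \<Longrightarrow> (\<Sum>i<m + k. frameE i i) * A = A" "A \<in> corner N \<Longrightarrow> A * (\<Sum>i<m + k. frameE i i) = A"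
    by (simp_all add: one_mult)
qed

lemma frame_scalar:
  assumes X: "X \<in> corner N" "frameE i i * X * frameE i i = X" and i: "i < m + k"
  shows "blk d i i * (P' * X * P) * blk d i i = P' * X * P" "P' * X * P \<in> corner N"
    "P' * X * P = scale c (blk d i i) \<Longrightarrow> X = scale c (frameE i i)"
proof -
  have c: "P' * X * P \<in> corner N" by (intro corner_mult P X)
  then show "P' * X * P \<in> corner N" .
  define Y where "Y = P' * X * P"
  have "X = P * Y * P'" unfolding Y_def using X(1) P by (simp add: mult.assoc one_mult)
  have Yc: "Y \<in> corner N" using c by (simp add: Y_def)
  have "P' * (P * (blk d i i * (P' * X * P) * blk d i i * P')) * P = P' * (frameE i i * X * frameE i i) * P"
    by (simp add: frameE_def mult.assoc)
  also have "\<dots> = Y" by (simp only: X(2) Y_def)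
  finally have "P' * (P * (blk d i i * Y * blk d i i * (P' * P))) = Y" by (simp only: Y_def mult.assoc)
  moreover have b: "blk d i i * Y * blk d i i \<in> corner N" by (intro corner_mult blkN i Yc)
  ultimately show "blk d i i * (P' * X * P) * blk d i i = P' * X * P"
    by (simp add: P(4) one_mult Y_def)
  show "X = scale c (frameE i i)" if "P' * X * P = scale c (blk d i i)"
    using \<open>X = P * Y * P'\<close> that by (simp add: Y_def frameE_def)
qed

lemma hermitian_total:
  assumes "d = 1"
  shows "hermitian N m k frameE (\<lambda>_ _. True) (\<lambda>A. A)"
proof (unfold_locales)
  show "\<exists>c. X = scale c (frameE i i)" if "i < m + k" "X \<in> corner N" "frameE i i * X * frameE i i = X" "True" for i X
  proof -
    note f = frame_scalar[OF that(2,3,1)]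
    have b: "blk d i i = (funit i i :: 'a fmatrix)" by (simp add: blk_def assms)
    have "P' * X * P = scale (entry (P' * X * P) i i) (blk d i i)"
      using f(1) unfolding b funit_sandwich by (rule sym)
    then show ?thesis using f(3) by blast
  qed
qed (use frame_units in auto)

text \<open>In the frame the form has Gram matrix \<Gamma>. As \<Gamma> commutes with the block
  units, the adjoint of a unit is the transposed unit. \<open>J' * (ftrans A * J)\<close> is the
  adjoint of A, and half the difference of A and its adjoint is the projection onto the
  skew-hermitian matrices.\<close>

lemma hermitian_form:
  fixes J \<Gamma> :: "'a fmatrix"
  assumes J: "J \<in> corner N" "ftrans J = scale \<epsilon> J" "\<epsilon> * \<epsilon> = 1"
    and J': "J' \<in> corner N" "J * J' = fmatrix_of_mat (1\<^sub>m N)" "J' * J = fmatrix_of_mat (1\<^sub>m N)"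
    and \<Gamma>: "ftrans P * (J * P) = \<Gamma>" "\<And>i j. i < m + k \<Longrightarrow> j < m + k \<Longrightarrow> blk d i j * \<Gamma> = \<Gamma> * blk d i j"
    and scalar: "\<And>i Y. i < m + k \<Longrightarrow> Y \<in> corner N \<Longrightarrow> blk d i i * Y * blk d i i = Y \<Longrightarrow> ftrans Y * \<Gamma> = \<Gamma> * Y \<Longrightarrow> \<exists>c. Y = scale c (blk d i i)"
  shows "hermitian N m k frameE (\<lambda>X Y. ftrans X * J = J * Y) (\<lambda>A. scale (1 / 2) (A - J' * (ftrans A * J)))"
proof -
  have I: "ftrans (fmatrix_of_mat (1\<^sub>m N)) = (fmatrix_of_mat (1\<^sub>m N) :: 'a fmatrix)"
    by (rule fmatrix_eqI) auto
  have Pt: "ftrans P \<in> corner N" "ftrans P' \<in> corner N" "ftrans P' * ftrans P = fmatrix_of_mat (1\<^sub>m N)"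
    "ftrans P * ftrans P' = fmatrix_of_mat (1\<^sub>m N)"
  proof -
    show "ftrans P' * ftrans P = fmatrix_of_mat (1\<^sub>m N)" using arg_cong[OF P(3), of ftrans] by (simp only: ftrans_mult I)
    show "ftrans P * ftrans P' = fmatrix_of_mat (1\<^sub>m N)" using arg_cong[OF P(4), of ftrans] by (simp only: ftrans_mult I)
  qed (use P in auto)
  have Pt': "ftrans P' * (ftrans P * A) = A" if "A \<in> corner N" for A
    using that by (simp add: mult.assoc [symmetric] Pt(3) one_mult)
  have PJ: "ftrans P * J = \<Gamma> * P'"
    unfolding \<Gamma>(1)[symmetric] using P(3) J Pt by (simp add: mult.assoc one_mult)
  have JP: "J * P = ftrans P' * \<Gamma>"
    unfolding \<Gamma>(1)[symmetric] by (rule Pt'[symmetric]) (intro corner_mult J P)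
  have JJ: "J * (J' * A) = A" "J' * (J * A) = A" if "A \<in> corner N" for A
    using that J' by (simp_all add: mult.assoc [symmetric] one_mult)
  have Jt: "ftrans J' = scale \<epsilon> J'"
  proof -
    have "ftrans J' * ftrans J = (fmatrix_of_mat (1\<^sub>m N) :: 'a fmatrix)"
      using arg_cong[OF J'(2), of ftrans] by (simp only: ftrans_mult I)
    then have "ftrans J' * ftrans J * J' = fmatrix_of_mat (1\<^sub>m N) * J'" by simp
    then have "scale \<epsilon> (ftrans J' * (J * J')) = J'" using J' by (simp add: J(2) one_mult mult.assoc)
    then have e: "scale \<epsilon> (ftrans J') = J'" using J' by (simp add: one_mult)
    have "scale \<epsilon> (scale \<epsilon> (ftrans J')) = ftrans J'" by (simp add: J(3))
    then show ?thesis by (simp only: e)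
  qed
  define S where "S A = J' * (ftrans A * J)" for A
  have Sc: "S A \<in> corner N" if "A \<in> corner N" for A
    unfolding S_def using that J(1) J'(1) by (intro corner_mult) auto
  have JS: "J * S A = ftrans A * J" "ftrans (S A) * J = J * A" if A: "A \<in> corner N" for A
  proof -
    have c: "ftrans A * J \<in> corner N" using A J(1) by (intro corner_mult) auto
    show "J * S A = ftrans A * J" unfolding S_def by (rule JJ(1)[OF c])
    have "ftrans (S A) * J = scale (\<epsilon> * \<epsilon>) (J * (A * (J' * J)))"
      by (simp add: S_def J(2) Jt mult.assoc)
    then show "ftrans (S A) * J = J * A" using A by (simp add: J(3) J'(3) one_mult)
  qed
  have half: "scale (1 / 2) (A - - A) = A" for A :: "'a fmatrix"
    using scale_left(1)[of "1 / 2" "1 / 2" A] by simp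
  have "hermitian N m k frameE (\<lambda>X Y. ftrans X * J = J * Y) (\<lambda>A. scale (1 / 2) (A - S A))"
  proof (unfold_locales)
    show "ftrans (X * Y) * J = J * (Y' * X')" if "ftrans X * J = J * X'" "ftrans Y * J = J * Y'" for X X' Y Y'
    proof -
      have "ftrans (X * Y) * J = ftrans Y * (J * X')" by (simp add: mult.assoc that(1))
      also have "\<dots> = J * Y' * X'" by (simp add: mult.assoc [symmetric] that(2))
      finally show ?thesis by (simp add: mult.assoc)
    qed
    show "ftrans (frameE i j) * J = J * frameE j i" if ij: "i < m + k" "j < m + k" for i j
    proof -
      have "ftrans (frameE i j) * J = ftrans P' * (blk d j i * (ftrans P * J))"
        by (simp add: frameE_def ftrans_blk mult.assoc)
      also have "\<dots> = ftrans P' * ((blk d j i * \<Gamma>) * P')" by (simp add: PJ mult.assoc)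
      also have "\<dots> = (ftrans P' * \<Gamma>) * (blk d j i * P')" by (simp add: \<Gamma>(2)[OF ij(2,1)] mult.assoc)
      also have "\<dots> = J * frameE j i" by (simp add: JP [symmetric] frameE_def mult.assoc)
      finally show ?thesis .
    qed
    show "ftrans A * J = J * B"
      if "ftrans X * J = J * X'" "ftrans p * J = J * p'" "X * A = p" "p * A = A" "X' * B = p'" "p' * B = B" for X X' p p' A B
    proof -
      have "ftrans A * J = ftrans A * (ftrans p * J)"
        by (subst that(4) [symmetric]) (simp add: mult.assoc)
      also have "\<dots> = ftrans A * (J * (X' * B))" by (simp add: that(2,5))
      also have "\<dots> = ftrans A * (ftrans X * J) * B" by (simp add: that(1) mult.assoc)
      also have "\<dots> = ftrans (X * A) * J * B" by (simp add: mult.assoc)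
      also have "\<dots> = J * (p' * B)" by (simp add: that(3) that(2) mult.assoc)
      finally have "ftrans A * J = J * (p' * B)" .
      then show ?thesis by (simp only: that(6))
    qed
    show "\<exists>c. X = scale c (frameE i i)"
      if i: "i < m + k" and X: "X \<in> corner N" "frameE i i * X * frameE i i = X" "ftrans X * J = J * X" for i X
    proof -
      note f = frame_scalar[OF X(1,2) i]
      have "ftrans (P' * X * P) * \<Gamma> = ftrans P * (ftrans X * (ftrans P' * \<Gamma>))" by (simp add: mult.assoc)
      also have "\<dots> = ftrans P * ((ftrans X * J) * P)" by (simp add: JP [symmetric] mult.assoc)
      also have "\<dots> = (ftrans P * J) * (X * P)" by (simp add: X(3) mult.assoc)
      also have "\<dots> = \<Gamma> * (P' * X * P)" by (simp add: PJ mult.assoc)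
      finally obtain c where "P' * X * P = scale c (blk d i i)" using scalar[OF i f(2,1)] by blast
      then show ?thesis using f(3) by blast
    qed
    show "scale (1 / 2) (A - S A) \<in> corner N \<and> ftrans (scale (1 / 2) (A - S A)) * J = J * - scale (1 / 2) (A - S A)"
      if A: "A \<in> corner N" for A
    proof
      show "scale (1 / 2) (A - S A) \<in> corner N" using A Sc[OF A] by auto
      show "ftrans (scale (1 / 2) (A - S A)) * J = J * - scale (1 / 2) (A - S A)"
        by (simp add: left_diff_distrib right_diff_distrib JS[OF A] del: scale_simps)
          (simp add: scale_simps)?
    qed
    show "scale (1 / 2) (X - S X) = X" if X: "X \<in> corner N" "ftrans X * J = J * - X" for X
    proof -
      have "S X = - (J' * (J * X))" by (simp add: S_def X(2))
      then show ?thesis using half[of X] JJ(2)[OF X(1)] by simp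
    qed
    show "ftrace (scale (1 / 2) (A - S A) * X) = ftrace (A * X)"
      if A: "A \<in> corner N" and X: "X \<in> corner N" "ftrans X * J = J * - X" for A X
    proof -
      have JX: "J * X = - (ftrans X * J)" by (simp add: X(2))
      have "S A * X = - (J' * (ftrans A * (ftrans X * J)))" by (simp add: S_def mult.assoc JX)
      then have "ftrace (S A * X) = - ftrace (J' * (ftrans A * (ftrans X * J)))" by simp
      also have "ftrace (J' * (ftrans A * (ftrans X * J))) = ftrace (ftrans A * (ftrans X * J) * J')" by (rule ftrace_commute)
      also have "ftrans A * (ftrans X * J) * J' = ftrans (X * A)"
        using X(1) by (simp add: mult.assoc J'(2) one_mult)
      also have "ftrace (ftrans (X * A)) = ftrace (A * X)" unfolding ftrace_ftrans by (rule ftrace_commute)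
      finally show ?thesis by (simp add: left_diff_distrib)
    qed
  qed (use frame_units in \<open>auto simp: S_def distrib_left distrib_right right_diff_distrib left_diff_distrib mult.commute[where 'a = 'a]\<close>)
  then show ?thesis by (simp add: S_def)
qed

end

section \<open>Indices of the isotropy representation\<close>

lemma (in hermitian) bracket_skew1:
  assumes X: "X \<in> skew1" and Y: "Y \<in> skew1"
  shows "X * Y - Y * X \<in> skew0"
proof -
  have odd: "eU * Z = Z * eW" if "Z \<in> skew1" for Z
  proof -
    have z: "eU * Z * eU = 0" "eW * Z * eW = 0" using that by (auto simp: skew1_def)
    have "eU * Z = (eU * Z) * eU + (eU * Z) * eW"
      using unit(2)[of "eU * Z"] skew_corner(3)[OF that] eUW_corner by simp
    also have "\<dots> = eU * Z * eW + eW * Z * eW" by (simp add: z)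
    also have "\<dots> = (eU * Z + eW * Z) * eW" by (simp add: distrib_right)
    also have "\<dots> = Z * eW" using unit(1)[OF skew_corner(3)[OF that]] by simp
    finally show ?thesis .
  qed
  have odd': "eW * Z = Z * eU" if "Z \<in> skew1" for Z
  proof -
    have "eU * Z + eW * Z = Z * eU + Z * eW" using unit[OF skew_corner(3)[OF that]] by simp
    then show ?thesis using odd[OF that] by simp
  qed
  have c: "eU * (A * B) = A * B * eU" if "A \<in> skew1" "B \<in> skew1" for A B
  proof -
    have "eU * (A * B) = A * (eW * B)" by (simp add: mult.assoc [symmetric] odd[OF that(1)])
    then show ?thesis by (simp add: odd'[OF that(2)] mult.assoc)
  qed
  show ?thesis
    using skew_closed(4)[OF skew01(2)[OF X] skew01(2)[OF Y]] c[OF X Y] c[OF Y X]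
    by (simp add: skew0_def left_diff_distrib right_diff_distrib)
qed

text \<open>The position (a, b) is encoded by the single index a N + b, to fit the sequences in
  terms of which independence and spanning are phrased.\<close>

lemma corner_units:
  assumes A: "A \<in> corner N"
  shows "A = (\<Sum>i<N * N. scale (entry A (i div N) (i mod N)) (funit (i div N) (i mod N)))"
proof (rule fmatrix_eqI)
  fix a b
  have "entry (\<Sum>i<N * N. scale (entry A (i div N) (i mod N)) (funit (i div N) (i mod N))) a b
    = (\<Sum>i<N * N. if a = i div N \<and> b = i mod N then entry A a b else 0)"
    unfolding entry_sum by (rule sum.cong) auto
  also have "\<dots> = entry A a b"
  proof (cases "a < N \<and> b < N")
    case True
    have eq: "a = i div N \<and> b = i mod N \<longleftrightarrow> i = a * N + b" for i
      using True by (auto simp: div_mult_mod_eq)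
    have "a * N + b < a * N + N" using True by simp
    also have "\<dots> = (a + 1) * N" by simp
    also have "\<dots> \<le> N * N" using True by (intro mult_le_mono1) simp
    finally show ?thesis by (simp add: eq)
  next
    case False
    then have "entry A a b = 0" using corner_entry_0[OF A] by (auto simp: not_less)
    then show ?thesis by (intro trans[OF sum.neutral]) auto
  qed
  finally show "entry A a b = entry (\<Sum>i<N * N. scale (entry A (i div N) (i mod N)) (funit (i div N) (i mod N))) a b" by simp
qed

text \<open>The involution is given by the automorphism property and its fixed algebra; that its
  -1-eigenspace is the odd part is derived in \<open>odd_eigenspace\<close>.\<close>

locale hermitian_pair = hermitian_hyperbolic N m k E adj pr \<iota>
  for N m k :: nat and E :: "nat \<Rightarrow> nat \<Rightarrow> 'a::field_char_0 fmatrix" and adj pr \<iota> +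
  fixes \<gg> \<gg>\<^sub>0 G\<^sub>0 :: "'a mat set" and \<sigma> :: "'a mat \<Rightarrow> 'a mat"
  assumes mk: "m \<le> k"
    and g: "\<gg> = {X \<in> carrier_mat N N. fmatrix_of_mat X \<in> skew}"
    and g0: "\<gg>\<^sub>0 = {X \<in> carrier_mat N N. fmatrix_of_mat X \<in> skew0}"
    and involution: "involutory_automorphism N \<gg> \<sigma>" "{X \<in> \<gg>. \<sigma> X = X} = \<gg>\<^sub>0"
    and G0: "connected_closed_subgroup N G\<^sub>0" "lie_algebra N G\<^sub>0 = \<gg>\<^sub>0"
begin

abbreviation "fm \<equiv> fmatrix_of_mat :: 'a mat \<Rightarrow> 'a fmatrix"
abbreviation "mt \<equiv> mat_of_fmatrix N"

definition "V = {X \<in> carrier_mat N N. fm X \<in> skew1}"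

lemma fm_hom:
  "A \<in> carrier_mat N N \<Longrightarrow> B \<in> carrier_mat N N \<Longrightarrow> fm (A + B) = fm A + fm B"
  "A \<in> carrier_mat N N \<Longrightarrow> B \<in> carrier_mat N N \<Longrightarrow> fm (A - B) = fm A - fm B"
  "A \<in> carrier_mat N N \<Longrightarrow> fm (- A) = - fm A"
  "A \<in> carrier_mat N N \<Longrightarrow> fm (c \<cdot>\<^sub>m A) = scale c (fm A)"
  "A \<in> carrier_mat N N \<Longrightarrow> B \<in> carrier_mat N N \<Longrightarrow> fm (lie_bracket A B) = fm A * fm B - fm B * fm A"
  "fm (0\<^sub>m N N) = 0"
proof -
  show 0: "fm (0\<^sub>m N N) = 0" using fmatrix_of_mat_hom(6)[of "0\<^sub>m N N" N "0\<^sub>m N N"] by simp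
  show "fm (- A) = - fm A" "fm (c \<cdot>\<^sub>m A) = scale c (fm A)" if "A \<in> carrier_mat N N"
    using fmatrix_of_mat_hom[OF that that] by auto
  assume AB: "A \<in> carrier_mat N N" "B \<in> carrier_mat N N"
  show "fm (A + B) = fm A + fm B" "fm (A - B) = fm A - fm B"
    using fmatrix_of_mat_hom[OF AB] by auto
  have "A * B \<in> carrier_mat N N" "B * A \<in> carrier_mat N N" using AB by (auto intro: mult_carrier_mat[of _ N N _ N])
  from fmatrix_of_mat_hom(2)[OF this] show "fm (lie_bracket A B) = fm A * fm B - fm B * fm A"
    using fmatrix_of_mat_hom(5)[OF AB] fmatrix_of_mat_hom(5)[OF AB(2,1)] by (simp add: lie_bracket_def)
qed

lemma carr: "A \<in> carrier_mat N N \<Longrightarrow> B \<in> carrier_mat N N \<Longrightarrow> A + B \<in> carrier_mat N N"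
  "A \<in> carrier_mat N N \<Longrightarrow> B \<in> carrier_mat N N \<Longrightarrow> A - B \<in> carrier_mat N N"
  "A \<in> carrier_mat N N \<Longrightarrow> - A \<in> carrier_mat N N"
  "A \<in> carrier_mat N N \<Longrightarrow> c \<cdot>\<^sub>m A \<in> carrier_mat N N" "0\<^sub>m N N \<in> carrier_mat N N"
  "A \<in> carrier_mat N N \<Longrightarrow> B \<in> carrier_mat N N \<Longrightarrow> lie_bracket A B \<in> carrier_mat N N"
  for A B :: "'a mat"
  by (auto simp: lie_bracket_def intro!: mult_carrier_mat[of _ N N _ N] minus_carrier_mat)

lemma mk0: "m + k > 0" using m3 by simp

lemma pair_carrier: "X \<in> \<gg> \<Longrightarrow> X \<in> carrier_mat N N" "X \<in> \<gg>\<^sub>0 \<Longrightarrow> X \<in> carrier_mat N N" "X \<in> V \<Longrightarrow> X \<in> carrier_mat N N"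
  by (auto simp: g g0 V_def)

lemma mt_mem: "A \<in> skew \<Longrightarrow> mt A \<in> \<gg>" "A \<in> skew0 \<Longrightarrow> mt A \<in> \<gg>\<^sub>0" "A \<in> skew1 \<Longrightarrow> mt A \<in> V"
  by (auto simp: g g0 V_def skew_corner)

lemma fm_mem: "X \<in> \<gg> \<Longrightarrow> fm X \<in> skew" "X \<in> \<gg>\<^sub>0 \<Longrightarrow> fm X \<in> skew0" "X \<in> V \<Longrightarrow> fm X \<in> skew1"
  by (auto simp: g g0 V_def)

lemma fm_eqI: "A \<in> carrier_mat N N \<Longrightarrow> B \<in> carrier_mat N N \<Longrightarrow> fm A = fm B \<Longrightarrow> A = B"
  by (rule fmatrix_of_mat_inj)

definition "s A = fm (\<sigma> (mt A))"

lemma \<sigma>_hom: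
  "X \<in> \<gg> \<Longrightarrow> \<sigma> X \<in> \<gg>" "X \<in> \<gg> \<Longrightarrow> Y \<in> \<gg> \<Longrightarrow> \<sigma> (X + Y) = \<sigma> X + \<sigma> Y" "X \<in> \<gg> \<Longrightarrow> \<sigma> (c \<cdot>\<^sub>m X) = c \<cdot>\<^sub>m \<sigma> X"
  using involution(1) by (auto simp: involutory_automorphism_def module_hom_def module_mat_simps)

lemma s:
  assumes A: "A \<in> skew" and B: "B \<in> skew"
  shows "s A \<in> skew" "mt (s A) = \<sigma> (mt A)" "s (A + B) = s A + s B" "s (scale c A) = scale c (s A)"
    "s (A * B - B * A) = s A * s B - s B * s A" "s (s A) = A" "s A = A \<longleftrightarrow> A \<in> skew0"
proof -
  have g: "\<sigma> (mt C) \<in> \<gg>" if "C \<in> skew" for C using \<sigma>_hom(1)[OF mt_mem(1)[OF that]] .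
  note c = pair_carrier(1)[OF g]
  show "s A \<in> skew" unfolding s_def by (rule fm_mem(1)[OF g[OF A]])
  show m: "mt (s A) = \<sigma> (mt A)" unfolding s_def using c[OF A] by simp
  show "s (A + B) = s A + s B"
    by (simp add: s_def mat_of_fmatrix_hom \<sigma>_hom(2)[OF mt_mem(1)[OF A] mt_mem(1)[OF B]] fm_hom(1)[OF c[OF A] c[OF B]])
  show "s (scale c A) = scale c (s A)"
    by (simp add: s_def mat_of_fmatrix_hom \<sigma>_hom(3)[OF mt_mem(1)[OF A]] fm_hom(4)[OF c[OF A]])
  have "mt (A * B - B * A) = lie_bracket (mt A) (mt B)"
    by (simp add: mat_of_fmatrix_hom mat_of_fmatrix_mult skew_corner(1)[OF A] skew_corner(1)[OF B] lie_bracket_def)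
  moreover have "\<sigma> (lie_bracket (mt A) (mt B)) = lie_bracket (\<sigma> (mt A)) (\<sigma> (mt B))"
    using involution(1) mt_mem(1)[OF A] mt_mem(1)[OF B] unfolding involutory_automorphism_def by blast
  ultimately show "s (A * B - B * A) = s A * s B - s B * s A"
    by (simp add: s_def fm_hom(5)[OF c[OF A] c[OF B]])
  have "\<sigma> (\<sigma> (mt A)) = mt A"
    using involution(1) mt_mem(1)[OF A] unfolding involutory_automorphism_def by blast
  then show "s (s A) = A" using m skew_corner(1)[OF A] by (simp add: s_def)
  have "s A = A \<longleftrightarrow> \<sigma> (mt A) = mt A"
    using m skew_corner(1)[OF A] by (metis s_def fmatrix_of_mat_of_fmatrix)
  also have "\<dots> \<longleftrightarrow> mt A \<in> \<gg>\<^sub>0" using involution(2) mt_mem(1)[OF A] by blast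
  also have "\<dots> \<longleftrightarrow> A \<in> skew0" using skew_corner(1)[OF A] by (simp add: g0)
  finally show "s A = A \<longleftrightarrow> A \<in> skew0" .
qed

text \<open>For odd Y the sum of Y and its image is fixed, hence even, and [a, [c, _]] kills even
  elements when a acts on U and c on W. So double brackets [a, [c, Y]] are negated, and these span
  the odd part.\<close>

lemma s_odd:
  assumes "X \<in> skew1"
  shows "s X = - X"
proof (rule skew1_double_bracket[OF _ _ assms, of "\<lambda>X. s X = - X"])
  show "m \<ge> 2" "k \<ge> 2" using m3 k4 by auto
  have z: "0 \<in> skew" using skew01(1)[OF skew1_ex(1)[OF mk0]] .
  show "s 0 = - 0" using s(4)[OF z z, of 0] by simp
  show "s (X + Y) = - (X + Y)" if "X \<in> skew1" "Y \<in> skew1" "s X = - X" "s Y = - Y" for X Y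
    using s(3)[OF skew01(2)[OF that(1)] skew01(2)[OF that(2)]] that by simp
  fix a c Y assume a: "a \<in> skew0" "eU * a * eU = a" and c: "c \<in> skew0" "eW * c * eW = c" and Y: "Y \<in> skew1"
  have sa: "s a = a" "s c = c" using s(7)[OF skew01(1) skew01(1)] a(1) c(1) by blast+
  have Ys: "Y \<in> skew" by (rule skew01(2)[OF Y])
  \<comment> \<open>Fixed by the involution, hence block diagonal.\<close>
  define D where "D = Y + s Y"
  have sYs: "s Y \<in> skew" by (rule s(1)[OF Ys Ys])
  have Ds: "D \<in> skew" unfolding D_def by (rule skew_closed(1)[OF Ys sYs])
  have "s D = D" unfolding D_def s(3)[OF Ys sYs] s(6)[OF Ys Ys] by (rule add.commute)
  then have D0: "D \<in> skew0" using s(7)[OF Ds Ds] by simp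
  have De: "eU * D = D * eU" "eW * D = D * eW" using D0 skew0_eW by (auto simp: skew0_def)
  have ae: "a * eW = 0" "eW * a = 0"
  proof -
    have "eU * a * eU * eW = 0" "eW * (eU * a * eU) = 0" by (simp_all add: UW mult.assoc)
    then show "a * eW = 0" "eW * a = 0" by (simp_all only: a(2))
  qed
  have ec: "eW * c = c" "c * eW = c"
  proof -
    have "eW * (eW * c * eW) = eW * c * eW" by (simp add: UW mult.assoc)
    then show "eW * c = c" by (simp only: c(2))
    have "eW * c * eW * eW = eW * c * eW" by (simp add: UW mult.assoc)
    then show "c * eW = c" by (simp only: c(2))
  qed
  have ac: "a * c = 0" "c * a = 0"
  proof -
    have "a * (eW * c) = 0" by (simp only: mult.assoc [symmetric] ae mult_zero_left)
    then show "a * c = 0" by (simp only: ec)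
    have "(c * eW) * a = 0" by (simp only: mult.assoc ae mult_zero_right)
    then show "c * a = 0" by (simp only: ec)
  qed
  have aDc: "a * (D * c) = 0" "c * (D * a) = 0"
  proof -
    have "a * (D * c) = a * (D * eW) * c" using ec by (simp add: mult.assoc)
    also have "\<dots> = (a * eW) * D * c" by (simp only: De(2) [symmetric] mult.assoc)
    finally show "a * (D * c) = 0" by (simp add: ae)
    have "c * (D * a) = c * (eW * D) * a" using ec by (simp add: mult.assoc [symmetric])
    also have "\<dots> = c * D * (eW * a)" by (simp only: De(2) mult.assoc)
    finally show "c * (D * a) = 0" by (simp add: ae)
  qed
  have ac': "a * (c * Z) = 0" "c * (a * Z) = 0" for Z using ac by (simp_all add: mult.assoc [symmetric])
  have D: "a * (c * D - D * c) - (c * D - D * c) * a = 0"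
    by (simp add: left_diff_distrib right_diff_distrib mult.assoc ac ac' aDc)
  have sY: "s Y = D - Y" by (simp add: D_def)
  have cY: "c * Y - Y * c \<in> skew" using bracket_skew01[OF c(1) Y] skew01(2) by blast
  have "s (a * (c * Y - Y * c) - (c * Y - Y * c) * a) =
      a * (c * (D - Y) - (D - Y) * c) - (c * (D - Y) - (D - Y) * c) * a"
    by (simp only: s(5)[OF skew01(1)[OF a(1)] cY] s(5)[OF skew01(1)[OF c(1)] Ys] sa sY)
  also have "\<dots> = (a * (c * D - D * c) - (c * D - D * c) * a) - (a * (c * Y - Y * c) - (c * Y - Y * c) * a)"
    by (simp add: left_diff_distrib right_diff_distrib)
  finally show "s (a * (c * Y - Y * c) - (c * Y - Y * c) * a) = - (a * (c * Y - Y * c) - (c * Y - Y * c) * a)"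
    by (simp add: D)
qed

text \<open>The involution fixes the even part of a matrix and negates the odd part, so on the
  -1-eigenspace twice the even part vanishes.\<close>

lemma odd_eigenspace: "{X \<in> \<gg>. \<sigma> X = - X} = V"
proof (rule equalityI; rule subsetI)
  fix X assume X: "X \<in> {X \<in> \<gg>. \<sigma> X = - X}"
  then have Xc: "X \<in> carrier_mat N N" and Xs: "fm X \<in> skew" using pair_carrier fm_mem by auto
  define A where "A = fm X"
  have A: "A \<in> skew" using Xs by (simp add: A_def)
  have "s A = - A" using X Xc by (simp add: s_def A_def fm_hom)
  moreover have p: "even_part A \<in> skew0" "odd_part A \<in> skew1" by (rule parts_skew[OF A mk0])+
  moreover have "s A = s (even_part A) + s (odd_part A)"
    using s(3)[OF skew01(1)[OF p(1)] skew01(2)[OF p(2)]] even_odd[OF skew_corner(1)[OF A]] by simp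
  moreover have "s (even_part A) = even_part A" using s(7)[OF skew01(1) skew01(1)] p(1) by blast
  moreover note s_odd[OF p(2)] even_odd[OF skew_corner(1)[OF A]]
  ultimately have e: "even_part A - odd_part A = - (even_part A + odd_part A)" by simp
  then have "even_part A = - even_part A" by (simp add: algebra_simps)
  then have "even_part A + even_part A = 0" by (simp only: eq_neg_iff_add_eq_0)
  then have "scale 2 (even_part A) = 0" using scale_left(1)[of 1 1 "even_part A"] by simp
  then have "scale (1 / 2) (scale 2 (even_part A)) = 0" by simp
  then have "even_part A = 0" by simp
  then have "A \<in> skew1" using p(2) even_odd[OF skew_corner(1)[OF A]] by simp
  then show "X \<in> V" using Xc by (simp add: V_def A_def)
next
  fix X assume X: "X \<in> V"
  then have Xc: "X \<in> carrier_mat N N" and X1: "fm X \<in> skew1" using pair_carrier fm_mem by auto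
  have Xg: "X \<in> \<gg>" using Xc skew01(2)[OF X1] by (simp add: g)
  have "fm (\<sigma> X) = - fm X" using s_odd[OF X1] Xc by (simp add: s_def)
  then have "\<sigma> X = - X"
    by (intro fm_eqI pair_carrier(1) \<sigma>_hom(1) Xg carr Xc) (simp add: fm_hom Xc)
  then show "X \<in> {X \<in> \<gg>. \<sigma> X = - X}" using Xg by simp
qed

section \<open>The isotropy representation and its nilpotent vector\<close>

abbreviation "VV \<equiv> sub_space (matrix_space N) V"
abbreviation "vnil \<equiv> mt nil"

lemma V_closed: "X \<in> V \<Longrightarrow> Y \<in> V \<Longrightarrow> X + Y \<in> V" "X \<in> V \<Longrightarrow> c \<cdot>\<^sub>m X \<in> V" "0\<^sub>m N N \<in> V"
    "X \<in> \<gg>\<^sub>0 \<Longrightarrow> Y \<in> V \<Longrightarrow> lie_bracket X Y \<in> V"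
  using skew1_ex[OF mk0]
  by (auto simp: V_def g0 fm_hom intro: carr skew1_closed bracket_skew01)

lemma g0_closed: "X \<in> \<gg>\<^sub>0 \<Longrightarrow> Y \<in> \<gg>\<^sub>0 \<Longrightarrow> X + Y \<in> \<gg>\<^sub>0" "X \<in> \<gg>\<^sub>0 \<Longrightarrow> c \<cdot>\<^sub>m X \<in> \<gg>\<^sub>0" "0\<^sub>m N N \<in> \<gg>\<^sub>0"
  using skew1_ex[OF mk0] by (auto simp: g0 fm_hom intro: carr skew0_closed)

text \<open>\<open>q3 - q1\<close> gives the layers \<open>q1\<close>, \<open>q0\<close>,
  \<open>q3\<close> the weights -1, 0, 1, so \<open>nil\<close> raises the weight by one and is
  scaled by t under the cocharacter. This grading element is even and thus lies in the Lie algebra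
  of \<open>G\<^sub>0\<close>.\<close>

lemma nilpotent: "nilpotent_vector G\<^sub>0 (conjugation N) VV vnil"
proof -
  have c: "mt q1 \<in> carrier_mat N N" "mt q3 \<in> carrier_mat N N" by auto
  have h: "q3 - q1 \<in> skew0"
  proof -
    have "eU * (q3 - q1) = 0" "(q3 - q1) * eU = 0" unfolding eUW_q(1) by (simp_all add: words)
    moreover have "adj (q3 - q1) (- (q3 - q1))" using adj_diff[OF adj_q(3,2)] by simp
    ultimately show ?thesis using corner_closed q_corner unfolding skew0_def skew_def by auto
  qed
  have Q: "mt q1 * mt q1 = mt q1" "mt q3 * mt q3 = mt q3" "mt q1 * mt q3 = 0\<^sub>m N N" "mt q3 * mt q1 = 0\<^sub>m N N"
    by (simp_all only: mat_of_fmatrix_mult [symmetric] q_corner pp mat_of_fmatrix_hom(5))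
  show ?thesis
  proof (rule nilpotent_vectorI[OF c Q G0(1)])
    show "mt q3 - mt q1 \<in> lie_algebra N G\<^sub>0"
      using mt_mem(2)[OF h] by (simp add: G0(2) mat_of_fmatrix_hom)
    show "vnil \<in> V" by (rule mt_mem(3)[OF nil_skew1])
    show "\<And>c x. x \<in> V \<Longrightarrow> c \<cdot>\<^sub>m x \<in> V" by (rule V_closed(2))
    show "V \<subseteq> carrier_mat N N" using pair_carrier by blast
    fix t :: 'a assume t: "t \<noteq> 0"
    let ?p = "one_parameter N (mt q1) (mt q3)"
    note p = one_parameter_carrier[OF c Q]
    have I: "fm (1\<^sub>m N) = q0 + qr + (q1 + q3 + qs)" using eU_eW by (simp add: eUW_q)
    have fp: "fm (?p u) = scale u q3 + (scale (1 / u) q1 + (q0 + qr + qs))" for u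
      unfolding one_parameter_fmatrix[OF c Q] I using q_corner by simp
    have "fm (?p t * vnil * ?p (1 / t)) = fm (?p t) * nil * fm (?p (1 / t))"
      using fmatrix_of_mat_hom(5)[OF mult_carrier_mat[OF p mat_of_fmatrix_carrier] p, of t nil "1 / t"]
        fmatrix_of_mat_hom(5)[OF p mat_of_fmatrix_carrier, of t nil] q_corner by simp
    also have "\<dots> = scale t (nil * q0 + nil * q1)"
      unfolding fp using t by (simp add: words)
    also have "nil * q0 + nil * q1 = nil"
      using pe(6-8) unit(2)[OF q_corner(4)] by (simp add: eUW_q distrib_left)
    finally show "?p t * vnil * ?p (1 / t) = t \<cdot>\<^sub>m vnil"
      by (intro fm_eqI mult_carrier_mat[of _ N N _ N] p carr mat_of_fmatrix_carrier)
        (simp add: fm_hom q_corner)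
  qed
qed

lemma VV_closed: "lin_closed VV" "carrier VV \<noteq> {}"
  using V_closed by (auto simp: lin_closed_def module_mat_simps)

lemma VV_action: "lin_action \<gg>\<^sub>0 lie_bracket VV"
proof -
  have 1: "lie_bracket X (A + B) = lie_bracket X A + lie_bracket X B"
    if "X \<in> carrier_mat N N" "A \<in> carrier_mat N N" "B \<in> carrier_mat N N" for X A B :: "'a mat"
    by (rule fm_eqI; (intro carr that)?; simp add: fm_hom carr that distrib_left distrib_right)
  have 2: "lie_bracket X (c \<cdot>\<^sub>m A) = c \<cdot>\<^sub>m lie_bracket X A" "lie_bracket (c \<cdot>\<^sub>m X) A = c \<cdot>\<^sub>m lie_bracket X A"
    if "X \<in> carrier_mat N N" "A \<in> carrier_mat N N" for X A :: "'a mat" and c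
    by (rule fm_eqI; (intro carr that)?; simp add: fm_hom carr that)+
  have 3: "lie_bracket (X + Y) A = lie_bracket X A + lie_bracket Y A"
    if "X \<in> carrier_mat N N" "Y \<in> carrier_mat N N" "A \<in> carrier_mat N N" for X Y A :: "'a mat"
    by (rule fm_eqI; (intro carr that)?; simp add: fm_hom carr that distrib_left distrib_right)
  show ?thesis
    unfolding lin_action_def
  proof (intro conjI ballI allI)
    show "\<gg>\<^sub>0 \<noteq> {}" using g0_closed(3) by blast
    show "\<exists>z\<in>\<gg>\<^sub>0. \<forall>v\<in>carrier VV. lie_bracket z v = lie_bracket x v \<oplus>\<^bsub>VV\<^esub> lie_bracket y v" if "x \<in> \<gg>\<^sub>0" "y \<in> \<gg>\<^sub>0" for x y
      by (rule bexI[OF _ g0_closed(1)[OF that]]) (use that pair_carrier in \<open>auto simp: module_mat_simps intro!: 3\<close>)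
    show "\<exists>z\<in>\<gg>\<^sub>0. \<forall>v\<in>carrier VV. lie_bracket z v = c \<odot>\<^bsub>VV\<^esub> lie_bracket x v" if "x \<in> \<gg>\<^sub>0" for x c
      by (rule bexI[OF _ g0_closed(2)[OF that]]) (use that pair_carrier in \<open>auto simp: module_mat_simps intro!: 2\<close>)
  qed (use V_closed(4) pair_carrier in \<open>auto simp: module_mat_simps intro!: 1 2\<close>)
qed

section \<open>Trace duality and the index of the odd part\<close>

definition "tr y = (\<lambda>X\<in>V. ftrace (y * fm X))"

lemma tr_dual: "tr y \<in> carrier (dual_module VV)"
  by (rule dual_carrierI) (auto simp: tr_def module_mat_simps V_closed fm_hom pair_carrier distrib_left)

text \<open>The functional is extended to all matrices by composing it with \<open>pr1\<close>, the
  extension is represented by a matrix K through its values on the matrix units, and projecting K to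
  the odd part leaves the functional unchanged on V.\<close>

lemma tr_surj:
  assumes \<mu>: "\<mu> \<in> carrier (dual_module VV)"
  shows "\<exists>y\<in>skew1. \<mu> = tr y"
proof -
  define h where "h A = \<mu> (mt (pr1 A))" for A
  have hV: "mt (pr1 A) \<in> V" if "A \<in> corner N" for A by (rule mt_mem(3)[OF pr1_skew[OF mk0 that]])
  have h_add: "h (A + B) = h A + h B" if "A \<in> corner N" "B \<in> corner N" for A B
    using dual_carrierD(2)[OF \<mu>, of "mt (pr1 A)" "mt (pr1 B)"] hV that
    by (simp add: h_def pr1_add mat_of_fmatrix_hom module_mat_simps)
  have h_scale: "h (scale c A) = c * h A" if "A \<in> corner N" for A c
    using dual_carrierD(3)[OF \<mu>, of "mt (pr1 A)"] hV that
    by (simp add: h_def pr1_scale mat_of_fmatrix_hom module_mat_simps)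
  have h_sum: "h (\<Sum>i<n. scale (c i) (U i)) = (\<Sum>i<n. c i * h (U i))" if "\<And>i. i < n \<Longrightarrow> U i \<in> corner N" for n :: nat and c U
    using that
  proof (induction n)
    case 0
    show ?case using h_scale[of 0 0] by simp
  next
    case (Suc n)
    have "(\<Sum>i<n. scale (c i) (U i)) \<in> corner N" using Suc.prems by (intro corner_sum corner_closed) auto
    then show ?case using Suc h_add h_scale by simp
  qed
  define U :: "nat \<Rightarrow> 'a fmatrix" where "U i = funit (i div N) (i mod N)" for i
  define K where "K = (\<Sum>i<N * N. scale (h (U i)) (funit (i mod N) (i div N)))"
  have lt: "i div N < N" "i mod N < N" if "i < N * N" for i
  proof -
    have "N > 0" using that by (auto intro: gr0I)
    then show "i div N < N" "i mod N < N" using that by (auto simp: less_mult_imp_div_less)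
  qed
  have U: "U i \<in> corner N" "funit (i mod N) (i div N) \<in> corner N" if "i < N * N" for i
    using lt[OF that] by (auto simp: U_def intro: funit_corner)
  have K: "K \<in> corner N" unfolding K_def by (intro corner_sum corner_closed) (use U in auto)
  have "\<mu> X = ftrace (pr1 K * fm X)" if X: "X \<in> V" for X
  proof -
    have A: "fm X \<in> skew1" "fm X \<in> corner N" using fm_mem(3)[OF X] skew_corner(3) by auto
    have "\<mu> X = h (fm X)" using pr1_id[OF A(1)] pair_carrier(3)[OF X] by (simp add: h_def)
    also have "\<dots> = (\<Sum>i<N * N. entry (fm X) (i div N) (i mod N) * h (U i))"
      by (subst corner_units[OF A(2)], fold U_def, rule h_sum) (use U in auto)
    also have "\<dots> = ftrace (K * fm X)"
      unfolding K_def sum_distrib_right ftrace_sum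
    proof (rule sum.cong)
      fix i assume "i \<in> {..<N * N}"
      then have i: "i < N * N" by simp
      show "entry (fm X) (i div N) (i mod N) * h (U i) = ftrace (scale (h (U i)) (funit (i mod N) (i div N)) * fm X)"
        using ftrace_mult_funit[OF A(2) lt(2,1)[OF i]] ftrace_commute[of "fm X" "funit (i mod N) (i div N)"]
        by simp
    qed simp
    also have "\<dots> = ftrace (pr1 K * fm X)" by (rule pr1_trace[OF mk0 K A(1), symmetric])
    finally show ?thesis .
  qed
  then have "\<mu> = tr (pr1 K)"
    by (intro dual_eqI[OF \<mu> tr_dual]) (simp add: tr_def)
  then show ?thesis using pr1_skew[OF mk0 K] by blast
qed

text \<open>A crude bound, which only serves to make the modules finite-dimensional: the traces
  against all N N matrix units span the dual.\<close>

lemma VV_bound: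
  assumes G: "\<And>i. i < n \<Longrightarrow> G i \<in> carrier (dual_module VV)" and ind: "independent_on (carrier VV) n G"
  shows "n \<le> N * N"
proof (rule dual_span_bound[OF VV_closed(1) _ _ G ind])
  show "tr (funit (i div N) (i mod N)) \<in> carrier (dual_module VV)" for i by (rule tr_dual)
  fix \<mu> assume "\<mu> \<in> carrier (dual_module VV)"
  then obtain y where y: "y \<in> skew1" "\<mu> = tr y" using tr_surj by blast
  have "\<mu> X = (\<Sum>i<N * N. entry y (i div N) (i mod N) * tr (funit (i div N) (i mod N)) X)" if X: "X \<in> V" for X
  proof -
    have "\<mu> X = ftrace (y * fm X)" using X y by (simp add: tr_def)
    also have "\<dots> = (\<Sum>i<N * N. entry y (i div N) (i mod N) * tr (funit (i div N) (i mod N)) X)"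
      by (subst corner_units[OF skew_corner(3)[OF y(1)]])
        (use X in \<open>simp add: sum_distrib_right ftrace_sum tr_def\<close>)
    finally show ?thesis .
  qed
  then show "\<exists>a. \<forall>X\<in>carrier VV. \<mu> X = (\<Sum>i<N * N. a i * tr (funit (i div N) (i mod N)) X)"
    by (intro exI[of _ "\<lambda>i. entry y (i div N) (i mod N)"]) simp
qed

lemma ftrace_cyclic: "ftrace (y * (x * z - z * x)) = ftrace ((z * y - y * z) * x)"
proof -
  have "ftrace (y * (x * z)) = ftrace (y * x * z)" by (simp add: mult.assoc)
  also have "\<dots> = ftrace (z * (y * x))" by (rule ftrace_commute)
  finally show ?thesis by (simp add: left_diff_distrib right_diff_distrib mult.assoc)
qed

text \<open>At the regular element \<xi> a functional tr y annihilates all brackets [x, \<xi>]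
  exactly if [\<xi>, y] is orthogonal to the even part, hence zero. The odd centraliser of \<xi> is
  spanned by m elements.\<close>

lemma index_V: "lie_index \<gg>\<^sub>0 (dual_action VV lie_bracket) (dual_module VV) \<le> int m"
proof -
  define \<kappa> where "\<kappa> i = E (m + i) i - E i (m + i)" for i
  obtain \<xi> where \<xi>: "\<xi> \<in> skew1" "\<And>K. K \<in> skew1 \<Longrightarrow> K * \<xi> = \<xi> * K \<Longrightarrow> \<exists>c. K = (\<Sum>i<m. scale (c i) (\<kappa> i))"
    using regular_odd_element(1)[OF mk] m3 unfolding \<kappa>_def by force
  have \<xi>V: "mt \<xi> \<in> carrier VV" using mt_mem(3)[OF \<xi>(1)] by simp
  show ?thesis
  proof (rule index_le[where D = "N * N", OF VV_closed VV_action _ \<xi>V])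
    show "n \<le> N * N" if "\<And>i. i < n \<Longrightarrow> G i \<in> carrier (dual_module VV)" "independent_on (carrier VV) n G" for n G
      by (rule VV_bound[OF that])
    show "tr (\<kappa> i) \<in> carrier (dual_module VV)" for i by (rule tr_dual)
    fix \<mu> assume \<mu>: "\<mu> \<in> carrier (dual_module VV)" "\<And>x. x \<in> \<gg>\<^sub>0 \<Longrightarrow> \<mu> (lie_bracket x (mt \<xi>)) = 0"
    obtain y where y: "y \<in> skew1" "\<mu> = tr y" using tr_surj[OF \<mu>(1)] by blast
    have "\<xi> * y - y * \<xi> = 0"
    proof (rule skew0_nondegenerate[OF mk0 bracket_skew1[OF \<xi>(1) y(1)]])
      fix x assume x: "x \<in> skew0"
      have "lie_bracket (mt x) (mt \<xi>) \<in> V" by (rule V_closed(4)[OF mt_mem(2)[OF x] mt_mem(3)[OF \<xi>(1)]])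
      then have "ftrace (y * (x * \<xi> - \<xi> * x)) = 0"
        using \<mu>(2)[OF mt_mem(2)[OF x]] skew_corner(2)[OF x] skew_corner(3)[OF \<xi>(1)]
        by (simp add: y(2) tr_def fm_hom)
      then show "ftrace ((\<xi> * y - y * \<xi>) * x) = 0" by (simp only: ftrace_cyclic)
    qed
    then obtain c where c: "y = (\<Sum>i<m. scale (c i) (\<kappa> i))" using \<xi>(2)[OF y(1)] by auto
    have "\<mu> X = (\<Sum>i<m. c i * tr (\<kappa> i) X)" if "X \<in> V" for X
      using that by (simp add: y(2) tr_def c sum_distrib_right ftrace_sum)
    then show "\<exists>a. \<forall>X\<in>carrier VV. \<mu> X = (\<Sum>i<m. a i * tr (\<kappa> i) X)" by auto
  qed
qed

section \<open>The slice representation at the nilpotent vector\<close>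

definition "T = lie_orbit \<gg>\<^sub>0 lie_bracket vnil"
definition "stab = lie_stabiliser \<gg>\<^sub>0 lie_bracket VV vnil"
definition "coset X = T +>\<^bsub>VV\<^esub> X"
abbreviation "QQ \<equiv> quotient_module VV T"
abbreviation "qact \<equiv> quotient_action VV T lie_bracket"

lemma vnil_V: "vnil \<in> V"
  by (rule mt_mem(3)[OF nil_skew1])

lemma T: "X \<in> T \<Longrightarrow> X \<in> V" "0\<^sub>m N N \<in> T" "X \<in> T \<Longrightarrow> Y \<in> T \<Longrightarrow> X + Y \<in> T" "X \<in> T \<Longrightarrow> c \<cdot>\<^sub>m X \<in> T"
proof -
  show TV: "X \<in> V" if "X \<in> T" for X using that vnil_V V_closed(4) by (auto simp: T_def lie_orbit_def)
  have scal: "c \<cdot>\<^sub>m X \<in> T" if X: "X \<in> T" for c X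
  proof -
    obtain x where x: "x \<in> \<gg>\<^sub>0" "X = lie_bracket x vnil" using X by (auto simp: T_def lie_orbit_def)
    have "\<exists>z\<in>\<gg>\<^sub>0. \<forall>v\<in>carrier VV. lie_bracket z v = c \<odot>\<^bsub>VV\<^esub> lie_bracket x v"
      using VV_action x(1) unfolding lin_action_def by blast
    then show ?thesis using vnil_V x(2) by (auto simp: T_def lie_orbit_def module_mat_simps intro: rev_image_eqI)
  qed
  then show "X \<in> T \<Longrightarrow> c \<cdot>\<^sub>m X \<in> T" .
  have "lie_bracket (0\<^sub>m N N) vnil \<in> T" using g0_closed(3) by (auto simp: T_def lie_orbit_def)
  from scal[OF this, of 0] show "0\<^sub>m N N \<in> T"
    by (subst (asm) fm_eqI[of _ "0\<^sub>m N N"]) (simp_all add: carr fm_hom)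
  assume "X \<in> T" "Y \<in> T"
  then obtain x y where xy: "x \<in> \<gg>\<^sub>0" "X = lie_bracket x vnil" "y \<in> \<gg>\<^sub>0" "Y = lie_bracket y vnil"
    by (auto simp: T_def lie_orbit_def)
  have "\<exists>z\<in>\<gg>\<^sub>0. \<forall>v\<in>carrier VV. lie_bracket z v = lie_bracket x v \<oplus>\<^bsub>VV\<^esub> lie_bracket y v"
    using VV_action xy(1,3) unfolding lin_action_def by blast
  then show "X + Y \<in> T" using vnil_V xy(2,4) by (auto simp: T_def lie_orbit_def module_mat_simps intro: rev_image_eqI)
qed

lemma T_carrier: "X \<in> T \<Longrightarrow> X \<in> carrier_mat N N"
  using T(1) pair_carrier(3) by blast

lemma coset_iff: "Y \<in> coset X \<longleftrightarrow> (\<exists>t\<in>T. Y = t + X)"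
  by (auto simp: coset_def a_r_coset_def' module_mat_simps)

lemma coset_self: "X \<in> V \<Longrightarrow> X \<in> coset X"
  unfolding coset_iff using T(2) pair_carrier(3) by (intro bexI[of _ "0\<^sub>m N N"]) auto

lemma coset_eqI:
  assumes X: "X \<in> V" and t: "t \<in> T" and Y: "Y = t + X"
  shows "coset Y = coset X"
proof (rule equalityI; rule subsetI)
  have c: "X \<in> carrier_mat N N" "t \<in> carrier_mat N N" using X t pair_carrier(3) T_carrier by auto
  fix W
  show "W \<in> coset X" if W: "W \<in> coset Y"
  proof -
    obtain u where u: "u \<in> T" "W = u + Y" using W by (auto simp: coset_iff)
    have "W = (u + t) + X" unfolding u(2) Y using assoc_add_mat[OF T_carrier[OF u(1)] c(2,1)] by simp
    then show ?thesis using T(3)[OF u(1) t] by (auto simp: coset_iff)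
  qed
  show "W \<in> coset Y" if W: "W \<in> coset X"
  proof -
    obtain u where u: "u \<in> T" "W = u + X" using W by (auto simp: coset_iff)
    have uc: "u \<in> carrier_mat N N" by (rule T_carrier[OF u(1)])
    have "W = (u + (-1) \<cdot>\<^sub>m t) + Y" unfolding u(2) Y
      by (intro fm_eqI carr c uc) (simp add: fm_hom carr c uc)
    then show ?thesis using T(3)[OF u(1) T(4)[OF t]] by (auto simp: coset_iff)
  qed
qed

lemma coset_UN:
  assumes "X \<in> V" "\<And>Y. Y \<in> coset X \<Longrightarrow> coset (f Y) = Z"
  shows "(\<Union>Y\<in>coset X. coset (f Y)) = Z"
  using assms coset_self by blast

lemma stabD: "x \<in> stab \<Longrightarrow> x \<in> \<gg>\<^sub>0" "x \<in> stab \<Longrightarrow> nil * fm x = fm x * nil"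
proof -
  show "x \<in> \<gg>\<^sub>0" if "x \<in> stab" using that by (simp add: stab_def lie_stabiliser_def)
  assume x: "x \<in> stab"
  then have "x \<in> \<gg>\<^sub>0" "lie_bracket x vnil = 0\<^sub>m N N" by (auto simp: stab_def lie_stabiliser_def module_mat_simps)
  then show "nil * fm x = fm x * nil"
    using fm_hom(5)[of x vnil] pair_carrier(2)[of x] q_corner by (simp add: fm_hom(6))
qed

lemma stabI: "x \<in> \<gg>\<^sub>0 \<Longrightarrow> nil * fm x = fm x * nil \<Longrightarrow> x \<in> stab"
proof -
  assume x: "x \<in> \<gg>\<^sub>0" "nil * fm x = fm x * nil"
  have xc: "x \<in> carrier_mat N N" by (rule pair_carrier(2)[OF x(1)])
  have "lie_bracket x vnil = 0\<^sub>m N N"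
    by (intro fm_eqI carr xc) (simp_all add: fm_hom xc q_corner x(2))
  then show ?thesis using x(1) by (simp add: stab_def lie_stabiliser_def module_mat_simps)
qed

text \<open>By the Jacobi identity [x, [z, e]] = [[x, z], e] if x commutes with e.\<close>

lemma stab_T:
  assumes x: "x \<in> stab" and t: "t \<in> T"
  shows "lie_bracket x t \<in> T"
proof -
  obtain z where z: "z \<in> \<gg>\<^sub>0" "t = lie_bracket z vnil" using t by (auto simp: T_def lie_orbit_def)
  have c: "x \<in> carrier_mat N N" "z \<in> carrier_mat N N" using pair_carrier(2) stabD(1)[OF x] z by auto
  have n: "fm x * nil = nil * fm x" "\<And>Z. fm x * (nil * Z) = nil * (fm x * Z)"
    using stabD(2)[OF x] by (simp_all add: mult.assoc [symmetric])
  have "lie_bracket x t = lie_bracket (lie_bracket x z) vnil"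
    unfolding z(2)
    by (intro fm_eqI carr c mat_of_fmatrix_carrier)
      (simp add: fm_hom carr c q_corner left_diff_distrib right_diff_distrib mult.assoc n)
  moreover have "lie_bracket x z \<in> \<gg>\<^sub>0"
    using skew0_closed(4)[OF fm_mem(2)[OF stabD(1)[OF x]] fm_mem(2)[OF z(1)]] c by (simp add: g0 fm_hom carr)
  ultimately show ?thesis by (auto simp: T_def lie_orbit_def)
qed

lemma bracket_add: "x \<in> \<gg>\<^sub>0 \<Longrightarrow> X \<in> V \<Longrightarrow> Y \<in> V \<Longrightarrow> lie_bracket x (X + Y) = lie_bracket x X + lie_bracket x Y"
  using VV_action by (simp add: lin_action_def module_mat_simps)

lemma QQ_simps:
  "carrier QQ = coset ` V"
  "X \<in> V \<Longrightarrow> Y \<in> V \<Longrightarrow> coset X \<oplus>\<^bsub>QQ\<^esub> coset Y = coset (X + Y)"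
  "X \<in> V \<Longrightarrow> c \<odot>\<^bsub>QQ\<^esub> coset X = coset (c \<cdot>\<^sub>m X)"
  "X \<in> V \<Longrightarrow> x \<in> stab \<Longrightarrow> qact x (coset X) = coset (lie_bracket x X)"
proof -
  show "carrier QQ = coset ` V"
    by (auto simp: quotient_module_def A_RCOSETS_def' coset_def)
  show "coset X \<oplus>\<^bsub>QQ\<^esub> coset Y = coset (X + Y)" if XY: "X \<in> V" "Y \<in> V"
  proof -
    have c: "X \<in> carrier_mat N N" "Y \<in> carrier_mat N N" using XY pair_carrier(3) by auto
    have eq: "(t + X) + (u + Y) = (t + u) + (X + Y)" if "t \<in> T" "u \<in> T" for t u
      using T_carrier[OF that(1)] T_carrier[OF that(2)]
      by (intro fm_eqI carr c) (simp_all add: fm_hom carr c)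
    have "coset X \<oplus>\<^bsub>QQ\<^esub> coset Y = {a + b |a b. a \<in> coset X \<and> b \<in> coset Y}"
      by (auto simp: quotient_module_def set_add_def' module_mat_simps)
    also have "\<dots> = coset (X + Y)"
    proof (rule equalityI; rule subsetI)
      fix W assume "W \<in> {a + b |a b. a \<in> coset X \<and> b \<in> coset Y}"
      then obtain t u where "t \<in> T" "u \<in> T" "W = (t + X) + (u + Y)" unfolding coset_iff by blast
      then show "W \<in> coset (X + Y)" using eq T(3) unfolding coset_iff by blast
    next
      fix W assume "W \<in> coset (X + Y)"
      then obtain t where t: "t \<in> T" "W = t + (X + Y)" unfolding coset_iff by blast
      then have "W = (t + X) + Y" using assoc_add_mat[OF T_carrier c, of t] by simp
      then show "W \<in> {a + b |a b. a \<in> coset X \<and> b \<in> coset Y}"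
        using t(1) coset_self[OF XY(2)] unfolding coset_iff[of _ X] by blast
    qed
    finally show ?thesis .
  qed
  show "c \<odot>\<^bsub>QQ\<^esub> coset X = coset (c \<cdot>\<^sub>m X)" if X: "X \<in> V"
  proof -
    have "coset (c \<cdot>\<^sub>m Y) = coset (c \<cdot>\<^sub>m X)" if "Y \<in> coset X" for Y
    proof -
      obtain t where t: "t \<in> T" "Y = t + X" using \<open>Y \<in> coset X\<close> by (auto simp: coset_iff)
      have "c \<cdot>\<^sub>m Y = c \<cdot>\<^sub>m t + c \<cdot>\<^sub>m X"
        unfolding t(2) by (rule add_smult_distrib_left_mat[OF T_carrier[OF t(1)] pair_carrier(3)[OF X]])
      then show ?thesis by (rule coset_eqI[OF V_closed(2)[OF X] T(4)[OF t(1)]])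
    qed
    from coset_UN[OF X, of "\<lambda>Y. c \<cdot>\<^sub>m Y", OF this] show ?thesis
      by (simp add: quotient_module_def coset_def module_mat_simps)
  qed
  show "qact x (coset X) = coset (lie_bracket x X)" if X: "X \<in> V" "x \<in> stab"
  proof -
    have "coset (lie_bracket x Y) = coset (lie_bracket x X)" if "Y \<in> coset X" for Y
    proof -
      obtain t where t: "t \<in> T" "Y = t + X" using \<open>Y \<in> coset X\<close> by (auto simp: coset_iff)
      have "lie_bracket x Y = lie_bracket x t + lie_bracket x X"
        unfolding t(2) by (rule bracket_add[OF stabD(1)[OF X(2)] T(1)[OF t(1)] X(1)])
      then show ?thesis by (rule coset_eqI[OF V_closed(4)[OF stabD(1)[OF X(2)] X(1)] stab_T[OF X(2) t(1)]])
    qed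
    from coset_UN[OF X(1), of "lie_bracket x", OF this] show ?thesis
      by (simp add: quotient_action_def coset_def)
  qed
qed

lemma QQ_closed: "lin_closed QQ" "carrier QQ \<noteq> {}"
  using V_closed by (auto simp: lin_closed_def QQ_simps)

lemma stab_closed: "x \<in> stab \<Longrightarrow> y \<in> stab \<Longrightarrow> x + y \<in> stab" "x \<in> stab \<Longrightarrow> c \<cdot>\<^sub>m x \<in> stab" "0\<^sub>m N N \<in> stab"
proof -
  have c: "z \<in> carrier_mat N N" if "z \<in> stab" for z by (rule pair_carrier(2)[OF stabD(1)[OF that]])
  show "x + y \<in> stab" if "x \<in> stab" "y \<in> stab"
    using that by (intro stabI g0_closed(1)) (simp_all add: stabD(1) fm_hom c stabD(2) distrib_left distrib_right)
  show "c \<cdot>\<^sub>m x \<in> stab" if "x \<in> stab"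
    using that by (intro stabI g0_closed(2)) (simp_all add: stabD(1) fm_hom c stabD(2))
  show "0\<^sub>m N N \<in> stab" by (intro stabI g0_closed) (simp add: fm_hom)
qed

lemma QQ_action: "lin_action stab qact QQ"
proof -
  note a = VV_action[unfolded lin_action_def module_mat_simps]
  have 1: "lie_bracket (x + y) X = lie_bracket x X + lie_bracket y X" "lie_bracket (c \<cdot>\<^sub>m x) X = c \<cdot>\<^sub>m lie_bracket x X"
    "lie_bracket x (c \<cdot>\<^sub>m X) = c \<cdot>\<^sub>m lie_bracket x X"
    if "x \<in> stab" "y \<in> stab" "X \<in> V" for x y X c
    using that(1,2)[THEN stabD(1), THEN pair_carrier(2)] pair_carrier(3)[OF that(3)]
    by - (rule fm_eqI; (intro carr)?; simp add: fm_hom carr distrib_left distrib_right)+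
  show ?thesis
    unfolding lin_action_def
  proof (intro conjI ballI allI)
    show "stab \<noteq> {}" using stab_closed(3) by blast
    show "\<exists>z\<in>stab. \<forall>C\<in>carrier QQ. qact z C = qact x C \<oplus>\<^bsub>QQ\<^esub> qact y C" if xy: "x \<in> stab" "y \<in> stab" for x y
      by (rule bexI[OF _ stab_closed(1)[OF xy]])
        (use xy V_closed(4) stabD(1) in \<open>auto simp: QQ_simps stab_closed 1[OF xy]\<close>)
    show "\<exists>z\<in>stab. \<forall>C\<in>carrier QQ. qact z C = c \<odot>\<^bsub>QQ\<^esub> qact x C" if x: "x \<in> stab" for x c
      by (rule bexI[OF _ stab_closed(2)[OF x]])
        (use x V_closed(4) stabD(1) in \<open>auto simp: QQ_simps stab_closed 1[OF x x]\<close>)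
    fix x C D assume x: "x \<in> stab" and C: "C \<in> carrier QQ"
    obtain X where X: "X \<in> V" "C = coset X" using C by (auto simp: QQ_simps)
    have xX: "lie_bracket x X \<in> V" by (rule V_closed(4)[OF stabD(1)[OF x] X(1)])
    show "qact x C \<in> carrier QQ" using x X xX by (simp add: QQ_simps)
    show "qact x (c \<odot>\<^bsub>QQ\<^esub> C) = c \<odot>\<^bsub>QQ\<^esub> qact x C" for c
      using x X xX V_closed(2)[OF X(1)] by (simp add: QQ_simps 1[OF x x])
    assume "D \<in> carrier QQ"
    then obtain Y where Y: "Y \<in> V" "D = coset Y" by (auto simp: QQ_simps)
    have xY: "lie_bracket x Y \<in> V" by (rule V_closed(4)[OF stabD(1)[OF x] Y(1)])
    show "qact x (C \<oplus>\<^bsub>QQ\<^esub> D) = qact x C \<oplus>\<^bsub>QQ\<^esub> qact x D"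
      using x X xX Y xY V_closed(1)[OF X(1) Y(1)] by (simp add: QQ_simps bracket_add[OF stabD(1)[OF x]])
  qed
qed

text \<open>For y centralising \<open>nil\<close> the trace against y vanishes on T, so the value
  does not depend on the chosen representative (\<open>psi_coset\<close>).\<close>

definition "psi y = (\<lambda>C\<in>carrier QQ. ftrace (y * fm (SOME X. X \<in> C)))"

lemma psi_coset:
  assumes y: "y \<in> slice" and X: "X \<in> V"
  shows "psi y (coset X) = ftrace (y * fm X)"
proof -
  have "(SOME Y. Y \<in> coset X) \<in> coset X" using coset_self[OF X] by (rule someI)
  then obtain t where t: "t \<in> T" "(SOME Y. Y \<in> coset X) = t + X" by (auto simp: coset_iff)
  obtain z where z: "z \<in> \<gg>\<^sub>0" "t = lie_bracket z vnil" using t(1) by (auto simp: T_def lie_orbit_def)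
  have "ftrace (y * fm t) = ftrace (y * (fm z * nil - nil * fm z))"
    using pair_carrier(2)[OF z(1)] q_corner by (simp add: z(2) fm_hom)
  also have "\<dots> = 0" using y unfolding ftrace_cyclic by (simp add: slice_def)
  finally show ?thesis
    using X t T_carrier[OF t(1)] pair_carrier(3)[OF X] by (simp add: psi_def QQ_simps fm_hom distrib_left)
qed

lemma psi_dual:
  assumes y: "y \<in> slice"
  shows "psi y \<in> carrier (dual_module QQ)"
proof (rule dual_carrierI)
  show "psi y \<in> extensional (carrier QQ)" by (simp add: psi_def)
  fix C D c assume "C \<in> carrier QQ"
  then obtain X where X: "X \<in> V" "C = coset X" by (auto simp: QQ_simps)
  show "psi y (c \<odot>\<^bsub>QQ\<^esub> C) = c * psi y C"
    using X V_closed(2)[OF X(1)] pair_carrier(3)[OF X(1)] by (simp add: QQ_simps psi_coset[OF y] fm_hom)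
  assume "D \<in> carrier QQ"
  then obtain Y where Y: "Y \<in> V" "D = coset Y" by (auto simp: QQ_simps)
  show "psi y (C \<oplus>\<^bsub>QQ\<^esub> D) = psi y C + psi y D"
    using X Y V_closed(1)[OF X(1) Y(1)] pair_carrier(3)[OF X(1)] pair_carrier(3)[OF Y(1)]
    by (simp add: QQ_simps psi_coset[OF y] fm_hom distrib_left)
qed

lemma pullback_dual:
  assumes \<mu>: "\<mu> \<in> carrier (dual_module QQ)"
  shows "(\<lambda>X\<in>V. \<mu> (coset X)) \<in> carrier (dual_module VV)"
proof (rule dual_carrierI)
  have C: "coset X \<in> carrier QQ" if "X \<in> V" for X using that by (simp add: QQ_simps(1))
  show "(\<lambda>X\<in>V. \<mu> (coset X)) (X \<oplus>\<^bsub>VV\<^esub> Y) = (\<lambda>X\<in>V. \<mu> (coset X)) X + (\<lambda>X\<in>V. \<mu> (coset X)) Y"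
    if "X \<in> carrier VV" "Y \<in> carrier VV" for X Y
    using that dual_carrierD(2)[OF \<mu> C C, of X Y] V_closed(1)[of X Y] by (simp add: module_mat_simps QQ_simps(2))
  show "(\<lambda>X\<in>V. \<mu> (coset X)) (c \<odot>\<^bsub>VV\<^esub> X) = c * (\<lambda>X\<in>V. \<mu> (coset X)) X" if "X \<in> carrier VV" for c X
    using that dual_carrierD(3)[OF \<mu> C, of X c] V_closed(2)[of X c] by (simp add: module_mat_simps QQ_simps(3))
qed simp

text \<open>The pullback to V is a trace against some odd y. Vanishing on T says that [nil, y] is
  orthogonal to the even part, hence zero, so y lies in the slice.\<close>

lemma psi_surj:
  assumes \<mu>: "\<mu> \<in> carrier (dual_module QQ)"
  shows "\<exists>y\<in>slice. \<mu> = psi y"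
proof -
  obtain y where y: "y \<in> skew1" "(\<lambda>X\<in>V. \<mu> (coset X)) = tr y" using tr_surj[OF pullback_dual[OF \<mu>]] by blast
  have \<mu>y: "\<mu> (coset X) = ftrace (y * fm X)" if "X \<in> V" for X
    using fun_cong[OF y(2), of X] that by (simp add: tr_def)
  have zero: "\<mu> (coset t) = 0" if t: "t \<in> T" for t
  proof -
    have 0: "0\<^sub>m N N \<in> V" by (rule V_closed(3))
    have "t = t + 0\<^sub>m N N" using T_carrier[OF t] by simp
    then have "coset t = coset (0\<^sub>m N N)" by (rule coset_eqI[OF 0 t])
    then show ?thesis using \<mu>y[OF 0] by (simp add: fm_hom)
  qed
  have "nil * y - y * nil = 0"
  proof (rule skew0_nondegenerate[OF mk0 bracket_skew1[OF nil_skew1 y(1)]])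
    fix x assume x: "x \<in> skew0"
    have t: "lie_bracket (mt x) vnil \<in> T" using mt_mem(2)[OF x] by (auto simp: T_def lie_orbit_def)
    have "ftrace (y * (x * nil - nil * x)) = 0"
      using zero[OF t] \<mu>y[OF T(1)[OF t]] skew_corner(2)[OF x] q_corner by (simp add: fm_hom)
    then show "ftrace ((nil * y - y * nil) * x) = 0" by (simp only: ftrace_cyclic)
  qed
  then have ys: "y \<in> slice" using y(1) by (simp add: slice_def)
  have "\<mu> = psi y"
    by (rule dual_eqI[OF \<mu> psi_dual[OF ys]]) (auto simp: QQ_simps psi_coset[OF ys] \<mu>y)
  then show ?thesis using ys by blast
qed

lemma QQ_bound:
  assumes G: "\<And>i. i < n \<Longrightarrow> G i \<in> carrier (dual_module QQ)" and ind: "independent_on (carrier QQ) n G"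
  shows "n \<le> N * N"
proof (rule VV_bound[where G = "\<lambda>i. \<lambda>X\<in>V. G i (coset X)"])
  show "(\<lambda>X\<in>V. G i (coset X)) \<in> carrier (dual_module VV)" if "i < n" for i by (rule pullback_dual[OF G[OF that]])
  show "independent_on (carrier VV) n (\<lambda>i. \<lambda>X\<in>V. G i (coset X))"
  proof (rule independent_onI)
    fix c i assume c: "\<And>X. X \<in> carrier VV \<Longrightarrow> (\<Sum>i<n. c i * (\<lambda>X\<in>V. G i (coset X)) X) = 0" and i: "i < n"
    show "c i = 0"
      by (rule independent_onD[OF ind _ i]) (use c in \<open>auto simp: QQ_simps\<close>)
  qed
qed

text \<open>R independent elements of an orbit yield by \<open>slice_bound\<close> R + (m + 1)
  independent slice elements. Nondegeneracy of the trace form turns these into as many independent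
  functionals on the quotient, which is the form required by \<open>index_ge\<close>.\<close>

lemma index_Q: "int (m + 1) \<le> lie_index stab (dual_action QQ qact) (dual_module QQ)"
proof (rule index_ge[where D = "N * N", OF QQ_closed QQ_action])
  show "n \<le> N * N" if "\<And>i. i < n \<Longrightarrow> G i \<in> carrier (dual_module QQ)" "independent_on (carrier QQ) n G" for n G
    by (rule QQ_bound[OF that])
  fix C R and x :: "nat \<Rightarrow> 'a mat"
  assume C: "C \<in> carrier QQ" and x: "\<And>i. i < R \<Longrightarrow> x i \<in> stab"
    and ind: "independent_on (carrier (dual_module QQ)) R (\<lambda>i \<mu>. \<mu> (qact (x i) C))"
  obtain X where X: "X \<in> V" "C = coset X" using C by (auto simp: QQ_simps)
  have Xc: "X \<in> carrier_mat N N" by (rule pair_carrier(3)[OF X(1)])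
  have "independent_on slice R (\<lambda>i y. ftrace (y * (fm (x i) * fm X - fm X * fm (x i))))"
  proof (rule independent_onI)
    fix c i assume c: "\<And>y. y \<in> slice \<Longrightarrow> (\<Sum>i<R. c i * ftrace (y * (fm (x i) * fm X - fm X * fm (x i)))) = 0"
      and i: "i < R"
    show "c i = 0"
    proof (rule independent_onD[OF ind _ i])
      fix \<mu> assume "\<mu> \<in> carrier (dual_module QQ)"
      then obtain y where y: "y \<in> slice" "\<mu> = psi y" using psi_surj by blast
      have "\<mu> (qact (x j) C) = ftrace (y * (fm (x j) * fm X - fm X * fm (x j)))" if "j < R" for j
        using x[OF that] V_closed(4)[OF stabD(1)[OF x[OF that]] X(1)] pair_carrier(2)[OF stabD(1)[OF x[OF that]]] X Xc
        by (simp add: QQ_simps y(2) psi_coset[OF y(1)] fm_hom)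
      then show "(\<Sum>i<R. c i * \<mu> (qact (x i) C)) = 0" using c[OF y(1)] by simp
    qed
  qed
  moreover have "fm (x i) \<in> skew0 \<and> nil * fm (x i) = fm (x i) * nil" if "i < R" for i
    using fm_mem(2)[OF stabD(1)[OF x[OF that]]] stabD(2)[OF x[OF that]] by blast
  ultimately obtain y where y: "\<And>i. i < R + (m + 1) \<Longrightarrow> y i \<in> slice" "findependent (R + (m + 1)) y"
    using slice_bound[OF mk fm_mem(3)[OF X(1)], of R "\<lambda>i. fm (x i)"] by blast
  have "independent_on (carrier QQ) (R + (m + 1)) (\<lambda>i. psi (y i))"
  proof (rule independent_onI)
    fix c i assume c: "\<And>C. C \<in> carrier QQ \<Longrightarrow> (\<Sum>i<R + (m + 1). c i * psi (y i) C) = 0" and i: "i < R + (m + 1)"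
    have "(\<Sum>i<R + (m + 1). scale (c i) (y i)) = 0"
    proof (rule skew1_nondegenerate[OF mk0])
      show "(\<Sum>i<R + (m + 1). scale (c i) (y i)) \<in> skew1"
        by (rule skew1_sum, rule skew1_closed(3)) (use y(1) skew1_ex(2)[OF mk0] in \<open>auto simp: slice_def\<close>)
      fix A assume A: "A \<in> skew1"
      have "(\<Sum>i<R + (m + 1). c i * psi (y i) (coset (mt A))) = 0"
        by (rule c) (use mt_mem(3)[OF A] in \<open>simp add: QQ_simps\<close>)
      moreover have "psi (y i) (coset (mt A)) = ftrace (y i * A)" if "i < R + (m + 1)" for i
        using psi_coset[OF y(1)[OF that] mt_mem(3)[OF A]] skew_corner(3)[OF A] by simp
      ultimately show "ftrace ((\<Sum>i<R + (m + 1). scale (c i) (y i)) * A) = 0"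
        by (simp only: sum_distrib_right ftrace_sum scale_mult ftrace_simps) simp
    qed
    then show "c i = 0" using findependentD[OF y(2)] i by blast
  qed
  then show "\<exists>G. (\<forall>i<R + (m + 1). G i \<in> carrier (dual_module QQ)) \<and> independent_on (carrier QQ) (R + (m + 1)) G"
    using psi_dual y(1) by (intro exI[of _ "\<lambda>i. psi (y i)"]) auto
qed

theorem not_isotropy_GNIB: "\<not> isotropy_GNIB N \<gg> \<sigma> G\<^sub>0"
proof
  assume "isotropy_GNIB N \<gg> \<sigma> G\<^sub>0"
  then have "lie_index \<gg>\<^sub>0 (dual_action VV lie_bracket) (dual_module VV) =
      lie_index stab (dual_action QQ qact) (dual_module QQ)"
    using nilpotent unfolding isotropy_GNIB_def odd_eigenspace GNIB_def Let_def G0(2) stab_def T_def by blast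
  then show False using index_V index_Q by simp
qed

end

section \<open>The three families\<close>

lemma square_root_exists: "\<exists>w. w * w = (c :: 'a::alg_closed_field)"
proof -
  obtain w where "(\<Sum>i\<le>2. (if i = 0 then - c else if i = 2 then 1 else 0) * w ^ i) = 0"
    using alg_closed[of 2 "\<lambda>i. if i = 0 then - c else if i = 2 then 1 else 0"] by auto
  then have "w * w = c" by (simp add: numeral_2_eq_2)
  then show ?thesis ..
qed

text \<open>Algebraic closedness provides the square root of -1 that splits the orthonormal part of
  W into hyperbolic planes.\<close>

lemma hermitian_not_GNIB:
  fixes E :: "nat \<Rightarrow> nat \<Rightarrow> 'a::{alg_closed_field, field_char_0} fmatrix"
  assumes H: "hermitian N m k E adj pr" and mk: "3 \<le> m" "4 \<le> k" "m \<le> k"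
    and g: "\<gg> = {X \<in> carrier_mat N N. adj (fmatrix_of_mat X) (- fmatrix_of_mat X)}"
    and g0: "\<gg>\<^sub>0 = {X \<in> \<gg>. (\<Sum>i<m. E i i) * fmatrix_of_mat X = fmatrix_of_mat X * (\<Sum>i<m. E i i)}"
    and involution: "involutory_automorphism N \<gg> \<sigma>" "{X \<in> \<gg>. \<sigma> X = X} = \<gg>\<^sub>0"
    and G0: "connected_closed_subgroup N G\<^sub>0" "lie_algebra N G\<^sub>0 = \<gg>\<^sub>0"
  shows "\<not> isotropy_GNIB N \<gg> \<sigma> G\<^sub>0"
proof -
  interpret hermitian N m k E adj pr by (rule H)
  obtain \<iota> :: 'a where \<iota>: "\<iota> * \<iota> = - 1" using square_root_exists by blast
  interpret hermitian_pair N m k E adj pr \<iota> \<gg> \<gg>\<^sub>0 G\<^sub>0 \<sigma>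
  proof unfold_locales
    show "\<gg> = {X \<in> carrier_mat N N. fmatrix_of_mat X \<in> skew}" by (auto simp: g skew_def)
    show "\<gg>\<^sub>0 = {X \<in> carrier_mat N N. fmatrix_of_mat X \<in> skew0}" by (auto simp: g0 g skew0_def skew_def eU_def)
  qed (use \<iota> mk involution G0 in auto)
  show ?thesis by (rule not_isotropy_GNIB)
qed

text \<open>In the frame the projection onto U along W is the sum of the first m diagonal units, so
  preserving U and W amounts to being even.\<close>

lemma frame_not_GNIB:
  fixes P P' :: "'a::{alg_closed_field, field_char_0} mat"
  assumes N: "N = d * (m + k)" and d: "d > 0"
    and P: "P \<in> carrier_mat N N" "P' \<in> carrier_mat N N" "P' * P = 1\<^sub>m N"
    and H: "hermitian N m k (frameE d (fmatrix_of_mat P) (fmatrix_of_mat P')) adj pr" and mk: "3 \<le> m" "4 \<le> k" "m \<le> k"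
    and dec: "direct_decomposition N U a W b"
    and cols: "\<And>i. i < d * m \<Longrightarrow> col P i \<in> U" "\<And>i. i < N \<Longrightarrow> d * m \<le> i \<Longrightarrow> col P i \<in> W"
    and g: "\<gg> = {X \<in> carrier_mat N N. adj (fmatrix_of_mat X) (- fmatrix_of_mat X)}" and g0: "\<gg>\<^sub>0 = preserving \<gg> U W"
    and involution: "involutory_automorphism N \<gg> \<sigma>" "{X \<in> \<gg>. \<sigma> X = X} = \<gg>\<^sub>0"
    and G0: "connected_closed_subgroup N G\<^sub>0" "lie_algebra N G\<^sub>0 = \<gg>\<^sub>0"
  shows "\<not> isotropy_GNIB N \<gg> \<sigma> G\<^sub>0"
proof (rule hermitian_not_GNIB[OF H mk g _ involution G0])
  let ?f = "fmatrix_of_mat :: 'a mat \<Rightarrow> 'a fmatrix"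
  have PP': "P * P' = 1\<^sub>m N" by (rule mat_mult_left_right_inverse[OF P(2,1,3)])
  have f: "?f P \<in> corner N" "?f P' \<in> corner N" "?f P * ?f P' = ?f (1\<^sub>m N)" "?f P' * ?f P = ?f (1\<^sub>m N)"
    using P fmatrix_of_mat_hom(5)[OF P(1,2)] fmatrix_of_mat_hom(5)[OF P(2,1)] PP' by auto
  define D :: "'a mat" where "D = mat N N (\<lambda>(i, j). if i = j \<and> i < d * m then 1 else 0)"
  have D: "D \<in> carrier_mat N N" by (simp add: D_def)
  have DP: "D * P' \<in> carrier_mat N N" using D P by auto
  define e where "e = P * (D * P')"
  have e: "e \<in> carrier_mat N N" unfolding e_def using P DP by auto
  have le: "m \<le> m + k" "d * m \<le> N" by (auto simp: N)
  have eU: "(\<Sum>i<m. frameE d (?f P) (?f P') i i) = ?f e"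
    unfolding frame_sum[OF N d f le(1)] e_def D_def [symmetric]
    by (simp only: fmatrix_of_mat_hom(5)[OF P(1) DP] fmatrix_of_mat_hom(5)[OF D P(2)])
  have "X \<in> preserving \<gg> U W \<longleftrightarrow> X \<in> \<gg> \<and> ?f e * ?f X = ?f X * ?f e" for X
  proof (cases "X \<in> \<gg>")
    case True
    then have X: "X \<in> carrier_mat N N" by (simp add: g)
    have c: "e * X \<in> carrier_mat N N" "X * e \<in> carrier_mat N N" using e X by auto
    have "X \<in> preserving \<gg> U W \<longleftrightarrow> e * X = X * e"
      using True preserving_iff[OF dec P(1,2) PP' le(2) cols X] unfolding preserving_def e_def D_def by auto
    also have "\<dots> \<longleftrightarrow> ?f (e * X) = ?f (X * e)" using fmatrix_of_mat_inj[OF c] by auto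
    finally show ?thesis using True by (simp only: fmatrix_of_mat_hom(5)[OF e X] fmatrix_of_mat_hom(5)[OF X e] simp_thms)
  qed (simp add: preserving_def)
  then show "\<gg>\<^sub>0 = {X \<in> \<gg>. (\<Sum>i<m. frameE d (?f P) (?f P') i i) * ?f X = ?f X * (\<Sum>i<m. frameE d (?f P) (?f P') i i)}"
    unfolding eU g0 by blast
qed

lemma bform_unit:
  assumes "M \<in> carrier_mat N N" "i < N" "j < N"
  shows "bform M (unit_vec N i) (unit_vec N j) = M $$ (i, j)"
  using assms by (simp add: bform_def scalar_prod_left_unit scalar_prod_right_unit)

lemma form_algebra_iff:
  fixes J :: "'a::field mat"
  assumes J: "J \<in> carrier_mat N N" and X: "X \<in> carrier_mat N N"
  shows "X \<in> form_algebra N J \<longleftrightarrow> transpose_mat X * J + J * X = 0\<^sub>m N N"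
proof -
  define M where "M = transpose_mat X * J + J * X"
  have Xt: "transpose_mat X \<in> carrier_mat N N" using X by simp
  have M: "M \<in> carrier_mat N N" unfolding M_def using J X by auto
  have b: "bform J (X *\<^sub>v x) y + bform J x (X *\<^sub>v y) = bform M x y" if xy: "x \<in> carrier_vec N" "y \<in> carrier_vec N" for x y
  proof -
    have Jy: "J *\<^sub>v y \<in> carrier_vec N" "X *\<^sub>v y \<in> carrier_vec N" "X *\<^sub>v x \<in> carrier_vec N" using J X xy by auto
    have t: "transpose_mat X *\<^sub>v (J *\<^sub>v y) \<in> carrier_vec N" "J *\<^sub>v (X *\<^sub>v y) \<in> carrier_vec N" using J Xt Jy by auto
    have "bform J (X *\<^sub>v x) y = (J *\<^sub>v y) \<bullet> (X *\<^sub>v x)"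
      unfolding bform_def by (rule comm_scalar_prod[OF Jy(3,1)])
    also have "\<dots> = (transpose_mat X *\<^sub>v (J *\<^sub>v y)) \<bullet> x" by (rule transpose_vec_mult_scalar[OF X xy(1) Jy(1), symmetric])
    also have "\<dots> = x \<bullet> (transpose_mat X *\<^sub>v (J *\<^sub>v y))" by (rule comm_scalar_prod[OF t(1) xy(1)])
    finally have "bform J (X *\<^sub>v x) y + bform J x (X *\<^sub>v y) = x \<bullet> (transpose_mat X *\<^sub>v (J *\<^sub>v y) + J *\<^sub>v (X *\<^sub>v y))"
      unfolding bform_def scalar_prod_add_distrib[OF xy(1) t] by simp
    also have "transpose_mat X *\<^sub>v (J *\<^sub>v y) + J *\<^sub>v (X *\<^sub>v y) = M *\<^sub>v y"
      unfolding M_def add_mult_distrib_mat_vec[OF mult_carrier_mat[OF Xt J] mult_carrier_mat[OF J X] xy(2)]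
      by (simp only: assoc_mult_mat_vec[OF Xt J xy(2)] assoc_mult_mat_vec[OF J X xy(2)])
    finally show ?thesis by (simp add: bform_def)
  qed
  have "X \<in> form_algebra N J \<longleftrightarrow> (\<forall>x\<in>carrier_vec N. \<forall>y\<in>carrier_vec N. bform M x y = 0)"
    using X b by (simp add: form_algebra_def)
  also have "\<dots> \<longleftrightarrow> M = 0\<^sub>m N N"
  proof
    assume z: "\<forall>x\<in>carrier_vec N. \<forall>y\<in>carrier_vec N. bform M x y = 0"
    show "M = 0\<^sub>m N N"
    proof (rule eq_matI)
      fix i j assume "i < dim_row (0\<^sub>m N N)" "j < dim_col (0\<^sub>m N N)"
      then have ij: "i < N" "j < N" by auto
      show "M $$ (i, j) = 0\<^sub>m N N $$ (i, j)"
        using z bform_unit[OF M ij] ij by (metis index_zero_mat(1) unit_vec_carrier)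
    qed (use M in auto)
  next
    assume z: "M = 0\<^sub>m N N"
    have "0\<^sub>m N N *\<^sub>v y = 0\<^sub>v N" if "y \<in> carrier_vec N" for y :: "'a vec"
      using that by (intro eq_vecI) auto
    then show "\<forall>x\<in>carrier_vec N. \<forall>y\<in>carrier_vec N. bform M x y = 0" by (simp add: z bform_def)
  qed
  finally show ?thesis by (simp add: M_def)
qed

lemma ftrans_fmatrix_of_mat: "ftrans (fmatrix_of_mat A) = fmatrix_of_mat (transpose_mat A)"
  by (rule fmatrix_eqI) auto

text \<open>Common to the two families with a form: d = 1 and \<epsilon> = 1 for the orthogonal one,
  d = 2 and \<epsilon> = -1 for the symplectic one. The standard Gram matrix is orthogonal, which
  gives explicit inverses of the frame matrix P and of J.\<close>

lemma form_not_GNIB: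
  fixes J :: "'a::{alg_closed_field, field_char_0} mat" and s :: "nat \<Rightarrow> 'a"
  defines "\<Gamma> \<equiv> \<lambda>N \<tau> s. fmatrix_of_mat (mat N N (\<lambda>(i, j). if j = \<tau> i then s i else 0)) :: 'a fmatrix"
  assumes N: "N = d * (m + k)" and mk: "3 \<le> m" "4 \<le> k" "m \<le> k"
    and J: "J \<in> carrier_mat N N" and d: "d > 0"
    and tau: "\<And>i. \<tau> (\<tau> i) = i" "\<And>i r. i < d * r \<Longrightarrow> \<tau> i < d * r" "\<And>i r. i < d \<Longrightarrow> \<tau> (d * r + i) = d * r + \<tau> i"
    and s: "\<And>i. s i * s i = 1" "\<And>i r. i < d \<Longrightarrow> s (d * r + i) = s i"
    and sym: "\<And>x y. x \<in> carrier_vec N \<Longrightarrow> y \<in> carrier_vec N \<Longrightarrow> bform J y x = \<epsilon> * bform J x y" "\<epsilon> * \<epsilon> = 1"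
    and ext: "\<And>Z z. lin_subspace N Z \<Longrightarrow> nondegenerate_on N J Z \<Longrightarrow> z \<in> Z \<Longrightarrow> z \<noteq> 0\<^sub>v N \<Longrightarrow>
      \<exists>f. \<forall>i<d. f i \<in> Z \<and> (\<forall>j<d. bform J (f i) (f j) = (if j = \<tau> i then s i else 0))"
    and comm: "\<And>i j. i < m + k \<Longrightarrow> j < m + k \<Longrightarrow> blk d i j * \<Gamma> N \<tau> s = \<Gamma> N \<tau> s * blk d i j"
    and scalar: "\<And>i Y. i < m + k \<Longrightarrow> Y \<in> corner N \<Longrightarrow> blk d i i * Y * blk d i i = Y \<Longrightarrow>
      ftrans Y * \<Gamma> N \<tau> s = \<Gamma> N \<tau> s * Y \<Longrightarrow> \<exists>c. Y = scale c (blk d i i)"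
    and dec: "orthogonal_decomposition N J U (d * m) W (d * k)"
    and g: "\<gg> = form_algebra N J" and g0: "\<gg>\<^sub>0 = preserving \<gg> U W"
    and involution: "involutory_automorphism N \<gg> \<sigma>" "{X \<in> \<gg>. \<sigma> X = X} = \<gg>\<^sub>0"
    and G0: "connected_closed_subgroup N G\<^sub>0" "lie_algebra N G\<^sub>0 = \<gg>\<^sub>0"
  shows "\<not> isotropy_GNIB N \<gg> \<sigma> G\<^sub>0"
proof -
  let ?f = "fmatrix_of_mat :: 'a mat \<Rightarrow> 'a fmatrix"
  define \<Omega> where "\<Omega> = mat N N (\<lambda>(i, j). if j = \<tau> i then s i else 0)"
  have \<Omega>: "\<Omega> \<in> carrier_mat N N" "transpose_mat \<Omega> \<in> carrier_mat N N" by (auto simp: \<Omega>_def)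
  \<comment> \<open>A signed permutation matrix, because \<tau> is an involution and the s i square
    to 1.\<close>
  have \<Omega>\<Omega>: "transpose_mat \<Omega> * \<Omega> = 1\<^sub>m N"
  proof (rule eq_matI)
    fix i j assume "i < dim_row (1\<^sub>m N :: 'a mat)" "j < dim_col (1\<^sub>m N :: 'a mat)"
    then have ij: "i < N" "j < N" by auto
    have ti: "\<tau> i < N" using tau(2)[of i "m + k"] ij N by simp
    have eq: "i = \<tau> a \<longleftrightarrow> a = \<tau> i" for a using tau(1) by metis
    have "(transpose_mat \<Omega> * \<Omega>) $$ (i, j) = (\<Sum>a=0..<N. (if i = \<tau> a then s a else 0) * (if j = \<tau> a then s a else 0))"
      using ij by (simp add: \<Omega>_def scalar_prod_def)
    also have "\<dots> = (\<Sum>a=0..<N. if a = \<tau> i then (if i = j then 1 else 0) else 0)"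
      by (rule sum.cong) (auto simp: eq tau(1) s(1))
    finally show "(transpose_mat \<Omega> * \<Omega>) $$ (i, j) = 1\<^sub>m N $$ (i, j)" using ij ti by simp
  qed (auto simp: \<Omega>_def)
  have ex: "\<exists>P\<in>carrier_mat N N. (\<forall>i<d * m. col P i \<in> U) \<and> (\<forall>i<N. d * m \<le> i \<longrightarrow> col P i \<in> W) \<and>
      transpose_mat P * (J * P) = \<Omega>"
    unfolding \<Omega>_def by (rule form_frame[OF J d tau s sym(1) ext N dec])
  obtain P where P: "P \<in> carrier_mat N N" "transpose_mat P * (J * P) = \<Omega>"
    and cols: "\<And>i. i < d * m \<Longrightarrow> col P i \<in> U" "\<And>i. i < N \<Longrightarrow> d * m \<le> i \<Longrightarrow> col P i \<in> W"
    using ex by blast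
  have Pt: "transpose_mat P \<in> carrier_mat N N" "J * P \<in> carrier_mat N N" "transpose_mat P * J \<in> carrier_mat N N"
    "transpose_mat \<Omega> * transpose_mat P \<in> carrier_mat N N"
    using P(1) J \<Omega> by auto
  define P' where "P' = transpose_mat \<Omega> * (transpose_mat P * J)"
  have P': "P' \<in> carrier_mat N N" unfolding P'_def using \<Omega> Pt by auto
  have P'P: "P' * P = 1\<^sub>m N"
    unfolding P'_def
    by (simp only: assoc_mult_mat[OF \<Omega>(2) Pt(3) P(1)] assoc_mult_mat[OF Pt(1) J P(1)] P(2) \<Omega>\<Omega>)
  define J' where "J' = P * (transpose_mat \<Omega> * transpose_mat P)"
  have J': "J' \<in> carrier_mat N N" unfolding J'_def using P Pt by auto
  have "(transpose_mat \<Omega> * transpose_mat P) * (J * P) = 1\<^sub>m N"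
    by (simp only: assoc_mult_mat[OF \<Omega>(2) Pt(1,2)] P(2) \<Omega>\<Omega>)
  then have "(J * P) * (transpose_mat \<Omega> * transpose_mat P) = 1\<^sub>m N" by (rule mat_mult_left_right_inverse[OF Pt(4,2)])
  then have JJ': "J * J' = 1\<^sub>m N" unfolding J'_def by (simp only: assoc_mult_mat[OF J P(1) Pt(4)])
  then have J'J: "J' * J = 1\<^sub>m N" by (rule mat_mult_left_right_inverse[OF J J'])
  have Jt: "transpose_mat J = \<epsilon> \<cdot>\<^sub>m J"
  proof (rule eq_matI)
    fix i j assume "i < dim_row (\<epsilon> \<cdot>\<^sub>m J)" "j < dim_col (\<epsilon> \<cdot>\<^sub>m J)"
    then have ij: "i < N" "j < N" using J by auto
    show "transpose_mat J $$ (i, j) = (\<epsilon> \<cdot>\<^sub>m J) $$ (i, j)"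
      using sym(1)[of "unit_vec N i" "unit_vec N j"] bform_unit[OF J ij] bform_unit[OF J ij(2,1)] ij J by simp
  qed (use J in auto)
  have f: "?f P \<in> corner N" "?f P' \<in> corner N" "?f P * ?f P' = ?f (1\<^sub>m N)" "?f P' * ?f P = ?f (1\<^sub>m N)"
    using P P' fmatrix_of_mat_hom(5)[OF P(1) P'] fmatrix_of_mat_hom(5)[OF P' P(1)] P'P
      mat_mult_left_right_inverse[OF P' P(1) P'P] by auto
  have fJ: "?f J \<in> corner N" "ftrans (?f J) = scale \<epsilon> (?f J)" "?f J' \<in> corner N" "?f J * ?f J' = ?f (1\<^sub>m N)" "?f J' * ?f J = ?f (1\<^sub>m N)"
    using J J' fmatrix_of_mat_hom(5)[OF J J'] fmatrix_of_mat_hom(5)[OF J' J] JJ' J'J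
      fmatrix_of_mat_hom(4)[OF J J] by (auto simp: ftrans_fmatrix_of_mat Jt)
  have f\<Gamma>: "ftrans (?f P) * (?f J * ?f P) = \<Gamma> N \<tau> s"
    unfolding ftrans_fmatrix_of_mat \<Gamma>_def \<Omega>_def [symmetric] P(2) [symmetric]
    by (simp only: fmatrix_of_mat_hom(5)[OF Pt(1,2)] fmatrix_of_mat_hom(5)[OF J P(1)])
  note H = hermitian_form[OF N d f fJ(1,2) sym(2) fJ(3-5) f\<Gamma> comm scalar]
  have g': "\<gg> = {X \<in> carrier_mat N N. ftrans (?f X) * ?f J = ?f J * - ?f X}"
  proof -
    have "X \<in> form_algebra N J \<longleftrightarrow> ftrans (?f X) * ?f J = ?f J * - ?f X" if X: "X \<in> carrier_mat N N" for X
    proof -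
      have Xt: "transpose_mat X \<in> carrier_mat N N" using X by simp
      have c: "transpose_mat X * J \<in> carrier_mat N N" "J * X \<in> carrier_mat N N" using J X by auto
      have "X \<in> form_algebra N J \<longleftrightarrow> ?f (transpose_mat X * J + J * X) = ?f (0\<^sub>m N N)"
        unfolding form_algebra_iff[OF J X] using fmatrix_of_mat_inj[OF add_carrier_mat[OF c(2)] zero_carrier_mat] by metis
      also have "?f (transpose_mat X * J + J * X) = ftrans (?f X) * ?f J + ?f J * ?f X"
        by (simp only: fmatrix_of_mat_hom(1)[OF c] fmatrix_of_mat_hom(5)[OF Xt J] fmatrix_of_mat_hom(5)[OF J X] ftrans_fmatrix_of_mat)
      also have "?f (0\<^sub>m N N) = 0" by (rule fmatrix_eqI) auto
      finally show ?thesis by (simp only: eq_neg_iff_add_eq_0 mult_minus_right)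
    qed
    moreover have "form_algebra N J \<subseteq> carrier_mat N N" by (auto simp: form_algebra_def)
    ultimately show ?thesis unfolding g by blast
  qed
  have dec': "direct_decomposition N U (d * m) W (d * k)" using dec by (simp add: orthogonal_decomposition_def)
  show ?thesis
    by (rule frame_not_GNIB[OF N d P(1) P' P'P H mk dec' cols g' g0 involution G0])
qed

lemma gl_not_GNIB:
  fixes \<gg> :: "'a::{alg_closed_field, field_char_0} mat set"
  assumes mk: "3 \<le> m" "4 \<le> n - m" "m \<le> n - m" and pair: "gl_pair n m \<gg> \<gg>\<^sub>0"
    and involution: "involutory_automorphism n \<gg> \<sigma>" "{X \<in> \<gg>. \<sigma> X = X} = \<gg>\<^sub>0"
    and G0: "connected_closed_subgroup n G\<^sub>0" "lie_algebra n G\<^sub>0 = \<gg>\<^sub>0"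
  shows "\<not> isotropy_GNIB n \<gg> \<sigma> G\<^sub>0"
proof -
  obtain U W where dec: "direct_decomposition n U m W (n - m)" and g: "\<gg> = carrier_mat n n" and g0: "\<gg>\<^sub>0 = preserving \<gg> U W"
    using pair by (auto simp: gl_pair_def)
  have n: "n = m + (n - m)" "n = 1 * (m + (n - m))" using mk by auto
  obtain P P' where P: "P \<in> carrier_mat n n" "P' \<in> carrier_mat n n" "P' * P = 1\<^sub>m n"
    and cols: "\<And>i. i < m \<Longrightarrow> col P i \<in> U" "\<And>i. i < n \<Longrightarrow> m \<le> i \<Longrightarrow> col P i \<in> W"
    using direct_frame[OF n(1) dec] by blast
  let ?f = "fmatrix_of_mat :: 'a mat \<Rightarrow> 'a fmatrix"
  have f: "?f P \<in> corner n" "?f P' \<in> corner n" "?f P * ?f P' = ?f (1\<^sub>m n)" "?f P' * ?f P = ?f (1\<^sub>m n)"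
    using P fmatrix_of_mat_hom(5)[OF P(1,2)] fmatrix_of_mat_hom(5)[OF P(2,1)]
      mat_mult_left_right_inverse[OF P(2,1,3)] by auto
  have H: "hermitian n m (n - m) (frameE 1 (?f P) (?f P')) (\<lambda>_ _. True) (\<lambda>A. A)"
    by (rule hermitian_total[where d = 1]) (use n(2) f in simp_all)
  have g': "\<gg> = {X \<in> carrier_mat n n. True}" by (simp add: g)
  have cols': "\<And>i. i < 1 * m \<Longrightarrow> col P i \<in> U" "\<And>i. i < n \<Longrightarrow> 1 * m \<le> i \<Longrightarrow> col P i \<in> W" using cols by simp_all
  show ?thesis
    by (rule frame_not_GNIB[where d = 1, OF n(2) _ P H mk dec cols' g' g0 involution G0]) simp
qed

lemma so_not_GNIB:
  fixes \<gg> :: "'a::{alg_closed_field, field_char_0} mat set"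
  assumes mk: "3 \<le> m" "4 \<le> n - m" "m \<le> n - m" and pair: "so_pair n m \<gg> \<gg>\<^sub>0"
    and involution: "involutory_automorphism n \<gg> \<sigma>" "{X \<in> \<gg>. \<sigma> X = X} = \<gg>\<^sub>0"
    and G0: "connected_closed_subgroup n G\<^sub>0" "lie_algebra n G\<^sub>0 = \<gg>\<^sub>0"
  shows "\<not> isotropy_GNIB n \<gg> \<sigma> G\<^sub>0"
proof -
  obtain J U W where J: "J \<in> carrier_mat n n"
    and sym: "\<And>x y. x \<in> carrier_vec n \<Longrightarrow> y \<in> carrier_vec n \<Longrightarrow> bform J x y = bform J y x"
    and dec: "orthogonal_decomposition n J U m W (n - m)" and g: "\<gg> = form_algebra n J" and g0: "\<gg>\<^sub>0 = preserving \<gg> U W"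
    using pair unfolding so_pair_def by blast
  have n: "n = 1 * (m + (n - m))" using mk by auto
  have \<Gamma>: "mat n n (\<lambda>(i, j). if j = i then 1 else 0) = (1\<^sub>m n :: 'a mat)" by (rule eq_matI) auto
  have b1: "blk 1 i j = (funit i j :: 'a fmatrix)" for i j by (simp add: blk_def)
  have add: "bform J (x + y) z = bform J x z + bform J y z" "bform J z (x + y) = bform J z x + bform J z y"
    "bform J (c \<cdot>\<^sub>v x) y = c * bform J x y" "bform J x (c \<cdot>\<^sub>v y) = c * bform J x y"
    if "x \<in> carrier_vec n" "y \<in> carrier_vec n" "z \<in> carrier_vec n" for x y z c
  proof -
    have M: "J *\<^sub>v x \<in> carrier_vec n" "J *\<^sub>v y \<in> carrier_vec n" "J *\<^sub>v z \<in> carrier_vec n" using J that by auto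
    show "bform J (x + y) z = bform J x z + bform J y z" unfolding bform_def by (rule add_scalar_prod_distrib[OF that(1,2) M(3)])
    show "bform J z (x + y) = bform J z x + bform J z y"
      unfolding bform_def mult_add_distrib_mat_vec[OF J that(1,2)] by (rule scalar_prod_add_distrib[OF that(3) M(1,2)])
    show "bform J (c \<cdot>\<^sub>v x) y = c * bform J x y" unfolding bform_def using that M by simp
    show "bform J x (c \<cdot>\<^sub>v y) = c * bform J x y" unfolding bform_def mult_mat_vec[OF J that(2)] using that M by simp
  qed
  show ?thesis
  proof (rule form_not_GNIB[where d = 1 and \<tau> = "\<lambda>i. i" and s = "\<lambda>_. 1" and \<epsilon> = 1, OF n mk J])
    show "orthogonal_decomposition n J U (1 * m) W (1 * (n - m))" using dec by simp
    show "bform J y x = 1 * bform J x y" if "x \<in> carrier_vec n" "y \<in> carrier_vec n" for x y using sym[OF that] by simp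
    fix Z z assume Z: "lin_subspace n Z" "nondegenerate_on n J Z" and z: "z \<in> Z" "z \<noteq> 0\<^sub>v n"
    have ZC: "x \<in> carrier_vec n" if "x \<in> Z" for x using Z(1) that by (auto simp: lin_subspace_def)
    obtain y where y: "y \<in> Z" "bform J z y \<noteq> 0" using Z(2) z unfolding nondegenerate_on_def by blast
    \<comment> \<open>Polarisation: if all values \<open>bform J w w\<close> were zero, twice
      \<open>bform J z y\<close> would vanish. A square root then normalises the vector
      found.\<close>
    have "\<exists>w\<in>Z. bform J w w \<noteq> 0"
    proof (rule ccontr)
      assume n: "\<not> ?thesis"
      have zy: "z + y \<in> Z" using Z(1) z(1) y(1) by (simp add: lin_subspace_def)
      have "bform J (z + y) (z + y) = bform J z z + bform J z y + (bform J y z + bform J y y)"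
        using add(1)[OF ZC[OF z(1)] ZC[OF y(1)] ZC[OF zy]] add(2)[OF ZC[OF z(1)] ZC[OF y(1)]] ZC z(1) y(1) by simp
      then have "bform J z y + bform J z y = 0" using n zy z(1) y(1) sym[OF ZC[OF y(1)] ZC[OF z(1)]] by simp
      then have "2 * bform J z y = 0" by (simp only: mult_2)
      then show False using y(2) by simp
    qed
    then obtain w where w: "w \<in> Z" "bform J w w \<noteq> 0" by blast
    obtain q where q: "q * q = bform J w w" using square_root_exists by blast
    have q0: "q \<noteq> 0" using q w(2) by auto
    have "(1 / q) \<cdot>\<^sub>v w \<in> Z" using Z(1) w(1) by (simp add: lin_subspace_def)
    moreover have "bform J ((1 / q) \<cdot>\<^sub>v w) ((1 / q) \<cdot>\<^sub>v w) = 1"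
    proof -
      have wc: "w \<in> carrier_vec n" "(1 / q) \<cdot>\<^sub>v w \<in> carrier_vec n" using ZC[OF w(1)] by auto
      have "bform J ((1 / q) \<cdot>\<^sub>v w) ((1 / q) \<cdot>\<^sub>v w) = (1 / q) * ((1 / q) * (q * q))"
        by (simp only: add(3)[OF wc wc(1)] add(4)[OF wc(1,1,1)] q)
      then show ?thesis using q0 by simp
    qed
    ultimately show "\<exists>f. \<forall>i<1 :: nat. f i \<in> Z \<and> (\<forall>j<1. bform J (f i) (f j) = (if j = i then 1 else 0))"
      by (intro exI[of _ "\<lambda>_. (1 / q) \<cdot>\<^sub>v w"]) auto
  next
    fix i j assume ij: "i < m + (n - m)" "j < m + (n - m)"
    have "(blk 1 i j :: 'a fmatrix) \<in> corner n" unfolding b1 by (rule funit_corner) (use ij mk in auto)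
    then show "blk 1 i j * (fmatrix_of_mat (mat n n (\<lambda>(i, j). if j = i then 1 else 0)) :: 'a fmatrix) =
        fmatrix_of_mat (mat n n (\<lambda>(i, j). if j = i then 1 else 0)) * blk 1 i j"
      unfolding \<Gamma> by (simp add: mult_one_fmatrix)
  next
    fix i and Y :: "'a fmatrix" assume "blk 1 i i * Y * blk 1 i i = Y"
    then show "\<exists>c. Y = scale c (blk 1 i i)" unfolding b1 funit_sandwich by metis
  qed (use g g0 involution G0 in auto)
qed

lemma sp_not_GNIB:
  fixes \<gg> :: "'a::{alg_closed_field, field_char_0} mat set"
  assumes mk: "3 \<le> m" "4 \<le> n - m" "m \<le> n - m" and pair: "sp_pair n m \<gg> \<gg>\<^sub>0"
    and involution: "involutory_automorphism (2 * n) \<gg> \<sigma>" "{X \<in> \<gg>. \<sigma> X = X} = \<gg>\<^sub>0"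
    and G0: "connected_closed_subgroup (2 * n) G\<^sub>0" "lie_algebra (2 * n) G\<^sub>0 = \<gg>\<^sub>0"
  shows "\<not> isotropy_GNIB (2 * n) \<gg> \<sigma> G\<^sub>0"
proof -
  define N where "N = 2 * n"
  obtain J U W where J: "J \<in> carrier_mat N N" and alt: "\<And>x. x \<in> carrier_vec N \<Longrightarrow> bform J x x = 0"
    and dec: "orthogonal_decomposition N J U (2 * m) W (2 * n - 2 * m)" and g: "\<gg> = form_algebra N J" and g0: "\<gg>\<^sub>0 = preserving \<gg> U W"
    using pair unfolding sp_pair_def N_def by blast
  have n: "N = 2 * (m + (n - m))" using mk by (auto simp: N_def)
  \<comment> \<open>The indices 2 i and 2 i + 1 form a symplectic pair, with sign 1 for the even and
    -1 for the odd index.\<close>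
  define \<tau> :: "nat \<Rightarrow> nat" where "\<tau> i = (if even i then i + 1 else i - 1)" for i
  define s :: "nat \<Rightarrow> 'a" where "s i = (if even i then 1 else - 1)" for i
  have add: "bform J (x + y) z = bform J x z + bform J y z" "bform J z (x + y) = bform J z x + bform J z y"
    "bform J (c \<cdot>\<^sub>v x) y = c * bform J x y" "bform J x (c \<cdot>\<^sub>v y) = c * bform J x y"
    if "x \<in> carrier_vec N" "y \<in> carrier_vec N" "z \<in> carrier_vec N" for x y z c
  proof -
    have M: "J *\<^sub>v x \<in> carrier_vec N" "J *\<^sub>v y \<in> carrier_vec N" "J *\<^sub>v z \<in> carrier_vec N" using J that by auto
    show "bform J (x + y) z = bform J x z + bform J y z" unfolding bform_def by (rule add_scalar_prod_distrib[OF that(1,2) M(3)])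
    show "bform J z (x + y) = bform J z x + bform J z y"
      unfolding bform_def mult_add_distrib_mat_vec[OF J that(1,2)] by (rule scalar_prod_add_distrib[OF that(3) M(1,2)])
    show "bform J (c \<cdot>\<^sub>v x) y = c * bform J x y" unfolding bform_def using that M by simp
    show "bform J x (c \<cdot>\<^sub>v y) = c * bform J x y" unfolding bform_def mult_mat_vec[OF J that(2)] using that M by simp
  qed
  have sym: "bform J y x = - 1 * bform J x y" if xy: "x \<in> carrier_vec N" "y \<in> carrier_vec N" for x y
  proof -
    have "bform J (x + y) (x + y) = bform J x x + bform J x y + (bform J y x + bform J y y)"
      using add(1)[OF xy, of "x + y"] add(2)[OF xy xy(1)] add(2)[OF xy xy(2)] xy by simp
    then have "bform J y x + bform J x y = 0" using alt[of "x + y"] alt[OF xy(1)] alt[OF xy(2)] xy by (simp add: add.commute)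
    then show ?thesis by (simp add: eq_neg_iff_add_eq_0)
  qed
  define \<Gamma> :: "'a fmatrix" where "\<Gamma> = fmatrix_of_mat (mat N N (\<lambda>(i, j). if j = \<tau> i then s i else 0))"
  have \<tau>N: "\<tau> i < N" if "i < N" for i using that by (auto simp: \<tau>_def N_def)
  have \<tau>\<tau>: "\<tau> (\<tau> i) = i" for i by (auto simp: \<tau>_def)
  have \<Gamma>c: "\<Gamma> \<in> corner N" by (simp add: \<Gamma>_def)
  have \<Gamma>R: "entry (A * \<Gamma>) x y = entry A x (\<tau> y) * s (\<tau> y)" if A: "A \<in> corner N" and y: "y < N" for A x y
  proof -
    have eq: "y = \<tau> a \<longleftrightarrow> a = \<tau> y" for a using \<tau>\<tau> by metis
    have "entry (A * \<Gamma>) x y = (\<Sum>a<N. if a = \<tau> y then entry A x (\<tau> y) * s (\<tau> y) else 0)"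
      unfolding entry_mult_corner[OF A] by (rule sum.cong) (use y in \<open>auto simp: \<Gamma>_def eq \<tau>\<tau>\<close>)
    then show ?thesis using \<tau>N[OF y] by simp
  qed
  have \<Gamma>L: "entry (\<Gamma> * A) x y = s x * entry A (\<tau> x) y" if x: "x < N" for A x y
  proof -
    have "entry (\<Gamma> * A) x y = (\<Sum>a<N. if a = \<tau> x then s x * entry A (\<tau> x) y else 0)"
      unfolding entry_mult_corner[OF \<Gamma>c] by (rule sum.cong) (use x in \<open>auto simp: \<Gamma>_def\<close>)
    then show ?thesis using \<tau>N[OF x] by simp
  qed
  have b2: "blk 2 i j = (funit (2 * i) (2 * j) + funit (2 * i + 1) (2 * j + 1) :: 'a fmatrix)" for i j
    by (simp add: blk_def numeral_2_eq_2)
  have ts: "\<tau> (2 * i) = 2 * i + 1" "\<tau> (2 * i + 1) = 2 * i" "s (2 * i) = 1" "s (2 * i + 1) = - 1" for i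
    by (auto simp: \<tau>_def s_def)
  have iff: "\<tau> x = 2 * i \<longleftrightarrow> x = 2 * i + 1" "\<tau> x = 2 * i + 1 \<longleftrightarrow> x = 2 * i" for x i
    using \<tau>\<tau>[of x] ts[of i] by metis+
  show ?thesis
    unfolding N_def [symmetric]
  proof (rule form_not_GNIB[where d = 2 and \<tau> = \<tau> and s = s and \<epsilon> = "- 1", OF n mk J])
    show "orthogonal_decomposition N J U (2 * m) W (2 * (n - m))" using dec by (simp add: diff_mult_distrib2)
    show "\<tau> i < 2 * r" if "i < 2 * r" for i r using that by (auto simp: \<tau>_def)
    show "\<tau> (2 * r + i) = 2 * r + \<tau> i" "s (2 * r + i) = s i" if "i < 2" for i r
      using that by (auto simp: \<tau>_def s_def less_2_cases_iff)
    show "s i * s i = 1" for i by (simp add: s_def)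
    show "bform J y x = - 1 * bform J x y" if "x \<in> carrier_vec N" "y \<in> carrier_vec N" for x y by (rule sym[OF that])
    fix Z z assume Z: "lin_subspace N Z" "nondegenerate_on N J Z" and z: "z \<in> Z" "z \<noteq> 0\<^sub>v N"
    have ZC: "x \<in> carrier_vec N" if "x \<in> Z" for x using Z(1) that by (auto simp: lin_subspace_def)
    obtain y where y: "y \<in> Z" "bform J z y \<noteq> 0" using Z(2) z unfolding nondegenerate_on_def by blast
    \<comment> \<open>Rescaled so that z and w form a symplectic pair.\<close>
    define w where "w = (1 / bform J z y) \<cdot>\<^sub>v y"
    have w: "w \<in> Z" using Z(1) y(1) by (simp add: w_def lin_subspace_def)
    have zw: "bform J z w = 1"
      using add(4)[OF ZC[OF z(1)] ZC[OF y(1)] ZC[OF y(1)]] y(2) by (simp add: w_def)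
    have wz: "bform J w z = - 1" using sym[OF ZC[OF z(1)] ZC[OF w]] zw by simp
    have "\<forall>i<2. (if i = 0 then z else w) \<in> Z \<and>
        (\<forall>j<2. bform J (if i = 0 then z else w) (if j = 0 then z else w) = (if j = \<tau> i then s i else 0))"
      using z(1) w zw wz alt ZC by (auto simp: less_2_cases_iff \<tau>_def s_def)
    then show "\<exists>f. \<forall>i<2. f i \<in> Z \<and> (\<forall>j<2. bform J (f i) (f j) = (if j = \<tau> i then s i else 0))"
      by (intro exI[of _ "\<lambda>i. if i = 0 then z else w"])
  next
    fix i j assume ij: "i < m + (n - m)" "j < m + (n - m)"
    have bc: "(blk 2 i j :: 'a fmatrix) \<in> corner N" unfolding n by (rule blk_corner[OF ij])
    have "blk 2 i j * \<Gamma> = \<Gamma> * blk 2 i j"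
    proof (rule fmatrix_eqI)
      fix x y
      show "entry (blk 2 i j * \<Gamma>) x y = entry (\<Gamma> * blk 2 i j) x y"
      proof (cases "x < N \<and> y < N")
        case True
        have "entry (blk 2 i j :: 'a fmatrix) x (\<tau> y) * s (\<tau> y) = s x * entry (blk 2 i j) (\<tau> x) y"
        proof -
          have st: "s (\<tau> z) = - s z" for z by (auto simp: \<tau>_def s_def)
          note S = ts[unfolded Suc_eq_plus1[symmetric]] iff[unfolded Suc_eq_plus1[symmetric]]
          have ne: "2 * a \<noteq> Suc (2 * b)" "Suc (2 * b) \<noteq> 2 * a" for a b :: nat by presburger+
          show ?thesis unfolding b2 Suc_eq_plus1[symmetric] by (auto simp: S st ne)
        qed
        then show ?thesis using True by (simp add: \<Gamma>R[OF bc] \<Gamma>L)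
      next
        case False
        have "blk 2 i j * \<Gamma> \<in> corner N" "\<Gamma> * blk 2 i j \<in> corner N" using bc \<Gamma>c by auto
        then show ?thesis using False by (simp add: corner_entry_0[of _ N] not_less)
      qed
    qed
    then show "blk 2 i j * (fmatrix_of_mat (mat N N (\<lambda>(i, j). if j = \<tau> i then s i else 0)) :: 'a fmatrix) =
        fmatrix_of_mat (mat N N (\<lambda>(i, j). if j = \<tau> i then s i else 0)) * blk 2 i j"
      unfolding \<Gamma>_def .
  next
    fix i and Y :: "'a fmatrix"
    assume i: "i < m + (n - m)" and Y: "Y \<in> corner N" "blk 2 i i * Y * blk 2 i i = Y"
      and adj: "ftrans Y * fmatrix_of_mat (mat N N (\<lambda>(i, j). if j = \<tau> i then s i else 0)) =
        fmatrix_of_mat (mat N N (\<lambda>(i, j). if j = \<tau> i then s i else 0)) * Y"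
    \<comment> \<open>On a 2 x 2 block, selfadjointness for the symplectic form forces equal
      diagonal entries and vanishing off-diagonal ones: only scalars remain, as for quaternionic
      conjugation.\<close>
    let ?p = "2 * i" and ?q = "2 * i + 1"
    have lt: "?p < N" "?q < N" using i n by auto
    have Yt: "ftrans Y \<in> corner N" using Y(1) by simp
    have e: "entry (ftrans Y) x (\<tau> y) * s (\<tau> y) = s x * entry Y (\<tau> x) y" if "x < N" "y < N" for x y
      using arg_cong[OF adj[folded \<Gamma>_def], of "\<lambda>A. entry A x y"] \<Gamma>R[OF Yt that(2)] \<Gamma>L[OF that(1)] by simp
    have pp: "entry Y ?p ?p = entry Y ?q ?q" and "- entry Y ?q ?p = entry Y ?q ?p" "entry Y ?p ?q = - entry Y ?p ?q"
      using e[OF lt(1,2)] e[OF lt(1,1)] e[OF lt(2,2)] by (simp_all add: ts[unfolded Suc_eq_plus1[symmetric]])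
    then have off: "entry Y ?q ?p = 0" "entry Y ?p ?q = 0" by auto
    have "Y = (funit ?p ?p + funit ?q ?q) * Y * (funit ?p ?p + funit ?q ?q)" using Y(2) by (simp only: b2)
    also have "\<dots> = scale (entry Y ?p ?p) (funit ?p ?p) + scale (entry Y ?q ?p) (funit ?q ?p) +
        (scale (entry Y ?p ?q) (funit ?p ?q) + scale (entry Y ?q ?q) (funit ?q ?q))"
      by (simp only: distrib_left distrib_right funit_sandwich)
    also have "\<dots> = scale (entry Y ?p ?p) (blk 2 i i)" unfolding off pp b2 by simp
    finally show "\<exists>c. Y = scale c (blk 2 i i)" by blast
  qed (use g g0 involution G0 \<tau>\<tau> in \<open>auto simp: N_def\<close>)
qed

theorem theorem6p3:
  fixes n m N :: nat
    and \<gg> \<gg>\<^sub>0 G G\<^sub>0 :: "'a::{alg_closed_field, field_char_0} mat set"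
    and \<sigma> :: "'a mat \<Rightarrow> 'a mat"
  assumes range: "(4 \<le> m \<and> m \<le> n - m) \<or> (m = 3 \<and> n - m = 4)"
    and pair: "(N = n \<and> gl_pair n m \<gg> \<gg>\<^sub>0) \<or> (N = n \<and> so_pair n m \<gg> \<gg>\<^sub>0) \<or>
               (N = 2 * n \<and> sp_pair n m \<gg> \<gg>\<^sub>0)"
    and involution: "involutory_automorphism N \<gg> \<sigma>" "{X \<in> \<gg>. \<sigma> X = X} = \<gg>\<^sub>0"
    and G: "connected_closed_subgroup N G" "lie_algebra N G = \<gg>"
    and G0: "G\<^sub>0 \<subseteq> G" "connected_closed_subgroup N G\<^sub>0" "lie_algebra N G\<^sub>0 = \<gg>\<^sub>0"
  shows "\<not> isotropy_GNIB N \<gg> \<sigma> G\<^sub>0"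
proof -
  have mk: "3 \<le> m" "4 \<le> n - m" "m \<le> n - m" using range by auto
  consider "N = n" "gl_pair n m \<gg> \<gg>\<^sub>0" | "N = n" "so_pair n m \<gg> \<gg>\<^sub>0" | "N = 2 * n" "sp_pair n m \<gg> \<gg>\<^sub>0"
    using pair by blast
  then show ?thesis
  proof cases
    case 1
    show ?thesis using gl_not_GNIB[OF mk 1(2)] involution G0(2,3) unfolding 1(1) by blast
  next
    case 2
    show ?thesis using so_not_GNIB[OF mk 2(2)] involution G0(2,3) unfolding 2(1) by blast
  next
    case 3
    show ?thesis using sp_not_GNIB[OF mk 3(2)] involution G0(2,3) unfolding 3(1) by blast
  qed
qed

end
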